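(* Let $p=1$ and assume that (H2), (H3) and (Z) are satisfied. Then there exists at most one solution $(Y,Z)$ of BSDE$(\xi,f+dV)$ such that $Y$ is of class (D) and $Z\in\bigcup_{\beta>\alpha}M^\beta$, where $\alpha$ is the constant from (Z).
   Context: $T>0$; $B$ standard $d$-dimensional Brownian motion on a complete probability space with standard augmented Brownian filtration; relations hold $P$-a.s. $M$: progressively measurable $\mathbb R^d$-valued $Z$ with $\int_0^T|Z|^2<\infty$ a.s.; $M^\beta$: $Z\in M$ with $E(\int_0^T|Z_t|^2dt)^{\beta/2}<\infty$. A process $Y$ is of class (D) if $\{Y_\tau\}$, $\tau$ ranging over stopping times with values in $[0,T]$, is uniformly integrable. $\mathcal V$: c\`adl\`ag progressively measurable finite variation processes with $V_0=0$. Data: $\xi$ $\mathcal F_T$-measurable real, $f:\Omega\times[0,T]\times\mathbb R\times\mathbb R^d\to\mathbb R$ with $f(\cdot,y,z)$ progressively measurable, $V\in\mathcal V$. A solution of BSDE$(\xi,f+dV)$ is a pair $(Y,Z)$ of progressively measurable processes with $Z\in M$, $t\mapsto f(t,Y_t,Z_t)\in L^1(0,T)$ a.s., and $Y_t=\xi+\int_t^Tf(s,Y_s,Z_s)ds+\int_t^TdV_s-\int_t^TZ_sdB_s$, $t\in[0,T]$. (H2): there is $\lambda>0$ with $|f(t,y,z)-f(t,y,z')|\le\lambda|z-z'|$. (H3): there is $\mu\in\mathbb R$ with $(f(t,y,z)-f(t,y',z))(y-y')\le\mu(y-y')^2$ for all $t,y,y',z$. (Z): there are $\alpha\in(0,1)$,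 $\gamma\ge0$ and a nonnegative progressively measurable $g$ with $E\int_0^Tg_tdt<\infty$ such that $|f(t,y,z)-f(t,y,0)|\le\gamma(g_t+|y|+|z|)^\alpha$ for all $t,y,z$. *)

theory Defs
  imports "HOL-Probability.Probability"
begin

definition brownian_motion :: "'w measure \<Rightarrow> real \<Rightarrow> (real \<Rightarrow> 'w \<Rightarrow> real^'d) \<Rightarrow> bool" where
  "brownian_motion M T B \<longleftrightarrow>
     (\<forall>t\<in>{0..T}. B t \<in> borel_measurable M) \<and>
     (\<forall>\<omega>\<in>space M. B 0 \<omega> = 0 \<and> continuous_on {0..T} (\<lambda>t. B t \<omega>)) \<and>
     (\<forall>(n::nat) tt. (\<forall>k<n. 0 \<le> tt k \<and> tt k < tt (Suc k) \<and> tt (Suc k) \<le> T) \<longrightarrow>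
        prob_space.indep_vars M (\<lambda>_. borel)
          (\<lambda>(k, i) \<omega>. B (tt (Suc k)) \<omega> $ i - B (tt k) \<omega> $ i) ({..<n} \<times> (UNIV :: 'd set)) \<and>
        (\<forall>k<n. \<forall>i. distributed M lborel (\<lambda>\<omega>. B (tt (Suc k)) \<omega> $ i - B (tt k) \<omega> $ i)
             (\<lambda>x. ennreal (normal_density 0 (sqrt (tt (Suc k) - tt k)) x))))"

definition bfilt :: "'w measure \<Rightarrow> (real \<Rightarrow> 'w \<Rightarrow> 'b::topological_space) \<Rightarrow> real \<Rightarrow> 'w set set" where
  "bfilt M B t = sigma_sets (space M)
     ({B s -` A \<inter> space M | s A. s \<in> {0..t} \<and> A \<in> sets borel} \<union> null_sets M)"

definition fmeas :: "'w measure \<Rightarrow> (real \<Rightarrow> 'w \<Rightarrow> 'b::topological_space) \<Rightarrow> real \<Rightarrow> 'w measure" where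
  "fmeas M B t = sigma (space M) (bfilt M B t)"

definition progressive :: "'w measure \<Rightarrow> (real \<Rightarrow> 'w \<Rightarrow> 'b::topological_space) \<Rightarrow> real
    \<Rightarrow> (real \<Rightarrow> 'w \<Rightarrow> 'c::topological_space) \<Rightarrow> bool" where
  "progressive M B T X \<longleftrightarrow> (\<forall>t\<in>{0..T}.
     (\<lambda>(s, \<omega>). X s \<omega>) \<in> borel_measurable (restrict_space borel {0..t} \<Otimes>\<^sub>M fmeas M B t))"

definition inM :: "'w measure \<Rightarrow> (real \<Rightarrow> 'w \<Rightarrow> real^'d) \<Rightarrow> real \<Rightarrow> (real \<Rightarrow> 'w \<Rightarrow> real^'d) \<Rightarrow> bool" where
  "inM M B T Z \<longleftrightarrow> progressive M B T Z \<and>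
     (AE \<omega> in M. (\<integral>\<^sup>+ t. ennreal ((norm (Z t \<omega>))\<^sup>2) * indicator {0..T} t \<partial>lborel) < \<infinity>)"

definition inMbeta :: "'w measure \<Rightarrow> (real \<Rightarrow> 'w \<Rightarrow> real^'d) \<Rightarrow> real \<Rightarrow> real \<Rightarrow> (real \<Rightarrow> 'w \<Rightarrow> real^'d) \<Rightarrow> bool" where
  "inMbeta M B T \<beta> Z \<longleftrightarrow> inM M B T Z \<and>
     (\<integral>\<^sup>+ \<omega>. ennreal ((LBINT t:{0..T}. (norm (Z t \<omega>))\<^sup>2) powr (\<beta> / 2)) \<partial>M) < \<infinity>"

definition unif_integrable :: "'w measure \<Rightarrow> ('w \<Rightarrow> real) set \<Rightarrow> bool" where
  "unif_integrable M \<X> \<longleftrightarrow> (\<forall>X\<in>\<X>. X \<in> borel_measurable M) \<and>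
     (\<forall>e>0. \<exists>c. \<forall>X\<in>\<X>. (\<integral>\<^sup>+ \<omega>. ennreal \<bar>X \<omega>\<bar> * indicator {\<omega>. c < \<bar>X \<omega>\<bar>} \<omega> \<partial>M) < ennreal e)"

definition classD :: "'w measure \<Rightarrow> (real \<Rightarrow> 'w \<Rightarrow> real^'d) \<Rightarrow> real \<Rightarrow> (real \<Rightarrow> 'w \<Rightarrow> real) \<Rightarrow> bool" where
  "classD M B T Y \<longleftrightarrow> unif_integrable M
     {(\<lambda>\<omega>. Y (\<tau> \<omega>) \<omega>) | \<tau>. stopping_time (fmeas M B) \<tau> \<and> (\<forall>\<omega>\<in>space M. \<tau> \<omega> \<in> {0..T})}"

definition bv_on :: "real \<Rightarrow> (real \<Rightarrow> real) \<Rightarrow> bool" where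
  "bv_on T v \<longleftrightarrow> (\<exists>C. \<forall>(n::nat) tt. (\<forall>k\<le>n. tt k \<in> {0..T}) \<and> (\<forall>k<n. tt k \<le> tt (Suc k)) \<longrightarrow>
      (\<Sum>k<n. \<bar>v (tt (Suc k)) - v (tt k)\<bar>) \<le> C)"

definition cadlag_on :: "real \<Rightarrow> (real \<Rightarrow> real) \<Rightarrow> bool" where
  "cadlag_on T v \<longleftrightarrow> (\<forall>t\<in>{0..<T}. continuous (at_right t) v) \<and>
     (\<forall>t\<in>{0<..T}. \<exists>l. (v \<longlongrightarrow> l) (at_left t))"

definition classV :: "'w measure \<Rightarrow> (real \<Rightarrow> 'w \<Rightarrow> real^'d) \<Rightarrow> real \<Rightarrow> (real \<Rightarrow> 'w \<Rightarrow> real) \<Rightarrow> bool" where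
  "classV M B T V \<longleftrightarrow> progressive M B T V \<and>
     (\<forall>\<omega>\<in>space M. V 0 \<omega> = 0 \<and> cadlag_on T (\<lambda>t. V t \<omega>) \<and> bv_on T (\<lambda>t. V t \<omega>))"

definition simple_pred :: "'w measure \<Rightarrow> (real \<Rightarrow> 'w \<Rightarrow> real^'d) \<Rightarrow> real \<Rightarrow> nat \<Rightarrow> (nat \<Rightarrow> real)
    \<Rightarrow> (nat \<Rightarrow> 'w \<Rightarrow> real^'d) \<Rightarrow> bool" where
  "simple_pred M B T n tt xs \<longleftrightarrow> tt 0 = 0 \<and> tt n = T \<and> (\<forall>k<n. tt k < tt (Suc k)) \<and>
     (\<forall>k<n. xs k \<in> borel_measurable (fmeas M B (tt k)) \<and> (\<exists>C. \<forall>\<omega>\<in>space M. norm (xs k \<omega>) \<le> C))"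

definition simple_proc :: "nat \<Rightarrow> (nat \<Rightarrow> real) \<Rightarrow> (nat \<Rightarrow> 'w \<Rightarrow> real^'d) \<Rightarrow> real \<Rightarrow> 'w \<Rightarrow> real^'d" where
  "simple_proc n tt xs t \<omega> = (\<Sum>k<n. indicator {tt k<..tt (Suc k)} t *\<^sub>R xs k \<omega>)"

definition simple_int :: "(real \<Rightarrow> 'w \<Rightarrow> real^'d) \<Rightarrow> nat \<Rightarrow> (nat \<Rightarrow> real) \<Rightarrow> (nat \<Rightarrow> 'w \<Rightarrow> real^'d)
    \<Rightarrow> real \<Rightarrow> 'w \<Rightarrow> real" where
  "simple_int B n tt xs t \<omega> = (\<Sum>k<n. xs k \<omega> \<bullet> (B (min (tt (Suc k)) t) \<omega> - B (min (tt k) t) \<omega>))"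

definition ito_integral :: "'w measure \<Rightarrow> (real \<Rightarrow> 'w \<Rightarrow> real^'d) \<Rightarrow> real \<Rightarrow> (real \<Rightarrow> 'w \<Rightarrow> real^'d)
    \<Rightarrow> (real \<Rightarrow> 'w \<Rightarrow> real) \<Rightarrow> bool" where
  "ito_integral M B T Z I \<longleftrightarrow> progressive M B T I \<and>
     (\<forall>\<omega>\<in>space M. continuous_on {0..T} (\<lambda>t. I t \<omega>)) \<and>
     (\<exists>nn tt xs. (\<forall>m. simple_pred M B T (nn m) (tt m) (xs m)) \<and>
        (\<forall>e>0. (\<lambda>m. measure M {\<omega>\<in>space M. ennreal e <
            (\<integral>\<^sup>+ t. ennreal ((norm (simple_proc (nn m) (tt m) (xs m) t \<omega> - Z t \<omega>))\<^sup>2)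
                       * indicator {0..T} t \<partial>lborel)}) \<longlonglongrightarrow> 0) \<and>
        (\<forall>e>0. (\<lambda>m. measure M {\<omega>\<in>space M. \<exists>t\<in>{0..T}.
            e < \<bar>simple_int B (nn m) (tt m) (xs m) t \<omega> - I t \<omega>\<bar>}) \<longlonglongrightarrow> 0))"

definition bsde_solution :: "'w measure \<Rightarrow> (real \<Rightarrow> 'w \<Rightarrow> real^'d) \<Rightarrow> real \<Rightarrow> ('w \<Rightarrow> real)
    \<Rightarrow> ('w \<Rightarrow> real \<Rightarrow> real \<Rightarrow> real^'d \<Rightarrow> real) \<Rightarrow> (real \<Rightarrow> 'w \<Rightarrow> real)
    \<Rightarrow> (real \<Rightarrow> 'w \<Rightarrow> real) \<Rightarrow> (real \<Rightarrow> 'w \<Rightarrow> real^'d) \<Rightarrow> bool" where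
  "bsde_solution M B T \<xi> f V Y Z \<longleftrightarrow> progressive M B T Y \<and> inM M B T Z \<and>
     (AE \<omega> in M. set_integrable lborel {0..T} (\<lambda>s. f \<omega> s (Y s \<omega>) (Z s \<omega>))) \<and>
     (\<exists>I. ito_integral M B T Z I \<and>
        (AE \<omega> in M. \<forall>t\<in>{0..T}. Y t \<omega> = \<xi> \<omega> + (LBINT s:{t..T}. f \<omega> s (Y s \<omega>) (Z s \<omega>))
                                   + (V T \<omega> - V t \<omega>) - (I T \<omega> - I t \<omega>)))"

end

theory Submission
  imports Defs
begin

text \<open>
  Put \<open>y = Y1 - Y2\<close> and \<open>z = Z1 - Z2\<close>. By (H2), (H3) and (Z) the drift \<open>a\<close> of \<open>y\<close> satisfies
  \<open>a y \<le> m y\<^sup>2 + \<bar>y\<bar> min (\<lambda> \<bar>z\<bar>) G\<close> with \<open>G = 2 \<gamma> (g + \<bar>Y2\<bar> + \<bar>Z1\<bar> + \<bar>Z2\<bar>) powr \<alpha>\<close>, and since \<open>Z1\<close>, \<open>Z2\<close> lie in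
  some \<open>M\<^sup>\<beta>\<close> with \<open>\<beta> > \<alpha>\<close>, \<open>G powr q\<close> is integrable for some \<open>q > 1\<close>. An Ito inequality for smooth functions of
  \<open>y\<close> with linear growth holds up to the hitting times of large levels, and class (D) removes the localisation.

  Applied to a smoothing of \<open>\<bar>y\<bar>\<close> it bounds \<open>E (\<Psi> \<bar>y s\<bar>)\<close> by \<open>E (\<Psi> (\<integral> m \<bar>y\<bar> + G))\<close> for past-measurable weights \<open>\<Psi> \<ge> 0\<close>;
  the weight \<open>\<Psi> = min \<bar>y s\<bar> n powr (q - 1)\<close> and Gronwall's inequality bound \<open>E (\<bar>y s\<bar> powr q)\<close> uniformly in \<open>s\<close>.
  Applied to approximations of \<open>\<bar>y\<bar> powr q\<close>, whose second derivative absorbs \<open>\<lambda> \<bar>z\<bar>\<close> because \<open>q > 1\<close>, it gives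
  \<open>E (\<bar>y s\<bar> powr q) \<le> C (\<integral> E (\<bar>y\<bar> powr q))\<close>, hence \<open>y = 0\<close>; applied to \<open>sqrt (1 + y\<^sup>2)\<close> it then gives \<open>z = 0\<close>.

  The Ito inequality needs no stochastic calculus beyond the martingale property of the stopped processes \<open>I = \<integral> z dB\<close> and
  \<open>I\<^sup>2 - \<integral> \<bar>z\<bar>\<^sup>2\<close>, which passes to the limit from elementary integrals thanks to a fourth moment bound.\<close>

text \<open>The obstacle at p = 1 is a circle. The Lipschitz term in z is absorbed by the second
  derivative of |y|^q only for q > 1, but class (D) provides just first moments of y, and Z1, Z2 may
  lie in \<open>inMbeta\<close> only for exponents below 1. Condition (Z) breaks the circle: its
  bound G grows with power \<alpha> < 1, so G has a q-th moment as soon as \<alpha> q stays below 1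
  and below both exponents \<beta>. This lifts y to L^q by an argument that is blind to z, and only
  then the Lipschitz bound takes over. The drift estimate therefore carries the minimum of the two
  bounds throughout. Past-measurable weights play the part of conditional expectations: a power of
  |y s| itself as weight turns a first-moment estimate into one of order q. The process V cancels in
  y, which is thus continuous although Y1 and Y2 may jump. Its drift, however, need not be
  progressive: f is progressive only for fixed (y, z), and (H3) gives no continuity in y. Because
  the Ito formula is wanted as an inequality, moment bounds for sums of squared increments are
  enough to control its remainder.\<close>

abbreviation (in prob_space) "E \<equiv> expectation"

section \<open>Brownian increments\<close>

locale bm_space = prob_space M + complete_measure M
  for M :: "'w measure" +
  fixes T :: real and B :: "real \<Rightarrow> 'w \<Rightarrow> real^'d"
  assumes T_pos: "0 < T" and bm: "brownian_motion M T B"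
begin

abbreviation "F \<equiv> fmeas M B"

abbreviation "TM \<equiv> (lborel :: real measure) \<Otimes>\<^sub>M M"

lemma B_measurable: "t \<in> {0..T} \<Longrightarrow> B t \<in> borel_measurable M"
  using bm by (auto simp: brownian_motion_def)

lemma B_0: "w \<in> space M \<Longrightarrow> B 0 w = 0"
  using bm by (auto simp: brownian_motion_def)

lemma B_continuous: "w \<in> space M \<Longrightarrow> continuous_on {0..T} (\<lambda>t. B t w)"
  using bm by (auto simp: brownian_motion_def)

lemma bfilt_gen: "{B s -` A \<inter> space M | s A. s \<in> {0..t} \<and> A \<in> sets borel} \<union> null_sets M \<subseteq> Pow (space M)"
  using sets.sets_into_space by blast

lemma space_F [simp]: "space (F t) = space M"
  unfolding fmeas_def bfilt_def
  using sigma_sets_into_sp[OF bfilt_gen] by (intro space_measure_of) blast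

lemma sets_F: "sets (F t) = bfilt M B t"
proof -
  interpret sigma_algebra "space M" "bfilt M B t"
    unfolding bfilt_def using bfilt_gen by (rule sigma_algebra_sigma_sets)
  show ?thesis
    unfolding fmeas_def using space_closed by (simp add: sigma_sets_eq)
qed

lemma sets_F_mono: "s \<le> t \<Longrightarrow> sets (F s) \<subseteq> sets (F t)"
  unfolding sets_F bfilt_def
proof (rule sigma_sets_mono', rule Un_mono, rule subsetI)
  fix x assume "s \<le> t" "x \<in> {B r -` A \<inter> space M |r A. r \<in> {0..s} \<and> A \<in> sets borel}"
  then obtain r A where "x = B r -` A \<inter> space M" "r \<in> {0..t}" "A \<in> sets borel" by auto
  then show "x \<in> {B r -` A \<inter> space M |r A. r \<in> {0..t} \<and> A \<in> sets borel}" by blast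
qed simp

lemma sets_F_subset: "t \<le> T \<Longrightarrow> sets (F t) \<subseteq> sets M"
  unfolding sets_F bfilt_def
  by (intro sets.sigma_sets_subset Un_least) (auto intro!: measurable_sets[OF B_measurable])

lemma F_measurable_mono: "f \<in> F s \<rightarrow>\<^sub>M N \<Longrightarrow> s \<le> t \<Longrightarrow> f \<in> F t \<rightarrow>\<^sub>M N"
  using sets_F_mono[of s t] by (auto simp: measurable_def)

lemma F_measurable_M: "f \<in> F t \<rightarrow>\<^sub>M N \<Longrightarrow> t \<le> T \<Longrightarrow> f \<in> M \<rightarrow>\<^sub>M N"
  using sets_F_subset[of t] by (auto simp: measurable_def)

lemma B_F_measurable: "s \<in> {0..t} \<Longrightarrow> B s \<in> borel_measurable (F t)"
proof (rule measurableI)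
  fix A :: "(real^'d) set" assume "s \<in> {0..t}" "A \<in> sets borel"
  then show "B s -` A \<inter> space (F t) \<in> sets (F t)"
    unfolding sets_F bfilt_def by (auto intro!: sigma_sets.Basic)
qed auto

lemma null_sets_F: "N \<in> null_sets M \<Longrightarrow> N \<in> sets (F t)"
  unfolding sets_F bfilt_def by (auto intro!: sigma_sets.Basic)

text \<open>\<open>brownian_motion\<close> speaks of increments along strictly increasing sequences,
  so a finite set of past times has to be listed in order before independence can be used. The
  points 0 and \<open>s\<close> are required in \<open>S\<close> so that every value of
  \<open>B\<close> on the grid is a sum of increments and the last step is exactly the one from
  \<open>s\<close> to \<open>t\<close>.\<close>

lemma increments_grid:
  fixes S :: "real set"
  assumes S: "finite S" "S \<subseteq> {0..s}" and s: "0 \<in> S" "s \<in> S" "s < t" "t \<le> T"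
  obtains n and tt :: "nat \<Rightarrow> real" where "\<forall>k<Suc n. 0 \<le> tt k \<and> tt k < tt (Suc k) \<and> tt (Suc k) \<le> T"
    "tt 0 = 0" "tt n = s" "tt (Suc n) = t" "S = tt ` {..n}"
proof -
  define xs where "xs = sorted_list_of_set S"
  have xs: "set xs = S" "sorted_wrt (<) xs" using S by (auto simp: xs_def)
  define n where "n = length xs - 1"
  have ne: "xs \<noteq> []" using xs s by auto
  have ln: "length xs = Suc n" using ne by (simp add: n_def)
  define tt where "tt k = (if k \<le> n then xs ! k else t)" for k
  have lt: "xs ! i < xs ! j" if "i < j" "j \<le> n" for i j
    using xs(2) that ln by (simp add: sorted_wrt_nth_less)
  have S_eq: "S = tt ` {..n}"
  proof -
    have "S = (\<lambda>k. xs ! k) ` {..<Suc n}" using xs(1) ln by (auto simp: set_conv_nth)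
    then show ?thesis by (auto simp: tt_def less_Suc_eq_le image_iff)
  qed
  have in_S: "tt k \<in> S" if "k \<le> n" for k using S_eq that by auto
  have le: "tt i \<le> tt j" if "i \<le> j" "j \<le> n" for i j
    using lt[of i j] that by (cases "i = j") (auto simp: tt_def)
  have t0: "tt 0 = 0"
  proof -
    obtain k where k: "k \<le> n" "tt k = 0" using s(1) S_eq by auto
    show ?thesis using le[of 0 k] k in_S[of 0] S by auto
  qed
  have tn: "tt n = s"
  proof -
    obtain k where k: "k \<le> n" "tt k = s" using s(2) S_eq by auto
    show ?thesis using le[of k n] k in_S[of n] S by auto
  qed
  show thesis
  proof (rule that[OF _ t0 tn _ S_eq])
    show "tt (Suc n) = t" by (simp add: tt_def)
    show "\<forall>k<Suc n. 0 \<le> tt k \<and> tt k < tt (Suc k) \<and> tt (Suc k) \<le> T"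
    proof (intro allI impI)
      fix k assume k: "k < Suc n"
      show "0 \<le> tt k \<and> tt k < tt (Suc k) \<and> tt (Suc k) \<le> T"
      proof (cases "k = n")
        case True then show ?thesis using tn s S in_S[of n] by (auto simp: tt_def)
      next
        case False
        then have "Suc k \<le> n" using k by auto
        then show ?thesis using lt[of k "Suc k"] in_S[of k] in_S[of "Suc k"] S s k
          by (auto simp: tt_def)
      qed
    qed
  qed
qed

lemma vec_nth_measurable [measurable]: "(\<lambda>x::real^'d. x $ i) \<in> borel_measurable borel"
  by (intro borel_measurable_continuous_onI continuous_intros)

lemma vec_measurable:
  fixes f :: "'x \<Rightarrow> real^'d"
  assumes "\<And>i. (\<lambda>x. f x $ i) \<in> borel_measurable N"
  shows "f \<in> borel_measurable N"
  using assms unfolding borel_measurable_euclidean_space[of f N] by (auto simp: Basis_vec_def inner_axis)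

text \<open>A pi-system argument: events that restrict finitely many past values, together with the
  null sets of the augmentation, are stable under intersection and generate a sigma-algebra
  containing \<open>F s\<close>. On such events the claim is the independence of disjoint blocks of
  increments.\<close>

lemma indep_past_increment:
  assumes st: "0 \<le> s" "s < t" "t \<le> T"
  shows "indep_set (sets (F s)) {(\<lambda>w. B t w - B s w) -` A \<inter> space M | A. A \<in> sets borel}"
proof -
  let ?D = "\<lambda>w. B t w - B s w"
  define C where "C = {{w\<in>space M. \<forall>r\<in>S. B r w \<in> c r} | S c. finite S \<and> S \<subseteq> {0..s} \<and> (\<forall>r. c r \<in> sets borel)}"
  define G2 where "G2 = {?D -` A \<inter> space M | A. A \<in> sets borel}"
  have Dm: "?D \<in> borel_measurable M"
    using st by (intro borel_measurable_diff B_measurable) auto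
  have C_meas: "C \<subseteq> events"
  proof
    fix a assume "a \<in> C"
    then obtain S c where a: "a = {w\<in>space M. \<forall>r\<in>S. B r w \<in> c r}" "finite S" "S \<subseteq> {0..s}" "\<And>r. c r \<in> sets borel"
      unfolding C_def by blast
    have "{w\<in>space M. B r w \<in> c r} \<in> events" if "r \<in> S" for r
      using measurable_sets[OF B_measurable, of r "c r"] a(3,4) that st
      by (auto simp: vimage_def Int_def conj_commute)
    then show "a \<in> events" unfolding a(1) using a(2) by (rule sets.sets_Collect_finite_All)
  qed
  have ind: "prob (a \<inter> b) = prob a * prob b" if "a \<in> C" "b \<in> G2" for a b
  proof -
    obtain S c where a: "a = {w\<in>space M. \<forall>r\<in>S. B r w \<in> c r}" "finite S" "S \<subseteq> {0..s}" "\<And>r. c r \<in> sets borel"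
      using \<open>a \<in> C\<close> unfolding C_def by blast
    obtain A where b: "b = ?D -` A \<inter> space M" "A \<in> sets borel" using \<open>b \<in> G2\<close> unfolding G2_def by blast
    define S' where "S' = S \<union> {0, s}"
    obtain n tt where tt: "\<forall>k<Suc n. 0 \<le> tt k \<and> tt k < tt (Suc k) \<and> tt (Suc k) \<le> T"
      "tt 0 = 0" "tt n = s" "tt (Suc n) = t" "S' = tt ` {..n}"
      by (rule increments_grid[of S' s t]) (use a st in \<open>auto simp: S'_def\<close>)
    let ?X = "\<lambda>(k, i) w. B (tt (Suc k)) w $ i - B (tt k) w $ i"
    have "indep_vars (\<lambda>_. borel) ?X ({..<Suc n} \<times> (UNIV :: 'd set))"
      using bm tt(1) unfolding brownian_motion_def by blast
    then have iv: "indep_var (PiM ({..<n} \<times> UNIV) (\<lambda>_. borel)) (\<lambda>w. restrict (\<lambda>i. ?X i w) ({..<n} \<times> UNIV))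
       (PiM ({n} \<times> (UNIV::'d set)) (\<lambda>_. borel)) (\<lambda>w. restrict (\<lambda>i. ?X i w) ({n} \<times> UNIV))"
      by (rule indep_var_restrict) auto
    define U where "U x = {k. k \<le> n \<and> tt k \<in> S \<longrightarrow> (\<chi> i. \<Sum>l<k. x (l, i)) \<in> c (tt k)}" for x :: "nat \<times> 'd \<Rightarrow> real"
    \<comment> \<open>\<open>f\<close> and \<open>g\<close> decide membership in \<open>a\<close>
      and \<open>b\<close> from the increments alone: since \<open>B\<close> vanishes at 0, its
      value at the k-th grid point is the sum of the first k increments.\<close>
    define f where "f x = (\<forall>k\<in>{k. k \<le> n \<and> tt k \<in> S}. (\<chi> i. \<Sum>l<k. x (l, i)) \<in> c (tt k))" for x :: "nat \<times> 'd \<Rightarrow> real"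
    define g where "g x = ((\<chi> i. x (n, i)) \<in> A)" for x :: "nat \<times> 'd \<Rightarrow> real"
    have fm: "f \<in> PiM ({..<n} \<times> UNIV) (\<lambda>_. borel) \<rightarrow>\<^sub>M count_space UNIV"
    proof -
      have [measurable]: "(\<lambda>x::nat \<times> 'd \<Rightarrow> real. \<chi> i. \<Sum>l<k. x (l, i)) \<in> borel_measurable (PiM ({..<n} \<times> (UNIV::'d set)) (\<lambda>_. borel))" if "k \<le> n" for k
        by (rule vec_measurable, simp only: vec_lambda_beta, rule borel_measurable_sum, rule measurable_component_singleton)
           (use that in auto)
      have "Measurable.pred (PiM ({..<n} \<times> UNIV) (\<lambda>_. borel)) (\<lambda>x. (\<chi> i. \<Sum>l<k. x (l, i)) \<in> c (tt k))" if "k \<in> {k. k \<le> n \<and> tt k \<in> S}" for k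
        using that a(4) by (intro pred_sets2[of "c (tt k)" borel]) auto
      then show ?thesis unfolding f_def by (intro pred_intros_finite) auto
    qed
    have gm: "g \<in> PiM ({n} \<times> UNIV) (\<lambda>_. borel) \<rightarrow>\<^sub>M count_space UNIV"
    proof -
      have "(\<lambda>x::nat \<times> 'd \<Rightarrow> real. \<chi> i. x (n, i)) \<in> borel_measurable (PiM ({n} \<times> (UNIV::'d set)) (\<lambda>_. borel))"
        by (rule vec_measurable, simp only: vec_lambda_beta, rule measurable_component_singleton) auto
      then show ?thesis unfolding g_def using b(2) by (intro pred_sets2[of A borel]) auto
    qed
    define ff where "ff w = f (restrict (\<lambda>i. ?X i w) ({..<n} \<times> UNIV))" for w
    define gg where "gg w = g (restrict (\<lambda>i. ?X i w) ({n} \<times> UNIV))" for w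
    have iv2: "indep_var (count_space UNIV) ff (count_space UNIV) gg"
      using indep_var_compose[OF iv fm gm] unfolding ff_def gg_def comp_def .
    have feq: "ff w \<longleftrightarrow> w \<in> a" if w: "w \<in> space M" for w
    proof -
      have "(\<chi> i. \<Sum>l<k. restrict (\<lambda>i. ?X i w) ({..<n} \<times> UNIV) (l, i)) = B (tt k) w" if "k \<le> n" for k
      proof -
        have "(\<Sum>l<k. restrict (\<lambda>i. ?X i w) ({..<n} \<times> UNIV) (l, i)) = B (tt k) w $ i" for i
          using sum_lessThan_telescope[of "\<lambda>l. B (tt l) w $ i" k] that B_0[OF w] tt(2) by simp
        then show ?thesis by (simp add: vec_eq_iff)
      qed
      then have "ff w \<longleftrightarrow> (\<forall>k\<in>{k. k \<le> n \<and> tt k \<in> S}. B (tt k) w \<in> c (tt k))"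
        by (auto simp: f_def ff_def)
      also have "\<dots> \<longleftrightarrow> (\<forall>r\<in>S. B r w \<in> c r)"
      proof -
        have *: "S = tt ` {k. k \<le> n \<and> tt k \<in> S}" using tt(5) unfolding S'_def by auto
        show ?thesis by (subst (2) *) simp
      qed
      finally show ?thesis using w a(1) by simp
    qed
    have geq: "gg w \<longleftrightarrow> w \<in> b" if w: "w \<in> space M" for w
    proof -
      have "(\<chi> i. restrict (\<lambda>i. ?X i w) ({n} \<times> UNIV) (n, i)) = ?D w"
        using tt by (simp add: vec_eq_iff)
      then show ?thesis using w b(1) by (simp add: g_def gg_def)
    qed
    have ea: "ff -` {True} \<inter> space M = a" "gg -` {True} \<inter> space M = b"
      using feq geq sets.sets_into_space[OF subsetD[OF C_meas \<open>a \<in> C\<close>]] unfolding b(1)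
      by blast+
    have "prob ((\<lambda>w. (ff w, gg w)) -` ({True} \<times> {True}) \<inter> space M) = prob (ff -` {True} \<inter> space M) * prob (gg -` {True} \<inter> space M)"
      by (rule indep_varD[OF iv2]) auto
    moreover have "(\<lambda>w. (ff w, gg w)) -` ({True} \<times> {True}) \<inter> space M = a \<inter> b"
      unfolding ea[symmetric] by auto
    ultimately show ?thesis unfolding ea by simp
  qed
  have is1: "Int_stable (C \<union> null_sets M)"
  proof (rule Int_stableI)
    fix a b assume ab: "a \<in> C \<union> null_sets M" "b \<in> C \<union> null_sets M"
    then have ev: "a \<in> events" "b \<in> events" using C_meas by auto
    show "a \<inter> b \<in> C \<union> null_sets M"
    proof (cases "a \<in> C \<and> b \<in> C")
      case True
      then obtain S c S' c' where a: "a = {w\<in>space M. \<forall>r\<in>S. B r w \<in> c r}" "finite S" "S \<subseteq> {0..s}" "\<And>r. c r \<in> sets borel"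
        and b: "b = {w\<in>space M. \<forall>r\<in>S'. B r w \<in> c' r}" "finite S'" "S' \<subseteq> {0..s}" "\<And>r. c' r \<in> sets borel"
        unfolding C_def by blast
      \<comment> \<open>A time restricted by only one of the two events gets the trivial restriction
        \<open>UNIV\<close> from the other.\<close>
      define c'' where "c'' r = (if r \<in> S then c r else UNIV) \<inter> (if r \<in> S' then c' r else UNIV)" for r
      have "a \<inter> b = {w\<in>space M. \<forall>r\<in>S \<union> S'. B r w \<in> c'' r}" unfolding a(1) b(1) c''_def by auto
      moreover have "c'' r \<in> sets borel" for r using a(4) b(4) by (auto simp: c''_def)
      moreover have "finite (S \<union> S')" "S \<union> S' \<subseteq> {0..s}" using a(2,3) b(2,3) by auto
      ultimately have "a \<inter> b \<in> C" unfolding C_def by (intro CollectI exI[of _ "S \<union> S'"] exI[of _ c'']) simp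
      then show ?thesis by simp
    next
      case False
      then have "a \<inter> b \<in> null_sets M" using ab ev
        by (auto intro: null_set_Int1 null_set_Int2)
      then show ?thesis by auto
    qed
  qed
  have is2: "Int_stable G2"
  proof (rule Int_stableI)
    fix a b assume "a \<in> G2" "b \<in> G2"
    then obtain A A' where "a = ?D -` A \<inter> space M" "A \<in> sets borel" "b = ?D -` A' \<inter> space M" "A' \<in> sets borel"
      unfolding G2_def by blast
    then show "a \<inter> b \<in> G2" unfolding G2_def by (auto intro!: exI[of _ "A \<inter> A'"])
  qed
  have "indep_set (C \<union> null_sets M) G2"
    unfolding indep_sets2_eq
  proof (intro conjI ballI)
    show "C \<union> null_sets M \<subseteq> events" using C_meas by auto
    show "G2 \<subseteq> events" unfolding G2_def using measurable_sets[OF Dm] by auto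
    fix a b assume "a \<in> C \<union> null_sets M" "b \<in> G2"
    moreover have "b \<in> events" using \<open>b \<in> G2\<close> measurable_sets[OF Dm] unfolding G2_def by auto
    ultimately show "prob (a \<inter> b) = prob a * prob b"
      using ind[of a b] null_set_Int2[of a M b] by (auto simp: null_sets_def measure_def)
  qed
  from indep_set_sigma_sets[OF this is1 is2]
  have "indep_set (sigma_sets (space M) (C \<union> null_sets M)) (sigma_sets (space M) G2)" .
  then show ?thesis
    unfolding indep_sets2_eq
  proof (elim conjE, intro conjI)
    assume *: "sigma_sets (space M) (C \<union> null_sets M) \<subseteq> events" "sigma_sets (space M) G2 \<subseteq> events"
       "\<forall>a\<in>sigma_sets (space M) (C \<union> null_sets M). \<forall>b\<in>sigma_sets (space M) G2. prob (a \<inter> b) = prob a * prob b"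
    have "sets (F s) \<subseteq> sigma_sets (space M) (C \<union> null_sets M)"
      unfolding sets_F bfilt_def
    proof (rule sigma_sets_mono', rule Un_mono)
      show "{B r -` A \<inter> space M |r A. r \<in> {0..s} \<and> A \<in> sets borel} \<subseteq> C"
      proof
        fix x assume "x \<in> {B r -` A \<inter> space M |r A. r \<in> {0..s} \<and> A \<in> sets borel}"
        then obtain r A where x: "x = B r -` A \<inter> space M" "r \<in> {0..s}" "A \<in> sets borel" by blast
        have "x = {w\<in>space M. \<forall>r'\<in>{r}. B r' w \<in> (\<lambda>_. A) r'}" using x by auto
        then show "x \<in> C" unfolding C_def using x by (intro CollectI exI[of _ "{r}"] exI[of _ "\<lambda>_. A"]) auto
      qed
    qed auto
    moreover have "G2 \<subseteq> sigma_sets (space M) G2" by auto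
    ultimately show "\<forall>a\<in>sets (F s). \<forall>b\<in>{(\<lambda>w. B t w - B s w) -` A \<inter> space M | A. A \<in> sets borel}. prob (a \<inter> b) = prob a * prob b"
      using * unfolding G2_def by blast
    show "sets (F s) \<subseteq> events" using st by (intro sets_F_subset) auto
    show "{(\<lambda>w. B t w - B s w) -` A \<inter> space M | A. A \<in> sets borel} \<subseteq> events"
      using measurable_sets[OF Dm] by auto
  qed
qed

lemma indep_set_mono:
  "indep_set G H \<Longrightarrow> G' \<subseteq> G \<Longrightarrow> H' \<subseteq> H \<Longrightarrow> indep_set G' H'"
  unfolding indep_sets2_eq by (meson subset_iff)

lemma indep_past_increment_var:
  fixes X :: "'w \<Rightarrow> real" and k :: "real^'d \<Rightarrow> real"
  assumes st: "0 \<le> s" "s < t" "t \<le> T"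
    and X: "X \<in> borel_measurable (F s)" and k: "k \<in> borel_measurable borel"
  shows "indep_var borel X borel (\<lambda>w. k (B t w - B s w))"
proof -
  let ?D = "\<lambda>w. B t w - B s w"
  have Dm: "?D \<in> borel_measurable M"
    using st by (intro borel_measurable_diff B_measurable) auto
  have kDm: "(\<lambda>w. k (?D w)) \<in> borel_measurable M"
    by (rule measurable_compose[OF Dm k])
  show ?thesis
    unfolding indep_var_eq
  proof (intro conjI)
    show "random_variable borel X" using X st by (intro F_measurable_M[OF X]) auto
    show "random_variable borel (\<lambda>w. k (?D w))" by (fact kDm)
    \<comment> \<open>The preimages of Borel sets already form a sigma-algebra, so generating one
      adds nothing and independence of events applies directly.\<close>
    have s1: "sigma_sets (space M) {X -` A \<inter> space M |A. A \<in> sets borel} = {X -` A \<inter> space M |A. A \<in> sets borel}"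
      by (subst sigma_sets_vimage_commute[of X "space M" UNIV "sets borel", symmetric])
        (simp_all add: sets.sigma_sets_eq[of borel, unfolded space_borel])
    have s2: "sigma_sets (space M) {(\<lambda>w. k (?D w)) -` A \<inter> space M |A. A \<in> sets borel} = {(\<lambda>w. k (?D w)) -` A \<inter> space M |A. A \<in> sets borel}"
      by (subst sigma_sets_vimage_commute[of "\<lambda>w. k (?D w)" "space M" UNIV "sets borel", symmetric])
        (simp_all add: sets.sigma_sets_eq[of borel, unfolded space_borel])
    have 1: "{X -` A \<inter> space M |A. A \<in> sets borel} \<subseteq> sets (F s)"
      using measurable_sets[OF X] by auto
    have 2: "{(\<lambda>w. k (?D w)) -` A \<inter> space M |A. A \<in> sets borel} \<subseteq> {?D -` A \<inter> space M | A. A \<in> sets borel}"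
    proof
      fix a assume "a \<in> {(\<lambda>w. k (?D w)) -` A \<inter> space M |A. A \<in> sets borel}"
      then obtain A where "a = (\<lambda>w. k (?D w)) -` A \<inter> space M" "A \<in> sets borel" by blast
      then have "a = ?D -` (k -` A) \<inter> space M" "k -` A \<in> sets borel" using measurable_sets[OF k] by auto
      then show "a \<in> {?D -` A \<inter> space M | A. A \<in> sets borel}" by blast
    qed
    show "indep_set (sigma_sets (space M) {X -` A \<inter> space M |A. A \<in> sets borel})
       (sigma_sets (space M) {(\<lambda>w. k (?D w)) -` A \<inter> space M | A. A \<in> sets borel})"
      unfolding s1 s2 by (rule indep_set_mono[OF indep_past_increment[OF st] 1 2])
  qed
qed

lemma increment_moments:
  assumes st: "0 \<le> s" "s < t" "t \<le> T"
  shows "integrable M (\<lambda>w. (B t w $ i - B s w $ i) ^ k)"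
    and "E (\<lambda>w. B t w $ i - B s w $ i) = 0"
    and "E (\<lambda>w. (B t w $ i - B s w $ i)\<^sup>2) = t - s"
    and "E (\<lambda>w. (B t w $ i - B s w $ i) ^ 4) = 3 * (t - s)\<^sup>2"
    and "i \<noteq> j \<Longrightarrow> E (\<lambda>w. (B t w $ i - B s w $ i) * (B t w $ j - B s w $ j)) = 0"
proof -
  \<comment> \<open>The definition of Brownian motion is used with the single step from
    \<open>s\<close> to \<open>t\<close>.\<close>
  define tt where "tt k = (if k = 0 then s else t)" for k :: nat
  have tt: "\<forall>k<1. 0 \<le> tt k \<and> tt k < tt (Suc k) \<and> tt (Suc k) \<le> T" using st by (auto simp: tt_def)
  have d: "distributed M lborel (\<lambda>w. B t w $ i - B s w $ i) (\<lambda>x. ennreal (normal_density 0 (sqrt (t - s)) x))" for i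
    using bm[unfolded brownian_motion_def, THEN conjunct2, THEN conjunct2, rule_format, of 1 tt] tt
    by (auto simp: tt_def)
  have iv: "indep_vars (\<lambda>_. borel) (\<lambda>(k, i) w. B (tt (Suc k)) w $ i - B (tt k) w $ i) ({..<1::nat} \<times> (UNIV :: 'd set))"
    using bm[unfolded brownian_motion_def, THEN conjunct2, THEN conjunct2, rule_format, of 1 tt] tt
    by auto
  have pos: "0 < sqrt (t - s)" using st by simp
  have int: "integrable M (\<lambda>w. (B t w $ i - B s w $ i) ^ k)" for k i
    using distributed_integrable[OF d, of "\<lambda>x. x ^ k"] integrable_normal_moment[OF pos, of 0 k] by simp
  then show "integrable M (\<lambda>w. (B t w $ i - B s w $ i) ^ k)" .
  have e: "E (\<lambda>w. (B t w $ i - B s w $ i) ^ k) = (\<integral>x. normal_density 0 (sqrt (t - s)) x * x ^ k \<partial>lborel)" for k i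
    using distributed_integral[OF d, of "\<lambda>x. x ^ k"] by simp
  have e1: "E (\<lambda>w. B t w $ i - B s w $ i) = 0" for i
    using e[of i 1] integral_normal_moment_nz_1[OF pos, of 0] by simp
  then show "E (\<lambda>w. B t w $ i - B s w $ i) = 0" .
  show "E (\<lambda>w. (B t w $ i - B s w $ i)\<^sup>2) = t - s"
  proof -
    have "(\<integral>x. normal_density 0 (sqrt (t - s)) x * x\<^sup>2 \<partial>lborel) = t - s"
      using integral_normal_moment_even[OF pos, of 0 1] st by simp
    then show ?thesis using e[of i 2] by simp
  qed
  have "(fact 4::real) = 24" by (simp add: fact_numeral)
  show "E (\<lambda>w. (B t w $ i - B s w $ i) ^ 4) = 3 * (t - s)\<^sup>2"
  proof -
    have "(\<integral>x. normal_density 0 (sqrt (t - s)) x * x ^ 4 \<partial>lborel) = 3 * (t - s)\<^sup>2"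
      using integral_normal_moment_even[OF pos, of 0 2] st \<open>(fact 4::real) = 24\<close> by (simp add: power_divide)
    then show ?thesis using e[of i 4] by simp
  qed
  assume ij: "i \<noteq> j"
  have iv2: "indep_vars (\<lambda>_. borel) (\<lambda>(k, i) w. B (tt (Suc k)) w $ i - B (tt k) w $ i) {(0::nat, i), (0, j)}"
    by (rule indep_vars_subset[OF iv]) auto
  have "integrable M (\<lambda>w. B t w $ i - B s w $ i)" for i using int[of i 1] by simp
  then have "E (\<lambda>w. \<Prod>x\<in>{(0::nat, i), (0, j)}. (case x of (k, i) \<Rightarrow> \<lambda>w. B (tt (Suc k)) w $ i - B (tt k) w $ i) w)
     = (\<Prod>x\<in>{(0::nat, i), (0, j)}. E (case x of (k, i) \<Rightarrow> \<lambda>w. B (tt (Suc k)) w $ i - B (tt k) w $ i))"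
    by (intro indep_vars_lebesgue_integral[OF _ iv2]) (auto simp: tt_def)
  then show "E (\<lambda>w. (B t w $ i - B s w $ i) * (B t w $ j - B s w $ j)) = 0"
    using ij by (simp add: tt_def e1)
qed

lemma past_times_increment:
  fixes X :: "'w \<Rightarrow> real"
  assumes st: "0 \<le> s" "s < t" "t \<le> T"
    and X: "X \<in> borel_measurable (F s)" "\<And>w. w \<in> space M \<Longrightarrow> \<bar>X w\<bar> \<le> C"
    and k: "k \<in> borel_measurable borel" "integrable M (\<lambda>w. k (B t w - B s w))"
  shows "integrable M (\<lambda>w. X w * k (B t w - B s w))"
    and "E (\<lambda>w. X w * k (B t w - B s w)) = E X * E (\<lambda>w. k (B t w - B s w))"
proof -
  have "integrable M X"
    using X st by (intro integrable_const_bound[where B=C] F_measurable_M[OF X(1)]) (auto intro!: AE_I2)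
  note * = this k(2)
  show "integrable M (\<lambda>w. X w * k (B t w - B s w))"
    by (rule indep_var_integrable[OF indep_past_increment_var[OF st X(1) k(1)] *])
  show "E (\<lambda>w. X w * k (B t w - B s w)) = E X * E (\<lambda>w. k (B t w - B s w))"
    by (rule indep_var_lebesgue_integral[OF indep_past_increment_var[OF st X(1) k(1)] *])
qed

text \<open>Given the past, \<open>\<xi>\<close> is centred with variance |h|^2 (t - s); the bounded
  past-measurable weight \<open>\<Psi>\<close> expresses the conditioning. In the fourth moment
  bound one factor d comes from squaring a sum of d squares, the other from adding up d coordinates,
  and 3 is the fourth moment of a standard normal variable.\<close>

lemma increment_inner:
  fixes h :: "'w \<Rightarrow> real^'d" and \<Psi> :: "'w \<Rightarrow> real"
  assumes st: "0 \<le> s" "s < t" "t \<le> T"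
    and h: "h \<in> borel_measurable (F s)" "\<And>w. w \<in> space M \<Longrightarrow> norm (h w) \<le> C"
    and P: "\<Psi> \<in> borel_measurable (F s)" "\<And>w. w \<in> space M \<Longrightarrow> \<bar>\<Psi> w\<bar> \<le> C'"
  defines "\<xi> \<equiv> \<lambda>w. h w \<bullet> (B t w - B s w)"
  shows "integrable M (\<lambda>w. \<Psi> w * \<xi> w)" "E (\<lambda>w. \<Psi> w * \<xi> w) = 0"
    and "integrable M (\<lambda>w. \<Psi> w * (\<xi> w)\<^sup>2)"
    and "E (\<lambda>w. \<Psi> w * (\<xi> w)\<^sup>2) = E (\<lambda>w. \<Psi> w * ((norm (h w))\<^sup>2 * (t - s)))"
    and "integrable M (\<lambda>w. (\<xi> w) ^ 4)"
    and "E (\<lambda>w. (\<xi> w) ^ 4) \<le> 3 * (real CARD('d))\<^sup>2 * E (\<lambda>w. ((norm (h w))\<^sup>2 * (t - s))\<^sup>2)"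
proof -
  let ?D = "\<lambda>i w. B t w $ i - B s w $ i"
  have sT: "s \<le> T" using st by auto
  have hi: "(\<lambda>w. h w $ i) \<in> borel_measurable (F s)" for i
    by (rule measurable_compose[OF h(1) vec_nth_measurable])
  have hb: "\<bar>h w $ i\<bar> \<le> C" if "w \<in> space M" for w i
    using component_le_norm_cart[of "h w" i] h(2)[OF that] by simp
  have hM: "h \<in> borel_measurable M" "\<Psi> \<in> borel_measurable M"
    using h(1) P(1) sT by (auto intro: F_measurable_M)
  have DM[measurable]: "?D i \<in> borel_measurable M" for i
    using st by (intro borel_measurable_diff measurable_compose[OF B_measurable vec_nth_measurable]) auto
  note [measurable] = hM
  have xi: "\<xi> w = (\<Sum>i\<in>UNIV. h w $ i * ?D i w)" for w
    by (simp add: \<xi>_def inner_vec_def)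
  have C0: "0 \<le> C" using h(2) not_empty by (metis all_not_in_conv norm_ge_zero order_trans)
  have C'0: "0 \<le> C'" using P(2) not_empty by (metis all_not_in_conv abs_ge_zero order_trans)
  have D1: "integrable M (?D i)" for i using increment_moments(1)[OF st, of i 1] by simp
  have lin: "integrable M (\<lambda>w. (\<Psi> w * h w $ i) * ?D i w)" "E (\<lambda>w. (\<Psi> w * h w $ i) * ?D i w) = 0" for i
  proof -
    have X: "(\<lambda>w. \<Psi> w * h w $ i) \<in> borel_measurable (F s)" using P(1) hi by measurable
    have Xb: "\<bar>\<Psi> w * h w $ i\<bar> \<le> C' * C" if "w \<in> space M" for w
      unfolding abs_mult using P(2)[OF that] hb[OF that] C'0 by (intro mult_mono) auto
    have "(\<lambda>x::real^'d. x $ i) \<in> borel_measurable borel" by measurable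
    note * = past_times_increment[OF st X Xb this]
    show "integrable M (\<lambda>w. (\<Psi> w * h w $ i) * ?D i w)" using *(1) D1[of i] by simp
    show "E (\<lambda>w. (\<Psi> w * h w $ i) * ?D i w) = 0"
      using *(2) D1[of i] increment_moments(2)[OF st, of i] by simp
  qed
  have e1: "\<Psi> w * \<xi> w = (\<Sum>i\<in>UNIV. (\<Psi> w * h w $ i) * ?D i w)" for w
    by (simp add: xi sum_distrib_left mult.assoc)
  show "integrable M (\<lambda>w. \<Psi> w * \<xi> w)" unfolding e1 using lin by (intro Bochner_Integration.integrable_sum)
  show "E (\<lambda>w. \<Psi> w * \<xi> w) = 0" unfolding e1 using lin by (subst Bochner_Integration.integral_sum) auto
  \<comment> \<open>Products of distinct coordinates of the increment have mean zero, so only the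
    diagonal of the double sum survives.\<close>
  have quad: "integrable M (\<lambda>w. (\<Psi> w * h w $ i * h w $ j) * (?D i w * ?D j w))"
    "E (\<lambda>w. (\<Psi> w * h w $ i * h w $ j) * (?D i w * ?D j w)) =
       (if i = j then E (\<lambda>w. \<Psi> w * (h w $ i)\<^sup>2) * (t - s) else 0)" for i j
  proof -
    have X: "(\<lambda>w. \<Psi> w * h w $ i * h w $ j) \<in> borel_measurable (F s)" using P(1) hi by measurable
    have Xb: "\<bar>\<Psi> w * h w $ i * h w $ j\<bar> \<le> C' * C * C" if "w \<in> space M" for w
      unfolding abs_mult using P(2)[OF that] hb[OF that] C'0 C0 by (intro mult_mono) auto
    have k: "(\<lambda>x::real^'d. x $ i * x $ j) \<in> borel_measurable borel" by measurable
    have ik: "integrable M (\<lambda>w. ?D i w * ?D j w)"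
    proof (rule Bochner_Integration.integrable_bound)
      show "integrable M (\<lambda>w. (?D i w)\<^sup>2 + (?D j w)\<^sup>2)"
        using increment_moments(1)[OF st] by (intro Bochner_Integration.integrable_add)
      have "\<bar>a * b\<bar> \<le> \<bar>a\<^sup>2 + b\<^sup>2\<bar>" for a b :: real
      proof -
        have "0 \<le> \<bar>a\<bar> * \<bar>b\<bar>" by simp
        moreover have "2 * (\<bar>a\<bar> * \<bar>b\<bar>) \<le> a\<^sup>2 + b\<^sup>2" using sum_squares_bound[of "\<bar>a\<bar>" "\<bar>b\<bar>"] by (simp add: mult.assoc)
        moreover have "\<bar>a * b\<bar> = \<bar>a\<bar> * \<bar>b\<bar>" "\<bar>a\<^sup>2 + b\<^sup>2\<bar> = a\<^sup>2 + b\<^sup>2" by (auto simp: abs_mult)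
        ultimately show ?thesis by linarith
      qed
      then show "AE w in M. norm (?D i w * ?D j w) \<le> norm ((?D i w)\<^sup>2 + (?D j w)\<^sup>2)" by simp
    qed measurable
    note * = past_times_increment[OF st X Xb k]
    show "integrable M (\<lambda>w. (\<Psi> w * h w $ i * h w $ j) * (?D i w * ?D j w))" using *(1) ik by simp
    show "E (\<lambda>w. (\<Psi> w * h w $ i * h w $ j) * (?D i w * ?D j w)) =
       (if i = j then E (\<lambda>w. \<Psi> w * (h w $ i)\<^sup>2) * (t - s) else 0)"
      using *(2) ik increment_moments(3)[OF st, of i] increment_moments(5)[OF st, of i j]
      by (cases "i = j") (simp_all add: power2_eq_square mult.assoc)
  qed
  have e2: "\<Psi> w * (\<xi> w)\<^sup>2 = (\<Sum>i\<in>UNIV. \<Sum>j\<in>UNIV. (\<Psi> w * h w $ i * h w $ j) * (?D i w * ?D j w))" for w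
    by (simp add: xi power2_eq_square sum_product sum_distrib_left mult_ac)
  show "integrable M (\<lambda>w. \<Psi> w * (\<xi> w)\<^sup>2)"
    unfolding e2 using quad by (intro Bochner_Integration.integrable_sum)
  have ih: "integrable M (\<lambda>w. \<Psi> w * (h w $ i)\<^sup>2)" for i
  proof (rule integrable_const_bound[where B="C' * C\<^sup>2"])
    show "AE w in M. norm (\<Psi> w * (h w $ i)\<^sup>2) \<le> C' * C\<^sup>2"
      using P(2) hb C'0 C0 by (intro AE_I2) (auto simp: abs_mult abs_le_square_iff[symmetric] intro!: mult_mono abs_le_square_iff[THEN iffD1])
  qed measurable
  have "E (\<lambda>w. \<Psi> w * (\<xi> w)\<^sup>2) = (\<Sum>i\<in>UNIV. \<Sum>j\<in>UNIV. if i = j then E (\<lambda>w. \<Psi> w * (h w $ i)\<^sup>2) * (t - s) else 0)"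
    unfolding e2 using quad by (simp add: Bochner_Integration.integral_sum Bochner_Integration.integrable_sum del: mult_cancel_left)
  also have "\<dots> = (\<Sum>i\<in>UNIV. E (\<lambda>w. \<Psi> w * (h w $ i)\<^sup>2)) * (t - s)"
    by (simp add: sum_distrib_right)
  also have "(\<Sum>i\<in>UNIV. E (\<lambda>w. \<Psi> w * (h w $ i)\<^sup>2)) = E (\<lambda>w. \<Sum>i\<in>UNIV. \<Psi> w * (h w $ i)\<^sup>2)"
    using ih by (subst Bochner_Integration.integral_sum) auto
  also have "(\<lambda>w. \<Sum>i\<in>UNIV. \<Psi> w * (h w $ i)\<^sup>2) = (\<lambda>w. \<Psi> w * (norm (h w))\<^sup>2)"
    unfolding power2_norm_eq_inner inner_vec_def by (simp add: sum_distrib_left power2_eq_square)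
  finally show "E (\<lambda>w. \<Psi> w * (\<xi> w)\<^sup>2) = E (\<lambda>w. \<Psi> w * ((norm (h w))\<^sup>2 * (t - s)))"
    by (simp flip: mult.assoc)
  let ?d = "real CARD('d)"
  let ?n4 = "\<lambda>w. ((norm (h w))\<^sup>2)\<^sup>2"
  have X: "?n4 \<in> borel_measurable (F s)" using h(1) by measurable
  have Xb: "\<bar>?n4 w\<bar> \<le> (C\<^sup>2)\<^sup>2" if "w \<in> space M" for w
    using h(2)[OF that] by (simp add: power_mono)
  have k: "(\<lambda>x::real^'d. (x $ i) ^ 4) \<in> borel_measurable borel" for i by measurable
  have i4: "integrable M (\<lambda>w. ?n4 w * (?D i w) ^ 4)"
    "E (\<lambda>w. ?n4 w * (?D i w) ^ 4) = E ?n4 * (3 * (t - s)\<^sup>2)" for i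
    using past_times_increment[OF st X Xb k[of i]] increment_moments(1)[OF st, of i 4] increment_moments(4)[OF st, of i] by auto
  have b4: "(\<xi> w) ^ 4 \<le> ?d * (\<Sum>i\<in>UNIV. ?n4 w * (?D i w) ^ 4)" for w
  proof -
    have "(\<xi> w)\<^sup>2 \<le> (norm (h w))\<^sup>2 * (norm (B t w - B s w))\<^sup>2"
      unfolding \<xi>_def using Cauchy_Schwarz_ineq[of "h w" "B t w - B s w"] by (simp add: power2_norm_eq_inner)
    then have "((\<xi> w)\<^sup>2)\<^sup>2 \<le> ((norm (h w))\<^sup>2 * (norm (B t w - B s w))\<^sup>2)\<^sup>2"
      by (rule power_mono) simp
    moreover have "((norm (B t w - B s w))\<^sup>2)\<^sup>2 \<le> ?d * (\<Sum>i\<in>UNIV. (?D i w) ^ 4)"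
    proof -
      have "(norm (B t w - B s w))\<^sup>2 = (\<Sum>i\<in>UNIV. (?D i w)\<^sup>2)"
        unfolding power2_norm_eq_inner inner_vec_def by (simp add: power2_eq_square)
      then have "((norm (B t w - B s w))\<^sup>2)\<^sup>2 \<le> ?d * (\<Sum>i\<in>UNIV. ((?D i w)\<^sup>2)\<^sup>2)"
        using Cauchy_Schwarz_ineq_sum[of "\<lambda>_. 1" "\<lambda>i. (?D i w)\<^sup>2" UNIV] by simp
      then show ?thesis by simp
    qed
    ultimately have "((\<xi> w)\<^sup>2)\<^sup>2 \<le> ?n4 w * (?d * (\<Sum>i\<in>UNIV. (?D i w) ^ 4))"
      by (simp add: power_mult_distrib) (meson mult_left_mono order_trans zero_le_power zero_le_even_power even_numeral)
    then show ?thesis by (simp add: sum_distrib_left mult_ac)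
  qed
  have ib: "integrable M (\<lambda>w. ?d * (\<Sum>i\<in>UNIV. ?n4 w * (?D i w) ^ 4))"
    using i4 by (intro integrable_mult_right Bochner_Integration.integrable_sum)
  have xm: "\<xi> \<in> borel_measurable M" unfolding xi[abs_def] by measurable
  show i\<xi>: "integrable M (\<lambda>w. (\<xi> w) ^ 4)"
    by (rule Bochner_Integration.integrable_bound[OF ib]) (use xm b4 in \<open>auto intro!: AE_I2 order_trans[OF _ abs_ge_self]\<close>)
  have "E (\<lambda>w. (\<xi> w) ^ 4) \<le> E (\<lambda>w. ?d * (\<Sum>i\<in>UNIV. ?n4 w * (?D i w) ^ 4))"
    by (rule integral_mono[OF i\<xi> ib b4])
  also have "\<dots> = ?d * (\<Sum>i\<in>(UNIV::'d set). E ?n4 * (3 * (t - s)\<^sup>2))"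
    using i4 by (simp add: Bochner_Integration.integral_sum)
  also have "\<dots> = 3 * ?d\<^sup>2 * E (\<lambda>w. ((norm (h w))\<^sup>2 * (t - s))\<^sup>2)"
    by (simp add: power_mult_distrib power2_eq_square[of ?d])
  finally show "E (\<lambda>w. (\<xi> w) ^ 4) \<le> 3 * ?d\<^sup>2 * E (\<lambda>w. ((norm (h w))\<^sup>2 * (t - s))\<^sup>2)" .
qed

end

section \<open>Elementary approximation of the Ito integral\<close>

text \<open>Lets a continuous path be tested at rational times: this makes events quantified over
  all times measurable and carries almost sure statements from rational times to all times.\<close>

lemma continuous_on_rational_hit:
  fixes f :: "real \<Rightarrow> 'b::topological_space"
  assumes f: "continuous_on {a..b} f" and ab: "a < b" and U: "open U" and t: "t \<in> {a..b}" "f t \<in> U"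
  obtains q where "q \<in> {a..b} \<inter> \<rat>" "f q \<in> U"
proof -
  obtain A where A: "open A" "A \<inter> {a..b} = f -` U \<inter> {a..b}"
    using f U unfolding continuous_on_open_invariant by blast
  have "t \<in> f -` U \<inter> {a..b}" using t by simp
  then have "t \<in> A" unfolding A(2)[symmetric] by simp
  then obtain d where d: "d > 0" "ball t d \<subseteq> A" using A(1) openE by blast
  have "max a (t - d) < min b (t + d)" using t ab d by auto
  then obtain q where q: "q \<in> \<rat>" "max a (t - d) < q" "q < min b (t + d)"
    using Rats_dense_in_real by blast
  then have "q \<in> ball t d" "q \<in> {a..b}" by (auto simp: dist_real_def)
  then have "q \<in> f -` U \<inter> {a..b}" unfolding A(2)[symmetric] using d(2) by blast
  then show thesis using that[of q] q(1) by simp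
qed

text \<open>Borel-Cantelli along indices chosen so fast that the k-th probability is below 2^-k,
  while the tolerance \<open>1 / Suc k\<close> shrinks along with them.\<close>

lemma (in prob_space) events_vanish_AE_subseq:
  fixes A :: "nat \<Rightarrow> real \<Rightarrow> 'a set"
  assumes A: "\<And>m e. e > 0 \<Longrightarrow> A m e \<in> events" and lim: "\<And>e. e > 0 \<Longrightarrow> (\<lambda>m. prob (A m e)) \<longlonglongrightarrow> 0"
  obtains r :: "nat \<Rightarrow> nat" where "AE w in M. eventually (\<lambda>k. w \<notin> A (r k) (1 / Suc k)) sequentially"
proof -
  have "\<exists>m. prob (A m (1 / Suc k)) < (1/2) ^ k" for k
    using order_tendstoD(2)[OF lim, of "1 / Suc k" "(1/2) ^ k"] by (auto simp: eventually_sequentially)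
  then obtain r where r: "\<And>k. prob (A (r k) (1 / Suc k)) < (1/2) ^ k" by metis
  have "summable (\<lambda>k. prob (A (r k) (1 / Suc k)))"
    by (rule summable_comparison_test'[OF summable_geometric[of "1/2::real"]]) (use r in \<open>auto intro: less_imp_le\<close>)
  then have "AE x in M. eventually (\<lambda>k. x \<in> space M - A (r k) (1 / Suc k)) sequentially"
    by (intro borel_cantelli_AE1) (auto simp: A less_top[symmetric])
  then have "AE x in M. eventually (\<lambda>k. x \<notin> A (r k) (1 / Suc k)) sequentially"
    by (rule AE_mp) (auto intro!: AE_I2 elim: eventually_mono)
  then show thesis by (rule that)
qed

text \<open>Progressive measurability is stated on a restricted time interval; a cut-off by an
  indicator moves it to the full product space, where Fubini's theorem applies.\<close>

lemma measurable_indicator_pair_restrict: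
  fixes f :: "real \<times> 'a \<Rightarrow> 'b::real_normed_vector"
  assumes f: "f \<in> borel_measurable (restrict_space borel A \<Otimes>\<^sub>M N)" and A: "A \<in> sets borel"
  shows "(\<lambda>x. indicator A (fst x) *\<^sub>R f x) \<in> borel_measurable (borel \<Otimes>\<^sub>M N)"
proof -
  have "(\<lambda>x. if fst x \<in> A then f x else 0) \<in> borel_measurable (borel \<Otimes>\<^sub>M N)"
  proof (rule measurable_If_restrict_space_iff[THEN iffD2, OF _ conjI])
    show "{x \<in> space (borel \<Otimes>\<^sub>M N). fst x \<in> A} \<in> sets (borel \<Otimes>\<^sub>M N)" using A by measurable
    have "(\<lambda>x. x) \<in> restrict_space (borel \<Otimes>\<^sub>M N) {x. fst x \<in> A} \<rightarrow>\<^sub>M restrict_space borel A \<Otimes>\<^sub>M N"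
    proof (rule measurable_pair)
      show "fst \<circ> (\<lambda>x. x) \<in> restrict_space (borel \<Otimes>\<^sub>M N) {x. fst x \<in> A} \<rightarrow>\<^sub>M restrict_space borel A"
        by (intro measurable_restrict_space2 measurable_restrict_space1) (auto simp: space_restrict_space comp_def)
      show "snd \<circ> (\<lambda>x. x) \<in> restrict_space (borel \<Otimes>\<^sub>M N) {x. fst x \<in> A} \<rightarrow>\<^sub>M N"
        by (intro measurable_restrict_space1) (auto simp: comp_def)
    qed
    from measurable_compose[OF this f]
    show "f \<in> borel_measurable (restrict_space (borel \<Otimes>\<^sub>M N) {x. fst x \<in> A})" by simp
  qed auto
  moreover have "(\<lambda>x. if fst x \<in> A then f x else 0) = (\<lambda>x. indicator A (fst x) *\<^sub>R f x)"
    by (auto simp: fun_eq_iff)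
  ultimately show ?thesis by simp
qed

lemma finite_set_grid:
  fixes S :: "real set"
  assumes S: "finite S" "S \<noteq> {}"
  obtains n and tg :: "nat \<Rightarrow> real" where "S = tg ` {..n}" "tg 0 = Min S" "tg n = Max S"
    "\<And>i j. i < j \<Longrightarrow> j \<le> n \<Longrightarrow> tg i < tg j" "\<And>i. i < n \<Longrightarrow> S \<inter> {tg i<..<tg (Suc i)} = {}"
proof -
  define xs where "xs = sorted_list_of_set S"
  have xs: "set xs = S" "sorted_wrt (<) xs" using S by (auto simp: xs_def)
  define n where "n = length xs - 1"
  have ne: "xs \<noteq> []" using xs S by auto
  have ln: "length xs = Suc n" using ne by (simp add: n_def)
  define tg where "tg k = xs ! k" for k
  have lt: "tg i < tg j" if "i < j" "j \<le> n" for i j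
    using xs(2) that ln by (simp add: sorted_wrt_nth_less tg_def)
  have S_eq: "S = tg ` {..n}"
  proof -
    have "S = (\<lambda>k. xs ! k) ` {..<Suc n}" using xs(1) ln by (auto simp: set_conv_nth)
    then show ?thesis by (auto simp: tg_def less_Suc_eq_le image_iff)
  qed
  have le: "tg i \<le> tg j" if "i \<le> j" "j \<le> n" for i j
    using lt[of i j] that by (cases "i = j") auto
  have "tg 0 = Min S" unfolding S_eq by (rule Min_eqI[symmetric]) (auto intro: le)
  moreover have "tg n = Max S" unfolding S_eq by (rule Max_eqI[symmetric]) (auto intro: le)
  moreover have "S \<inter> {tg i<..<tg (Suc i)} = {}" if "i < n" for i
  proof (rule ccontr)
    assume "S \<inter> {tg i<..<tg (Suc i)} \<noteq> {}"
    then obtain k where k: "k \<le> n" "tg i < tg k" "tg k < tg (Suc i)" using S_eq by auto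
    then show False using le[of k i] le[of "Suc i" k] that by (cases "k \<le> i") auto
  qed
  ultimately show thesis using that[OF S_eq _ _ lt] by simp
qed

text \<open>Besides \<open>P\<close> the grid contains the division points of [s,t] into
  \<open>N\<close> equal parts shorter than \<open>\<delta>\<close>; the points of \<open>P\<close>
  only refine it further.\<close>

lemma refined_grid:
  fixes s t \<delta> :: real
  assumes st: "s < t" and P: "finite P" and d: "\<delta> > 0"
  obtains n and tg :: "nat \<Rightarrow> real" where "tg 0 = s" "tg n = t"
    "\<And>i j. i < j \<Longrightarrow> j \<le> n \<Longrightarrow> tg i < tg j" "\<And>i. i < n \<Longrightarrow> P \<inter> {tg i<..<tg (Suc i)} = {}"
    "\<And>i. i < n \<Longrightarrow> tg (Suc i) - tg i \<le> \<delta>"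
proof -
  obtain N :: nat where N: "(t - s) / \<delta> < N" using reals_Archimedean2 by blast
  then have N0: "0 < N" using st d by (metis divide_pos_pos diff_gt_0_iff_gt of_nat_0_less_iff order_less_trans)
  define S where "S = {s, t} \<union> (P \<inter> {s..t}) \<union> (\<lambda>i. s + (t - s) * real i / N) ` {..N}"
  have pt: "s + (t - s) * real i / N \<in> {s..t}" if "i \<le> N" for i
  proof -
    have "(t - s) * (real i / N) \<le> (t - s) * 1" using that N0 st by (intro mult_left_mono) auto
    then show ?thesis using st by auto
  qed
  have S: "finite S" "S \<noteq> {}" "S \<subseteq> {s..t}" "s \<in> S" "t \<in> S" using P pt st by (auto simp: S_def)
  obtain n tg where g: "S = tg ` {..n}" "tg 0 = Min S" "tg n = Max S"
    "\<And>i j. i < j \<Longrightarrow> j \<le> n \<Longrightarrow> tg i < tg j" "\<And>i. i < n \<Longrightarrow> S \<inter> {tg i<..<tg (Suc i)} = {}"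
    by (rule finite_set_grid[OF S(1,2)]) (rule that)
  have "Min S = s" using S by (intro Min_eqI) auto
  moreover have "Max S = t" using S by (intro Max_eqI) auto
  moreover have inS: "tg i \<in> {s..t}" if "i \<le> n" for i using g(1) S(3) that by auto
  have "P \<inter> {tg i<..<tg (Suc i)} = {}" if "i < n" for i
    using g(5)[OF that] inS[of i] inS[of "Suc i"] that by (auto simp: S_def)
  moreover have "tg (Suc i) - tg i \<le> \<delta>" if i: "i < n" for i
  proof (rule ccontr)
    assume "\<not> tg (Suc i) - tg i \<le> \<delta>"
    then have gt: "tg i + \<delta> < tg (Suc i)" by simp
    \<comment> \<open>The first equidistant point strictly after \<open>tg i\<close>. If the cell
      were longer than \<open>\<delta>\<close>, this point would lie inside it, although it belongs
      to \<open>S\<close>.\<close>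
    define k where "k = nat \<lfloor>(tg i - s) * N / (t - s)\<rfloor> + 1"
    have nn: "0 \<le> (tg i - s) * N / (t - s)" using inS[of i] i st by simp
    have k1: "(tg i - s) * N / (t - s) < k" "k \<le> (tg i - s) * N / (t - s) + 1"
      unfolding k_def using nn by linarith+
    have "(tg i - s) * N < k * (t - s)" using k1(1) st by (simp add: divide_less_eq)
    then have a: "tg i < s + (t - s) * k / N" using N0 by (simp add: field_simps)
    have "real k - 1 \<le> (tg i - s) * N / (t - s)" using k1(2) by simp
    then have "(real k - 1) * (t - s) \<le> (tg i - s) * N" using st by (subst (asm) pos_le_divide_eq) auto
    then have "(real k - 1) * (t - s) / N \<le> tg i - s" using N0 by (subst pos_divide_le_eq) auto
    then have "s + (t - s) * k / N \<le> tg i + (t - s) / N" by (simp add: field_simps diff_divide_distrib add_divide_distrib)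
    also have "(t - s) / N < \<delta>" using N d N0 by (simp add: field_simps)
    finally have b: "s + (t - s) * k / N < tg (Suc i)" using gt by simp
    have "s + (t - s) * k / N < t" using b inS[of "Suc i"] i by auto
    then have "(t - s) * (real k / N) < (t - s) * 1" by simp
    then have "real k / N < 1" using st by (subst (asm) mult_less_cancel_left_pos) auto
    then have "k \<le> N" using N0 by simp
    then have "s + (t - s) * k / N \<in> S" by (auto simp: S_def)
    then show False using a b g(5)[OF i] by auto
  qed
  ultimately show thesis using that[of tg n] g by simp
qed

context bm_space
begin

text \<open>\<open>J m\<close> is an elementary integral with integrand \<open>H m\<close> and grid \<open>P m\<close>; both are described only through their
  increments over intervals free of grid points, so that two approximations can be subtracted over the union of
  their grids.\<close>

definition elem_approx :: "(nat \<Rightarrow> real \<Rightarrow> 'w \<Rightarrow> real) \<Rightarrow> (nat \<Rightarrow> real \<Rightarrow> 'w \<Rightarrow> real^'d) \<Rightarrow> (nat \<Rightarrow> real set)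
    \<Rightarrow> (real \<Rightarrow> 'w \<Rightarrow> real) \<Rightarrow> (real \<Rightarrow> 'w \<Rightarrow> real^'d) \<Rightarrow> bool" where
  "elem_approx J H P I Z \<longleftrightarrow> (\<forall>m. finite (P m)) \<and>
     (\<forall>m u v. 0 \<le> u \<longrightarrow> u < v \<longrightarrow> v \<le> T \<longrightarrow> P m \<inter> {u<..<v} = {} \<longrightarrow>
        (\<exists>h C. h \<in> borel_measurable (F u) \<and> (\<forall>w\<in>space M. norm (h w) \<le> C \<and>
            J m v w - J m u w = h w \<bullet> (B v w - B u w) \<and> (\<forall>r\<in>{u<..v}. H m r w = h w)))) \<and>
     (\<forall>m w. (\<lambda>r. H m r w) \<in> borel_measurable borel) \<and>
     (AE w in M. (\<lambda>m. \<integral>\<^sup>+ t. ennreal ((norm (H m t w - Z t w))\<^sup>2) * indicator {0..T} t \<partial>lborel) \<longlonglongrightarrow> 0) \<and>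
     (AE w in M. uniform_limit {0..T} (\<lambda>m t. J m t w) (\<lambda>t. I t w) sequentially)"

lemma elem_approxD:
  assumes "elem_approx J H P I Z" "0 \<le> u" "u < v" "v \<le> T" "P m \<inter> {u<..<v} = {}"
  obtains h C where "h \<in> borel_measurable (F u)" "\<forall>w\<in>space M. norm (h w) \<le> C \<and>
            J m v w - J m u w = h w \<bullet> (B v w - B u w) \<and> (\<forall>r\<in>{u<..v}. H m r w = h w)"
proof -
  have "\<exists>h C. h \<in> borel_measurable (F u) \<and> (\<forall>w\<in>space M. norm (h w) \<le> C \<and>
            J m v w - J m u w = h w \<bullet> (B v w - B u w) \<and> (\<forall>r\<in>{u<..v}. H m r w = h w))"
    using assms(1)[unfolded elem_approx_def, THEN conjunct2, THEN conjunct1, THEN spec[of _ m], THEN spec[of _ u], THEN spec[of _ v]]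
      assms(2-5) by simp
  then show thesis using that by (elim exE conjE)
qed

text \<open>Between grid points a simple integrand is constant, equal to its value on the cell that
  begins at the last grid point up to \<open>u\<close>. Earlier cells contribute equally at
  \<open>u\<close> and \<open>v\<close>, later ones are clipped to nothing.\<close>

lemma simple_elementary:
  assumes sp: "simple_pred M B T n tt xs" and uv: "0 \<le> u" "u < v" "v \<le> T" and e: "tt ` {..n} \<inter> {u<..<v} = {}"
  shows "\<exists>h C. h \<in> borel_measurable (F u) \<and> (\<forall>w\<in>space M. norm (h w) \<le> C \<and>
            simple_int B n tt xs v w - simple_int B n tt xs u w = h w \<bullet> (B v w - B u w) \<and>
            (\<forall>r\<in>{u<..v}. simple_proc n tt xs r w = h w))"
proof -
  have tt: "tt 0 = 0" "tt n = T" "\<And>k. k < n \<Longrightarrow> tt k < tt (Suc k)"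
    and xs: "\<And>k. k < n \<Longrightarrow> xs k \<in> borel_measurable (F (tt k))" "\<And>k. k < n \<Longrightarrow> \<exists>C. \<forall>w\<in>space M. norm (xs k w) \<le> C"
    using sp by (auto simp: simple_pred_def)
  have mono: "tt i \<le> tt j" if "i \<le> j" "j \<le> n" for i j
    using that by (induction j rule: dec_induct) (auto intro: order_trans[OF _ less_imp_le[OF tt(3)]])
  define k where "k = Max {k. k \<le> n \<and> tt k \<le> u}"
  have fin: "finite {k. k \<le> n \<and> tt k \<le> u}" by simp
  have kin: "k \<in> {k. k \<le> n \<and> tt k \<le> u}" unfolding k_def using tt(1) uv by (intro Max_in) auto
  have kn: "k < n" using kin tt(2) uv by (cases "k = n") auto
  have "\<not> tt (Suc k) \<le> u"
  proof
    assume "tt (Suc k) \<le> u"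
    then have "Suc k \<le> k" unfolding k_def using kn fin by (intro Max_ge) (auto simp: k_def[symmetric])
    then show False by simp
  qed
  then have kv: "v \<le> tt (Suc k)" using e kn by (auto simp: disjoint_iff) (meson Suc_leI atMost_iff image_eqI not_le)
  have ku: "tt k \<le> u" using kin by simp
  have low: "tt (Suc l) \<le> u" "tt l \<le> u" if "l < k" for l using mono[of "Suc l" k] mono[of l k] that ku kn by auto
  have high: "v \<le> tt l" "v \<le> tt (Suc l)" if "k < l" "l < n" for l
    using mono[of "Suc k" l] mono[of "Suc k" "Suc l"] that kv by auto
  obtain C where C: "\<forall>w\<in>space M. norm (xs k w) \<le> C" using xs(2)[OF kn] by blast
  show ?thesis
  proof (intro exI[of _ "xs k"] exI[of _ C] conjI ballI)
    show "xs k \<in> borel_measurable (F u)" by (rule F_measurable_mono[OF xs(1)[OF kn] ku])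
    fix w assume w: "w \<in> space M"
    show "norm (xs k w) \<le> C" using C w by auto
    define d where "d l = xs l w \<bullet> (B (min (tt (Suc l)) v) w - B (min (tt l) v) w)
       - xs l w \<bullet> (B (min (tt (Suc l)) u) w - B (min (tt l) u) w)" for l
    have d0: "d l = 0" if "l < n" "l \<noteq> k" for l
    proof (cases "l < k")
      case True
      then show ?thesis using low[of l] uv by (simp add: d_def min_absorb1)
    next
      case False
      then show ?thesis using high[of l] that uv by (simp add: d_def min_absorb2)
    qed
    have "simple_int B n tt xs v w - simple_int B n tt xs u w = (\<Sum>l<n. d l)"
      by (simp add: simple_int_def d_def sum_subtractf)
    also have "\<dots> = d k" using kn d0 by (subst sum.remove[of _ k]) (auto intro!: sum.neutral)
    also have "d k = xs k w \<bullet> (B v w - B u w)"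
      using ku kv uv by (simp add: d_def min_absorb1 min_absorb2 inner_diff_right)
    finally show "simple_int B n tt xs v w - simple_int B n tt xs u w = xs k w \<bullet> (B v w - B u w)" .
    fix r assume r: "r \<in> {u<..v}"
    have "(\<Sum>l<n. indicator {tt l<..tt (Suc l)} r *\<^sub>R xs l w) = indicator {tt k<..tt (Suc k)} r *\<^sub>R xs k w"
    proof (subst sum.remove[of _ k])
      have "r \<notin> {tt l<..tt (Suc l)}" if "l < n" "l \<noteq> k" for l
        using that r low[of l] high[of l] by (cases "l < k") auto
      then show "indicator {tt k<..tt (Suc k)} r *\<^sub>R xs k w + (\<Sum>l\<in>{..<n} - {k}. indicator {tt l<..tt (Suc l)} r *\<^sub>R xs l w)
         = indicator {tt k<..tt (Suc k)} r *\<^sub>R xs k w" by (auto intro!: sum.neutral)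
    qed (use kn in auto)
    then show "simple_proc n tt xs r w = xs k w" using r ku kv by (simp add: simple_proc_def)
  qed
qed

lemma progressive_joint_measurable:
  fixes X :: "real \<Rightarrow> 'w \<Rightarrow> 'b::real_normed_vector"
  assumes X: "progressive M B T X" and t: "t \<in> {0..T}"
  shows "(\<lambda>(s, w). indicator {0..t} s *\<^sub>R X s w) \<in> borel_measurable (borel \<Otimes>\<^sub>M F t)"
  using measurable_indicator_pair_restrict[of "\<lambda>(s, w). X s w" "{0..t}" "F t"] X t
  by (auto simp: progressive_def split_beta')

lemma progressive_joint_measurable_M:
  fixes X :: "real \<Rightarrow> 'w \<Rightarrow> 'b::real_normed_vector"
  assumes X: "progressive M B T X"
  shows "(\<lambda>(s, w). indicator {0..T} s *\<^sub>R X s w) \<in> borel_measurable (borel \<Otimes>\<^sub>M M)"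
proof -
  have "(\<lambda>x. x) \<in> borel \<Otimes>\<^sub>M M \<rightarrow>\<^sub>M borel \<Otimes>\<^sub>M F T"
    by (rule measurable_pair) (auto simp: comp_def intro!: measurable_compose[OF measurable_snd] F_measurable_M[of _ T] measurableI
       dest: subsetD[OF sets_F_subset[OF order_refl]])
  from measurable_compose[OF this progressive_joint_measurable[OF X, of T]] T_pos show ?thesis by auto
qed

lemma progressive_adapted:
  assumes X: "progressive M B T X" and t: "t \<in> {0..T}"
  shows "X t \<in> borel_measurable (F t)"
proof -
  have "(\<lambda>w. (t, w)) \<in> F t \<rightarrow>\<^sub>M restrict_space borel {0..t} \<Otimes>\<^sub>M F t"
    using t by (intro measurable_Pair1') (auto simp: space_restrict_space)
  from measurable_compose[OF this X[unfolded progressive_def, rule_format, OF t]] show ?thesis by simp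
qed

lemma progressive_section:
  fixes X :: "real \<Rightarrow> 'w \<Rightarrow> 'b::real_normed_vector"
  assumes X: "progressive M B T X" and w: "w \<in> space M"
  shows "(\<lambda>s. indicator {0..T} s *\<^sub>R X s w) \<in> borel_measurable borel"
  using measurable_compose[OF measurable_Pair2'[OF w] progressive_joint_measurable_M[OF X]] by simp

lemma simple_proc_measurable:
  assumes sp: "simple_pred M B T n tt xs"
  shows "(\<lambda>(t, w). simple_proc n tt xs t w) \<in> borel_measurable (borel \<Otimes>\<^sub>M M)"
    and "(\<lambda>t. simple_proc n tt xs t w) \<in> borel_measurable borel"
proof -
  have mono: "tt i \<le> T" if "i \<le> n" for i
    using that sp unfolding simple_pred_def
    by (induction rule: inc_induct) (auto intro: order_trans[OF less_imp_le])
  have [measurable]: "xs k \<in> borel_measurable M" if "k < n" for k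
    using sp that mono[of k] by (intro F_measurable_M[of _ "tt k"]) (auto simp: simple_pred_def)
  show "(\<lambda>(t, w). simple_proc n tt xs t w) \<in> borel_measurable (borel \<Otimes>\<^sub>M M)"
    unfolding simple_proc_def split_beta'
    by (intro borel_measurable_sum borel_measurable_scaleR) (auto intro!: borel_measurable_indicator' measurable_compose[OF measurable_snd])
  show "(\<lambda>t. simple_proc n tt xs t w) \<in> borel_measurable borel"
    unfolding simple_proc_def by measurable
qed

lemma simple_int_continuous:
  assumes sp: "simple_pred M B T n tt xs" and w: "w \<in> space M"
  shows "continuous_on {0..T} (\<lambda>t. simple_int B n tt xs t w)"
    and "\<And>t. t \<in> {0..T} \<Longrightarrow> simple_int B n tt xs t \<in> borel_measurable M"
proof -
  have m1: "0 \<le> tt i" if "i \<le> n" for i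
    using that sp unfolding simple_pred_def by (induction i) (auto intro: order_trans[OF _ less_imp_le])
  have m2: "tt i \<le> T" if "i \<le> n" for i
    using that sp unfolding simple_pred_def
    by (induction rule: inc_induct) (auto intro: order_trans[OF less_imp_le])
  have c: "continuous_on {0..T} (\<lambda>t. B (min (tt k) t) w)" if "k \<le> n" for k
    by (rule continuous_on_compose2[OF B_continuous[OF w]]) (use m1 m2 that in \<open>auto intro!: continuous_intros\<close>)
  show "continuous_on {0..T} (\<lambda>t. simple_int B n tt xs t w)"
    unfolding simple_int_def by (intro continuous_intros c) auto
  fix t assume t: "t \<in> {0..T}"
  have "xs k \<in> borel_measurable M" if "k < n" for k
    using sp that m2[of k] by (intro F_measurable_M[of _ "tt k"]) (auto simp: simple_pred_def)
  moreover have "B (min (tt k) t) \<in> borel_measurable M" if "k \<le> n" for k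
    using m1[OF that] t by (intro B_measurable) auto
  ultimately show "simple_int B n tt xs t \<in> borel_measurable M"
    unfolding simple_int_def by (intro borel_measurable_sum borel_measurable_inner borel_measurable_diff) auto
qed

text \<open>Both convergences in probability become almost sure along one common subsequence, so
  that the later arguments can be made path by path.\<close>

lemma ito_integral_AE_approx:
  assumes I: "ito_integral M B T Z I" and Z: "progressive M B T Z"
  obtains J H P where "elem_approx J H P I Z"
proof -
  obtain nn tt xs where sp: "\<And>m. simple_pred M B T (nn m) (tt m) (xs m)"
    and c1: "\<And>e. e > 0 \<Longrightarrow> (\<lambda>m. measure M {w\<in>space M. ennreal e <
            (\<integral>\<^sup>+ t. ennreal ((norm (simple_proc (nn m) (tt m) (xs m) t w - Z t w))\<^sup>2)
                       * indicator {0..T} t \<partial>lborel)}) \<longlonglongrightarrow> 0"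
    and c2: "\<And>e. e > 0 \<Longrightarrow> (\<lambda>m. measure M {w\<in>space M. \<exists>t\<in>{0..T}.
            e < \<bar>simple_int B (nn m) (tt m) (xs m) t w - I t w\<bar>}) \<longlonglongrightarrow> 0"
    using I unfolding ito_integral_def by blast
  let ?H = "\<lambda>m. simple_proc (nn m) (tt m) (xs m)" and ?J = "\<lambda>m. simple_int B (nn m) (tt m) (xs m)"
  let ?q = "\<lambda>m w. \<integral>\<^sup>+ t. ennreal ((norm (?H m t w - Z t w))\<^sup>2) * indicator {0..T} t \<partial>lborel"
  define A1 where "A1 m e = {w\<in>space M. ennreal e < ?q m w}" for m e
  define A2 where "A2 m e = {w\<in>space M. \<exists>t\<in>{0..T}. e < \<bar>?J m t w - I t w\<bar>}" for m e
  have Ip: "progressive M B T I" and Ic: "\<And>w. w \<in> space M \<Longrightarrow> continuous_on {0..T} (\<lambda>t. I t w)"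
    using I by (auto simp: ito_integral_def)
  have "?q m \<in> borel_measurable M" for m
  proof -
    have eq: "ennreal ((norm (?H m t w - Z t w))\<^sup>2) * indicator {0..T} t
      = ennreal ((norm (?H m t w - indicator {0..T} t *\<^sub>R Z t w))\<^sup>2) * indicator {0..T} t" for t w
      by (auto simp: indicator_def)
    have [measurable]: "(\<lambda>x. ?H m (snd x) (fst x)) \<in> borel_measurable (M \<Otimes>\<^sub>M lborel)"
      "(\<lambda>x. indicator {0..T} (snd x) *\<^sub>R Z (snd x) (fst x)) \<in> borel_measurable (M \<Otimes>\<^sub>M lborel)"
      using measurable_compose[OF measurable_pair_swap' simple_proc_measurable(1)[OF sp[of m]]]
        measurable_compose[OF measurable_pair_swap' progressive_joint_measurable_M[OF Z]]
      by (auto simp: split_beta' cong: measurable_cong_sets)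
    show ?thesis unfolding eq
      by (intro lborel.borel_measurable_nn_integral) (auto simp: split_beta')
  qed
  then have A1: "A1 m e \<in> events" for m e unfolding A1_def by measurable
  have A2: "A2 m e \<in> events" if "e > 0" for m e
  proof -
    \<comment> \<open>Both processes are continuous, so a strict excess at some time also occurs at
      a rational time.\<close>
    have "A2 m e = (\<Union>q\<in>{0..T} \<inter> \<rat>. {w\<in>space M. e < \<bar>?J m q w - I q w\<bar>})"
    proof (intro set_eqI iffI)
      fix w assume "w \<in> A2 m e"
      then obtain t where w: "w \<in> space M" "t \<in> {0..T}" "\<bar>?J m t w - I t w\<bar> \<in> {e<..}" unfolding A2_def by auto
      have "continuous_on {0..T} (\<lambda>t. \<bar>?J m t w - I t w\<bar>)"
        using simple_int_continuous(1)[OF sp w(1)] Ic[OF w(1)] by (intro continuous_intros)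
      from continuous_on_rational_hit[OF this T_pos open_greaterThan w(2,3)]
      obtain q where "q \<in> {0..T} \<inter> \<rat>" "\<bar>?J m q w - I q w\<bar> \<in> {e<..}" .
      then show "w \<in> (\<Union>q\<in>{0..T} \<inter> \<rat>. {w\<in>space M. e < \<bar>?J m q w - I q w\<bar>})" using w(1) by auto
    qed (auto simp: A2_def)
    also have "\<dots> \<in> events"
    proof (rule sets.countable_UN')
      show "countable ({0..T} \<inter> \<rat>)" using countable_rat by blast
      have "{w\<in>space M. e < \<bar>?J m q w - I q w\<bar>} \<in> events" if q: "q \<in> {0..T} \<inter> \<rat>" for q
      proof -
        have [measurable]: "?J m q \<in> borel_measurable M" "I q \<in> borel_measurable M"
          using simple_int_continuous(2)[OF sp[of m]] not_empty q
            F_measurable_M[OF progressive_adapted[OF Ip, of q]] by auto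
        show ?thesis by measurable
      qed
      then show "(\<lambda>q. {w\<in>space M. e < \<bar>?J m q w - I q w\<bar>}) ` ({0..T} \<inter> \<rat>) \<subseteq> events" by blast
    qed
    finally show ?thesis .
  qed
  \<comment> \<open>Applied to the union of the two bad events, Borel-Cantelli yields a single
    subsequence for the integrands and the integrals.\<close>
  obtain r where r: "AE w in M. eventually (\<lambda>k. w \<notin> A1 (r k) (1 / Suc k) \<union> A2 (r k) (1 / Suc k)) sequentially"
  proof (rule events_vanish_AE_subseq[of "\<lambda>m e. A1 m e \<union> A2 m e"])
    show "e > 0 \<Longrightarrow> A1 m e \<union> A2 m e \<in> events" for m e using A1 A2 by auto
    fix e :: real assume e: "e > 0"
    show "(\<lambda>m. prob (A1 m e \<union> A2 m e)) \<longlonglongrightarrow> 0"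
    proof (rule tendsto_sandwich[OF always_eventually always_eventually tendsto_const])
      show "(\<lambda>m. prob (A1 m e) + prob (A2 m e)) \<longlonglongrightarrow> 0"
        using tendsto_add[OF c1[OF e] c2[OF e]] by (simp add: A1_def A2_def)
      show "\<forall>m. prob (A1 m e \<union> A2 m e) \<le> prob (A1 m e) + prob (A2 m e)"
        using A1 A2[OF e] by (auto intro: measure_Un_le)
    qed auto
  qed blast
  have "elem_approx (\<lambda>k. ?J (r k)) (\<lambda>k. ?H (r k)) (\<lambda>k. tt (r k) ` {..nn (r k)}) I Z"
    unfolding elem_approx_def
  proof (intro conjI allI impI)
    fix m u v assume uv: "0 \<le> u" "u < v" "v \<le> T" "tt (r m) ` {..nn (r m)} \<inter> {u<..<v} = {}"
    show "\<exists>h C. h \<in> borel_measurable (F u) \<and> (\<forall>w\<in>space M. norm (h w) \<le> C \<and>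
            ?J (r m) v w - ?J (r m) u w = h w \<bullet> (B v w - B u w) \<and> (\<forall>q\<in>{u<..v}. ?H (r m) q w = h w))"
      by (rule simple_elementary[OF sp uv])
  next
    show "AE w in M. (\<lambda>k. ?q (r k) w) \<longlonglongrightarrow> 0"
      using r
    proof (rule AE_mp, intro AE_I2 impI)
      fix w assume w: "w \<in> space M" and ev: "eventually (\<lambda>k. w \<notin> A1 (r k) (1 / Suc k) \<union> A2 (r k) (1 / Suc k)) sequentially"
      show "(\<lambda>k. ?q (r k) w) \<longlonglongrightarrow> 0"
      proof (rule tendsto_sandwich[OF always_eventually _ tendsto_const])
        show "eventually (\<lambda>k. ?q (r k) w \<le> ennreal (1 / Suc k)) sequentially"
          using ev by (rule eventually_mono) (use w in \<open>auto simp: A1_def not_less\<close>)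
        have "(\<lambda>k. ennreal (1 / Suc k)) \<longlonglongrightarrow> ennreal 0"
          by (rule tendsto_ennrealI) (use LIMSEQ_inverse_real_of_nat in \<open>simp add: inverse_eq_divide\<close>)
        then show "(\<lambda>k. ennreal (1 / Suc k)) \<longlonglongrightarrow> 0" by simp
      qed auto
    qed
  next
    show "AE w in M. uniform_limit {0..T} (\<lambda>k t. ?J (r k) t w) (\<lambda>t. I t w) sequentially"
      using r
    proof (rule AE_mp, intro AE_I2 impI)
      fix w assume w: "w \<in> space M" and ev: "eventually (\<lambda>k. w \<notin> A1 (r k) (1 / Suc k) \<union> A2 (r k) (1 / Suc k)) sequentially"
      show "uniform_limit {0..T} (\<lambda>k t. ?J (r k) t w) (\<lambda>t. I t w) sequentially"
      proof (rule uniform_limitI)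
        fix e :: real assume e: "e > 0"
        have "eventually (\<lambda>k. inverse (real (Suc k)) < e) sequentially"
          using order_tendstoD(2)[OF LIMSEQ_inverse_real_of_nat e] .
        with ev show "eventually (\<lambda>k. \<forall>t\<in>{0..T}. dist (?J (r k) t w) (I t w) < e) sequentially"
        proof eventually_elim
          case (elim k)
          then have "\<forall>t\<in>{0..T}. \<bar>?J (r k) t w - I t w\<bar> \<le> inverse (real (Suc k))"
            using w by (auto simp: A2_def not_less inverse_eq_divide)
          with elim(2) show ?case by (auto simp: dist_real_def intro: le_less_trans)
        qed
      qed
    qed
  qed (auto intro: simple_proc_measurable(2)[OF sp])
  then show thesis by (rule that)
qed

lemma elem_approx_diff:
  assumes 1: "elem_approx J1 H1 P1 I1 Z1" and 2: "elem_approx J2 H2 P2 I2 Z2"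
    and Z: "progressive M B T Z1" "progressive M B T Z2"
  shows "elem_approx (\<lambda>m t w. J1 m t w - J2 m t w) (\<lambda>m t w. H1 m t w - H2 m t w) (\<lambda>m. P1 m \<union> P2 m)
    (\<lambda>t w. I1 t w - I2 t w) (\<lambda>t w. Z1 t w - Z2 t w)"
  unfolding elem_approx_def
proof (intro conjI allI impI)
  show "finite (P1 m \<union> P2 m)" for m using 1 2 by (auto simp: elem_approx_def)
  fix m u v assume uv: "0 \<le> u" "u < v" "v \<le> T" "(P1 m \<union> P2 m) \<inter> {u<..<v} = {}"
  have e: "P1 m \<inter> {u<..<v} = {}" "P2 m \<inter> {u<..<v} = {}" using uv(4) by auto
  obtain h1 C1 where
    a: "h1 \<in> borel_measurable (F u)" "\<forall>w\<in>space M. norm (h1 w) \<le> C1 \<and>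
            J1 m v w - J1 m u w = h1 w \<bullet> (B v w - B u w) \<and> (\<forall>r\<in>{u<..v}. H1 m r w = h1 w)"
    by (rule elem_approxD[OF 1 uv(1-3) e(1)])
  obtain h2 C2 where b: "h2 \<in> borel_measurable (F u)" "\<forall>w\<in>space M. norm (h2 w) \<le> C2 \<and>
            J2 m v w - J2 m u w = h2 w \<bullet> (B v w - B u w) \<and> (\<forall>r\<in>{u<..v}. H2 m r w = h2 w)"
    by (rule elem_approxD[OF 2 uv(1-3) e(2)])
  show "\<exists>h C. h \<in> borel_measurable (F u) \<and> (\<forall>w\<in>space M. norm (h w) \<le> C \<and>
            J1 m v w - J2 m v w - (J1 m u w - J2 m u w) = h w \<bullet> (B v w - B u w) \<and>
            (\<forall>r\<in>{u<..v}. H1 m r w - H2 m r w = h w))"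
  proof (intro exI[of _ "\<lambda>w. h1 w - h2 w"] exI[of _ "C1 + C2"] conjI ballI)
    show "(\<lambda>w. h1 w - h2 w) \<in> borel_measurable (F u)" using a(1) b(1) by measurable
    fix w assume w: "w \<in> space M"
    show "norm (h1 w - h2 w) \<le> C1 + C2" using a(2) b(2) w norm_triangle_ineq4[of "h1 w" "h2 w"] by fastforce
    show "J1 m v w - J2 m v w - (J1 m u w - J2 m u w) = (h1 w - h2 w) \<bullet> (B v w - B u w)"
      using a(2) b(2) w unfolding inner_diff_left by (smt (verit))
    show "\<And>r. r \<in> {u<..v} \<Longrightarrow> H1 m r w - H2 m r w = h1 w - h2 w" using a(2) b(2) w by auto
  qed
next
  have m: "(\<lambda>r. H1 m r w) \<in> borel_measurable borel" "(\<lambda>r. H2 m r w) \<in> borel_measurable borel" for m w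
    using 1 2 unfolding elem_approx_def by auto
  then show "(\<lambda>r. H1 m r w - H2 m r w) \<in> borel_measurable borel" for m w
    by (intro borel_measurable_diff)
  let ?q = "\<lambda>H Z m w. \<integral>\<^sup>+ t. ennreal ((norm (H m t w - Z t w))\<^sup>2) * indicator {0..T} t \<partial>lborel"
  have "AE w in M. (\<lambda>m. ?q H1 Z1 m w) \<longlonglongrightarrow> 0" "AE w in M. (\<lambda>m. ?q H2 Z2 m w) \<longlonglongrightarrow> 0"
    using 1 2 unfolding elem_approx_def by auto
  then show "AE w in M. (\<lambda>m. \<integral>\<^sup>+ t. ennreal ((norm (H1 m t w - H2 m t w - (Z1 t w - Z2 t w)))\<^sup>2) * indicator {0..T} t \<partial>lborel) \<longlonglongrightarrow> 0"
  proof (rule AE_mp[OF _ AE_mp], intro AE_I2 impI)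
    fix w assume w: "w \<in> space M" and l: "(\<lambda>m. ?q H1 Z1 m w) \<longlonglongrightarrow> 0" "(\<lambda>m. ?q H2 Z2 m w) \<longlonglongrightarrow> 0"
    show "(\<lambda>m. \<integral>\<^sup>+ t. ennreal ((norm (H1 m t w - H2 m t w - (Z1 t w - Z2 t w)))\<^sup>2) * indicator {0..T} t \<partial>lborel) \<longlonglongrightarrow> 0" (is "?L \<longlonglongrightarrow> 0")
    proof (rule tendsto_sandwich[OF always_eventually always_eventually tendsto_const])
      show "(\<lambda>m. 2 * ?q H1 Z1 m w + 2 * ?q H2 Z2 m w) \<longlonglongrightarrow> 0"
        using tendsto_add[OF ennreal_tendsto_cmult[OF _ l(1), of 2] ennreal_tendsto_cmult[OF _ l(2), of 2]] by simp
      show "\<forall>m. ?L m \<le> 2 * ?q H1 Z1 m w + 2 * ?q H2 Z2 m w"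
      proof
        fix m
        note [measurable] = m
        have eq: "ennreal ((norm (H m t w - Z t w))\<^sup>2) * indicator {0..T} t
          = ennreal ((norm (H m t w - indicator {0..T} t *\<^sub>R Z t w))\<^sup>2) * indicator {0..T} t" for H :: "nat \<Rightarrow> real \<Rightarrow> 'w \<Rightarrow> real^'d" and Z t
          by (auto simp: indicator_def)
        have [measurable]: "(\<lambda>t. ennreal ((norm (H1 m t w - Z1 t w))\<^sup>2) * indicator {0..T} t) \<in> borel_measurable lborel"
          "(\<lambda>t. ennreal ((norm (H2 m t w - Z2 t w))\<^sup>2) * indicator {0..T} t) \<in> borel_measurable lborel"
          unfolding eq[of H1] eq[of H2] using progressive_section[OF Z(1) w] progressive_section[OF Z(2) w] m[of m w]
          by (auto intro!: borel_measurable_times_ennreal measurable_compose[OF _ measurable_ennreal] borel_measurable_power borel_measurable_norm borel_measurable_diff)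
        have "?L m \<le> (\<integral>\<^sup>+ t. 2 * (ennreal ((norm (H1 m t w - Z1 t w))\<^sup>2) * indicator {0..T} t) + 2 * (ennreal ((norm (H2 m t w - Z2 t w))\<^sup>2) * indicator {0..T} t) \<partial>lborel)"
        proof (rule nn_integral_mono)
          fix t
          let ?a = "H1 m t w - Z1 t w" and ?b = "H2 m t w - Z2 t w"
          have "norm (?a - ?b) \<le> norm ?a + norm ?b" by (rule norm_triangle_ineq4)
          then have "(norm (?a - ?b))\<^sup>2 \<le> (norm ?a + norm ?b)\<^sup>2" by (rule power_mono) simp
          also have "\<dots> \<le> 2 * (norm ?a)\<^sup>2 + 2 * (norm ?b)\<^sup>2" using sum_squares_bound[of "norm ?a" "norm ?b"] by (simp add: power2_sum)
          finally have "ennreal ((norm (?a - ?b))\<^sup>2) \<le> 2 * ennreal ((norm ?a)\<^sup>2) + 2 * ennreal ((norm ?b)\<^sup>2)"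
            by (simp add: ennreal_mult'[symmetric] ennreal_plus[symmetric] flip: ennreal_numeral del: ennreal_plus)
          moreover have "?a - ?b = H1 m t w - H2 m t w - (Z1 t w - Z2 t w)" by simp
          ultimately show "ennreal ((norm (H1 m t w - H2 m t w - (Z1 t w - Z2 t w)))\<^sup>2) * indicator {0..T} t
             \<le> 2 * (ennreal ((norm ?a)\<^sup>2) * indicator {0..T} t) + 2 * (ennreal ((norm ?b)\<^sup>2) * indicator {0..T} t)"
            by (auto simp: indicator_def)
        qed
        also have "\<dots> = 2 * ?q H1 Z1 m w + 2 * ?q H2 Z2 m w"
          by (subst nn_integral_add) (auto simp: nn_integral_cmult)
        finally show "?L m \<le> 2 * ?q H1 Z1 m w + 2 * ?q H2 Z2 m w" .
      qed
    qed auto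
  qed
  have "AE w in M. uniform_limit {0..T} (\<lambda>m t. J1 m t w) (\<lambda>t. I1 t w) sequentially"
     "AE w in M. uniform_limit {0..T} (\<lambda>m t. J2 m t w) (\<lambda>t. I2 t w) sequentially"
    using 1 2 unfolding elem_approx_def by auto
  then show "AE w in M. uniform_limit {0..T} (\<lambda>m t. J1 m t w - J2 m t w) (\<lambda>t. I1 t w - I2 t w) sequentially"
    by eventually_elim (rule uniform_limit_minus)
qed

end

section \<open>Stopped martingales\<close>

lemma set_integral_diff_initial:
  fixes f :: "real \<Rightarrow> real"
  assumes f: "set_integrable lborel {0..T} f" and uv: "0 \<le> u" "u \<le> v" "v \<le> T"
  shows "(LBINT r:{0..v}. f r) - (LBINT r:{0..u}. f r) = (LBINT r:{u<..v}. f r)"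
proof -
  have "{0..v} = {0..u} \<union> {u<..v}" using uv by auto
  moreover have "set_integrable lborel {0..u} f" "set_integrable lborel {u<..v} f"
    using uv by (auto intro: set_integrable_subset[OF f])
  ultimately show ?thesis using set_integral_Un[of "{0..u}" "{u<..v}" lborel f] by fastforce
qed

lemma set_integral_mono_subset:
  fixes f :: "real \<Rightarrow> real"
  assumes f: "set_integrable lborel B f" and "A \<subseteq> B" "A \<in> sets borel" "\<And>r. r \<in> B \<Longrightarrow> 0 \<le> f r"
  shows "(LBINT r:A. f r) \<le> (LBINT r:B. f r)"
  unfolding set_lebesgue_integral_def
proof (rule integral_mono)
  show "integrable lborel (\<lambda>r. indicator A r *\<^sub>R f r)" "integrable lborel (\<lambda>r. indicator B r *\<^sub>R f r)"
    using f set_integrable_subset[OF f, of A] assms by (auto simp: set_integrable_def)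
  show "indicator A r *\<^sub>R f r \<le> indicator B r *\<^sub>R f r" for r
    using assms(2,4) by (auto simp: indicator_def)
qed

lemma continuous_on_initial_integral:
  fixes f :: "real \<Rightarrow> real"
  assumes f: "set_integrable lborel {0..T} f"
  shows "continuous_on {0..T} (\<lambda>u. LBINT r:{0..u}. f r)"
proof -
  have "continuous_on {0..T} (\<lambda>u. integral {0..u} f)"
    by (rule indefinite_integral_continuous_1[OF set_borel_integral_eq_integral(1)[OF f]])
  moreover have "(LBINT r:{0..u}. f r) = integral {0..u} f" if "u \<in> {0..T}" for u
    using that by (intro set_borel_integral_eq_integral(2) set_integrable_subset[OF f]) auto
  ultimately show ?thesis by (subst continuous_on_cong[OF refl]) auto
qed

text \<open>The cross term is split by Young's inequality with parameter \<open>\<eta>\<close>. A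
  small \<open>\<eta>\<close> charges little to |b|^2 and puts the large factor on |a - b|^2, which
  tends to zero in the application.\<close>

lemma abs_power2_norm_diff_le:
  fixes a b :: "'a::real_normed_vector"
  assumes "\<eta> > 0"
  shows "\<bar>(norm a)\<^sup>2 - (norm b)\<^sup>2\<bar> \<le> (1 + 1 / \<eta>) * (norm (a - b))\<^sup>2 + \<eta> * (norm b)\<^sup>2"
proof -
  let ?d = "norm (a - b)"
  have "\<bar>(norm a)\<^sup>2 - (norm b)\<^sup>2\<bar> = \<bar>norm a - norm b\<bar> * (norm a + norm b)"
    by (simp add: power2_eq_square square_diff_square_factored abs_mult)
  also have "\<dots> \<le> ?d * (?d + 2 * norm b)"
    using norm_triangle_ineq3[of a b] by (intro mult_mono) (auto simp: abs_le_iff)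
  also have "\<dots> = ?d\<^sup>2 + 2 * (?d / sqrt \<eta>) * (sqrt \<eta> * norm b)"
    using assms by (simp add: power2_eq_square algebra_simps)
  also have "\<dots> \<le> ?d\<^sup>2 + ((?d / sqrt \<eta>)\<^sup>2 + (sqrt \<eta> * norm b)\<^sup>2)"
    by (intro add_left_mono sum_squares_bound)
  also have "\<dots> = (1 + 1 / \<eta>) * ?d\<^sup>2 + \<eta> * (norm b)\<^sup>2"
    using assms by (simp add: power_mult_distrib power_divide algebra_simps)
  finally show ?thesis .
qed

lemma initial_energy_uniform_convergence:
  fixes H :: "nat \<Rightarrow> real \<Rightarrow> 'b::euclidean_space" and z :: "real \<Rightarrow> 'b"
  assumes H: "\<And>m. H m \<in> borel_measurable borel"
    and zm: "(\<lambda>r. indicator {0..T} r *\<^sub>R z r) \<in> borel_measurable borel"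
    and z: "set_integrable lborel {0..T} (\<lambda>r. (norm (z r))\<^sup>2)"
    and lim: "(\<lambda>m. \<integral>\<^sup>+ t. ennreal ((norm (H m t - z t))\<^sup>2) * indicator {0..T} t \<partial>lborel) \<longlonglongrightarrow> 0"
    and e: "e > 0"
  shows "eventually (\<lambda>m. set_integrable lborel {0..T} (\<lambda>r. (norm (H m r))\<^sup>2) \<and>
     (\<forall>u\<in>{0..T}. \<bar>(LBINT r:{0..u}. (norm (H m r))\<^sup>2) - (LBINT r:{0..u}. (norm (z r))\<^sup>2)\<bar> \<le> e)) sequentially"
proof -
  define QT where "QT = (LBINT r:{0..T}. (norm (z r))\<^sup>2)"
  have QT: "0 \<le> QT" unfolding QT_def by (simp add: set_lebesgue_integral_def)
  \<comment> \<open>\<open>\<eta>\<close> and \<open>\<delta>\<close> make each of the two terms of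
    \<open>abs_power2_norm_diff_le\<close> at most e / 2; the 1 added to \<open>QT\<close> avoids a
    division by zero.\<close>
  define \<eta> where "\<eta> = e / (2 * (QT + 1))"
  have \<eta>: "\<eta> > 0" using e QT by (simp add: \<eta>_def)
  define \<delta> where "\<delta> = e / (2 * (1 + 1 / \<eta>))"
  have dpos: "1 + 1 / \<eta> > 0" using \<eta> by (simp add: add_pos_pos)
  then have \<delta>: "\<delta> > 0" using e unfolding \<delta>_def by (intro divide_pos_pos mult_pos_pos) auto
  have "eventually (\<lambda>m. (\<integral>\<^sup>+ t. ennreal ((norm (H m t - z t))\<^sup>2) * indicator {0..T} t \<partial>lborel) < ennreal \<delta>) sequentially"
    using order_tendstoD(2)[OF lim, of "ennreal \<delta>"] \<delta> by simp
  then show ?thesis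
  proof eventually_elim
    case (elim m)
    let ?D = "\<lambda>r. (norm (H m r - z r))\<^sup>2"
    have eqD: "indicator {0..T} r *\<^sub>R ?D r = indicator {0..T} r * (norm (H m r - indicator {0..T} r *\<^sub>R z r))\<^sup>2" for r
      by (auto simp: indicator_def)
    have Dm: "(\<lambda>r. indicator {0..T} r *\<^sub>R ?D r) \<in> borel_measurable lborel"
      unfolding eqD using H[of m] zm by (auto intro!: borel_measurable_times borel_measurable_power borel_measurable_norm borel_measurable_diff)
    have e2: "(\<integral>\<^sup>+ r. ennreal (indicator {0..T} r *\<^sub>R ?D r) \<partial>lborel) < ennreal \<delta>"
    proof -
      have "ennreal (indicator {0..T} r *\<^sub>R ?D r) = ennreal (?D r) * indicator {0..T} r" for r
        by (auto simp: indicator_def)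
      then show ?thesis using elim by simp
    qed
    have Di: "set_integrable lborel {0..T} ?D"
      unfolding set_integrable_def
      by (rule integrableI_nonneg[OF Dm]) (use e2 in \<open>auto intro: order_less_trans\<close>)
    have Dle: "(LBINT r:{0..T}. ?D r) \<le> \<delta>"
      unfolding set_lebesgue_integral_def
      by (subst integral_eq_nn_integral[OF Dm]) (use enn2real_leI[OF _ less_imp_le[OF e2]] \<delta> in auto)
    have Hi: "set_integrable lborel {0..T} (\<lambda>r. (norm (H m r))\<^sup>2)"
    proof -
      have "set_integrable lborel {0..T} (\<lambda>r. 2 * ?D r + 2 * (norm (z r))\<^sup>2)"
        using Di z by (intro set_integral_add(1) set_integrable_mult_right) auto
      then show ?thesis
      proof (rule set_integrable_bound)
        show "set_borel_measurable lborel {0..T} (\<lambda>r. (norm (H m r))\<^sup>2)"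
          unfolding set_borel_measurable_def using H[of m] by measurable
        have "norm ((norm (H m r))\<^sup>2) \<le> norm (2 * ?D r + 2 * (norm (z r))\<^sup>2)" for r
        proof -
          have "(norm (H m r))\<^sup>2 \<le> (norm (H m r - z r) + norm (z r))\<^sup>2"
            using norm_triangle_sub[of "H m r" "z r"] by (intro power_mono) auto
          also have "\<dots> \<le> 2 * ?D r + 2 * (norm (z r))\<^sup>2"
            using sum_squares_bound[of "norm (H m r - z r)" "norm (z r)"] by (simp add: power2_sum)
          finally show ?thesis by simp
        qed
        then show "AE r in lborel. r \<in> {0..T} \<longrightarrow> norm ((norm (H m r))\<^sup>2) \<le> norm (2 * ?D r + 2 * (norm (z r))\<^sup>2)" by simp
      qed
    qed
    moreover have "\<bar>(LBINT r:{0..u}. (norm (H m r))\<^sup>2) - (LBINT r:{0..u}. (norm (z r))\<^sup>2)\<bar> \<le> e" if u: "u \<in> {0..T}" for u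
    proof -
      have sub: "{0..u} \<subseteq> {0..T}" using u by auto
      have iu: "set_integrable lborel {0..u} (\<lambda>r. (norm (H m r))\<^sup>2)" "set_integrable lborel {0..u} (\<lambda>r. (norm (z r))\<^sup>2)"
        using Hi z sub by (auto intro: set_integrable_subset)
      have i3: "set_integrable lborel {0..T} (\<lambda>r. (1 + 1 / \<eta>) * ?D r + \<eta> * (norm (z r))\<^sup>2)"
        using Di z by (intro set_integral_add(1) set_integrable_mult_right) auto
      have "\<bar>(LBINT r:{0..u}. (norm (H m r))\<^sup>2) - (LBINT r:{0..u}. (norm (z r))\<^sup>2)\<bar>
          = norm (LBINT r:{0..u}. (norm (H m r))\<^sup>2 - (norm (z r))\<^sup>2)"
        using iu by (simp add: set_integral_diff(2))
      also have "\<dots> \<le> (LBINT r:{0..u}. norm ((norm (H m r))\<^sup>2 - (norm (z r))\<^sup>2))"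
        using iu by (intro set_integral_norm_bound set_integral_diff(1))
      also have "\<dots> \<le> (LBINT r:{0..u}. (1 + 1 / \<eta>) * ?D r + \<eta> * (norm (z r))\<^sup>2)"
      proof (rule set_integral_mono)
        show "set_integrable lborel {0..u} (\<lambda>r. norm ((norm (H m r))\<^sup>2 - (norm (z r))\<^sup>2))"
          using iu by (intro set_integrable_norm set_integral_diff(1))
        show "set_integrable lborel {0..u} (\<lambda>r. (1 + 1 / \<eta>) * ?D r + \<eta> * (norm (z r))\<^sup>2)"
          using i3 sub by (auto intro: set_integrable_subset)
        show "\<And>r. r \<in> {0..u} \<Longrightarrow> norm ((norm (H m r))\<^sup>2 - (norm (z r))\<^sup>2) \<le> (1 + 1 / \<eta>) * ?D r + \<eta> * (norm (z r))\<^sup>2"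
          using abs_power2_norm_diff_le[OF \<eta>] by simp
      qed
      \<comment> \<open>Enlarging the interval makes the bound independent of \<open>u\<close>,
        which is the required uniformity in time.\<close>
      also have "\<dots> \<le> (LBINT r:{0..T}. (1 + 1 / \<eta>) * ?D r + \<eta> * (norm (z r))\<^sup>2)"
        by (rule set_integral_mono_subset[OF i3 sub]) (use \<eta> dpos in \<open>auto intro!: add_nonneg_nonneg mult_nonneg_nonneg\<close>)
      also have "\<dots> = (1 + 1 / \<eta>) * (LBINT r:{0..T}. ?D r) + \<eta> * QT"
        using Di z by (simp add: set_integral_add(2) set_integrable_mult_right QT_def)
      also have "\<dots> \<le> (1 + 1 / \<eta>) * \<delta> + \<eta> * (QT + 1)"
        using Dle dpos \<eta> by (intro add_mono mult_left_mono) auto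
      also have "\<dots> = e"
      proof -
        have "(1 + 1 / \<eta>) * \<delta> = e / 2" using dpos unfolding \<delta>_def by (metis (no_types, lifting) less_irrefl mult.commute mult_divide_mult_cancel_left times_divide_eq_right)
        moreover have "\<eta> * (QT + 1) = e / 2" using QT unfolding \<eta>_def by (simp add: field_simps)
        ultimately show ?thesis by simp
      qed
      finally show ?thesis .
    qed
    ultimately show ?case by blast
  qed
qed

text \<open>Boundedness in L^2 gives uniform integrability. The limit inherits the bound by Fatou's
  lemma, truncation at level \<open>N\<close> changes each mean by at most C / N because |x - cl N
  x| is at most x^2 / N, and the truncated variables converge by dominated convergence.\<close>

lemma (in prob_space) tendsto_expectation_L2_bounded:
  fixes U :: "nat \<Rightarrow> 'a \<Rightarrow> real"
  assumes U: "\<And>m. integrable M (\<lambda>w. (U m w)\<^sup>2)" "\<And>m. E (\<lambda>w. (U m w)\<^sup>2) \<le> C"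
    and Um: "\<And>m. U m \<in> borel_measurable M" and Lm: "L \<in> borel_measurable M"
    and lim: "AE w in M. (\<lambda>m. U m w) \<longlonglongrightarrow> L w"
  shows "integrable M L" "(\<lambda>m. E (U m)) \<longlonglongrightarrow> E L"
proof -
  note [measurable] = Um Lm
  have C0: "0 \<le> C" using order_trans[OF Bochner_Integration.integral_nonneg U(2)[of 0]] by simp
  have "(\<integral>\<^sup>+w. ennreal ((L w)\<^sup>2) \<partial>M) = (\<integral>\<^sup>+w. liminf (\<lambda>m. ennreal ((U m w)\<^sup>2)) \<partial>M)"
  proof (rule nn_integral_cong_AE)
    show "AE w in M. ennreal ((L w)\<^sup>2) = liminf (\<lambda>m. ennreal ((U m w)\<^sup>2))"
      using lim by eventually_elim (auto intro!: lim_imp_Liminf[symmetric] tendsto_intros)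
  qed
  also have "\<dots> \<le> liminf (\<lambda>m. \<integral>\<^sup>+w. ennreal ((U m w)\<^sup>2) \<partial>M)" by (rule nn_integral_liminf) auto
  also have "\<dots> \<le> ennreal C"
  proof (rule Liminf_le)
    have "(\<integral>\<^sup>+w. ennreal ((U m w)\<^sup>2) \<partial>M) \<le> ennreal C" for m
      using U by (subst nn_integral_eq_integral) (auto intro: ennreal_leI)
    then show "\<forall>\<^sub>F m in sequentially. (\<integral>\<^sup>+w. ennreal ((U m w)\<^sup>2) \<partial>M) \<le> ennreal C" by simp
  qed simp
  finally have L2: "(\<integral>\<^sup>+w. ennreal ((L w)\<^sup>2) \<partial>M) \<le> ennreal C" .
  then have iL2: "integrable M (\<lambda>w. (L w)\<^sup>2)"
    by (intro integrableI_nonneg) (auto intro: le_less_trans)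
  have eL2: "E (\<lambda>w. (L w)\<^sup>2) \<le> C"
    using L2 C0 by (subst integral_eq_nn_integral) (auto intro!: enn2real_leI)
  have sq: "integrable M X" if "integrable M (\<lambda>w. (X w)\<^sup>2)" "X \<in> borel_measurable M" for X :: "'a \<Rightarrow> real"
    by (rule square_integrable_imp_integrable[OF that(2,1)])
  show iL: "integrable M L" by (rule sq[OF iL2 Lm])
  define cl where "cl N x = max (- N) (min N x)" for N x :: real
  have [measurable]: "cl N \<in> borel_measurable borel" for N unfolding cl_def by measurable
  have clb: "\<bar>cl N x\<bar> \<le> N" if "N > 0" for N x using that by (auto simp: cl_def)
  have cld: "\<bar>x - cl N x\<bar> \<le> x\<^sup>2 / N" if N: "N > 0" for N x
  proof (cases "\<bar>x\<bar> \<le> N")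
    case True then show ?thesis using N by (auto simp: cl_def)
  next
    case False
    then have "\<bar>x - cl N x\<bar> \<le> \<bar>x\<bar>" using N by (auto simp: cl_def)
    also have "\<dots> \<le> x\<^sup>2 / N"
    proof -
      have "\<bar>x\<bar> * N \<le> \<bar>x\<bar> * \<bar>x\<bar>" using False by (intro mult_left_mono) auto
      then show ?thesis using N by (simp add: pos_le_divide_eq power2_eq_square)
    qed
    finally show ?thesis .
  qed
  have err: "\<bar>E X - E (\<lambda>w. cl N (X w))\<bar> \<le> C / N"
    if N: "N > 0" and X: "X \<in> borel_measurable M" "integrable M (\<lambda>w. (X w)\<^sup>2)" "E (\<lambda>w. (X w)\<^sup>2) \<le> C" for N X
  proof -
    note [measurable] = X(1)
    have ic: "integrable M (\<lambda>w. cl N (X w))"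
      by (rule integrable_const_bound[where B=N]) (use clb[OF N] in auto)
    have "\<bar>E X - E (\<lambda>w. cl N (X w))\<bar> = \<bar>E (\<lambda>w. X w - cl N (X w))\<bar>"
      using sq[OF X(2,1)] ic by simp
    also have "\<dots> \<le> E (\<lambda>w. \<bar>X w - cl N (X w)\<bar>)"
      by (rule integral_abs_bound)
    also have "\<dots> \<le> E (\<lambda>w. (X w)\<^sup>2 / N)"
      using sq[OF X(2,1)] ic X(2) cld[OF N] by (intro integral_mono) auto
    also have "\<dots> \<le> C / N" using X(3) N by (simp add: divide_right_mono)
    finally show ?thesis .
  qed
  show "(\<lambda>m. E (U m)) \<longlonglongrightarrow> E L"
  proof (rule LIMSEQ_I)
    fix e :: real assume e: "e > 0"
    define N where "N = 4 * (C + 1) / e"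
    have N: "N > 0" using e C0 by (simp add: N_def)
    have CN: "C / N \<le> e / 4" using e C0 by (simp add: N_def field_simps)
    have "(\<lambda>m. E (\<lambda>w. cl N (U m w))) \<longlonglongrightarrow> E (\<lambda>w. cl N (L w))"
    proof (rule integral_dominated_convergence[where w="\<lambda>_. N"])
      show "AE x in M. (\<lambda>m. cl N (U m x)) \<longlonglongrightarrow> cl N (L x)"
        using lim unfolding cl_def by eventually_elim (intro tendsto_intros)
    qed (use clb[OF N] in auto)
    then obtain m0 where m0: "\<And>m. m \<ge> m0 \<Longrightarrow> \<bar>E (\<lambda>w. cl N (U m w)) - E (\<lambda>w. cl N (L w))\<bar> < e / 4"
      using LIMSEQ_D[of _ _ "e / 4"] e by fastforce
    show "\<exists>no. \<forall>m\<ge>no. norm (E (U m) - E L) < e"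
    proof (intro exI allI impI)
      fix m assume "m \<ge> m0"
      then show "norm (E (U m) - E L) < e"
        using m0[of m] err[OF N Um U, of m] err[OF N Lm iL2 eL2] CN unfolding real_norm_def by linarith
    qed
  qed
qed

section \<open>Martingale transforms of Brownian increments on a finite grid\<close>

context bm_space
begin

text \<open>Stopping is built into the coefficients: \<open>x i\<close> is nonzero only while the
  walk is within \<open>c\<close>, and the total energy is at most \<open>c'\<close>. The walk
  itself may leave the range, since its last step is unbounded.\<close>

context
  fixes n :: nat and tg :: "nat \<Rightarrow> real" and x :: "nat \<Rightarrow> 'w \<Rightarrow> real^'d" and \<Psi> :: "'w \<Rightarrow> real" and c c' C' :: real
  fixes X :: "nat \<Rightarrow> 'w \<Rightarrow> real" and q :: "nat \<Rightarrow> 'w \<Rightarrow> real"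
  assumes tg: "0 \<le> tg 0" "tg n \<le> T" "\<And>i. i < n \<Longrightarrow> tg i < tg (Suc i)"
    and x: "\<And>i. i < n \<Longrightarrow> x i \<in> borel_measurable (F (tg i))" "\<And>i. i < n \<Longrightarrow> \<exists>C. \<forall>w\<in>space M. norm (x i w) \<le> C"
    and X: "\<And>j w. X j w = (\<Sum>i<j. x i w \<bullet> (B (tg (Suc i)) w - B (tg i) w))"
    and q: "\<And>i w. q i w = (norm (x i w))\<^sup>2 * (tg (Suc i) - tg i)"
    and stop: "\<And>i w. i < n \<Longrightarrow> w \<in> space M \<Longrightarrow> x i w \<noteq> 0 \<Longrightarrow> \<bar>X i w\<bar> \<le> c"
    and stopq: "\<And>w. w \<in> space M \<Longrightarrow> (\<Sum>i<n. q i w) \<le> c'"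
    and P: "\<Psi> \<in> borel_measurable (F (tg 0))" "\<And>w. w \<in> space M \<Longrightarrow> \<bar>\<Psi> w\<bar> \<le> C'"
begin

lemma grid_le: "i \<le> j \<Longrightarrow> j \<le> n \<Longrightarrow> tg i \<le> tg j"
  by (induction j rule: dec_induct) (auto intro: order_trans[OF _ less_imp_le[OF tg(3)]])

lemma grid_bounds: "i \<le> n \<Longrightarrow> 0 \<le> tg i \<and> tg i \<le> T"
  using grid_le[of 0 i] grid_le[of i n] tg(1,2) by auto

lemma walk_measurable: "j \<le> n \<Longrightarrow> X j \<in> borel_measurable (F (tg j))"
  unfolding X[abs_def]
proof (intro borel_measurable_sum borel_measurable_inner borel_measurable_diff)
  fix i assume ij: "j \<le> n" "i \<in> {..<j}"
  show "x i \<in> borel_measurable (F (tg j))"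
    using ij by (intro F_measurable_mono[OF x(1) grid_le]) auto
  show "B (tg (Suc i)) \<in> borel_measurable (F (tg j))" "B (tg i) \<in> borel_measurable (F (tg j))"
    using ij grid_bounds[of i] grid_bounds[of "Suc i"] grid_le[of i j] grid_le[of "Suc i" j] by (auto intro!: B_F_measurable)
qed

lemma walk_Suc: "X (Suc j) w = X j w + x j w \<bullet> (B (tg (Suc j)) w - B (tg j) w)"
  by (simp add: X)

lemma q_facts:
  assumes "j < n"
  shows "q j \<in> borel_measurable M" "\<exists>C. \<forall>w\<in>space M. \<bar>q j w\<bar> \<le> C" "0 \<le> q j w"
proof -
  have jT: "tg j \<le> T" using grid_bounds[of j] assms by auto
  have [measurable]: "x j \<in> borel_measurable M" using x(1)[OF assms] jT by (rule F_measurable_M)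
  show "q j \<in> borel_measurable M" unfolding q[abs_def] by measurable
  show "0 \<le> q j w" using tg(3)[OF assms] by (simp add: q)
  obtain C where C: "\<And>w. w \<in> space M \<Longrightarrow> norm (x j w) \<le> C" using x(2)[OF assms] by blast
  have "\<bar>q j w\<bar> \<le> C\<^sup>2 * (tg (Suc j) - tg j)" if "w \<in> space M" for w
    using tg(3)[OF assms] C[OF that] by (simp add: q abs_mult power_mono mult_right_mono)
  then show "\<exists>C. \<forall>w\<in>space M. \<bar>q j w\<bar> \<le> C" by blast
qed

lemma q_integrable:
  assumes j: "j < n" and Y: "Y \<in> borel_measurable M" "\<And>w. w \<in> space M \<Longrightarrow> \<bar>Y w\<bar> \<le> D"
  shows "integrable M (\<lambda>w. Y w * q j w)" "integrable M (\<lambda>w. (q j w)\<^sup>2)" "integrable M (q j)"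
proof -
  note [measurable] = q_facts(1)[OF j] Y(1)
  obtain C where C: "\<And>w. w \<in> space M \<Longrightarrow> \<bar>q j w\<bar> \<le> C" using q_facts(2)[OF j] by blast
  have "\<bar>Y w * q j w\<bar> \<le> D * C" if "w \<in> space M" for w
    unfolding abs_mult using Y(2)[OF that] C[OF that] abs_ge_zero[of "Y w"] by (intro mult_mono) linarith+
  then show "integrable M (\<lambda>w. Y w * q j w)"
    by (intro integrable_const_bound[where B="D * C"]) (auto intro!: AE_I2)
  have "\<bar>(q j w)\<^sup>2\<bar> \<le> C\<^sup>2" if "w \<in> space M" for w
    using power_mono[OF C[OF that] abs_ge_zero, of 2] by simp
  then show "integrable M (\<lambda>w. (q j w)\<^sup>2)"
    by (intro integrable_const_bound[where B="C\<^sup>2"]) (auto intro!: AE_I2)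
  show "integrable M (q j)"
    by (intro integrable_const_bound[where B=C]) (use C in \<open>auto intro!: AE_I2\<close>)
qed

text \<open>The six facts go by one induction, because each step draws on integrability at the
  previous one. The fourth moment bound involves the stopping level and the energies but not the
  number of steps.\<close>

lemma discrete_martingale:
  assumes "j \<le> n"
  shows "integrable M (\<lambda>w. \<Psi> w * X j w)" "E (\<lambda>w. \<Psi> w * X j w) = 0"
    "integrable M (\<lambda>w. \<Psi> w * (X j w)\<^sup>2)"
    "E (\<lambda>w. \<Psi> w * (X j w)\<^sup>2) = E (\<lambda>w. \<Psi> w * (\<Sum>i<j. q i w))"
    "integrable M (\<lambda>w. (X j w) ^ 4)"
    "E (\<lambda>w. (X j w) ^ 4) \<le> 8 * c\<^sup>2 * E (\<lambda>w. \<Sum>i<j. q i w) + 9 * (real CARD('d))\<^sup>2 * E (\<lambda>w. \<Sum>i<j. (q i w)\<^sup>2)"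
  using assms
proof (induction j)
  case 0
  { case 1 then show ?case by (simp add: X) next
    case 2 then show ?case by (simp add: X) next
    case 3 then show ?case by (simp add: X) next
    case 4 then show ?case by (simp add: X) next
    case 5 then show ?case by (simp add: X) next
    case 6 then show ?case by (simp add: X) }
next
  case (Suc j)
  define \<xi> where "\<xi> w = x j w \<bullet> (B (tg (Suc j)) w - B (tg j) w)" for w
  have X1: "X (Suc j) w = X j w + \<xi> w" for w by (simp add: walk_Suc \<xi>_def)
  have *: "integrable M (\<lambda>w. \<Psi> w * X (Suc j) w) \<and> E (\<lambda>w. \<Psi> w * X (Suc j) w) = 0 \<and>
    integrable M (\<lambda>w. \<Psi> w * (X (Suc j) w)\<^sup>2) \<and>
    E (\<lambda>w. \<Psi> w * (X (Suc j) w)\<^sup>2) = E (\<lambda>w. \<Psi> w * (\<Sum>i<Suc j. q i w)) \<and>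
    integrable M (\<lambda>w. (X (Suc j) w) ^ 4) \<and>
    E (\<lambda>w. (X (Suc j) w) ^ 4) \<le> 8 * c\<^sup>2 * E (\<lambda>w. \<Sum>i<Suc j. q i w) + 9 * (real CARD('d))\<^sup>2 * E (\<lambda>w. \<Sum>i<Suc j. (q i w)\<^sup>2)"
    if jn: "Suc j \<le> n"
  proof -
    have j: "j < n" "j \<le> n" using jn by auto
    note IH = Suc[OF j(2)]
    have gb: "0 \<le> tg j" "tg j < tg (Suc j)" "tg (Suc j) \<le> T" "tg j \<le> T"
      using grid_bounds[of j] grid_bounds[of "Suc j"] tg(3)[OF j(1)] jn by auto
    obtain Cx where Cx: "\<And>w. w \<in> space M \<Longrightarrow> norm (x j w) \<le> Cx" using x(2)[OF j(1)] by blast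
    have Pj: "\<Psi> \<in> borel_measurable (F (tg j))" using F_measurable_mono[OF P(1) grid_le[of 0 j]] j by auto
    have Xj: "X j \<in> borel_measurable (F (tg j))" by (rule walk_measurable[OF j(2)])
    have [measurable]: "\<Psi> \<in> borel_measurable M" "X j \<in> borel_measurable M" "x j \<in> borel_measurable M"
      using Pj Xj x(1)[OF j(1)] gb(4) by (auto intro: F_measurable_M)
    have [measurable]: "\<xi> \<in> borel_measurable M"
      unfolding \<xi>_def using gb by (intro borel_measurable_inner borel_measurable_diff B_measurable) auto
    \<comment> \<open>\<open>\<zeta>\<close> marks the paths on which the step is active. There
      \<open>stop\<close> bounds \<open>X j\<close>, so \<open>\<zeta> w * X j w\<close> is a
      bounded past-measurable weight, while \<open>\<zeta> w * \<xi> w = \<xi> w\<close> lets it be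
      inserted for free.\<close>
    define \<zeta> where "\<zeta> w = (if x j w = 0 then 0 else 1::real)" for w
    have \<zeta>m: "\<zeta> \<in> borel_measurable (F (tg j))" unfolding \<zeta>_def using x(1)[OF j(1)] by measurable
    have \<zeta>x: "\<zeta> w * \<xi> w = \<xi> w" "\<zeta> w * q j w = q j w" "\<zeta> w * \<zeta> w = \<zeta> w" for w by (auto simp: \<zeta>_def \<xi>_def q)
    have \<zeta>X: "\<bar>\<zeta> w * X j w\<bar> \<le> \<bar>c\<bar>" if "w \<in> space M" for w
      using stop[OF j(1) that] by (auto simp: \<zeta>_def)
    have \<zeta>X': "\<bar>(\<zeta> w * X j w) ^ k\<bar> \<le> \<bar>c\<bar> ^ k" if "w \<in> space M" for w k
      unfolding power_abs by (intro power_mono \<zeta>X that) auto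
    note inc = increment_inner[OF gb(1-3) x(1)[OF j(1)], folded \<xi>_def]
    note i1 = inc(1,2)[OF Cx Pj P(2)] and i2 = inc(3,4)[OF Cx Pj P(2)]
    have i3: "integrable M (\<lambda>w. (\<Psi> w * (\<zeta> w * X j w)) * \<xi> w)" "E (\<lambda>w. (\<Psi> w * (\<zeta> w * X j w)) * \<xi> w) = 0"
    proof -
      have "(\<lambda>w. \<Psi> w * (\<zeta> w * X j w)) \<in> borel_measurable (F (tg j))" using Pj \<zeta>m Xj by measurable
      moreover have "\<bar>\<Psi> w * (\<zeta> w * X j w)\<bar> \<le> C' * \<bar>c\<bar>" if "w \<in> space M" for w
        unfolding abs_mult[of "\<Psi> w"] using P(2)[OF that] \<zeta>X[OF that] abs_ge_zero[of "\<Psi> w"] by (intro mult_mono) linarith+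
      ultimately show "integrable M (\<lambda>w. (\<Psi> w * (\<zeta> w * X j w)) * \<xi> w)" "E (\<lambda>w. (\<Psi> w * (\<zeta> w * X j w)) * \<xi> w) = 0"
        using inc(1,2)[OF Cx] by blast+
    qed
    have pm: "(\<lambda>w. (\<zeta> w * X j w) ^ k) \<in> borel_measurable (F (tg j))" for k using \<zeta>m Xj by measurable
    note i4 = inc(1,2)[OF Cx pm[of 3] \<zeta>X'] and i5 = inc(3,4)[OF Cx pm[of 2] \<zeta>X']
    note i6 = inc(5,6)[OF Cx pm[of 0] \<zeta>X']
    note qi = q_integrable[OF _ \<open>\<Psi> \<in> borel_measurable M\<close> P(2)]
    have e1: "\<Psi> w * X (Suc j) w = \<Psi> w * X j w + \<Psi> w * \<xi> w" for w by (simp add: X1 algebra_simps)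
    have e2: "\<Psi> w * (X (Suc j) w)\<^sup>2 = \<Psi> w * (X j w)\<^sup>2 + 2 * ((\<Psi> w * (\<zeta> w * X j w)) * \<xi> w) + \<Psi> w * (\<xi> w)\<^sup>2" for w
    proof -
      have "\<Psi> w * (X (Suc j) w)\<^sup>2 = \<Psi> w * (X j w)\<^sup>2 + 2 * ((\<Psi> w * X j w) * (\<zeta> w * \<xi> w)) + \<Psi> w * (\<xi> w)\<^sup>2"
        unfolding \<zeta>x X1 by (simp add: power2_eq_square algebra_simps)
      then show ?thesis by (simp add: mult_ac)
    qed
    have p1: "integrable M (\<lambda>w. \<Psi> w * X (Suc j) w)" "E (\<lambda>w. \<Psi> w * X (Suc j) w) = 0"
      unfolding e1 using IH(1,2) i1 by auto
    have p2: "integrable M (\<lambda>w. \<Psi> w * (X (Suc j) w)\<^sup>2)"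
      unfolding e2 using IH(3) i3 i2 by (intro Bochner_Integration.integrable_add integrable_mult_right)
    have p3: "E (\<lambda>w. \<Psi> w * (X (Suc j) w)\<^sup>2) = E (\<lambda>w. \<Psi> w * (\<Sum>i<Suc j. q i w))"
    proof -
      have "E (\<lambda>w. \<Psi> w * (X (Suc j) w)\<^sup>2) = E (\<lambda>w. \<Psi> w * (\<Sum>i<j. q i w)) + E (\<lambda>w. \<Psi> w * q j w)"
        unfolding e2 using IH(3,4) i3 i2 by (simp add: q)
      also have "\<dots> = E (\<lambda>w. \<Psi> w * (\<Sum>i<j. q i w) + \<Psi> w * q j w)"
        using qi(1) j by (intro Bochner_Integration.integral_add[symmetric]) (auto simp: sum_distrib_left)
      finally show ?thesis by (simp add: algebra_simps)
    qed
    have p4: "integrable M (\<lambda>w. (X (Suc j) w) ^ 4)"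
    proof (rule Bochner_Integration.integrable_bound)
      show "integrable M (\<lambda>w. 8 * ((X j w) ^ 4 + (\<xi> w) ^ 4))"
        using IH(5) i6 by (intro integrable_mult_right Bochner_Integration.integrable_add)
      have "(a + b) ^ 4 \<le> 8 * (a ^ 4 + b ^ 4)" for a b :: real
      proof -
        have s: "(u + v)\<^sup>2 \<le> 2 * (u\<^sup>2 + v\<^sup>2)" for u v :: real using sum_squares_bound[of u v] by (simp add: power2_sum)
        have "((a + b)\<^sup>2)\<^sup>2 \<le> (2 * (a\<^sup>2 + b\<^sup>2))\<^sup>2" by (rule power_mono[OF s]) simp
        also have "\<dots> = 4 * (a\<^sup>2 + b\<^sup>2)\<^sup>2" unfolding power_mult_distrib by simp
        also have "\<dots> \<le> 4 * (2 * ((a\<^sup>2)\<^sup>2 + (b\<^sup>2)\<^sup>2))" by (intro mult_left_mono s) simp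
        finally show ?thesis by simp
      qed
      then show "AE w in M. norm ((X (Suc j) w) ^ 4) \<le> norm (8 * ((X j w) ^ 4 + (\<xi> w) ^ 4))" by (simp add: X1)
    qed (simp add: X1)
    have b4: "(X (Suc j) w) ^ 4 \<le> (X j w) ^ 4 + 4 * ((\<zeta> w * X j w) ^ 3 * \<xi> w) + 8 * ((\<zeta> w * X j w)\<^sup>2 * (\<xi> w)\<^sup>2) + 3 * (\<xi> w) ^ 4" for w
    proof -
      \<comment> \<open>The term 4 a b^3 is absorbed into 2 a^2 b^2 + 2 b^4, which leaves only even
        moments of the increment besides a^3 b, whose mean is zero.\<close>
      have *: "(a + b) ^ 4 \<le> a ^ 4 + 4 * (a ^ 3 * b) + 8 * (a\<^sup>2 * b\<^sup>2) + 3 * b ^ 4" for a b :: real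
      proof -
        have "0 \<le> 2 * (b * (a - b))\<^sup>2" by simp
        then show ?thesis by (simp add: power2_eq_square power3_eq_cube power4_eq_xxxx algebra_simps)
      qed
      show ?thesis
      proof (cases "x j w = 0")
        case True then show ?thesis by (simp add: X1 \<xi>_def \<zeta>_def)
      next
        case False then show ?thesis using *[of "X j w" "\<xi> w"] by (simp add: X1 \<zeta>_def)
      qed
    qed
    have i5b: "E (\<lambda>w. (\<zeta> w * X j w)\<^sup>2 * (\<xi> w)\<^sup>2) \<le> c\<^sup>2 * E (q j)"
    proof -
      have "E (\<lambda>w. (\<zeta> w * X j w)\<^sup>2 * (\<xi> w)\<^sup>2) = E (\<lambda>w. (\<zeta> w * X j w)\<^sup>2 * q j w)"
        using i5(2) by (simp add: q)
      also have "\<dots> \<le> E (\<lambda>w. c\<^sup>2 * q j w)"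
      proof (rule integral_mono')
        show "integrable M (\<lambda>w. c\<^sup>2 * q j w)" using qi(3)[OF j(1)] by simp
        show "(\<zeta> w * X j w)\<^sup>2 * q j w \<le> c\<^sup>2 * q j w" if "w \<in> space M" for w
          using \<zeta>X'[OF that, of 2] q_facts(3)[OF j(1)] by (intro mult_right_mono) auto
        show "0 \<le> c\<^sup>2 * q j w" for w using q_facts(3)[OF j(1)] by simp
      qed
      finally show ?thesis by simp
    qed
    have "E (\<lambda>w. (X (Suc j) w) ^ 4) \<le> E (\<lambda>w. (X j w) ^ 4 + 4 * ((\<zeta> w * X j w) ^ 3 * \<xi> w) + 8 * ((\<zeta> w * X j w)\<^sup>2 * (\<xi> w)\<^sup>2) + 3 * (\<xi> w) ^ 4)"
      using p4 IH(5) i4(1) i5(1) i6(1) b4 by (intro integral_mono) auto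
    also have "\<dots> = E (\<lambda>w. (X j w) ^ 4) + 8 * E (\<lambda>w. (\<zeta> w * X j w)\<^sup>2 * (\<xi> w)\<^sup>2) + 3 * E (\<lambda>w. (\<xi> w) ^ 4)"
      using IH(5) i4 i5(1) i6(1) by simp
    also have "\<dots> \<le> (8 * c\<^sup>2 * E (\<lambda>w. \<Sum>i<j. q i w) + 9 * (real CARD('d))\<^sup>2 * E (\<lambda>w. \<Sum>i<j. (q i w)\<^sup>2))
        + 8 * (c\<^sup>2 * E (q j)) + 3 * (3 * (real CARD('d))\<^sup>2 * E (\<lambda>w. (q j w)\<^sup>2))"
      using IH(6) i5b i6(2) by (intro add_mono mult_left_mono) (auto simp: q)
    also have "\<dots> = 8 * c\<^sup>2 * (E (\<lambda>w. \<Sum>i<j. q i w) + E (q j)) + 9 * (real CARD('d))\<^sup>2 * (E (\<lambda>w. \<Sum>i<j. (q i w)\<^sup>2) + E (\<lambda>w. (q j w)\<^sup>2))"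
      by (simp add: algebra_simps)
    also have "E (\<lambda>w. \<Sum>i<j. q i w) + E (q j) = E (\<lambda>w. \<Sum>i<Suc j. q i w)"
      using qi(3) j by (subst Bochner_Integration.integral_add[symmetric]) auto
    also have "E (\<lambda>w. \<Sum>i<j. (q i w)\<^sup>2) + E (\<lambda>w. (q j w)\<^sup>2) = E (\<lambda>w. \<Sum>i<Suc j. (q i w)\<^sup>2)"
      using qi(2) j by (subst Bochner_Integration.integral_add[symmetric]) auto
    finally show ?thesis using p1 p2 p3 p4 by blast
  qed
  { case 1 then show ?case using * by blast next
    case 2 then show ?case using * by blast next
    case 3 then show ?case using * by blast next
    case 4 then show ?case using * by blast next
    case 5 then show ?case using * by blast next
    case 6 then show ?case using * by blast }
qed

text \<open>The energies are nonnegative, so the sum of their squares is at most the square of their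
  sum. The bound is the same for all grids, which is what lets squares of the walks pass to the
  limit.\<close>

lemma discrete_martingale_fourth_moment:
  "E (\<lambda>w. (X n w) ^ 4) \<le> 8 * c\<^sup>2 * c' + 9 * (real CARD('d))\<^sup>2 * c'\<^sup>2"
proof -
  have nn: "0 \<le> (\<Sum>i<n. q i w)" for w using q_facts(3) by (intro sum_nonneg) auto
  have [measurable]: "q i \<in> borel_measurable M" if "i < n" for i by (rule q_facts(1)[OF that])
  have "E (\<lambda>w. \<Sum>i<n. q i w) \<le> E (\<lambda>w. c')"
    using stopq by (intro integral_mono Bochner_Integration.integrable_sum q_integrable(3)[OF _ borel_measurable_const]) auto
  then have 1: "E (\<lambda>w. \<Sum>i<n. q i w) \<le> c'" by (simp add: prob_space)
  have "(\<Sum>i<n. (q i w)\<^sup>2) \<le> c'\<^sup>2" if w: "w \<in> space M" for w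
  proof -
    have "(\<Sum>i<n. (q i w)\<^sup>2) \<le> (\<Sum>i<n. q i w * (\<Sum>i<n. q i w))"
      unfolding power2_eq_square using q_facts(3) by (intro sum_mono mult_left_mono member_le_sum) auto
    also have "\<dots> = (\<Sum>i<n. q i w)\<^sup>2" by (simp add: power2_eq_square sum_distrib_right)
    also have "\<dots> \<le> c'\<^sup>2" using stopq[OF w] nn by (intro power_mono)
    finally show ?thesis .
  qed
  then have "E (\<lambda>w. \<Sum>i<n. (q i w)\<^sup>2) \<le> E (\<lambda>w. c'\<^sup>2)"
    by (intro integral_mono Bochner_Integration.integrable_sum q_integrable(2)[OF _ borel_measurable_const]) auto
  then have 2: "E (\<lambda>w. \<Sum>i<n. (q i w)\<^sup>2) \<le> c'\<^sup>2" by (simp add: prob_space)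
  show ?thesis
    by (rule order_trans[OF discrete_martingale(6)[OF order_refl]]) (intro add_mono mult_left_mono 1 2; simp)
qed

end

end

section \<open>Stopping times with values in [0,T] and walks stopped along fine grids\<close>

context bm_space
begin

definition bounded_stopping :: "('w \<Rightarrow> real) \<Rightarrow> bool" where
  "bounded_stopping \<tau> \<longleftrightarrow> stopping_time F \<tau> \<and> (\<forall>w\<in>space M. \<tau> w \<in> {0..T})"

lemma min_stopping_measurable:
  assumes \<tau>: "bounded_stopping \<tau>"
  shows "(\<lambda>w. min t (\<tau> w)) \<in> borel_measurable (F t)"
proof (rule borel_measurableI_le)
  fix u
  show "{w \<in> space (F t). min t (\<tau> w) \<le> u} \<in> sets (F t)"
  proof (cases "t \<le> u")
    case True
    then have "{w \<in> space (F t). min t (\<tau> w) \<le> u} = space (F t)" by auto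
    then show ?thesis by (simp only: sets.top)
  next
    case False
    have "{w \<in> space (F u). \<tau> w \<le> u} \<in> sets (F u)"
      using \<tau> unfolding bounded_stopping_def stopping_time_def pred_def by blast
    moreover have "{w \<in> space (F t). min t (\<tau> w) \<le> u} = {w \<in> space (F u). \<tau> w \<le> u}" using False by auto
    ultimately show ?thesis using sets_F_mono[of u t] False by auto
  qed
qed

lemma stopping_pred:
  assumes \<tau>: "bounded_stopping \<tau>"
  shows "Measurable.pred (F t) (\<lambda>w. t < \<tau> w)"
  using \<tau> unfolding bounded_stopping_def by (intro stopping_timeD2) auto

lemma stopping_measurable:
  assumes \<tau>: "bounded_stopping \<tau>"
  shows "\<tau> \<in> borel_measurable M"
proof -
  have "(\<lambda>w. min T (\<tau> w)) \<in> borel_measurable M"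
    by (rule F_measurable_M[OF min_stopping_measurable[OF \<tau>]]) simp
  moreover have "min T (\<tau> w) = \<tau> w" if "w \<in> space M" for w
    using \<tau> that by (auto simp: bounded_stopping_def)
  ultimately show ?thesis by (simp cong: measurable_cong)
qed

lemma progressive_stopped:
  assumes X: "progressive M B T X" and \<tau>: "bounded_stopping \<tau>" and t: "t \<in> {0..T}"
  shows "(\<lambda>w. X (min t (\<tau> w)) w) \<in> borel_measurable (F t)"
proof -
  have "(\<lambda>w. (min t (\<tau> w), w)) \<in> F t \<rightarrow>\<^sub>M restrict_space borel {0..t} \<Otimes>\<^sub>M F t"
    using t \<tau> by (intro measurable_Pair measurable_restrict_space2 min_stopping_measurable)
      (auto simp: bounded_stopping_def)
  from measurable_compose[OF this X[unfolded progressive_def, rule_format, OF t]] show ?thesis by simp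
qed

lemma progressive_initial_integral_stopped:
  fixes f :: "real \<Rightarrow> 'w \<Rightarrow> real"
  assumes f: "progressive M B T f" and \<tau>: "bounded_stopping \<tau>" and t: "t \<in> {0..T}"
  shows "(\<lambda>w. LBINT r:{0..min t (\<tau> w)}. f r w) \<in> borel_measurable (F t)"
proof -
  have [measurable]: "(\<lambda>x. indicator {0..t} (snd x) *\<^sub>R f (snd x) (fst x)) \<in> borel_measurable (F t \<Otimes>\<^sub>M borel)"
    using measurable_compose[OF measurable_pair_swap' progressive_joint_measurable[OF f t]] by (simp add: split_beta')
  have [measurable]: "(\<lambda>x. min t (\<tau> (fst x))) \<in> borel_measurable (F t \<Otimes>\<^sub>M borel)"
    using measurable_compose[OF measurable_fst min_stopping_measurable[OF \<tau>]] .
  have [measurable]: "{x \<in> space (F t \<Otimes>\<^sub>M borel). snd x \<le> min t (\<tau> (fst x))} \<in> sets (F t \<Otimes>\<^sub>M borel)" by measurable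
  have "(\<lambda>x. if snd x \<le> min t (\<tau> (fst x)) then indicator {0..t} (snd x) *\<^sub>R f (snd x) (fst x) else 0) \<in> borel_measurable (F t \<Otimes>\<^sub>M borel)"
    by measurable
  then have "(\<lambda>x. if snd x \<le> min t (\<tau> (fst x)) then indicator {0..t} (snd x) *\<^sub>R f (snd x) (fst x) else 0) \<in> borel_measurable (F t \<Otimes>\<^sub>M lborel)"
    by (simp cong: measurable_cong_sets)
  then have "(\<lambda>w. \<integral>r. (if r \<le> min t (\<tau> w) then indicator {0..t} r *\<^sub>R f r w else 0) \<partial>lborel) \<in> borel_measurable (F t)"
    by (intro lborel.borel_measurable_lebesgue_integral) (simp add: split_beta')
  moreover have "(if r \<le> min t (\<tau> w) then indicator {0..t} r *\<^sub>R f r w else 0) = indicator {0..min t (\<tau> w)} r *\<^sub>R f r w" for r w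
    by (auto simp: indicator_def)
  ultimately show ?thesis by (simp add: set_lebesgue_integral_def)
qed

text \<open>Tying the mesh to \<open>m\<close> lets one limit take care of the elementary
  approximation and of the rounding of a stopping time to the grid.\<close>

definition fine_grid :: "(nat \<Rightarrow> real \<Rightarrow> 'w \<Rightarrow> real) \<Rightarrow> (nat \<Rightarrow> real \<Rightarrow> 'w \<Rightarrow> real^'d) \<Rightarrow> real \<Rightarrow> real \<Rightarrow> nat
    \<Rightarrow> nat \<Rightarrow> (nat \<Rightarrow> real) \<Rightarrow> (nat \<Rightarrow> 'w \<Rightarrow> real^'d) \<Rightarrow> bool" where
  "fine_grid J H s t m n tg h \<longleftrightarrow> tg 0 = s \<and> tg n = t \<and> (\<forall>i j. i < j \<longrightarrow> j \<le> n \<longrightarrow> tg i < tg j) \<and>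
     (\<forall>i<n. tg (Suc i) - tg i \<le> 1 / Suc m \<and> h i \<in> borel_measurable (F (tg i)) \<and>
        (\<exists>C. \<forall>w\<in>space M. norm (h i w) \<le> C) \<and>
        (\<forall>w\<in>space M. J m (tg (Suc i)) w - J m (tg i) w = h i w \<bullet> (B (tg (Suc i)) w - B (tg i) w) \<and>
           (\<forall>r\<in>{tg i<..tg (Suc i)}. H m r w = h i w)))"

lemma fine_grid_exists:
  assumes ea: "elem_approx J H P I z" and st: "0 \<le> s" "s < t" "t \<le> T"
  shows "\<exists>n tg h. fine_grid J H s t m n tg h"
proof -
  have fin: "finite (P m)" using ea by (simp add: elem_approx_def)
  obtain tg n where g: "tg 0 = s" "tg n = t" "\<And>i j. i < j \<Longrightarrow> j \<le> n \<Longrightarrow> tg i < tg j"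
     "\<And>i. i < n \<Longrightarrow> P m \<inter> {tg i<..<tg (Suc i)} = {}" "\<And>i. i < n \<Longrightarrow> tg (Suc i) - tg i \<le> 1 / Suc m"
    by (rule refined_grid[OF st(2) fin, of "1 / Suc m"]) (simp, rule that)
  have le: "tg i \<le> tg j" if "i \<le> j" "j \<le> n" for i j using g(3)[of i j] that by (cases "i = j") auto
  have "\<exists>h. h \<in> borel_measurable (F (tg i)) \<and> (\<exists>C. \<forall>w\<in>space M. norm (h w) \<le> C) \<and>
        (\<forall>w\<in>space M. J m (tg (Suc i)) w - J m (tg i) w = h w \<bullet> (B (tg (Suc i)) w - B (tg i) w) \<and>
           (\<forall>r\<in>{tg i<..tg (Suc i)}. H m r w = h w))" if i: "i < n" for i
  proof -
    have "0 \<le> tg i" "tg i < tg (Suc i)" "tg (Suc i) \<le> T"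
      using le[of 0 i] g(1,2) st g(3)[of i "Suc i"] le[of "Suc i" n] i by auto
    then obtain h C where "h \<in> borel_measurable (F (tg i))" "\<forall>w\<in>space M. norm (h w) \<le> C \<and>
            J m (tg (Suc i)) w - J m (tg i) w = h w \<bullet> (B (tg (Suc i)) w - B (tg i) w) \<and> (\<forall>r\<in>{tg i<..tg (Suc i)}. H m r w = h w)"
      by (rule elem_approxD[OF ea _ _ _ g(4)[OF i]])
    then show ?thesis by (intro exI[of _ h] conjI exI[of _ C]) auto
  qed
  then obtain h where "\<And>i. i < n \<Longrightarrow> h i \<in> borel_measurable (F (tg i)) \<and> (\<exists>C. \<forall>w\<in>space M. norm (h i w) \<le> C) \<and>
        (\<forall>w\<in>space M. J m (tg (Suc i)) w - J m (tg i) w = h i w \<bullet> (B (tg (Suc i)) w - B (tg i) w) \<and>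
           (\<forall>r\<in>{tg i<..tg (Suc i)}. H m r w = h i w))"
    by metis
  then have "fine_grid J H s t m n tg h" unfolding fine_grid_def using g by simp
  then show ?thesis by blast
qed

text \<open>A coefficient is switched off when the left end of its cell reaches
  \<open>\<tau>\<close>, or when a cap on the walk or on its energy is exceeded. The caps are there
  because \<open>J m\<close>, unlike the process that it approximates, has no bound up to
  \<open>\<tau>\<close>. The extra 1 in each cap leaves room for the approximation error; on paths
  satisfying \<open>G\<close> only \<open>\<tau>\<close> stops the walk.\<close>

lemma stopped_walk:
  fixes K :: real
  assumes fg: "fine_grid J H s t m n tg h" and st: "0 \<le> s" "s < t" "t \<le> T" and \<tau>: "bounded_stopping \<tau>"
    and K: "0 \<le> K"
    and P: "\<Psi> \<in> borel_measurable (F s)" "\<And>w. w \<in> space M \<Longrightarrow> \<bar>\<Psi> w\<bar> \<le> C'"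
  defines "G \<equiv> \<lambda>w. \<forall>i<n. tg i < \<tau> w \<longrightarrow> (\<forall>j\<le>i. \<bar>J m (tg j) w - J m s w\<bar> \<le> 2 * K + 1) \<and>
      (\<Sum>j\<le>i. (norm (h j w))\<^sup>2 * (tg (Suc j) - tg j)) \<le> K + 1"
  obtains U q where "U \<in> borel_measurable M" "q \<in> borel_measurable M"
    "E (\<lambda>w. \<Psi> w * U w) = 0" "E (\<lambda>w. \<Psi> w * (U w)\<^sup>2) = E (\<lambda>w. \<Psi> w * q w)"
    "\<And>w. w \<in> space M \<Longrightarrow> 0 \<le> q w \<and> q w \<le> K + 1"
    "integrable M (\<lambda>w. (U w) ^ 4)"
    "E (\<lambda>w. (U w) ^ 4) \<le> 8 * (2 * K + 1)\<^sup>2 * (K + 1) + 9 * (real CARD('d))\<^sup>2 * (K + 1)\<^sup>2"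
    "\<And>w. w \<in> space M \<Longrightarrow> G w \<Longrightarrow> \<exists>k\<le>n. (\<forall>i<n. tg i < \<tau> w \<longleftrightarrow> i < k) \<and> U w = J m (tg k) w - J m s w \<and>
        q w = (\<Sum>j<k. (norm (h j w))\<^sup>2 * (tg (Suc j) - tg j))"
proof -
  have tg: "tg 0 = s" "tg n = t" "\<And>i j. i < j \<Longrightarrow> j \<le> n \<Longrightarrow> tg i < tg j"
    and h: "\<And>i. i < n \<Longrightarrow> h i \<in> borel_measurable (F (tg i))" "\<And>i. i < n \<Longrightarrow> \<exists>C. \<forall>w\<in>space M. norm (h i w) \<le> C"
    and JB: "\<And>i w. i < n \<Longrightarrow> w \<in> space M \<Longrightarrow> J m (tg (Suc i)) w - J m (tg i) w = h i w \<bullet> (B (tg (Suc i)) w - B (tg i) w)"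
    using fg by (auto simp: fine_grid_def)
  have le: "tg i \<le> tg j" if "i \<le> j" "j \<le> n" for i j using tg(3)[of i j] that by (cases "i = j") auto
  have gb: "0 \<le> tg i" "tg i \<le> T" if "i \<le> n" for i using le[of 0 i] le[of i n] tg(1,2) st that by auto
  define Y where "Y j w = (\<Sum>i<j. h i w \<bullet> (B (tg (Suc i)) w - B (tg i) w))" for j w
  define qh where "qh i w = (norm (h i w))\<^sup>2 * (tg (Suc i) - tg i)" for i w
  have YJ: "Y j w = J m (tg j) w - J m s w" if "j \<le> n" "w \<in> space M" for j w
    using that(1)
  proof (induction j)
    case (Suc j)
    then show ?case using JB[of j w] that(2) by (simp add: Y_def)
  qed (simp add: Y_def tg)
  \<comment> \<open>The energy sum includes the current cell, whose coefficient is known at its left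
    end, so the energy never exceeds \<open>K + 1\<close>; the cap on the walk can only look at
    values already reached.\<close>
  define A where "A i w \<longleftrightarrow> tg i < \<tau> w \<and> (\<forall>j\<le>i. \<bar>Y j w\<bar> \<le> 2 * K + 1) \<and> (\<Sum>j\<le>i. qh j w) \<le> K + 1" for i w
  have qh0: "0 \<le> qh i w" if "i < n" for i w using tg(3)[of i "Suc i"] that by (simp add: qh_def)
  have A_dec: "A i w" if "A j w" "i \<le> j" "j < n" for i j w
  proof -
    have "(\<Sum>l\<le>i. qh l w) \<le> (\<Sum>l\<le>j. qh l w)" using that qh0 by (intro sum_mono2) auto
    then show ?thesis using that le[of i j] by (auto simp: A_def)
  qed
  define x where "x i w = (if A i w then h i w else 0)" for i w
  define X where "X j w = (\<Sum>i<j. x i w \<bullet> (B (tg (Suc i)) w - B (tg i) w))" for j w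
  define q where "q i w = (norm (x i w))\<^sup>2 * (tg (Suc i) - tg i)" for i w
  have XY: "X j w = Y j w" if "\<And>i. i < j \<Longrightarrow> A i w" for j w
    using that by (auto simp: X_def Y_def x_def)
  have qqh: "(\<Sum>i<j. q i w) = (\<Sum>i<j. qh i w)" if "\<And>i. i < j \<Longrightarrow> A i w" for j w
    using that by (auto simp: q_def qh_def x_def)
  have q0: "0 \<le> q i w" if "i < n" for i w using tg(3)[of i "Suc i"] that by (simp add: q_def)
  have Am: "Measurable.pred (F (tg i)) (A i)" if i: "i < n" for i
  proof -
    have [measurable]: "Y j \<in> borel_measurable (F (tg i))" if j: "j \<le> i" for j
      unfolding Y_def
    proof (intro borel_measurable_sum borel_measurable_inner borel_measurable_diff)
      fix l assume l: "l \<in> {..<j}"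
      show "h l \<in> borel_measurable (F (tg i))" using i j l by (intro F_measurable_mono[OF h(1) le]) auto
      show "B (tg (Suc l)) \<in> borel_measurable (F (tg i))" "B (tg l) \<in> borel_measurable (F (tg i))"
        using i j l gb[of l] gb[of "Suc l"] le[of l i] le[of "Suc l" i] by (auto intro!: B_F_measurable)
    qed
    have [measurable]: "qh j \<in> borel_measurable (F (tg i))" if j: "j \<le> i" for j
    proof -
      have [measurable]: "h j \<in> borel_measurable (F (tg i))" using i j by (intro F_measurable_mono[OF h(1) le]) auto
      show ?thesis unfolding qh_def by measurable
    qed
    have 1: "Measurable.pred (F (tg i)) (\<lambda>w. tg i < \<tau> w)" by (rule stopping_pred[OF \<tau>])
    have 2: "Measurable.pred (F (tg i)) (\<lambda>w. \<bar>Y j w\<bar> \<le> 2 * K + 1)" if "j \<in> {..i}" for j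
    proof -
      have [measurable]: "Y j \<in> borel_measurable (F (tg i))" using that by auto
      show ?thesis by measurable
    qed
    have 3: "(\<lambda>w. \<Sum>j\<le>i. qh j w) \<in> borel_measurable (F (tg i))" by (intro borel_measurable_sum) auto
    have 4: "Measurable.pred (F (tg i)) (\<lambda>w. (\<Sum>j\<le>i. qh j w) \<le> K + 1)" using 3 by measurable
    have "A i = (\<lambda>w. tg i < \<tau> w \<and> (\<forall>j\<in>{..i}. \<bar>Y j w\<bar> \<le> 2 * K + 1) \<and> (\<Sum>j\<le>i. qh j w) \<le> K + 1)"
      by (auto simp: A_def fun_eq_iff)
    then show ?thesis by (simp only:) (intro pred_intros_logic 1 4 pred_intros_finite(3) 2; simp)
  qed
  have xm: "x i \<in> borel_measurable (F (tg i))" if "i < n" for i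
    unfolding x_def using Am[OF that] h(1)[OF that] by measurable
  have xb: "\<exists>C. \<forall>w\<in>space M. norm (x i w) \<le> C" if i: "i < n" for i
  proof -
    obtain C where "\<forall>w\<in>space M. norm (h i w) \<le> C" using h(2)[OF i] by blast
    then have "\<forall>w\<in>space M. norm (x i w) \<le> max C 0" by (auto simp: x_def)
    then show ?thesis by blast
  qed
  have stop: "\<bar>X i w\<bar> \<le> 2 * K + 1" if "i < n" "w \<in> space M" "x i w \<noteq> 0" for i w
  proof -
    have Ai: "A i w" using that(3) by (auto simp: x_def split: if_splits)
    then have "X i w = Y i w" using A_dec[of i w] that by (intro XY) auto
    then show ?thesis using Ai by (auto simp: A_def)
  qed
  have stopq: "(\<Sum>i<j. q i w) \<le> K + 1" if "j \<le> n" for j w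
    using that
  proof (induction j)
    case (Suc j)
    show ?case
    proof (cases "A j w")
      case True
      have "(\<Sum>i<Suc j. q i w) = (\<Sum>i<Suc j. qh i w)" using A_dec[OF True] Suc(2) by (intro qqh) auto
      then show ?thesis using True by (simp add: A_def lessThan_Suc_atMost)
    next
      case False
      then have "q j w = 0" by (simp add: q_def x_def)
      then show ?thesis using Suc by simp
    qed
  qed (use K in simp)
  have tg': "0 \<le> tg 0" "tg n \<le> T" "\<And>i. i < n \<Longrightarrow> tg i < tg (Suc i)" using tg st by auto
  have P0: "\<Psi> \<in> borel_measurable (F (tg 0))" using P(1) tg by simp
  note dm = discrete_martingale[OF tg' xm xb X_def q_def stop stopq[OF order_refl] P0 P(2) order_refl]
  note d4 = discrete_martingale_fourth_moment[OF tg' xm xb X_def q_def stop stopq[OF order_refl] P0 P(2)]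
  have [measurable]: "X n \<in> borel_measurable M"
    by (rule F_measurable_M[OF walk_measurable[OF tg' xm xb X_def q_def stop stopq[OF order_refl] P0 P(2) order_refl]]) (use tg st in auto)
  have [measurable]: "x i \<in> borel_measurable M" if "i < n" for i using xm[OF that] gb[of i] that by (auto intro: F_measurable_M)
  have qm: "(\<lambda>w. \<Sum>i<n. q i w) \<in> borel_measurable M" unfolding q_def by measurable
  show thesis
  proof (rule that[of "X n" "\<lambda>w. \<Sum>i<n. q i w"])
    show "E (\<lambda>w. \<Psi> w * X n w) = 0" by (rule dm(2))
    show "E (\<lambda>w. \<Psi> w * (X n w)\<^sup>2) = E (\<lambda>w. \<Psi> w * (\<Sum>i<n. q i w))" by (rule dm(4))
    show "integrable M (\<lambda>w. (X n w) ^ 4)" by (rule dm(5))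
    show "E (\<lambda>w. (X n w) ^ 4) \<le> 8 * (2 * K + 1)\<^sup>2 * (K + 1) + 9 * (real CARD('d))\<^sup>2 * (K + 1)\<^sup>2" by (rule d4)
    show "0 \<le> (\<Sum>i<n. q i w) \<and> (\<Sum>i<n. q i w) \<le> K + 1" for w using stopq[of n w] q0 by (auto intro: sum_nonneg)
    fix w assume w: "w \<in> space M" and G: "G w"
    have AG: "A i w \<longleftrightarrow> tg i < \<tau> w" if "i < n" for i
      using G that w unfolding A_def G_def qh_def by (auto simp: YJ)
    \<comment> \<open>The cells that begin before \<open>\<tau>\<close> form an initial segment of
      length \<open>k\<close>, so \<open>tg k\<close> is \<open>\<tau>\<close> clipped to [s,t] and
      rounded up to the grid.\<close>
    define k where "k = card {i. i < n \<and> tg i < \<tau> w}"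
    have kn: "k \<le> n" unfolding k_def using card_mono[of "{..<n}" "{i. i < n \<and> tg i < \<tau> w}"] by auto
    have "{i. i < n \<and> tg i < \<tau> w} = {..<k}"
    proof -
      let ?S = "{i. i < n \<and> tg i < \<tau> w}"
      have dc: "i \<in> ?S" if "j \<in> ?S" "i \<le> j" for i j using that le[of i j] by auto
      have "\<exists>k. ?S = {..<k}"
      proof (intro exI set_eqI iffI)
        let ?k = "LEAST k. k \<notin> ?S"
        have ex: "n \<notin> ?S" by simp
        fix i
        { assume "i \<in> ?S"
          moreover have "?k \<notin> ?S" using ex by (rule LeastI)
          ultimately show "i \<in> {..<?k}" using dc[of i ?k] by (auto simp del: mem_Collect_eq simp: not_less[symmetric]) }
        { assume "i \<in> {..<?k}" then show "i \<in> ?S" using not_less_Least[of i "\<lambda>k. k \<notin> ?S"] by blast }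
      qed
      then show ?thesis unfolding k_def by (metis card_lessThan)
    qed
    then have ki: "i < n \<and> tg i < \<tau> w \<longleftrightarrow> i < k" for i by auto
    have Ak: "A i w" if "i < k" for i using ki[of i] AG[of i] that by auto
    have nAk: "x i w = 0" if "\<not> i < k" "i < n" for i using ki[of i] AG[of i] that by (auto simp: x_def)
    have "X n w = X k w" unfolding X_def using kn nAk by (intro sum.mono_neutral_right) auto
    also have "\<dots> = Y k w" by (rule XY) (rule Ak)
    also have "\<dots> = J m (tg k) w - J m s w" by (rule YJ[OF kn w])
    finally have 1: "X n w = J m (tg k) w - J m s w" .
    have "(\<Sum>i<n. q i w) = (\<Sum>i<k. q i w)" using kn nAk by (intro sum.mono_neutral_right) (auto simp: q_def)
    also have "\<dots> = (\<Sum>i<k. qh i w)" by (rule qqh) (rule Ak)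
    finally have 2: "(\<Sum>i<n. q i w) = (\<Sum>j<k. (norm (h j w))\<^sup>2 * (tg (Suc j) - tg j))" by (simp add: qh_def)
    show "\<exists>k\<le>n. (\<forall>i<n. tg i < \<tau> w \<longleftrightarrow> i < k) \<and> X n w = J m (tg k) w - J m s w \<and>
        (\<Sum>i<n. q i w) = (\<Sum>j<k. (norm (h j w))\<^sup>2 * (tg (Suc j) - tg j))"
      using kn ki 1 2 by blast
  qed (use qm in auto)
qed

end

section \<open>From stopped walks to the stopped Ito integral\<close>

locale ito_process = bm_space M T B for M :: "'w measure" and T and B :: "real \<Rightarrow> 'w \<Rightarrow> real^'d" +
  fixes J :: "nat \<Rightarrow> real \<Rightarrow> 'w \<Rightarrow> real" and H :: "nat \<Rightarrow> real \<Rightarrow> 'w \<Rightarrow> real^'d" and P :: "nat \<Rightarrow> real set"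
    and I :: "real \<Rightarrow> 'w \<Rightarrow> real" and z :: "real \<Rightarrow> 'w \<Rightarrow> real^'d"
  assumes approx: "elem_approx J H P I z"
    and z_prog: "progressive M B T z"
    and z_sq: "\<And>w. w \<in> space M \<Longrightarrow> set_integrable lborel {0..T} (\<lambda>r. (norm (z r w))\<^sup>2)"
    and I_prog: "progressive M B T I"
    and I_cont: "\<And>w. w \<in> space M \<Longrightarrow> continuous_on {0..T} (\<lambda>t. I t w)"
    and I_0: "\<And>w. w \<in> space M \<Longrightarrow> I 0 w = 0"
begin

text \<open>The quadratic variation of \<open>I\<close>, taken as the energy of the
  integrand.\<close>

definition "Q t w = (LBINT r:{0..t}. (norm (z r w))\<^sup>2)"

lemma z_sq_prog: "progressive M B T (\<lambda>r w. (norm (z r w))\<^sup>2)"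
  using z_prog unfolding progressive_def split_beta' by (auto intro!: borel_measurable_power borel_measurable_norm)

lemma Q_stopped_measurable:
  "bounded_stopping \<tau> \<Longrightarrow> t \<in> {0..T} \<Longrightarrow> (\<lambda>w. Q (min t (\<tau> w)) w) \<in> borel_measurable (F t)"
  unfolding Q_def by (rule progressive_initial_integral_stopped[OF z_sq_prog])

lemma Q_continuous: "w \<in> space M \<Longrightarrow> continuous_on {0..T} (\<lambda>t. Q t w)"
  unfolding Q_def by (rule continuous_on_initial_integral[OF z_sq])

lemma Q_mono: "w \<in> space M \<Longrightarrow> 0 \<le> u \<Longrightarrow> u \<le> v \<Longrightarrow> v \<le> T \<Longrightarrow> Q u w \<le> Q v w"
  unfolding Q_def by (rule set_integral_mono_subset) (auto intro: set_integrable_subset[OF z_sq])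

lemma Q_0: "Q 0 w = 0"
proof -
  have "AE r in lborel. indicator {0..0} r *\<^sub>R (norm (z r w))\<^sup>2 = 0"
    using AE_lborel_singleton[of 0] by eventually_elim auto
  then show ?thesis unfolding Q_def set_lebesgue_integral_def by (rule integral_eq_zero_AE)
qed

lemma pathwise_approx:
  assumes w: "w \<in> space M"
    and uJ: "uniform_limit {0..T} (\<lambda>m t. J m t w) (\<lambda>t. I t w) sequentially"
    and uH: "(\<lambda>m. \<integral>\<^sup>+ t. ennreal ((norm (H m t w - z t w))\<^sup>2) * indicator {0..T} t \<partial>lborel) \<longlonglongrightarrow> 0"
    and \<epsilon>: "\<epsilon> > 0"
  shows "eventually (\<lambda>m. (\<forall>u\<in>{0..T}. \<bar>J m u w - I u w\<bar> \<le> \<epsilon>) \<and>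
     set_integrable lborel {0..T} (\<lambda>r. (norm (H m r w))\<^sup>2) \<and>
     (\<forall>u\<in>{0..T}. \<bar>(LBINT r:{0..u}. (norm (H m r w))\<^sup>2) - Q u w\<bar> \<le> \<epsilon>) \<and>
     (\<forall>u\<in>{0..T}. \<forall>v\<in>{0..T}. \<bar>u - v\<bar> \<le> 1 / Suc m \<longrightarrow> \<bar>I u w - I v w\<bar> \<le> \<epsilon> \<and> \<bar>Q u w - Q v w\<bar> \<le> \<epsilon>)) sequentially"
proof -
  have Hm: "(\<lambda>r. H m r w) \<in> borel_measurable borel" for m using approx by (auto simp: elem_approx_def)
  have 1: "eventually (\<lambda>m. \<forall>u\<in>{0..T}. dist (J m u w) (I u w) < \<epsilon>) sequentially"
    using uniform_limitD[OF uJ \<epsilon>] .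
  have 2: "eventually (\<lambda>m. set_integrable lborel {0..T} (\<lambda>r. (norm (H m r w))\<^sup>2) \<and>
     (\<forall>u\<in>{0..T}. \<bar>(LBINT r:{0..u}. (norm (H m r w))\<^sup>2) - Q u w\<bar> \<le> \<epsilon>)) sequentially"
    unfolding Q_def
    by (rule initial_energy_uniform_convergence[OF Hm progressive_section[OF z_prog w] z_sq[OF w] uH \<epsilon>])
  have "uniformly_continuous_on {0..T} (\<lambda>t. I t w)" "uniformly_continuous_on {0..T} (\<lambda>t. Q t w)"
    using I_cont[OF w] Q_continuous[OF w] by (auto intro: compact_uniformly_continuous)
  then obtain d1 d2 where d: "d1 > 0" "d2 > 0"
    "\<And>u v. u \<in> {0..T} \<Longrightarrow> v \<in> {0..T} \<Longrightarrow> dist u v < d1 \<Longrightarrow> dist (I u w) (I v w) < \<epsilon>"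
    "\<And>u v. u \<in> {0..T} \<Longrightarrow> v \<in> {0..T} \<Longrightarrow> dist u v < d2 \<Longrightarrow> dist (Q u w) (Q v w) < \<epsilon>"
    unfolding uniformly_continuous_on_def using \<epsilon> by metis
  have 3: "eventually (\<lambda>m. inverse (real (Suc m)) < min d1 d2) sequentially"
    using order_tendstoD(2)[OF LIMSEQ_inverse_real_of_nat, of "min d1 d2"] d by simp
  show ?thesis using 1 2 3
  proof eventually_elim
    case (elim m)
    then have "\<bar>I u w - I v w\<bar> \<le> \<epsilon> \<and> \<bar>Q u w - Q v w\<bar> \<le> \<epsilon>" if "u \<in> {0..T}" "v \<in> {0..T}" "\<bar>u - v\<bar> \<le> 1 / Suc m" for u v
      using d(3)[of u v] d(4)[of u v] that by (auto simp: dist_real_def inverse_eq_divide)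
    with elim show ?case by (auto simp: dist_real_def intro: less_imp_le)
  qed
qed

text \<open>Each error in the second claim is a sum of three: the approximation at
  \<open>tg k\<close>, the approximation at \<open>s\<close>, and the oscillation between
  \<open>tg k\<close> and the stopped time, which are at most one mesh width apart. A small
  \<open>\<epsilon>\<close> keeps the caps of the walk from acting.\<close>

lemma stopped_walk_close:
  assumes w: "w \<in> space M" and st: "0 \<le> s" "s < t" "t \<le> T" and \<tau>w: "\<tau> w \<in> {0..T}"
    and fg: "fine_grid J H s t m n tg h"
    and bdI: "\<And>r. 0 \<le> r \<Longrightarrow> r \<le> \<tau> w \<Longrightarrow> \<bar>I r w\<bar> \<le> K" and bdQ: "Q (\<tau> w) w \<le> K"
    and \<epsilon>: "\<epsilon> \<le> 1 / 4" "\<epsilon> > 0"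
    and cJ: "\<And>u. u \<in> {0..T} \<Longrightarrow> \<bar>J m u w - I u w\<bar> \<le> \<epsilon>"
    and iH: "set_integrable lborel {0..T} (\<lambda>r. (norm (H m r w))\<^sup>2)"
    and cH: "\<And>u. u \<in> {0..T} \<Longrightarrow> \<bar>(LBINT r:{0..u}. (norm (H m r w))\<^sup>2) - Q u w\<bar> \<le> \<epsilon>"
    and osc: "\<And>u v. u \<in> {0..T} \<Longrightarrow> v \<in> {0..T} \<Longrightarrow> \<bar>u - v\<bar> \<le> 1 / Suc m \<Longrightarrow> \<bar>I u w - I v w\<bar> \<le> \<epsilon> \<and> \<bar>Q u w - Q v w\<bar> \<le> \<epsilon>"
  shows "\<forall>i<n. tg i < \<tau> w \<longrightarrow> (\<forall>j\<le>i. \<bar>J m (tg j) w - J m s w\<bar> \<le> 2 * K + 1) \<and>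
      (\<Sum>j\<le>i. (norm (h j w))\<^sup>2 * (tg (Suc j) - tg j)) \<le> K + 1"
    and "k \<le> n \<Longrightarrow> \<forall>i<n. tg i < \<tau> w \<longleftrightarrow> i < k \<Longrightarrow>
       \<bar>(J m (tg k) w - J m s w) - (I (min t (\<tau> w)) w - I (min s (\<tau> w)) w)\<bar> \<le> 3 * \<epsilon> \<and>
       \<bar>(\<Sum>j<k. (norm (h j w))\<^sup>2 * (tg (Suc j) - tg j)) - (Q (min t (\<tau> w)) w - Q (min s (\<tau> w)) w)\<bar> \<le> 3 * \<epsilon>"
proof -
  have tg: "tg 0 = s" "tg n = t" "\<And>i j. i < j \<Longrightarrow> j \<le> n \<Longrightarrow> tg i < tg j" "\<And>i. i < n \<Longrightarrow> tg (Suc i) - tg i \<le> 1 / Suc m"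
    and Hh: "\<And>i r. i < n \<Longrightarrow> tg i < r \<Longrightarrow> r \<le> tg (Suc i) \<Longrightarrow> H m r w = h i w"
    using fg w by (auto simp: fine_grid_def)
  have le: "tg i \<le> tg j" if "i \<le> j" "j \<le> n" for i j using tg(3)[of i j] that by (cases "i = j") auto
  have gb: "tg i \<in> {0..T}" "s \<le> tg i" "tg i \<le> t" if "i \<le> n" for i using le[of 0 i] le[of i n] tg(1,2) st that by auto
  define R where "R u = (LBINT r:{0..u}. (norm (H m r w))\<^sup>2)" for u
  have Rstep: "R (tg (Suc j)) - R (tg j) = (norm (h j w))\<^sup>2 * (tg (Suc j) - tg j)" if "j < n" for j
  proof -
    have "R (tg (Suc j)) - R (tg j) = (LBINT r:{tg j<..tg (Suc j)}. (norm (H m r w))\<^sup>2)"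
      unfolding R_def using gb[of j] gb[of "Suc j"] le[of j "Suc j"] that by (intro set_integral_diff_initial[OF iH]) auto
    also have "\<dots> = (LBINT r:{tg j<..tg (Suc j)}. (norm (h j w))\<^sup>2)"
      using Hh that by (intro set_lebesgue_integral_cong) auto
    also have "\<dots> = (norm (h j w))\<^sup>2 * (tg (Suc j) - tg j)"
      using le[of j "Suc j"] that by (simp add: set_lebesgue_integral_def)
    finally show ?thesis .
  qed
  have Rsum: "(\<Sum>j<k. (norm (h j w))\<^sup>2 * (tg (Suc j) - tg j)) = R (tg k) - R s" if "k \<le> n" for k
    using that by (induction k) (auto simp: tg(1) Rstep[symmetric])
  have sT: "s \<in> {0..T}" using st by auto
  show "\<forall>i<n. tg i < \<tau> w \<longrightarrow> (\<forall>j\<le>i. \<bar>J m (tg j) w - J m s w\<bar> \<le> 2 * K + 1) \<and>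
      (\<Sum>j\<le>i. (norm (h j w))\<^sup>2 * (tg (Suc j) - tg j)) \<le> K + 1"
  proof (intro allI impI conjI)
    fix i assume i: "i < n" "tg i < \<tau> w"
    have s\<tau>: "s \<le> \<tau> w" using gb(2)[of i] i by auto
    { fix j assume j: "j \<le> i"
      have "\<bar>I (tg j) w\<bar> \<le> K" using bdI[of "tg j"] gb(1)[of j] le[of j i] i j by auto
      moreover have "\<bar>I s w\<bar> \<le> K" using bdI[of s] st s\<tau> by auto
      moreover have "\<bar>J m (tg j) w - I (tg j) w\<bar> \<le> \<epsilon>" "\<bar>J m s w - I s w\<bar> \<le> \<epsilon>"
        using cJ gb(1)[of j] i j sT by auto
      ultimately show "\<bar>J m (tg j) w - J m s w\<bar> \<le> 2 * K + 1" using \<epsilon> by linarith }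
    have "(\<Sum>j\<le>i. (norm (h j w))\<^sup>2 * (tg (Suc j) - tg j)) = R (tg (Suc i)) - R s"
      using Rsum[of "Suc i"] i by (simp add: lessThan_Suc_atMost)
    moreover have "\<bar>R (tg (Suc i)) - Q (tg (Suc i)) w\<bar> \<le> \<epsilon>" "\<bar>R s - Q s w\<bar> \<le> \<epsilon>"
      unfolding R_def using cH gb(1)[of "Suc i"] i sT by auto
    moreover have "\<bar>Q (tg (Suc i)) w - Q (tg i) w\<bar> \<le> \<epsilon>"
      using osc[of "tg (Suc i)" "tg i"] gb(1)[of i] gb(1)[of "Suc i"] i tg(4)[of i] le[of i "Suc i"] by auto
    moreover have "Q (tg i) w \<le> Q (\<tau> w) w" using i gb(1)[of i] \<tau>w by (intro Q_mono[OF w]) auto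
    moreover have "0 \<le> Q s w" using Q_mono[OF w, of 0 s] st by (simp add: Q_0)
    ultimately show "(\<Sum>j\<le>i. (norm (h j w))\<^sup>2 * (tg (Suc j) - tg j)) \<le> K + 1"
      using bdQ \<epsilon> by linarith
  qed
  assume k: "k \<le> n" "\<forall>i<n. tg i < \<tau> w \<longleftrightarrow> i < k"
  have n0: "0 < n" using tg(1,2) st by (cases n) auto
  show "\<bar>(J m (tg k) w - J m s w) - (I (min t (\<tau> w)) w - I (min s (\<tau> w)) w)\<bar> \<le> 3 * \<epsilon> \<and>
       \<bar>(\<Sum>j<k. (norm (h j w))\<^sup>2 * (tg (Suc j) - tg j)) - (Q (min t (\<tau> w)) w - Q (min s (\<tau> w)) w)\<bar> \<le> 3 * \<epsilon>"
  proof (cases "s < \<tau> w")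
    case False
    then have "k = 0" using k(2) n0 tg(1) by auto
    then show ?thesis using False st \<epsilon> tg(1) by (simp add: min_absorb2)
  next
    case True
    then have k0: "0 < k" using k(2) n0 tg(1) by auto
    then obtain k' where k': "k = Suc k'" by (cases k) auto
    let ?u = "min t (\<tau> w)"
    have "tg k' < \<tau> w" "tg k' < tg k" "tg k - tg k' \<le> 1 / Suc m" using k k' tg(3)[of k' k] tg(4)[of k'] by auto
    moreover have "tg k' < t" using tg(2) tg(3)[of k' n] k k' by auto
    moreover have "?u \<le> tg k" using k(1) k(2)[rule_format, of k] tg(2) by (cases "k = n") auto
    ultimately have du: "\<bar>tg k - ?u\<bar> \<le> 1 / Suc m" by (auto simp: min_def abs_le_iff split: if_splits)
    have uT: "?u \<in> {0..T}" using st \<tau>w by auto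
    have ms: "min s (\<tau> w) = s" using True by simp
    have o: "\<bar>I (tg k) w - I ?u w\<bar> \<le> \<epsilon>" "\<bar>Q (tg k) w - Q ?u w\<bar> \<le> \<epsilon>"
      using osc[OF gb(1)[OF k(1)] uT du] by auto
    have "\<bar>J m (tg k) w - I (tg k) w\<bar> \<le> \<epsilon>" "\<bar>J m s w - I s w\<bar> \<le> \<epsilon>"
      using cJ gb(1)[OF k(1)] sT by auto
    moreover have "\<bar>R (tg k) - Q (tg k) w\<bar> \<le> \<epsilon>" "\<bar>R s - Q s w\<bar> \<le> \<epsilon>"
      unfolding R_def using cH gb(1)[OF k(1)] sT by auto
    moreover have "\<bar>(a - b) - (c - b')\<bar> \<le> 3 * \<epsilon>" if "\<bar>a - a'\<bar> \<le> \<epsilon>" "\<bar>b - b'\<bar> \<le> \<epsilon>" "\<bar>a' - c\<bar> \<le> \<epsilon>" for a a' b b' c :: real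
      using that by linarith
    ultimately show ?thesis unfolding Rsum[OF k(1)] ms using o by blast
  qed
qed

text \<open>The martingale property of the stopped processes I and I^2 - Q, tested against bounded
  past-measurable weights. The stopped walks converge almost surely; their uniform fourth moments
  make the squares uniformly integrable, and the discrete energies stay below \<open>K + 1\<close>,
  so both discrete identities pass to the limit.\<close>

lemma stopped_martingale:
  assumes st: "0 \<le> s" "s \<le> t" "t \<le> T" and \<tau>: "bounded_stopping \<tau>" and K: "0 \<le> K"
    and bdI: "\<And>w r. w \<in> space M \<Longrightarrow> 0 \<le> r \<Longrightarrow> r \<le> \<tau> w \<Longrightarrow> \<bar>I r w\<bar> \<le> K"
    and bdQ: "\<And>w. w \<in> space M \<Longrightarrow> Q (\<tau> w) w \<le> K"
    and Psi: "\<Psi> \<in> borel_measurable (F s)" "\<And>w. w \<in> space M \<Longrightarrow> \<bar>\<Psi> w\<bar> \<le> C'"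
  shows "E (\<lambda>w. \<Psi> w * (I (min t (\<tau> w)) w - I (min s (\<tau> w)) w)) = 0"
    and "E (\<lambda>w. \<Psi> w * (I (min t (\<tau> w)) w - I (min s (\<tau> w)) w)\<^sup>2) =
         E (\<lambda>w. \<Psi> w * (Q (min t (\<tau> w)) w - Q (min s (\<tau> w)) w))"
proof -
  define \<Delta> where "\<Delta> w = I (min t (\<tau> w)) w - I (min s (\<tau> w)) w" for w
  define \<Delta>Q where "\<Delta>Q w = Q (min t (\<tau> w)) w - Q (min s (\<tau> w)) w" for w
  have "E (\<lambda>w. \<Psi> w * \<Delta> w) = 0 \<and> E (\<lambda>w. \<Psi> w * (\<Delta> w)\<^sup>2) = E (\<lambda>w. \<Psi> w * \<Delta>Q w)"
  proof (cases "s = t")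
    case True then show ?thesis by (simp add: \<Delta>_def \<Delta>Q_def)
  next
    case False
    then have st': "s < t" using st by simp
    have tT: "t \<in> {0..T}" "s \<in> {0..T}" using st by auto
    have [measurable]: "\<Psi> \<in> borel_measurable M" using Psi st by (auto intro: F_measurable_M)
    have [measurable]: "\<Delta> \<in> borel_measurable M" "\<Delta>Q \<in> borel_measurable M"
      unfolding \<Delta>_def \<Delta>Q_def using tT
      by (auto intro!: borel_measurable_diff intro: F_measurable_M[OF progressive_stopped[OF I_prog \<tau>]] F_measurable_M[OF Q_stopped_measurable[OF \<tau>]])
    define C4 where "C4 = 8 * (2 * K + 1)\<^sup>2 * (K + 1) + 9 * (real CARD('d))\<^sup>2 * (K + 1)\<^sup>2"
    have "\<forall>m. \<exists>n tg h. fine_grid J H s t m n tg h" using fine_grid_exists[OF approx st(1) st' st(3)] by blast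
    then obtain n tg h where fg: "\<And>m. fine_grid J H s t m (n m) (tg m) (h m)" by metis
    define G where "G m w \<longleftrightarrow> (\<forall>i<n m. tg m i < \<tau> w \<longrightarrow> (\<forall>j\<le>i. \<bar>J m (tg m j) w - J m s w\<bar> \<le> 2 * K + 1) \<and>
      (\<Sum>j\<le>i. (norm (h m j w))\<^sup>2 * (tg m (Suc j) - tg m j)) \<le> K + 1)" for m w
    \<comment> \<open>Collects the conclusions of \<open>stopped_walk\<close> in one predicate, so
      that walks can be chosen for all \<open>m\<close> at once.\<close>
    define W where "W m U q \<longleftrightarrow> U \<in> borel_measurable M \<and> q \<in> borel_measurable M \<and>
      E (\<lambda>w. \<Psi> w * U w) = 0 \<and> E (\<lambda>w. \<Psi> w * (U w)\<^sup>2) = E (\<lambda>w. \<Psi> w * q w) \<and>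
      (\<forall>w\<in>space M. 0 \<le> q w \<and> q w \<le> K + 1) \<and> integrable M (\<lambda>w. (U w) ^ 4) \<and>
      E (\<lambda>w. (U w) ^ 4) \<le> C4 \<and>
      (\<forall>w\<in>space M. G m w \<longrightarrow> (\<exists>k\<le>n m. (\<forall>i<n m. tg m i < \<tau> w \<longleftrightarrow> i < k) \<and> U w = J m (tg m k) w - J m s w \<and>
        q w = (\<Sum>j<k. (norm (h m j w))\<^sup>2 * (tg m (Suc j) - tg m j))))" for m U q
    have "\<exists>U q. W m U q" for m
    proof (rule stopped_walk[OF fg[of m] st(1) st' st(3) \<tau> K Psi, folded G_def C4_def])
      fix U q
      assume *: "U \<in> borel_measurable M" "q \<in> borel_measurable M" "E (\<lambda>w. \<Psi> w * U w) = 0"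
        "E (\<lambda>w. \<Psi> w * (U w)\<^sup>2) = E (\<lambda>w. \<Psi> w * q w)"
        "\<And>w. w \<in> space M \<Longrightarrow> 0 \<le> q w \<and> q w \<le> K + 1" "integrable M (\<lambda>w. (U w) ^ 4)" "E (\<lambda>w. (U w) ^ 4) \<le> C4"
        "\<And>w. w \<in> space M \<Longrightarrow> G m w \<Longrightarrow> \<exists>k\<le>n m. (\<forall>i<n m. tg m i < \<tau> w \<longleftrightarrow> i < k) \<and> U w = J m (tg m k) w - J m s w \<and>
          q w = (\<Sum>j<k. (norm (h m j w))\<^sup>2 * (tg m (Suc j) - tg m j))"
      show ?thesis by (rule exI[of _ U], rule exI[of _ q]) (unfold W_def, intro conjI ballI impI *(1-4,6-8) *(5)[THEN conjunct1] *(5)[THEN conjunct2])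
    qed
    then obtain U q where W: "\<And>m. W m (U m) (q m)" by metis
    have Um[measurable]: "U m \<in> borel_measurable M" and qm[measurable]: "q m \<in> borel_measurable M" for m using W[of m] by (auto simp: W_def)
    have lim: "AE w in M. (\<lambda>m. U m w) \<longlonglongrightarrow> \<Delta> w \<and> (\<lambda>m. q m w) \<longlonglongrightarrow> \<Delta>Q w"
    proof -
      have a1: "AE w in M. uniform_limit {0..T} (\<lambda>m t. J m t w) (\<lambda>t. I t w) sequentially"
        and a2: "AE w in M. (\<lambda>m. \<integral>\<^sup>+ t. ennreal ((norm (H m t w - z t w))\<^sup>2) * indicator {0..T} t \<partial>lborel) \<longlonglongrightarrow> 0"
        using approx by (auto simp: elem_approx_def)
      from a1 a2 AE_space show ?thesis
      proof eventually_elim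
        case (elim w)
        have \<tau>w: "\<tau> w \<in> {0..T}" using \<tau> elim(3) by (auto simp: bounded_stopping_def)
        have ev: "eventually (\<lambda>m. \<bar>U m w - \<Delta> w\<bar> \<le> 3 * \<epsilon> \<and> \<bar>q m w - \<Delta>Q w\<bar> \<le> 3 * \<epsilon>) sequentially"
          if \<epsilon>: "\<epsilon> > 0" "\<epsilon> \<le> 1 / 4" for \<epsilon>
          using pathwise_approx[OF elim(3,1,2) \<epsilon>(1)]
        proof eventually_elim
          case (elim m)
          note c = stopped_walk_close[where \<tau>=\<tau> and K=K and w=w, OF \<open>w \<in> space M\<close> st(1) st' st(3) \<tau>w fg[of m] bdI[OF \<open>w \<in> space M\<close>] bdQ[OF \<open>w \<in> space M\<close>] \<epsilon>(2,1)]
          have "G m w" unfolding G_def using elim by (intro c(1)) auto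
          then obtain k where k: "k \<le> n m" "\<forall>i<n m. tg m i < \<tau> w \<longleftrightarrow> i < k" "U m w = J m (tg m k) w - J m s w"
            "q m w = (\<Sum>j<k. (norm (h m j w))\<^sup>2 * (tg m (Suc j) - tg m j))"
            using W[of m] \<open>w \<in> space M\<close> unfolding W_def by blast
          show ?case unfolding k(3,4) \<Delta>_def \<Delta>Q_def using elim k(1,2) by (intro c(2)) auto
        qed
        have "eventually (\<lambda>m. \<bar>U m w - \<Delta> w\<bar> < e \<and> \<bar>q m w - \<Delta>Q w\<bar> < e) sequentially" if e: "e > 0" for e
        proof -
          have "min (e / 6) (1 / 4) > 0" "min (e / 6) (1 / 4) \<le> 1 / (4::real)" using e by auto
          from ev[OF this] show ?thesis
            by (rule eventually_mono) (use e in \<open>auto simp: min_def split: if_splits\<close>)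
        qed
        then show ?case by (auto simp: tendsto_iff dist_real_def eventually_conj_iff)
      qed
    qed
    have C'0: "0 \<le> C'" using Psi(2) not_empty by (metis all_not_in_conv abs_ge_zero order_trans)
    have Psi2: "(\<Psi> w)\<^sup>2 \<le> C'\<^sup>2" if "w \<in> space M" for w using power_mono[OF Psi(2)[OF that], of 2] by simp
    have U4: "integrable M (\<lambda>w. (U m w) ^ 4)" "E (\<lambda>w. (U m w) ^ 4) \<le> C4" for m using W[of m] by (auto simp: W_def)
    have d1: "integrable M (\<lambda>w. (\<Psi> w * (U m w)\<^sup>2)\<^sup>2)" "E (\<lambda>w. (\<Psi> w * (U m w)\<^sup>2)\<^sup>2) \<le> C'\<^sup>2 * C4" for m
    proof -
      have le: "(\<Psi> w * (U m w)\<^sup>2)\<^sup>2 \<le> C'\<^sup>2 * (U m w) ^ 4" if "w \<in> space M" for w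
        using mult_right_mono[OF Psi2[OF that], of "(U m w) ^ 4"] by (simp add: power_mult_distrib)
      show i: "integrable M (\<lambda>w. (\<Psi> w * (U m w)\<^sup>2)\<^sup>2)"
        by (rule Bochner_Integration.integrable_bound[OF integrable_mult_right[OF U4(1), of "C'\<^sup>2"]]) (use le in \<open>auto intro!: AE_I2\<close>)
      have "E (\<lambda>w. (\<Psi> w * (U m w)\<^sup>2)\<^sup>2) \<le> E (\<lambda>w. C'\<^sup>2 * (U m w) ^ 4)"
        using i U4(1) le by (intro integral_mono) auto
      also have "\<dots> \<le> C'\<^sup>2 * C4" using U4(2) by (simp add: mult_left_mono)
      finally show "E (\<lambda>w. (\<Psi> w * (U m w)\<^sup>2)\<^sup>2) \<le> C'\<^sup>2 * C4" .
    qed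
    have d2: "integrable M (\<lambda>w. (\<Psi> w * U m w)\<^sup>2)" "E (\<lambda>w. (\<Psi> w * U m w)\<^sup>2) \<le> C'\<^sup>2 * (1 + C4)" for m
    proof -
      have le: "(\<Psi> w * U m w)\<^sup>2 \<le> C'\<^sup>2 * (1 + (U m w) ^ 4)" if "w \<in> space M" for w
      proof -
        have "2 * (U m w)\<^sup>2 \<le> 1 + (U m w) ^ 4" using sum_squares_bound[of 1 "(U m w)\<^sup>2"] by simp
        moreover have "0 \<le> (U m w)\<^sup>2" by simp
        ultimately have "(U m w)\<^sup>2 \<le> 1 + (U m w) ^ 4" by linarith
        then show ?thesis unfolding power_mult_distrib using Psi2[OF that] by (intro mult_mono) auto
      qed
      have i1: "integrable M (\<lambda>w. C'\<^sup>2 * (1 + (U m w) ^ 4))"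
        using U4(1)[of m] by (intro integrable_mult_right Bochner_Integration.integrable_add) auto
      show i: "integrable M (\<lambda>w. (\<Psi> w * U m w)\<^sup>2)"
        by (rule Bochner_Integration.integrable_bound[OF i1]) (use le in \<open>auto intro!: AE_I2 order_trans[OF _ abs_ge_self]\<close>)
      have "E (\<lambda>w. (\<Psi> w * U m w)\<^sup>2) \<le> E (\<lambda>w. C'\<^sup>2 * (1 + (U m w) ^ 4))"
        using i i1 le by (intro integral_mono) auto
      also have "\<dots> \<le> C'\<^sup>2 * (1 + C4)" using U4 by (simp add: mult_left_mono prob_space)
      finally show "E (\<lambda>w. (\<Psi> w * U m w)\<^sup>2) \<le> C'\<^sup>2 * (1 + C4)" .
    qed
    have l1: "(\<lambda>m. E (\<lambda>w. \<Psi> w * U m w)) \<longlonglongrightarrow> E (\<lambda>w. \<Psi> w * \<Delta> w)"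
      by (rule tendsto_expectation_L2_bounded(2)[OF d2]) (use lim in \<open>auto intro!: tendsto_intros elim!: eventually_mono\<close>)
    have l2: "(\<lambda>m. E (\<lambda>w. \<Psi> w * (U m w)\<^sup>2)) \<longlonglongrightarrow> E (\<lambda>w. \<Psi> w * (\<Delta> w)\<^sup>2)"
      by (rule tendsto_expectation_L2_bounded(2)[OF d1]) (use lim in \<open>auto intro!: tendsto_intros elim!: eventually_mono\<close>)
    have l3: "(\<lambda>m. E (\<lambda>w. \<Psi> w * q m w)) \<longlonglongrightarrow> E (\<lambda>w. \<Psi> w * \<Delta>Q w)"
    proof (rule integral_dominated_convergence[where w="\<lambda>_. C' * (K + 1)"])
      show "AE w in M. (\<lambda>m. \<Psi> w * q m w) \<longlonglongrightarrow> \<Psi> w * \<Delta>Q w"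
        using lim by eventually_elim (auto intro!: tendsto_intros)
      show "AE w in M. norm (\<Psi> w * q m w) \<le> C' * (K + 1)" for m
      proof (rule AE_I2)
        fix w assume w: "w \<in> space M"
        have "0 \<le> q m w \<and> q m w \<le> K + 1" using W[of m] w by (auto simp: W_def)
        then show "norm (\<Psi> w * q m w) \<le> C' * (K + 1)"
          unfolding real_norm_def abs_mult using Psi(2)[OF w] C'0 by (intro mult_mono) auto
      qed
    qed auto
    have "E (\<lambda>w. \<Psi> w * U m w) = 0" "E (\<lambda>w. \<Psi> w * (U m w)\<^sup>2) = E (\<lambda>w. \<Psi> w * q m w)" for m
      using W[of m] by (auto simp: W_def)
    then show ?thesis using l1 l2 l3 by (auto intro: LIMSEQ_unique)
  qed
  then show "E (\<lambda>w. \<Psi> w * (I (min t (\<tau> w)) w - I (min s (\<tau> w)) w)) = 0"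
    and "E (\<lambda>w. \<Psi> w * (I (min t (\<tau> w)) w - I (min s (\<tau> w)) w)\<^sup>2) =
         E (\<lambda>w. \<Psi> w * (Q (min t (\<tau> w)) w - Q (min s (\<tau> w)) w))"
    by (auto simp: \<Delta>_def \<Delta>Q_def)
qed

end

section \<open>An Ito inequality for bounded semimartingales\<close>

lemma set_integrable_continuous_mult:
  fixes k b :: "real \<Rightarrow> real"
  assumes k: "continuous_on {0..T} k" and b: "set_integrable lborel {0..T} b"
  shows "set_integrable lborel {0..T} (\<lambda>r. k r * b r)"
proof -
  have "compact (k ` {0..T})" by (rule compact_continuous_image[OF k]) simp
  then obtain C where C: "\<And>r. r \<in> {0..T} \<Longrightarrow> \<bar>k r\<bar> \<le> C"
    using compact_imp_bounded bounded_iff by (metis image_eqI real_norm_def)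
  have "set_integrable lborel {0..T} (\<lambda>r. C * b r)" using b by simp
  then show ?thesis
  proof (rule set_integrable_bound)
    have "(\<lambda>r. indicator {0..T} r *\<^sub>R k r) \<in> borel_measurable lborel"
      using borel_measurable_continuous_on_indicator[OF _ k] by simp
    moreover have "(\<lambda>r. indicator {0..T} r *\<^sub>R b r) \<in> borel_measurable lborel"
      using b unfolding set_integrable_def by (rule borel_measurable_integrable)
    ultimately have "(\<lambda>r. (indicator {0..T} r *\<^sub>R k r) * (indicator {0..T} r *\<^sub>R b r)) \<in> borel_measurable lborel" by (rule borel_measurable_times)
    moreover have "(\<lambda>r. (indicator {0..T} r *\<^sub>R k r) * (indicator {0..T} r *\<^sub>R b r)) = (\<lambda>r. indicator {0..T} r *\<^sub>R (k r * b r))"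
      by (auto simp: indicator_def)
    ultimately show "set_borel_measurable lborel {0..T} (\<lambda>r. k r * b r)"
      unfolding set_borel_measurable_def by (simp only:)
    have "\<bar>k r * b r\<bar> \<le> \<bar>C * b r\<bar>" if "r \<in> {0..T}" for r
      unfolding abs_mult using C[OF that] by (intro mult_right_mono) auto
    then show "AE r in lborel. r \<in> {0..T} \<longrightarrow> norm (k r * b r) \<le> norm (C * b r)" by simp
  qed
qed

definition ugrid :: "real \<Rightarrow> real \<Rightarrow> nat \<Rightarrow> nat \<Rightarrow> real" where
  "ugrid s T n i = s + (T - s) * real i / real (Suc n)"

lemma ugrid_0: "ugrid s T n 0 = s" and ugrid_end: "ugrid s T n (Suc n) = T"
  and ugrid_step: "ugrid s T n (Suc i) - ugrid s T n i = (T - s) / Suc n"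
  by (simp_all add: ugrid_def field_simps del: of_nat_Suc) (simp add: field_simps)

lemma ugrid_mono: "s \<le> T \<Longrightarrow> i \<le> j \<Longrightarrow> ugrid s T n i \<le> ugrid s T n j"
  unfolding ugrid_def by (intro add_left_mono divide_right_mono mult_left_mono) auto

lemma ugrid_bounds: "s \<le> T \<Longrightarrow> i \<le> Suc n \<Longrightarrow> s \<le> ugrid s T n i \<and> ugrid s T n i \<le> T"
  using ugrid_mono[of s T 0 i n] ugrid_mono[of s T i "Suc n" n] ugrid_0[of s T n] ugrid_end[of s T n] by auto

lemma ugrid_mesh_vanishes: "e > 0 \<Longrightarrow> eventually (\<lambda>n. (T - s) / real (Suc n) < e) sequentially"
proof -
  have "(\<lambda>n. (T - s) * inverse (real (Suc n))) \<longlonglongrightarrow> (T - s) * 0"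
    by (intro tendsto_mult_left LIMSEQ_inverse_real_of_nat)
  then show "e > 0 \<Longrightarrow> eventually (\<lambda>n. (T - s) / real (Suc n) < e) sequentially"
    using order_tendstoD(2)[of _ 0] by (simp add: divide_inverse)
qed

lemma ugrid_cell:
  assumes "s \<le> T" "i < Suc n"
  shows "min (ugrid s T n i) u \<le> min (ugrid s T n (Suc i)) u"
    "min (ugrid s T n (Suc i)) u - min (ugrid s T n i) u \<le> (T - s) / Suc n"
proof -
  have "ugrid s T n i \<le> ugrid s T n (Suc i)" using ugrid_mono[OF assms(1)] by simp
  then show "min (ugrid s T n i) u \<le> min (ugrid s T n (Suc i)) u" by auto
  show "min (ugrid s T n (Suc i)) u - min (ugrid s T n i) u \<le> (T - s) / Suc n"
    using ugrid_step[of s T n i] \<open>ugrid s T n i \<le> ugrid s T n (Suc i)\<close> by (auto simp: min_def)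
qed

text \<open>Left-point Stieltjes sums against the integral function of \<open>b\<close>. On each
  cell the error is at most the oscillation of \<open>k\<close> times the integral of |b|, and
  capping the grid points at \<open>u\<close> empties the cells beyond it.\<close>

lemma riemann_sum_tendsto:
  fixes k b :: "real \<Rightarrow> real"
  assumes k: "continuous_on {0..T} k" and b: "set_integrable lborel {0..T} b" and s: "0 \<le> s" "s \<le> u" "u \<le> T"
  shows "(\<lambda>n. \<Sum>i<Suc n. k (min (ugrid s T n i) u) *
      ((LBINT r:{0..min (ugrid s T n (Suc i)) u}. b r) - (LBINT r:{0..min (ugrid s T n i) u}. b r)))
    \<longlonglongrightarrow> (LBINT r:{s<..u}. k r * b r)"
proof (rule LIMSEQ_I)
  fix e :: real assume e: "e > 0"
  define F where "F x = (LBINT r:{0..x}. b r)" for x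
  define KB where "KB x = (LBINT r:{0..x}. k r * b r)" for x
  define WF where "WF x = (LBINT r:{0..x}. \<bar>b r\<bar>)" for x
  have kb: "set_integrable lborel {0..T} (\<lambda>r. k r * b r)" by (rule set_integrable_continuous_mult[OF k b])
  have ab: "set_integrable lborel {0..T} (\<lambda>r. \<bar>b r\<bar>)" using b by (rule set_integrable_abs)
  have W0: "0 \<le> WF x" for x by (simp add: WF_def set_lebesgue_integral_def)
  have Wmono: "WF x \<le> WF v" if "0 \<le> x" "x \<le> v" "v \<le> T" for x v
    unfolding WF_def using that by (intro set_integral_mono_subset set_integrable_subset[OF ab]) auto
  define \<eta> where "\<eta> = e / (2 * (WF T + 1))"
  have \<eta>: "\<eta> > 0" using e W0[of T] by (simp add: \<eta>_def)
  have \<eta>W: "\<eta> * WF T < e"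
  proof -
    have "\<eta> * WF T \<le> \<eta> * (WF T + 1)" using \<eta> by (intro mult_left_mono) auto
    also have "\<dots> = e / 2" using W0[of T] by (simp add: \<eta>_def field_simps)
    finally show ?thesis using e by simp
  qed
  have "uniformly_continuous_on {0..T} k" using k by (rule compact_uniformly_continuous) simp
  then obtain d where d: "d > 0" "\<And>v w. v \<in> {0..T} \<Longrightarrow> w \<in> {0..T} \<Longrightarrow> dist v w < d \<Longrightarrow> dist (k v) (k w) < \<eta>"
    unfolding uniformly_continuous_on_def using \<eta> by metis
  obtain N where N: "\<And>n. n \<ge> N \<Longrightarrow> (T - s) / real (Suc n) < d"
    using ugrid_mesh_vanishes[OF d(1)] unfolding eventually_sequentially by blast
  show "\<exists>no. \<forall>n\<ge>no. norm ((\<Sum>i<Suc n. k (min (ugrid s T n i) u) *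
      ((LBINT r:{0..min (ugrid s T n (Suc i)) u}. b r) - (LBINT r:{0..min (ugrid s T n i) u}. b r))) - (LBINT r:{s<..u}. k r * b r)) < e"
  proof (intro exI allI impI)
    fix n assume n: "n \<ge> N"
    let ?v = "\<lambda>i. min (ugrid s T n i) u"
    have vb: "?v i \<in> {0..T}" "0 \<le> ?v i" "?v i \<le> T" if "i \<le> Suc n" for i using ugrid_bounds[of s T i n] that s by auto
    have cell: "\<bar>k (?v i) * (F (?v (Suc i)) - F (?v i)) - (KB (?v (Suc i)) - KB (?v i))\<bar> \<le> \<eta> * (WF (?v (Suc i)) - WF (?v i))"
      if i: "i < Suc n" for i
    proof -
      note c = ugrid_cell[of s T i n u, OF _ i]
      have le: "?v i \<le> ?v (Suc i)" using c s by auto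
      have sub: "{?v i<..?v (Suc i)} \<subseteq> {0..T}" using vb[of i] vb[of "Suc i"] i by auto
      have ib: "set_integrable lborel {?v i<..?v (Suc i)} b" "set_integrable lborel {?v i<..?v (Suc i)} (\<lambda>r. k r * b r)"
        "set_integrable lborel {?v i<..?v (Suc i)} (\<lambda>r. \<bar>b r\<bar>)"
        using sub by (auto intro: set_integrable_subset[OF b] set_integrable_subset[OF kb] set_integrable_subset[OF ab])
      have "k (?v i) * (F (?v (Suc i)) - F (?v i)) - (KB (?v (Suc i)) - KB (?v i))
          = (LBINT r:{?v i<..?v (Suc i)}. k (?v i) * b r) - (LBINT r:{?v i<..?v (Suc i)}. k r * b r)"
        unfolding F_def KB_def using set_integral_diff_initial[OF b _ le] set_integral_diff_initial[OF kb _ le] vb[of i] vb[of "Suc i"] i by simp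
      also have "\<dots> = (LBINT r:{?v i<..?v (Suc i)}. k (?v i) * b r - k r * b r)"
        using ib by (intro set_integral_diff(2)[symmetric]) auto
      also have "norm \<dots> \<le> (LBINT r:{?v i<..?v (Suc i)}. norm (k (?v i) * b r - k r * b r))"
        using ib by (intro set_integral_norm_bound set_integral_diff(1)) auto
      also have "\<dots> \<le> (LBINT r:{?v i<..?v (Suc i)}. \<eta> * \<bar>b r\<bar>)"
      proof (rule set_integral_mono)
        show "set_integrable lborel {?v i<..?v (Suc i)} (\<lambda>r. norm (k (?v i) * b r - k r * b r))"
          using ib by (intro set_integrable_norm set_integral_diff(1)) auto
        show "set_integrable lborel {?v i<..?v (Suc i)} (\<lambda>r. \<eta> * \<bar>b r\<bar>)" using ib by simp
        fix r assume r: "r \<in> {?v i<..?v (Suc i)}"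
        have "dist (k (?v i)) (k r) < \<eta>"
          using r sub vb[of i] i c(2) s N[OF n] by (intro d(2)) (auto simp: dist_real_def)
        then show "norm (k (?v i) * b r - k r * b r) \<le> \<eta> * \<bar>b r\<bar>"
          by (simp add: left_diff_distrib[symmetric] abs_mult dist_real_def mult_right_mono)
      qed
      also have "\<dots> = \<eta> * (WF (?v (Suc i)) - WF (?v i))"
        unfolding WF_def using set_integral_diff_initial[OF ab _ le] vb[of i] vb[of "Suc i"] i by simp
      finally show ?thesis by simp
    qed
    have tel: "(\<Sum>i<Suc n. G (?v (Suc i)) - G (?v i)) = G u - G s" for G :: "real \<Rightarrow> real"
      using sum_lessThan_telescope[of "\<lambda>i. G (?v i)" "Suc n"] s by (simp add: ugrid_0 ugrid_end min_absorb1 min_absorb2 del: sum.lessThan_Suc)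
    have "(LBINT r:{s<..u}. k r * b r) = KB u - KB s"
      unfolding KB_def using set_integral_diff_initial[OF kb s] by simp
    then have "\<bar>(\<Sum>i<Suc n. k (?v i) * (F (?v (Suc i)) - F (?v i))) - (LBINT r:{s<..u}. k r * b r)\<bar>
       = \<bar>\<Sum>i<Suc n. k (?v i) * (F (?v (Suc i)) - F (?v i)) - (KB (?v (Suc i)) - KB (?v i))\<bar>"
      by (simp only: sum_subtractf[of "\<lambda>i. k (?v i) * (F (?v (Suc i)) - F (?v i))"] tel)
    also have "\<dots> \<le> (\<Sum>i<Suc n. \<eta> * (WF (?v (Suc i)) - WF (?v i)))"
      by (rule order_trans[OF sum_abs]) (intro sum_mono cell, simp)
    also have "\<dots> = \<eta> * (WF u - WF s)" by (simp only: sum_distrib_left[symmetric] tel)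
    also have "\<dots> \<le> \<eta> * WF T" using Wmono[of u T] W0[of s] s \<eta> by (intro mult_left_mono) auto
    finally show "norm ((\<Sum>i<Suc n. k (?v i) *
      ((LBINT r:{0..?v (Suc i)}. b r) - (LBINT r:{0..?v i}. b r))) - (LBINT r:{s<..u}. k r * b r)) < e"
      using \<eta>W by (simp add: F_def del: sum.lessThan_Suc)
  qed
qed

text \<open>Close points are handled by uniform continuity of the second derivative. For points at
  least \<open>d\<close> apart a quadratic error is at most a cubic one with constant C / d, where C
  bounds the second derivative. On a grid a cubic error is small: it is an oscillation times a sum
  of squares.\<close>

lemma second_order_lower_bound:
  fixes \<phi> \<phi>' \<phi>'' :: "real \<Rightarrow> real"
  assumes d1: "\<And>x. (\<phi> has_real_derivative \<phi>' x) (at x)" and d2: "\<And>x. (\<phi>' has_real_derivative \<phi>'' x) (at x)"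
    and c: "continuous_on {-K..K} \<phi>''" and \<eta>: "\<eta> > 0"
  obtains L where "L \<ge> 0" "\<And>x x'. \<bar>x\<bar> \<le> K \<Longrightarrow> \<bar>x'\<bar> \<le> K \<Longrightarrow>
     \<phi> x' - \<phi> x \<ge> \<phi>' x * (x' - x) + \<phi>'' x / 2 * (x' - x)\<^sup>2 - \<eta> * (x' - x)\<^sup>2 - L * \<bar>x' - x\<bar> ^ 3"
proof -
  have "uniformly_continuous_on {-K..K} \<phi>''" using c by (rule compact_uniformly_continuous) simp
  then obtain d where d: "d > 0" "\<And>v w. v \<in> {-K..K} \<Longrightarrow> w \<in> {-K..K} \<Longrightarrow> dist v w < d \<Longrightarrow> dist (\<phi>'' v) (\<phi>'' w) < \<eta>"
    unfolding uniformly_continuous_on_def using \<eta> by metis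
  have "compact (\<phi>'' ` {-K..K})" by (rule compact_continuous_image[OF c]) simp
  then obtain C where C: "\<And>r. r \<in> {-K..K} \<Longrightarrow> \<bar>\<phi>'' r\<bar> \<le> C"
    using compact_imp_bounded bounded_iff by (metis image_eqI real_norm_def)
  define L where "L = max C 0 / d"
  show thesis
  proof (rule that[of L])
    show L0: "L \<ge> 0" using d by (simp add: L_def)
    fix x x' assume x: "\<bar>x\<bar> \<le> K" "\<bar>x'\<bar> \<le> K"
    show "\<phi> x' - \<phi> x \<ge> \<phi>' x * (x' - x) + \<phi>'' x / 2 * (x' - x)\<^sup>2 - \<eta> * (x' - x)\<^sup>2 - L * \<bar>x' - x\<bar> ^ 3"
    proof (cases "x' = x")
      case False
      define df where "df m = (if m = 0 then \<phi> else if m = 1 then \<phi>' else \<phi>'')" for m :: nat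
      obtain t where t: "if x' < x then x' < t \<and> t < x else x < t \<and> t < x'"
        and eq: "\<phi> x' = (\<Sum>m<2. df m x / fact m * (x' - x) ^ m) + df 2 t / fact 2 * (x' - x)\<^sup>2"
      proof -
        have "\<forall>m t. m < 2 \<and> -K \<le> t \<and> t \<le> K \<longrightarrow> (df m has_real_derivative df (Suc m) t) (at t)"
          using d1 d2 by (auto simp: df_def less_2_cases_iff)
        from Taylor[of 2 df \<phi> "-K" K x x', OF _ _ this] x False that show ?thesis by (auto simp: df_def abs_le_iff)
      qed
      have eq2: "\<phi> x' - \<phi> x = \<phi>' x * (x' - x) + \<phi>'' t / 2 * (x' - x)\<^sup>2"
        using eq by (simp add: df_def numeral_2_eq_2)
      have tK: "t \<in> {-K..K}" "x \<in> {-K..K}" "\<bar>t - x\<bar> \<le> \<bar>x' - x\<bar>" using t x by (auto split: if_splits)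
      have "\<phi>'' t / 2 * (x' - x)\<^sup>2 \<ge> \<phi>'' x / 2 * (x' - x)\<^sup>2 - \<eta> * (x' - x)\<^sup>2 - L * \<bar>x' - x\<bar> ^ 3"
      proof (cases "\<bar>x' - x\<bar> < d")
        case True
        then have "\<bar>\<phi>'' t - \<phi>'' x\<bar> < \<eta>" using d(2)[OF tK(1,2)] tK(3) by (simp add: dist_real_def)
        then have "(\<phi>'' x / 2 - \<eta>) * (x' - x)\<^sup>2 \<le> \<phi>'' t / 2 * (x' - x)\<^sup>2" using \<eta> by (intro mult_right_mono) auto
        moreover have "0 \<le> L * \<bar>x' - x\<bar> ^ 3" using L0 by simp
        ultimately show ?thesis by (simp add: left_diff_distrib)
      next
        case False
        have "\<bar>\<phi>'' t\<bar> \<le> C" "\<bar>\<phi>'' x\<bar> \<le> C" using C tK by auto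
        then have "(\<phi>'' x / 2 - max C 0) * (x' - x)\<^sup>2 \<le> \<phi>'' t / 2 * (x' - x)\<^sup>2" by (intro mult_right_mono) auto
        moreover have "max C 0 * (x' - x)\<^sup>2 \<le> L * \<bar>x' - x\<bar> ^ 3"
        proof -
          have "L * \<bar>x' - x\<bar> ^ 3 = L * \<bar>x' - x\<bar> * (x' - x)\<^sup>2" by (simp add: power3_eq_cube power2_eq_square)
          moreover have "max C 0 * (x' - x)\<^sup>2 \<le> (L * \<bar>x' - x\<bar>) * (x' - x)\<^sup>2"
          proof (rule mult_right_mono)
            have "max C 0 = L * d" using d by (simp add: L_def)
            also have "\<dots> \<le> L * \<bar>x' - x\<bar>" using False L0 by (intro mult_left_mono) auto
            finally show "max C 0 \<le> L * \<bar>x' - x\<bar>" .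
          qed simp
          ultimately show ?thesis by linarith
        qed
        moreover have "0 \<le> \<eta> * (x' - x)\<^sup>2" using \<eta> by simp
        ultimately show ?thesis by (simp add: left_diff_distrib)
      qed
      then show ?thesis unfolding eq2 by simp
    qed simp
  qed
qed

lemma (in prob_space) integrable_bounded:
  fixes X :: "'a \<Rightarrow> real"
  assumes "X \<in> borel_measurable M" "\<And>w. w \<in> space M \<Longrightarrow> \<bar>X w\<bar> \<le> C"
  shows "integrable M X"
  using assms by (intro integrable_const_bound[where B=C]) (auto intro!: AE_I2)

lemma (in bm_space) stopped_integral_integrable:
  fixes \<Theta> :: "real \<Rightarrow> 'w \<Rightarrow> real"
  assumes Th: "integrable (TM) (\<lambda>(r, w). indicator {0..T} r * \<Theta> r w)"
    and \<tau>: "bounded_stopping \<tau>" and s: "0 \<le> s"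
  shows "integrable M (\<lambda>w. LBINT r:{s<..\<tau> w}. \<Theta> r w)"
proof -
  have ThM: "(\<lambda>x. indicator {0..T} (fst x) * \<Theta> (fst x) (snd x)) \<in> borel_measurable (TM)"
    using borel_measurable_integrable[OF Th] by (simp add: split_beta')
  have \<tau>m[measurable]: "\<tau> \<in> borel_measurable M" by (rule stopping_measurable[OF \<tau>])
  have Thi: "integrable (TM) (\<lambda>(r, w). indicator {s<..\<tau> w} r * (indicator {0..T} r * \<Theta> r w))"
  proof (rule Bochner_Integration.integrable_bound[OF Th])
    have [measurable]: "(\<lambda>x. \<tau> (snd x)) \<in> borel_measurable (TM)" by measurable
    have "{x \<in> space (TM). s < fst x \<and> fst x \<le> \<tau> (snd x)} \<in> sets (TM)" by measurable
    then have "(\<lambda>x. if s < fst x \<and> fst x \<le> \<tau> (snd x) then indicator {0..T} (fst x) * \<Theta> (fst x) (snd x) else 0) \<in> borel_measurable (TM)"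
      using ThM by measurable
    moreover have "(\<lambda>x. if s < fst x \<and> fst x \<le> \<tau> (snd x) then indicator {0..T} (fst x) * \<Theta> (fst x) (snd x) else 0)
       = (\<lambda>(r, w). indicator {s<..\<tau> w} r * (indicator {0..T} r * \<Theta> r w))"
      by (auto simp: fun_eq_iff indicator_def)
    ultimately show "(\<lambda>(r, w). indicator {s<..\<tau> w} r * (indicator {0..T} r * \<Theta> r w)) \<in> borel_measurable (TM)" by simp
  qed (auto intro!: AE_I2 simp: indicator_def)
  interpret LM: pair_sigma_finite lborel M by unfold_locales
  have eq: "(LBINT r:{s<..\<tau> w}. \<Theta> r w) = (\<integral>r. indicator {s<..\<tau> w} r * (indicator {0..T} r * \<Theta> r w) \<partial>lborel)" if "w \<in> space M" for w
    unfolding set_lebesgue_integral_def using \<tau> that s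
    by (intro Bochner_Integration.integral_cong) (auto simp: indicator_def bounded_stopping_def)
  have "integrable M (\<lambda>w. \<integral>r. indicator {s<..\<tau> w} r * (indicator {0..T} r * \<Theta> r w) \<partial>lborel)"
    by (rule LM.integrable_snd[OF Thi])
  then show ?thesis using eq by (subst Bochner_Integration.integrable_cong[OF refl]) auto
qed

text \<open>The drift has a minus sign because the equation is posed backwards in time.
  \<open>V\<close> is here not the process of the equation but a majorant of the variation of the
  drift integral.\<close>

locale semimart = ito_process M T B J H P I z for M :: "'w measure" and T and B :: "real \<Rightarrow> 'w \<Rightarrow> real^'d"
    and J H P I z +
  fixes y a V :: "real \<Rightarrow> 'w \<Rightarrow> real"
  assumes y_prog: "progressive M B T y"
    and y_cont: "\<And>w. w \<in> space M \<Longrightarrow> continuous_on {0..T} (\<lambda>t. y t w)"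
    and a_int: "\<And>w. w \<in> space M \<Longrightarrow> set_integrable lborel {0..T} (\<lambda>r. a r w)"
    and y_eq: "\<And>w t. w \<in> space M \<Longrightarrow> t \<in> {0..T} \<Longrightarrow> y t w = y 0 w - (LBINT r:{0..t}. a r w) + I t w"
    and V_nonneg: "\<And>w t. w \<in> space M \<Longrightarrow> t \<in> {0..T} \<Longrightarrow> 0 \<le> V t w"
    and V_bound: "\<And>w u t. w \<in> space M \<Longrightarrow> 0 \<le> u \<Longrightarrow> u \<le> t \<Longrightarrow> t \<le> T \<Longrightarrow>
        \<bar>(LBINT r:{0..t}. a r w) - (LBINT r:{0..u}. a r w)\<bar> \<le> V t w - V u w"
begin

definition "D t w = (LBINT r:{0..t}. a r w)"

lemma D_eq: "w \<in> space M \<Longrightarrow> t \<in> {0..T} \<Longrightarrow> D t w = y 0 w + I t w - y t w"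
  using y_eq[of w t] by (simp add: D_def)

lemma D_continuous: "w \<in> space M \<Longrightarrow> continuous_on {0..T} (\<lambda>t. D t w)"
  unfolding D_def by (rule continuous_on_initial_integral[OF a_int])

lemma D_stopped_measurable:
  assumes \<tau>: "bounded_stopping \<tau>" and t: "t \<in> {0..T}"
  shows "(\<lambda>w. D (min t (\<tau> w)) w) \<in> borel_measurable M"
proof -
  have "(\<lambda>w. y 0 w + I (min t (\<tau> w)) w - y (min t (\<tau> w)) w) \<in> borel_measurable M"
    using t T_pos by (intro borel_measurable_diff borel_measurable_add F_measurable_M[OF progressive_stopped[OF I_prog \<tau> t]]
      F_measurable_M[OF progressive_stopped[OF y_prog \<tau> t]] F_measurable_M[OF progressive_adapted[OF y_prog, of 0]]) auto
  moreover have "min t (\<tau> w) \<in> {0..T}" if "w \<in> space M" for w using \<tau> t that by (auto simp: bounded_stopping_def)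
  ultimately show ?thesis using D_eq by (subst measurable_cong[OF D_eq]) auto
qed

text \<open>Up to \<open>\<tau>\<close> everything is bounded by \<open>K\<close>, except that
  \<open>y\<close> may start above that level: hence \<open>bdy\<close> is required only where
  \<open>\<tau>\<close> is positive, and \<open>\<Psi>\<close> vanishes on paths stopped by time
  \<open>s\<close>.\<close>

context
  fixes s K C' :: real and \<tau> \<Psi> :: "'w \<Rightarrow> real"
  assumes s: "0 \<le> s" "s < T" and \<tau>: "bounded_stopping \<tau>" and K: "0 \<le> K"
    and bdI: "\<And>w r. w \<in> space M \<Longrightarrow> 0 \<le> r \<Longrightarrow> r \<le> \<tau> w \<Longrightarrow> \<bar>I r w\<bar> \<le> K"
    and bdQ: "\<And>w. w \<in> space M \<Longrightarrow> Q (\<tau> w) w \<le> K"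
    and bdV: "\<And>w. w \<in> space M \<Longrightarrow> V (\<tau> w) w \<le> K"
    and bdy: "\<And>w r. w \<in> space M \<Longrightarrow> 0 < \<tau> w \<Longrightarrow> 0 \<le> r \<Longrightarrow> r \<le> \<tau> w \<Longrightarrow> \<bar>y r w\<bar> \<le> K"
    and Psi: "\<Psi> \<in> borel_measurable (F s)" "\<And>w. w \<in> space M \<Longrightarrow> 0 \<le> \<Psi> w \<and> \<Psi> w \<le> C'"
      "\<And>w. w \<in> space M \<Longrightarrow> \<tau> w \<le> s \<Longrightarrow> \<Psi> w = 0"
begin

definition "cell n i w = min (ugrid s T n i) (\<tau> w)"
definition "\<Delta>I n i w = I (cell n (Suc i) w) w - I (cell n i w) w"
definition "\<Delta>D n i w = D (cell n (Suc i) w) w - D (cell n i w) w"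
definition "\<Delta>Q n i w = Q (cell n (Suc i) w) w - Q (cell n i w) w"
definition "quadvar n j w = (\<Sum>i<j. (\<Delta>I n i w)\<^sup>2)"
definition "osc n w = Max ((\<lambda>i. \<bar>\<Delta>I n i w\<bar> + \<bar>\<Delta>D n i w\<bar>) ` {..<Suc n})"

lemma tau_range: "w \<in> space M \<Longrightarrow> 0 \<le> \<tau> w \<and> \<tau> w \<le> T"
  using \<tau> by (auto simp: bounded_stopping_def)

lemma grid_in: "i \<le> Suc n \<Longrightarrow> ugrid s T n i \<in> {0..T} \<and> s \<le> ugrid s T n i"
  using ugrid_bounds[of s T i n] s by auto

lemma cell_range:
  "w \<in> space M \<Longrightarrow> i \<le> Suc n \<Longrightarrow> cell n i w \<in> {0..T} \<and> cell n i w \<le> \<tau> w \<and> 0 \<le> cell n i w \<and> cell n i w \<le> T"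
  using grid_in[of i n] tau_range[of w] by (auto simp: cell_def)

lemma cell_mono: "i < Suc n \<Longrightarrow> cell n i w \<le> cell n (Suc i) w"
  and cell_step: "i < Suc n \<Longrightarrow> cell n (Suc i) w - cell n i w \<le> (T - s) / Suc n"
  using ugrid_cell[of s T i n "\<tau> w"] s by (auto simp: cell_def)

lemma cell_0: "s < \<tau> w \<Longrightarrow> cell n 0 w = s" and cell_end: "w \<in> space M \<Longrightarrow> cell n (Suc n) w = \<tau> w"
  using tau_range[of w] by (auto simp: cell_def ugrid_0 ugrid_end)

lemma cell_measurable:
  assumes i: "i \<le> Suc n"
  shows "(\<lambda>w. I (cell n i w) w) \<in> borel_measurable (F (ugrid s T n i))"
    "(\<lambda>w. y (cell n i w) w) \<in> borel_measurable (F (ugrid s T n i))"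
    "(\<lambda>w. Q (cell n i w) w) \<in> borel_measurable (F (ugrid s T n i))"
    "(\<lambda>w. I (cell n i w) w) \<in> borel_measurable M"
    "(\<lambda>w. y (cell n i w) w) \<in> borel_measurable M"
    "(\<lambda>w. Q (cell n i w) w) \<in> borel_measurable M"
    "(\<lambda>w. D (cell n i w) w) \<in> borel_measurable M"
proof -
  have g: "ugrid s T n i \<in> {0..T}" "ugrid s T n i \<le> T" using grid_in[OF i] by auto
  show 1: "(\<lambda>w. I (cell n i w) w) \<in> borel_measurable (F (ugrid s T n i))"
    "(\<lambda>w. y (cell n i w) w) \<in> borel_measurable (F (ugrid s T n i))"
    "(\<lambda>w. Q (cell n i w) w) \<in> borel_measurable (F (ugrid s T n i))"
    unfolding cell_def by (rule progressive_stopped[OF I_prog \<tau> g(1)] progressive_stopped[OF y_prog \<tau> g(1)] Q_stopped_measurable[OF \<tau> g(1)])+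
  show "(\<lambda>w. I (cell n i w) w) \<in> borel_measurable M"
    "(\<lambda>w. y (cell n i w) w) \<in> borel_measurable M"
    "(\<lambda>w. Q (cell n i w) w) \<in> borel_measurable M"
    by (rule F_measurable_M[OF 1(1) g(2)] F_measurable_M[OF 1(2) g(2)] F_measurable_M[OF 1(3) g(2)])+
  show "(\<lambda>w. D (cell n i w) w) \<in> borel_measurable M"
    unfolding cell_def by (rule D_stopped_measurable[OF \<tau> g(1)])
qed

lemma increments_measurable [measurable]:
  assumes "i < Suc n"
  shows "\<Delta>I n i \<in> borel_measurable M" "\<Delta>D n i \<in> borel_measurable M" "\<Delta>Q n i \<in> borel_measurable M"
  unfolding \<Delta>I_def[abs_def] \<Delta>D_def[abs_def] \<Delta>Q_def[abs_def]
  using assms by (intro borel_measurable_diff cell_measurable; simp)+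

lemma V_mono: "w \<in> space M \<Longrightarrow> 0 \<le> u \<Longrightarrow> u \<le> v \<Longrightarrow> v \<le> T \<Longrightarrow> V u w \<le> V v w"
  using V_bound[of w u v] by (smt (verit))

lemma increments_bounds:
  assumes w: "w \<in> space M" and i: "i < Suc n"
  shows "\<bar>\<Delta>I n i w\<bar> \<le> 2 * K" "\<bar>\<Delta>D n i w\<bar> \<le> V (cell n (Suc i) w) w - V (cell n i w) w"
    "\<bar>\<Delta>D n i w\<bar> \<le> K" "0 \<le> \<Delta>Q n i w" "\<Delta>Q n i w \<le> K"
proof -
  have c: "cell n i w \<le> cell n (Suc i) w" "0 \<le> cell n i w" "cell n (Suc i) w \<le> \<tau> w" "\<tau> w \<le> T"
    using cell_range[OF w, of i n] cell_range[OF w, of "Suc i" n] cell_mono[OF i, of w] i tau_range[OF w] by auto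
  show "\<bar>\<Delta>I n i w\<bar> \<le> 2 * K"
    using bdI[OF w, of "cell n i w"] bdI[OF w, of "cell n (Suc i) w"] c by (auto simp: \<Delta>I_def)
  show 1: "\<bar>\<Delta>D n i w\<bar> \<le> V (cell n (Suc i) w) w - V (cell n i w) w"
    using V_bound[OF w, of "cell n i w" "cell n (Suc i) w"] c by (simp add: \<Delta>D_def D_def)
  show "\<bar>\<Delta>D n i w\<bar> \<le> K"
    using 1 V_mono[OF w, of "cell n (Suc i) w" "\<tau> w"] V_nonneg[OF w, of "cell n i w"] bdV[OF w] c by simp
  show "0 \<le> \<Delta>Q n i w" using Q_mono[OF w, of "cell n i w" "cell n (Suc i) w"] c by (simp add: \<Delta>Q_def)
  show "\<Delta>Q n i w \<le> K"
    using Q_mono[OF w, of "cell n (Suc i) w" "\<tau> w"] Q_mono[OF w, of 0 "cell n i w"] bdQ[OF w] c by (simp add: \<Delta>Q_def Q_0)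
qed

lemma sum_increments:
  assumes w: "w \<in> space M"
  shows "(\<Sum>i<Suc n. \<bar>\<Delta>D n i w\<bar>) \<le> K" "(\<Sum>i<Suc n. \<Delta>Q n i w) \<le> K"
proof -
  have c: "0 \<le> cell n 0 w" "cell n 0 w \<le> T" using cell_range[OF w, of 0 n] by auto
  have "(\<Sum>i<Suc n. \<bar>\<Delta>D n i w\<bar>) \<le> (\<Sum>i<Suc n. V (cell n (Suc i) w) w - V (cell n i w) w)"
    by (intro sum_mono increments_bounds(2)[OF w]) simp
  also have "\<dots> = V (\<tau> w) w - V (cell n 0 w) w"
    using sum_lessThan_telescope[of "\<lambda>i. V (cell n i w) w" "Suc n"] cell_end[OF w] by (simp del: sum.lessThan_Suc)
  also have "\<dots> \<le> K" using bdV[OF w] V_nonneg[OF w, of "cell n 0 w"] c by simp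
  finally show "(\<Sum>i<Suc n. \<bar>\<Delta>D n i w\<bar>) \<le> K" .
  have "(\<Sum>i<Suc n. \<Delta>Q n i w) = Q (\<tau> w) w - Q (cell n 0 w) w"
    using sum_lessThan_telescope[of "\<lambda>i. Q (cell n i w) w" "Suc n"] cell_end[OF w] by (simp add: \<Delta>Q_def del: sum.lessThan_Suc)
  also have "\<dots> \<le> K" using bdQ[OF w] Q_mono[OF w, of 0 "cell n 0 w"] c by (simp add: Q_0)
  finally show "(\<Sum>i<Suc n. \<Delta>Q n i w) \<le> K" .
qed

lemma increment_orthogonality:
  assumes i: "i < Suc n" and X: "X \<in> borel_measurable (F (ugrid s T n i))" "\<And>w. w \<in> space M \<Longrightarrow> \<bar>X w\<bar> \<le> C"
  shows "E (\<lambda>w. X w * \<Delta>I n i w) = 0"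
    "E (\<lambda>w. X w * (\<Delta>I n i w)\<^sup>2) = E (\<lambda>w. X w * \<Delta>Q n i w)"
proof -
  have g: "0 \<le> ugrid s T n i" "ugrid s T n i \<le> ugrid s T n (Suc i)" "ugrid s T n (Suc i) \<le> T"
    using grid_in[of i n] grid_in[of "Suc i" n] i ugrid_mono[of s T i "Suc i" n] s by auto
  show "E (\<lambda>w. X w * \<Delta>I n i w) = 0"
    "E (\<lambda>w. X w * (\<Delta>I n i w)\<^sup>2) = E (\<lambda>w. X w * \<Delta>Q n i w)"
    using stopped_martingale[OF g \<tau> K bdI bdQ X] by (simp_all add: \<Delta>I_def \<Delta>Q_def cell_def)
qed

text \<open>Expanding the square leaves twice past times present plus fourth powers. The past sum is
  measurable at the left end of the cell, so the present square may be replaced by the increment of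
  \<open>Q\<close>, and these add up to at most \<open>K\<close>; a fourth power is at most 4 K^2
  times a square. The moment bounds are independent of \<open>n\<close>.\<close>

lemma quadvar_moments:
  shows "quadvar n (Suc n) \<in> borel_measurable M" "\<exists>C. \<forall>w\<in>space M. \<bar>quadvar n (Suc n) w\<bar> \<le> C"
    "E (quadvar n (Suc n)) \<le> K" "E (\<lambda>w. (quadvar n (Suc n) w)\<^sup>2) \<le> 2 * K\<^sup>2 + 4 * K ^ 3"
proof -
  have qm: "quadvar n j \<in> borel_measurable M" if "j \<le> Suc n" for j
    unfolding quadvar_def[abs_def] using that by (intro borel_measurable_sum borel_measurable_power increments_measurable) auto
  have q0: "0 \<le> quadvar n j w" for j w by (simp add: quadvar_def sum_nonneg)
  have dI2: "(\<Delta>I n i w)\<^sup>2 \<le> (2 * K)\<^sup>2" if "w \<in> space M" "i < Suc n" for i w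
    using power_mono[OF increments_bounds(1)[OF that], of 2] by simp
  have qb: "quadvar n j w \<le> real (Suc n) * (2 * K)\<^sup>2" if "w \<in> space M" "j \<le> Suc n" for j w
  proof -
    have "quadvar n j w \<le> (\<Sum>i<j. (2 * K)\<^sup>2)" unfolding quadvar_def using that by (intro sum_mono dI2) auto
    also have "\<dots> \<le> real (Suc n) * (2 * K)\<^sup>2" using that by (auto intro!: mult_right_mono)
    finally show ?thesis .
  qed
  show [measurable]: "quadvar n (Suc n) \<in> borel_measurable M" by (rule qm) simp
  show "\<exists>C. \<forall>w\<in>space M. \<bar>quadvar n (Suc n) w\<bar> \<le> C"
    using qb[of _ "Suc n"] q0[of "Suc n"] by (intro exI[of _ "real (Suc n) * (2 * K)\<^sup>2"]) auto
  have iI2: "integrable M (\<lambda>w. (\<Delta>I n i w)\<^sup>2)" if "i < Suc n" for i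
    using dI2[OF _ that] increments_measurable[OF that] by (intro integrable_bounded[where C="(2 * K)\<^sup>2"]) auto
  have iQ: "integrable M (\<Delta>Q n i)" if "i < Suc n" for i
    using increments_bounds(4,5)[OF _ that] increments_measurable[OF that] by (intro integrable_bounded[where C=K]) auto
  have "E (quadvar n (Suc n)) = (\<Sum>i<Suc n. E (\<lambda>w. 1 * (\<Delta>I n i w)\<^sup>2))"
    unfolding quadvar_def[abs_def] using iI2 by (subst Bochner_Integration.integral_sum) auto
  also have "\<dots> = (\<Sum>i<Suc n. E (\<lambda>w. 1 * \<Delta>Q n i w))"
    by (intro sum.cong refl increment_orthogonality(2)[where C=1]) auto
  also have "\<dots> = E (\<lambda>w. \<Sum>i<Suc n. \<Delta>Q n i w)"
    using iQ by (subst Bochner_Integration.integral_sum) auto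
  also have "\<dots> \<le> E (\<lambda>w. K)"
    using sum_increments(2) iQ by (intro integral_mono Bochner_Integration.integrable_sum) auto
  finally show e1: "E (quadvar n (Suc n)) \<le> K" by (simp add: prob_space)
  have sq: "(quadvar n j w)\<^sup>2 = (\<Sum>i<j. 2 * (quadvar n i w * (\<Delta>I n i w)\<^sup>2) + (\<Delta>I n i w) ^ 4)" for j w
    by (induction j) (simp_all add: quadvar_def power2_sum algebra_simps)
  have m1: "quadvar n i \<in> borel_measurable (F (ugrid s T n i))" if i: "i < Suc n" for i
    unfolding quadvar_def[abs_def] \<Delta>I_def[abs_def]
  proof (intro borel_measurable_sum borel_measurable_power borel_measurable_diff)
    fix l assume l: "l \<in> {..<i}"
    show "(\<lambda>w. I (cell n (Suc l) w) w) \<in> borel_measurable (F (ugrid s T n i))"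
      "(\<lambda>w. I (cell n l w) w) \<in> borel_measurable (F (ugrid s T n i))"
      using i l s by (auto intro!: F_measurable_mono[OF cell_measurable(1)] ugrid_mono)
  qed
  have iqI: "integrable M (\<lambda>w. quadvar n i w * (\<Delta>I n i w)\<^sup>2)" "integrable M (\<lambda>w. quadvar n i w * \<Delta>Q n i w)" "integrable M (\<lambda>w. (\<Delta>I n i w) ^ 4)"
    if i: "i < Suc n" for i
  proof -
    note [measurable] = qm[OF less_imp_le[OF i]] increments_measurable[OF i]
    have b: "\<bar>quadvar n i w\<bar> \<le> real (Suc n) * (2 * K)\<^sup>2" if "w \<in> space M" for w
      using qb[OF that less_imp_le[OF i]] q0[of i w] by simp
    have "\<bar>quadvar n i w * (\<Delta>I n i w)\<^sup>2\<bar> \<le> (real (Suc n) * (2 * K)\<^sup>2) * (2 * K)\<^sup>2" if "w \<in> space M" for w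
      unfolding abs_mult using b[OF that] dI2[OF that i] by (intro mult_mono) auto
    then show "integrable M (\<lambda>w. quadvar n i w * (\<Delta>I n i w)\<^sup>2)"
      by (intro integrable_bounded) auto
    show "integrable M (\<lambda>w. quadvar n i w * \<Delta>Q n i w)"
      by (intro integrable_bounded[where C="real (Suc n) * (2 * K)\<^sup>2 * K"]) (use b increments_bounds(4,5)[OF _ i] K in \<open>auto simp: abs_mult intro!: mult_mono\<close>)
    have "(\<Delta>I n i w) ^ 4 \<le> (2 * K) ^ 4" if "w \<in> space M" for w
      using power_mono[OF increments_bounds(1)[OF that i], of 4] by simp
    then show "integrable M (\<lambda>w. (\<Delta>I n i w) ^ 4)" by (intro integrable_bounded[where C="(2 * K) ^ 4"]) auto
  qed
  have "E (\<lambda>w. (quadvar n (Suc n) w)\<^sup>2) = (\<Sum>i<Suc n. 2 * E (\<lambda>w. quadvar n i w * (\<Delta>I n i w)\<^sup>2) + E (\<lambda>w. (\<Delta>I n i w) ^ 4))"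
    unfolding sq using iqI by (subst Bochner_Integration.integral_sum) auto
  also have "\<dots> = (\<Sum>i<Suc n. 2 * E (\<lambda>w. quadvar n i w * \<Delta>Q n i w) + E (\<lambda>w. (\<Delta>I n i w) ^ 4))"
  proof (intro sum.cong refl arg_cong2[where f="(+)"] arg_cong2[where f="(*)"])
    fix i assume "i \<in> {..<Suc n}"
    then have i: "i < Suc n" by simp
    show "E (\<lambda>w. quadvar n i w * (\<Delta>I n i w)\<^sup>2) = E (\<lambda>w. quadvar n i w * \<Delta>Q n i w)"
      by (rule increment_orthogonality(2)[OF i m1[OF i], where C="real (Suc n) * (2 * K)\<^sup>2"])
        (use qb[OF _ less_imp_le[OF i]] q0[of i] in auto)
  qed
  also have "\<dots> = E (\<lambda>w. \<Sum>i<Suc n. 2 * (quadvar n i w * \<Delta>Q n i w) + (\<Delta>I n i w) ^ 4)"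
    using iqI by (subst Bochner_Integration.integral_sum) auto
  also have "\<dots> \<le> E (\<lambda>w. 2 * K * quadvar n (Suc n) w + 4 * K\<^sup>2 * quadvar n (Suc n) w)"
  proof (rule integral_mono)
    show "integrable M (\<lambda>w. \<Sum>i<Suc n. 2 * (quadvar n i w * \<Delta>Q n i w) + (\<Delta>I n i w) ^ 4)"
      using iqI by (intro Bochner_Integration.integrable_sum Bochner_Integration.integrable_add integrable_mult_right) auto
    have "integrable M (quadvar n (Suc n))"
      using qb[of _ "Suc n"] q0[of "Suc n"] by (intro integrable_bounded[where C="real (Suc n) * (2 * K)\<^sup>2"]) auto
    then show "integrable M (\<lambda>w. 2 * K * quadvar n (Suc n) w + 4 * K\<^sup>2 * quadvar n (Suc n) w)" by simp
    fix w assume w: "w \<in> space M"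
    have "(\<Sum>i<Suc n. 2 * (quadvar n i w * \<Delta>Q n i w) + (\<Delta>I n i w) ^ 4) \<le> (\<Sum>i<Suc n. 2 * quadvar n (Suc n) w * \<Delta>Q n i w + 4 * K\<^sup>2 * (\<Delta>I n i w)\<^sup>2)"
    proof (rule sum_mono, rule add_mono)
      fix i assume "i \<in> {..<Suc n}"
      then have i: "i < Suc n" by simp
      have "quadvar n i w \<le> quadvar n (Suc n) w" unfolding quadvar_def using i by (intro sum_mono2) auto
      then show "2 * (quadvar n i w * \<Delta>Q n i w) \<le> 2 * quadvar n (Suc n) w * \<Delta>Q n i w"
        using increments_bounds(4)[OF w i] by (simp add: mult_right_mono)
      have "(\<Delta>I n i w) ^ 4 = (\<Delta>I n i w)\<^sup>2 * (\<Delta>I n i w)\<^sup>2" by (simp add: power_add[symmetric])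
      also have "\<dots> \<le> (2 * K)\<^sup>2 * (\<Delta>I n i w)\<^sup>2" by (intro mult_right_mono dI2[OF w i]) simp
      finally show "(\<Delta>I n i w) ^ 4 \<le> 4 * K\<^sup>2 * (\<Delta>I n i w)\<^sup>2" by (simp add: power_mult_distrib)
    qed
    also have "\<dots> = 2 * quadvar n (Suc n) w * (\<Sum>i<Suc n. \<Delta>Q n i w) + 4 * K\<^sup>2 * quadvar n (Suc n) w"
      by (simp only: sum.distrib sum_distrib_left quadvar_def)
    also have "\<dots> \<le> 2 * quadvar n (Suc n) w * K + 4 * K\<^sup>2 * quadvar n (Suc n) w"
      by (intro add_right_mono mult_left_mono sum_increments(2)[OF w]) (simp add: q0)
    finally show "(\<Sum>i<Suc n. 2 * (quadvar n i w * \<Delta>Q n i w) + (\<Delta>I n i w) ^ 4) \<le> 2 * K * quadvar n (Suc n) w + 4 * K\<^sup>2 * quadvar n (Suc n) w"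
      by (simp add: mult_ac)
  qed
  also have "\<dots> = (2 * K + 4 * K\<^sup>2) * E (quadvar n (Suc n))"
    by (simp only: distrib_right[symmetric]) simp
  also have "\<dots> \<le> (2 * K + 4 * K\<^sup>2) * K" using e1 K by (intro mult_left_mono) auto
  finally show "E (\<lambda>w. (quadvar n (Suc n) w)\<^sup>2) \<le> 2 * K\<^sup>2 + 4 * K ^ 3"
    by (simp add: power2_eq_square power3_eq_cube algebra_simps)
qed

text \<open>Uniform continuity of each path makes the largest increment vanish with the mesh. The
  bound 3 K, from 2 K for \<open>I\<close> and K for the drift integral, turns this into convergence
  in mean.\<close>

lemma osc_facts:
  shows "osc n \<in> borel_measurable M" "\<And>w. w \<in> space M \<Longrightarrow> 0 \<le> osc n w \<and> osc n w \<le> 3 * K"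
    "\<And>w i. i < Suc n \<Longrightarrow> \<bar>\<Delta>I n i w\<bar> + \<bar>\<Delta>D n i w\<bar> \<le> osc n w"
    "\<And>w. w \<in> space M \<Longrightarrow> (\<lambda>n. osc n w) \<longlonglongrightarrow> 0" "(\<lambda>n. E (osc n)) \<longlonglongrightarrow> 0"
proof -
  show m: "osc n \<in> borel_measurable M" for n
    unfolding osc_def[abs_def] by (intro borel_measurable_Max borel_measurable_add borel_measurable_abs increments_measurable) auto
  show ge: "\<bar>\<Delta>I n i w\<bar> + \<bar>\<Delta>D n i w\<bar> \<le> osc n w" if "i < Suc n" for n w i
    unfolding osc_def using that by (intro Max_ge) auto
  have le: "osc n w \<le> e" if "\<And>i. i < Suc n \<Longrightarrow> \<bar>\<Delta>I n i w\<bar> + \<bar>\<Delta>D n i w\<bar> \<le> e" for n w e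
    unfolding osc_def using that by (subst Max_le_iff) auto
  show b: "0 \<le> osc n w \<and> osc n w \<le> 3 * K" if w: "w \<in> space M" for n w
  proof
    show "0 \<le> osc n w" using ge[of 0 n w] by simp
    show "osc n w \<le> 3 * K"
    proof (rule le)
      fix i assume "i < Suc n"
      then show "\<bar>\<Delta>I n i w\<bar> + \<bar>\<Delta>D n i w\<bar> \<le> 3 * K" using increments_bounds(1,3)[OF w, of i n] by linarith
    qed
  qed
  show lim: "(\<lambda>n. osc n w) \<longlonglongrightarrow> 0" if w: "w \<in> space M" for w
  proof (rule tendstoI)
    fix e :: real assume e: "e > 0"
    have "uniformly_continuous_on {0..T} (\<lambda>t. I t w)" "uniformly_continuous_on {0..T} (\<lambda>t. D t w)"
      using I_cont[OF w] D_continuous[OF w] by (auto intro: compact_uniformly_continuous)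
    moreover have e3: "e / 3 > 0" using e by simp
    ultimately obtain d1 d2 where d: "d1 > 0" "d2 > 0"
      "\<And>u v. u \<in> {0..T} \<Longrightarrow> v \<in> {0..T} \<Longrightarrow> dist u v < d1 \<Longrightarrow> dist (I u w) (I v w) < e / 3"
      "\<And>u v. u \<in> {0..T} \<Longrightarrow> v \<in> {0..T} \<Longrightarrow> dist u v < d2 \<Longrightarrow> dist (D u w) (D v w) < e / 3"
      unfolding uniformly_continuous_on_def by metis
    have "eventually (\<lambda>n. (T - s) / real (Suc n) < min d1 d2) sequentially"
      by (rule ugrid_mesh_vanishes) (use d in simp)
    then show "eventually (\<lambda>n. dist (osc n w) 0 < e) sequentially"
    proof eventually_elim
      case (elim n)
      have "osc n w \<le> 2 * (e / 3)"
      proof (rule le)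
        fix i assume i: "i < Suc n"
        have "cell n i w \<in> {0..T}" "cell n (Suc i) w \<in> {0..T}" using cell_range[OF w] i by auto
        moreover have "dist (cell n (Suc i) w) (cell n i w) < min d1 d2"
          using cell_mono[OF i, of w] cell_step[OF i, of w] elim by (simp add: dist_real_def)
        ultimately have "dist (I (cell n (Suc i) w) w) (I (cell n i w) w) < e / 3" "dist (D (cell n (Suc i) w) w) (D (cell n i w) w) < e / 3"
          using d(3,4) by auto
        then show "\<bar>\<Delta>I n i w\<bar> + \<bar>\<Delta>D n i w\<bar> \<le> 2 * (e / 3)" by (simp add: \<Delta>I_def \<Delta>D_def dist_real_def)
      qed
      then show ?case using b[OF w, of n] e by simp
    qed
  qed
  have "(\<lambda>n. E (osc n)) \<longlonglongrightarrow> E (\<lambda>_. 0)"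
    by (rule integral_dominated_convergence[where w="\<lambda>_. 3 * K"]) (use m b lim in \<open>auto intro!: AE_I2\<close>)
  then show "(\<lambda>n. E (osc n)) \<longlonglongrightarrow> 0" by simp
qed

text \<open>A second-order Taylor bound is summed over the stopped grid. In the mean the first-order
  martingale part vanishes and squared increments of \<open>I\<close> turn into increments of
  \<open>Q\<close>, so that Riemann sums remain. The remainder is controlled by the two moments of
  the sum of squares and by the vanishing mean of \<open>osc\<close>.\<close>

lemma ito_inequality:
  fixes \<phi> \<phi>' \<phi>'' :: "real \<Rightarrow> real" and \<Theta> :: "real \<Rightarrow> 'w \<Rightarrow> real"
  assumes d1: "\<And>x. (\<phi> has_real_derivative \<phi>' x) (at x)" and d2: "\<And>x. (\<phi>' has_real_derivative \<phi>'' x) (at x)"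
    and c2: "continuous_on UNIV \<phi>''"
    and Th: "integrable (TM) (\<lambda>(r, w). indicator {0..T} r * \<Theta> r w)"
    and ineq: "AE w in M. AE r in lborel. r \<in> {0..T} \<longrightarrow> \<phi>' (y r w) * a r w - \<phi>'' (y r w) / 2 * (norm (z r w))\<^sup>2 \<le> \<Theta> r w"
  shows "E (\<lambda>w. \<Psi> w * \<phi> (y s w)) \<le> E (\<lambda>w. \<Psi> w * \<phi> (y (\<tau> w) w))
     + E (\<lambda>w. \<Psi> w * (LBINT r:{s<..\<tau> w}. \<Theta> r w))"
proof -
  have c0: "continuous_on UNIV \<phi>" and c1: "continuous_on UNIV \<phi>'"
    by (rule continuous_at_imp_continuous_on, simp add: DERIV_isCont[OF d1] DERIV_isCont[OF d2])+
  have [measurable]: "\<phi> \<in> borel_measurable borel" "\<phi>' \<in> borel_measurable borel" "\<phi>'' \<in> borel_measurable borel"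
    using c0 c1 c2 by (auto intro: borel_measurable_continuous_onI)
  have bnd: "\<exists>C\<ge>0. \<forall>x. \<bar>x\<bar> \<le> K \<longrightarrow> \<bar>f x\<bar> \<le> C" if "continuous_on UNIV f" for f :: "real \<Rightarrow> real"
  proof -
    have "compact (f ` {-K..K})" by (rule compact_continuous_image[OF continuous_on_subset[OF that]]) auto
    then obtain C where C: "\<And>r. r \<in> {-K..K} \<Longrightarrow> \<bar>f r\<bar> \<le> C"
      using compact_imp_bounded bounded_iff by (metis image_eqI real_norm_def)
    have "\<bar>f x\<bar> \<le> max C 0" if "\<bar>x\<bar> \<le> K" for x using C[of x] that by (simp add: abs_le_iff max.coboundedI1)
    then show ?thesis by (intro exI[of _ "max C 0"]) auto
  qed
  obtain M0 where M0: "M0 \<ge> 0" "\<And>x. \<bar>x\<bar> \<le> K \<Longrightarrow> \<bar>\<phi> x\<bar> \<le> M0" using bnd[OF c0] by blast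
  obtain M1 where M1: "M1 \<ge> 0" "\<And>x. \<bar>x\<bar> \<le> K \<Longrightarrow> \<bar>\<phi>' x\<bar> \<le> M1" using bnd[OF c1] by blast
  obtain M2 where M2: "M2 \<ge> 0" "\<And>x. \<bar>x\<bar> \<le> K \<Longrightarrow> \<bar>\<phi>'' x\<bar> \<le> M2" using bnd[OF c2] by blast
  have C'0: "0 \<le> C'" using Psi(2) not_empty by (metis all_not_in_conv order_trans)
  have Psi0: "0 \<le> \<Psi> w" "\<Psi> w \<le> C'" if "w \<in> space M" for w using Psi(2)[OF that] by auto
  have act: "s < \<tau> w" if "w \<in> space M" "\<Psi> w \<noteq> 0" for w using Psi(3)[OF that(1)] that(2) by force
  have yK: "\<bar>y (cell n i w) w\<bar> \<le> K" if "w \<in> space M" "\<Psi> w \<noteq> 0" "i \<le> Suc n" for w n i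
    using bdy[OF that(1), of "cell n i w"] cell_range[OF that(1,3)] act[OF that(1,2)] s by auto
  have [measurable]: "\<Psi> \<in> borel_measurable M" using F_measurable_M[OF Psi(1)] s by simp
  \<comment> \<open>Bounds on \<open>y\<close> are available where \<open>\<Psi>\<close> is nonzero;
    elsewhere the product vanishes.\<close>
  have Pbd: "\<bar>\<Psi> w * X\<bar> \<le> C' * c" if "w \<in> space M" "\<Psi> w \<noteq> 0 \<Longrightarrow> \<bar>X\<bar> \<le> c" "0 \<le> c" for w X c
  proof (cases "\<Psi> w = 0")
    case False
    then show ?thesis unfolding abs_mult using that Psi0[OF that(1)] by (intro mult_mono) auto
  qed (use C'0 that in simp)
  have ym[measurable]: "y r \<in> borel_measurable M" if "r \<in> {0..T}" for r
    using F_measurable_M[OF progressive_adapted[OF y_prog that]] that by auto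
  have [measurable]: "(\<lambda>w. y (\<tau> w) w) \<in> borel_measurable M"
    using cell_measurable(5)[of "Suc 0" 0] cell_end[of _ 0] by (subst measurable_cong[where g="\<lambda>w. y (cell 0 (Suc 0) w) w"]) auto
  \<comment> \<open>\<open>S1\<close> and \<open>S2\<close> are the drift and energy sums,
    \<open>R1\<close> and \<open>R2\<close> the martingale sum and the sum of squares. Weighted by
    \<open>\<Psi>\<close>, \<open>R1\<close> has mean zero and \<open>R2\<close> has the mean of
    \<open>S2\<close>.\<close>
  define S1 where "S1 n w = (\<Sum>i<Suc n. \<phi>' (y (cell n i w) w) * \<Delta>D n i w)" for n w
  define S2 where "S2 n w = (\<Sum>i<Suc n. \<phi>'' (y (cell n i w) w) * \<Delta>Q n i w)" for n w
  define R1 where "R1 n w = (\<Sum>i<Suc n. \<phi>' (y (cell n i w) w) * \<Delta>I n i w)" for n w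
  define R2 where "R2 n w = (\<Sum>i<Suc n. \<phi>'' (y (cell n i w) w) * (\<Delta>I n i w)\<^sup>2)" for n w
  define Tn where "Tn n w = S1 n w - S2 n w / 2" for n w
  have cm: "(\<lambda>w. y (cell n i w) w) \<in> borel_measurable M" if "i < Suc n" for n i using cell_measurable(5)[of i n] that by auto
  have Sm[measurable]: "S1 n \<in> borel_measurable M" "S2 n \<in> borel_measurable M" "R1 n \<in> borel_measurable M" "R2 n \<in> borel_measurable M" for n
    unfolding S1_def[abs_def] S2_def[abs_def] R1_def[abs_def] R2_def[abs_def]
    by (intro borel_measurable_sum borel_measurable_times borel_measurable_power increments_measurable measurable_compose[OF cm]; simp)+
  have Tm[measurable]: "Tn n \<in> borel_measurable M" for n unfolding Tn_def[abs_def] by measurable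
  have Tb: "\<bar>Tn n w\<bar> \<le> (M1 + M2) * K" if w: "w \<in> space M" "\<Psi> w \<noteq> 0" for n w
  proof -
    have "\<bar>S1 n w\<bar> \<le> (\<Sum>i<Suc n. M1 * \<bar>\<Delta>D n i w\<bar>)"
      unfolding S1_def by (rule order_trans[OF sum_abs]) (auto intro!: sum_mono mult_right_mono M1(2) yK[OF w] simp: abs_mult simp del: sum.lessThan_Suc)
    also have "\<dots> = M1 * (\<Sum>i<Suc n. \<bar>\<Delta>D n i w\<bar>)" by (simp only: sum_distrib_left)
    also have "\<dots> \<le> M1 * K" using M1(1) sum_increments(1)[OF w(1)] by (intro mult_left_mono)
    finally have 1: "\<bar>S1 n w\<bar> \<le> M1 * K" .
    have "\<bar>S2 n w\<bar> \<le> (\<Sum>i<Suc n. M2 * \<Delta>Q n i w)"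
      unfolding S2_def
    proof (rule order_trans[OF sum_abs], rule sum_mono)
      fix i assume "i \<in> {..<Suc n}"
      then show "\<bar>\<phi>'' (y (cell n i w) w) * \<Delta>Q n i w\<bar> \<le> M2 * \<Delta>Q n i w"
        using increments_bounds(4)[OF w(1), of i n] M2(2)[OF yK[OF w, of i n]] by (simp add: abs_mult mult_right_mono)
    qed
    also have "\<dots> = M2 * (\<Sum>i<Suc n. \<Delta>Q n i w)" by (simp only: sum_distrib_left)
    also have "\<dots> \<le> M2 * K" using M2(1) sum_increments(2)[OF w(1)] by (intro mult_left_mono)
    finally have 2: "\<bar>S2 n w\<bar> \<le> M2 * K" .
    have "0 \<le> M2 * K" using M2 K by simp
    moreover have "\<bar>Tn n w\<bar> \<le> \<bar>S1 n w\<bar> + \<bar>S2 n w\<bar>" unfolding Tn_def by linarith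
    ultimately show ?thesis using 1 2 unfolding distrib_right by linarith
  qed
  define \<rho> where "\<rho> w = (LBINT r:{s<..\<tau> w}. \<phi>' (y r w) * a r w) - (LBINT r:{s<..\<tau> w}. \<phi>'' (y r w) * (norm (z r w))\<^sup>2) / 2" for w
  have kc: "continuous_on {0..T} (\<lambda>r. f (y r w))" if "continuous_on UNIV f" "w \<in> space M" for f :: "real \<Rightarrow> real" and w
    by (rule continuous_on_compose2[OF that(1) y_cont[OF that(2)]]) auto
  have Tlim: "(\<lambda>n. Tn n w) \<longlonglongrightarrow> \<rho> w" if w: "w \<in> space M" "s < \<tau> w" for w
  proof -
    have r: "0 \<le> s" "s \<le> \<tau> w" "\<tau> w \<le> T" using s w(2) tau_range[OF w(1)] by auto
    show ?thesis
      unfolding Tn_def \<rho>_def S1_def S2_def \<Delta>D_def \<Delta>Q_def D_def Q_def cell_def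
      by (intro tendsto_diff tendsto_divide tendsto_const riemann_sum_tendsto[OF kc[OF c1 w(1)] a_int[OF w(1)] r]
        riemann_sum_tendsto[OF kc[OF c2 w(1)] z_sq[OF w(1)] r]) simp
  qed
  interpret LM: pair_sigma_finite lborel M by unfold_locales
  define \<theta> where "\<theta> w = (LBINT r:{s<..\<tau> w}. \<Theta> r w)" for w
  have \<theta>i: "integrable M \<theta>" unfolding \<theta>_def using s by (intro stopped_integral_integrable[OF Th \<tau>]) auto
  have Thsec: "AE w in M. integrable lborel (\<lambda>r. indicator {0..T} r * \<Theta> r w)"
    using LM.AE_integrable_snd[OF Th] by simp
  have P\<theta>: "integrable M (\<lambda>w. \<Psi> w * \<theta> w)"
    by (rule Bochner_Integration.integrable_bound[OF integrable_mult_right[OF \<theta>i, of C']])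
      (use \<theta>i Psi0 C'0 in \<open>auto intro!: AE_I2 mult_right_mono simp: abs_mult\<close>)
  have \<rho>\<theta>: "AE w in M. \<Psi> w * \<rho> w \<le> \<Psi> w * \<theta> w"
    using ineq Thsec AE_space
  proof eventually_elim
    case (elim w)
    show ?case
    proof (cases "\<Psi> w = 0")
      case False
      then have st: "s < \<tau> w" using act elim by auto
      have sub: "{s<..\<tau> w} \<subseteq> {0..T}" using s tau_range[OF elim(3)] by auto
      have i: "set_integrable lborel {s<..\<tau> w} (\<lambda>r. \<phi>' (y r w) * a r w)" "set_integrable lborel {s<..\<tau> w} (\<lambda>r. \<phi>'' (y r w) * (norm (z r w))\<^sup>2)"
        using set_integrable_continuous_mult[OF kc[OF c1 elim(3)] a_int[OF elim(3)]]
          set_integrable_continuous_mult[OF kc[OF c2 elim(3)] z_sq[OF elim(3)]] sub by (auto intro: set_integrable_subset)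
      have "set_integrable lborel {0..T} (\<lambda>r. \<Theta> r w)" using elim(2) by (simp add: set_integrable_def)
      then have it: "set_integrable lborel {s<..\<tau> w} (\<lambda>r. \<Theta> r w)" using sub by (auto intro: set_integrable_subset)
      have "\<rho> w = (LBINT r:{s<..\<tau> w}. \<phi>' (y r w) * a r w - (\<phi>'' (y r w) * (norm (z r w))\<^sup>2) / 2)"
        unfolding \<rho>_def using i by (subst set_integral_diff(2)) auto
      also have "\<dots> \<le> \<theta> w"
        unfolding \<theta>_def
      proof (rule set_integral_mono_AE)
        show "AE r \<in> {s<..\<tau> w} in lborel. \<phi>' (y r w) * a r w - (\<phi>'' (y r w) * (norm (z r w))\<^sup>2) / 2 \<le> \<Theta> r w"
          using elim(1) by eventually_elim (use sub in auto)
      qed (use i it in auto)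
      finally show ?thesis using Psi0[OF elim(3)] by (intro mult_left_mono)
    qed simp
  qed
  have lim1: "(\<lambda>n. E (\<lambda>w. \<Psi> w * Tn n w)) \<longlonglongrightarrow> E (\<lambda>w. \<Psi> w * \<rho> w)" "integrable M (\<lambda>w. \<Psi> w * \<rho> w)"
  proof -
    have pl: "(\<lambda>n. \<Psi> w * Tn n w) \<longlonglongrightarrow> \<Psi> w * \<rho> w" if w: "w \<in> space M" for w
      using Tlim[OF w act[OF w]] by (cases "\<Psi> w = 0") (auto intro!: tendsto_intros)
    have lm: "(\<lambda>w. \<Psi> w * \<rho> w) \<in> borel_measurable M"
      by (rule borel_measurable_LIMSEQ_real[where u="\<lambda>n w. \<Psi> w * Tn n w"]) (use pl in auto)
    have b: "\<bar>\<Psi> w * Tn n w\<bar> \<le> C' * ((M1 + M2) * K)" if w: "w \<in> space M" for w n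
      using Tb[OF w] M1 M2 K by (intro Pbd[OF w]) auto
    show "(\<lambda>n. E (\<lambda>w. \<Psi> w * Tn n w)) \<longlonglongrightarrow> E (\<lambda>w. \<Psi> w * \<rho> w)"
      by (rule integral_dominated_convergence[where w="\<lambda>_. C' * ((M1 + M2) * K)"]) (use lm pl b in \<open>auto intro!: AE_I2\<close>)
    show "integrable M (\<lambda>w. \<Psi> w * \<rho> w)"
      by (rule integrable_dominated_convergence[where w="\<lambda>_. C' * ((M1 + M2) * K)" and s="\<lambda>n w. \<Psi> w * Tn n w"]) (use lm pl b in \<open>auto intro!: AE_I2\<close>)
  qed
  have iphi: "integrable M (\<lambda>w. \<Psi> w * \<phi> (y s w))" "integrable M (\<lambda>w. \<Psi> w * \<phi> (y (\<tau> w) w))"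
  proof -
    have sT: "s \<in> {0..T}" using s by auto
    note [measurable] = ym[OF sT]
    have "\<bar>\<Psi> w * \<phi> (y s w)\<bar> \<le> C' * M0" if w: "w \<in> space M" for w
      using M0 bdy[OF w, of s] act[OF w] s by (intro Pbd[OF w]) auto
    then show "integrable M (\<lambda>w. \<Psi> w * \<phi> (y s w))" by (intro integrable_bounded) auto
    have "\<bar>\<Psi> w * \<phi> (y (\<tau> w) w)\<bar> \<le> C' * M0" if w: "w \<in> space M" for w
      using M0 bdy[OF w, of "\<tau> w"] act[OF w] s tau_range[OF w] by (intro Pbd[OF w]) auto
    then show "integrable M (\<lambda>w. \<Psi> w * \<phi> (y (\<tau> w) w))" by (intro integrable_bounded) auto
  qed
  have orth: "E (\<lambda>w. \<Psi> w * R1 n w) = 0" "integrable M (\<lambda>w. \<Psi> w * R1 n w)"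
    "E (\<lambda>w. \<Psi> w * R2 n w) = E (\<lambda>w. \<Psi> w * S2 n w)" "integrable M (\<lambda>w. \<Psi> w * R2 n w)" "integrable M (\<lambda>w. \<Psi> w * S2 n w)" for n
  proof -
    have e1: "\<Psi> w * R1 n w = (\<Sum>i<Suc n. (\<Psi> w * \<phi>' (y (cell n i w) w)) * \<Delta>I n i w)" for w
      unfolding R1_def sum_distrib_left by (simp only: mult.assoc)
    have e2: "\<Psi> w * R2 n w = (\<Sum>i<Suc n. (\<Psi> w * \<phi>'' (y (cell n i w) w)) * (\<Delta>I n i w)\<^sup>2)" for w
      unfolding R2_def sum_distrib_left by (simp only: mult.assoc)
    have e3: "\<Psi> w * S2 n w = (\<Sum>i<Suc n. (\<Psi> w * \<phi>'' (y (cell n i w) w)) * \<Delta>Q n i w)" for w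
      unfolding S2_def sum_distrib_left by (simp only: mult.assoc)
    have meas: "(\<lambda>w. \<Psi> w * f (y (cell n i w) w)) \<in> borel_measurable (F (ugrid s T n i))"
      if "i < Suc n" "f \<in> borel_measurable borel" for i and f :: "real \<Rightarrow> real"
    proof (rule borel_measurable_times)
      show "\<Psi> \<in> borel_measurable (F (ugrid s T n i))" using F_measurable_mono[OF Psi(1)] grid_in[of i n] that(1) by auto
      show "(\<lambda>w. f (y (cell n i w) w)) \<in> borel_measurable (F (ugrid s T n i))"
        using that by (intro measurable_compose[OF cell_measurable(2)]) auto
    qed
    have b1: "\<bar>\<Psi> w * \<phi>' (y (cell n i w) w)\<bar> \<le> C' * M1" if "w \<in> space M" "i < Suc n" for w i
      using M1 yK[OF that(1), of i n] that(2) by (intro Pbd[OF that(1)]) auto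
    have b2: "\<bar>\<Psi> w * \<phi>'' (y (cell n i w) w)\<bar> \<le> C' * M2" if "w \<in> space M" "i < Suc n" for w i
      using M2 yK[OF that(1), of i n] that(2) by (intro Pbd[OF that(1)]) auto
    have t1: "E (\<lambda>w. (\<Psi> w * \<phi>' (y (cell n i w) w)) * \<Delta>I n i w) = 0" if i: "i < Suc n" for i
      by (rule increment_orthogonality(1)[OF i meas[OF i] b1[OF _ i]]) auto
    have t2: "E (\<lambda>w. (\<Psi> w * \<phi>'' (y (cell n i w) w)) * (\<Delta>I n i w)\<^sup>2) = E (\<lambda>w. (\<Psi> w * \<phi>'' (y (cell n i w) w)) * \<Delta>Q n i w)" if i: "i < Suc n" for i
      by (rule increment_orthogonality(2)[OF i meas[OF i] b2[OF _ i]]) auto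
    have i1: "integrable M (\<lambda>w. (\<Psi> w * \<phi>' (y (cell n i w) w)) * \<Delta>I n i w)" if i: "i < Suc n" for i
    proof (rule integrable_bounded)
      note [measurable] = cm[OF i] increments_measurable[OF i]
      show "(\<lambda>w. (\<Psi> w * \<phi>' (y (cell n i w) w)) * \<Delta>I n i w) \<in> borel_measurable M" by measurable
      show "\<bar>(\<Psi> w * \<phi>' (y (cell n i w) w)) * \<Delta>I n i w\<bar> \<le> (C' * M1) * (2 * K)" if w: "w \<in> space M" for w
        unfolding abs_mult[of "\<Psi> w * _"] using b1[OF w i] increments_bounds(1)[OF w i] C'0 M1(1) by (intro mult_mono) auto
    qed
    have i2: "integrable M (\<lambda>w. (\<Psi> w * \<phi>'' (y (cell n i w) w)) * (\<Delta>I n i w)\<^sup>2)" if i: "i < Suc n" for i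
    proof (rule integrable_bounded)
      note [measurable] = cm[OF i] increments_measurable[OF i]
      show "(\<lambda>w. (\<Psi> w * \<phi>'' (y (cell n i w) w)) * (\<Delta>I n i w)\<^sup>2) \<in> borel_measurable M" by measurable
      show "\<bar>(\<Psi> w * \<phi>'' (y (cell n i w) w)) * (\<Delta>I n i w)\<^sup>2\<bar> \<le> (C' * M2) * (2 * K)\<^sup>2" if w: "w \<in> space M" for w
        unfolding abs_mult[of "\<Psi> w * _"] using b2[OF w i] power_mono[OF increments_bounds(1)[OF w i], of 2] C'0 M2(1) by (intro mult_mono) auto
    qed
    have i3: "integrable M (\<lambda>w. (\<Psi> w * \<phi>'' (y (cell n i w) w)) * \<Delta>Q n i w)" if i: "i < Suc n" for i
    proof (rule integrable_bounded)
      note [measurable] = cm[OF i] increments_measurable[OF i]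
      show "(\<lambda>w. (\<Psi> w * \<phi>'' (y (cell n i w) w)) * \<Delta>Q n i w) \<in> borel_measurable M" by measurable
      show "\<bar>(\<Psi> w * \<phi>'' (y (cell n i w) w)) * \<Delta>Q n i w\<bar> \<le> (C' * M2) * K" if w: "w \<in> space M" for w
        unfolding abs_mult[of "\<Psi> w * _"] using b2[OF w i] increments_bounds(4,5)[OF w i] C'0 M2(1) by (intro mult_mono) auto
    qed
    show "E (\<lambda>w. \<Psi> w * R1 n w) = 0" unfolding e1 using i1 t1 by (subst Bochner_Integration.integral_sum) (auto simp del: sum.lessThan_Suc)
    show "integrable M (\<lambda>w. \<Psi> w * R1 n w)" unfolding e1 using i1 by (intro Bochner_Integration.integrable_sum) auto
    show "integrable M (\<lambda>w. \<Psi> w * R2 n w)" unfolding e2 using i2 by (intro Bochner_Integration.integrable_sum) auto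
    show "integrable M (\<lambda>w. \<Psi> w * S2 n w)" unfolding e3 using i3 by (intro Bochner_Integration.integrable_sum) auto
    have "E (\<lambda>w. \<Psi> w * R2 n w) = (\<Sum>i<Suc n. E (\<lambda>w. (\<Psi> w * \<phi>'' (y (cell n i w) w)) * (\<Delta>I n i w)\<^sup>2))"
      unfolding e2 using i2 by (subst Bochner_Integration.integral_sum) auto
    also have "\<dots> = (\<Sum>i<Suc n. E (\<lambda>w. (\<Psi> w * \<phi>'' (y (cell n i w) w)) * \<Delta>Q n i w))"
      by (intro sum.cong refl t2) auto
    also have "\<dots> = E (\<lambda>w. \<Psi> w * S2 n w)"
      unfolding e3 using i3 by (subst Bochner_Integration.integral_sum) auto
    finally show "E (\<lambda>w. \<Psi> w * R2 n w) = E (\<lambda>w. \<Psi> w * S2 n w)" .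
  qed
  define X where "X = E (\<lambda>w. \<Psi> w * \<phi> (y (\<tau> w) w)) - E (\<lambda>w. \<Psi> w * \<phi> (y s w)) + E (\<lambda>w. \<Psi> w * \<rho> w)"
  define K2 where "K2 = 2 * K\<^sup>2 + 4 * K ^ 3"
  have K20: "0 \<le> K2" using K by (simp add: K2_def)
  \<comment> \<open>\<open>\<eta>\<close> measures the quadratic Taylor error, and
    \<open>\<kappa>\<close> weighs the product of \<open>osc\<close> with the sum of squares. For
    fixed \<open>\<eta>\<close> and \<open>\<kappa>\<close> every term with a factor
    \<open>osc\<close> disappears as \<open>n\<close> grows.\<close>
  have main: "X \<ge> - (2 * \<eta> * K + 2 * L * \<kappa> * K2) * C'"
    if \<eta>: "\<eta> > 0" and \<kappa>: "\<kappa> > 0" and L: "L \<ge> 0"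
      and tay: "\<And>x x'. \<bar>x\<bar> \<le> K \<Longrightarrow> \<bar>x'\<bar> \<le> K \<Longrightarrow>
     \<phi> x' - \<phi> x \<ge> \<phi>' x * (x' - x) + \<phi>'' x / 2 * (x' - x)\<^sup>2 - \<eta> * (x' - x)\<^sup>2 - L * \<bar>x' - x\<bar> ^ 3" for \<eta> \<kappa> L
  proof -
    \<comment> \<open>Collects the coefficients of \<open>osc\<close>. It may be large, since it
      multiplies a mean that tends to zero.\<close>
    define c3 where "c3 = 2 * M2 * K + 2 * \<eta> * K + 6 * L * K\<^sup>2 + 6 * L * K / \<kappa>"
    have c30: "0 \<le> c3" using M2(1) K \<eta> L \<kappa> by (simp add: c3_def)
    define err where "err n w = 2 * \<eta> * quadvar n (Suc n) w + 2 * L * \<kappa> * (quadvar n (Suc n) w)\<^sup>2 + c3 * osc n w" for n w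
    have path: "\<phi> (y (\<tau> w) w) - \<phi> (y s w) \<ge> R1 n w - S1 n w + R2 n w / 2 - err n w"
      if w: "w \<in> space M" "\<Psi> w \<noteq> 0" for n w
    proof -
      let ?o = "osc n w" and ?S = "quadvar n (Suc n) w"
      have o: "0 \<le> ?o" "?o \<le> 3 * K" using osc_facts(2)[OF w(1), of n] by auto
      have S0: "0 \<le> ?S" by (simp add: quadvar_def sum_nonneg del: sum.lessThan_Suc)
      have trm: "\<phi> (y (cell n (Suc i) w) w) - \<phi> (y (cell n i w) w) \<ge>
          \<phi>' (y (cell n i w) w) * \<Delta>I n i w - \<phi>' (y (cell n i w) w) * \<Delta>D n i w + \<phi>'' (y (cell n i w) w) * (\<Delta>I n i w)\<^sup>2 / 2
          - (2 * M2 * ?o * \<bar>\<Delta>D n i w\<bar> + (\<eta> + L * ?o) * (2 * (\<Delta>I n i w)\<^sup>2 + 2 * ?o * \<bar>\<Delta>D n i w\<bar>))"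
        if i: "i < Suc n" for i
      proof -
        define x x' b c where "x = y (cell n i w) w" "x' = y (cell n (Suc i) w) w" "b = \<Delta>I n i w" "c = \<Delta>D n i w"
        note defs = this
        have xx: "\<bar>x\<bar> \<le> K" "\<bar>x'\<bar> \<le> K" unfolding defs using yK[OF w] i by auto
        have dx: "x' - x = b - c"
          unfolding defs \<Delta>I_def \<Delta>D_def using D_eq[OF w(1)] cell_range[OF w(1), of i n] cell_range[OF w(1), of "Suc i" n] i by auto
        have bc: "\<bar>b\<bar> + \<bar>c\<bar> \<le> ?o" unfolding defs by (rule osc_facts(3)[OF i])
        have cc: "c\<^sup>2 \<le> ?o * \<bar>c\<bar>" using bc by (simp add: power2_eq_square abs_mult_self_eq[symmetric, of c] mult_right_mono del: abs_mult_self_eq)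
        have bcm: "\<bar>b * c\<bar> \<le> ?o * \<bar>c\<bar>" unfolding abs_mult using bc by (intro mult_right_mono) auto
        have d2: "(x' - x)\<^sup>2 \<le> 2 * b\<^sup>2 + 2 * ?o * \<bar>c\<bar>"
        proof -
          have "(b - c)\<^sup>2 \<le> 2 * b\<^sup>2 + 2 * c\<^sup>2" using zero_le_power2[of "b + c"] by (simp add: power2_eq_square algebra_simps)
          then show ?thesis using cc dx by simp
        qed
        have d3: "\<bar>x' - x\<bar> ^ 3 \<le> ?o * (2 * b\<^sup>2 + 2 * ?o * \<bar>c\<bar>)"
        proof -
          have "\<bar>x' - x\<bar> ^ 3 = \<bar>x' - x\<bar> * (x' - x)\<^sup>2" by (simp add: power3_eq_cube power2_eq_square)
          also have "\<dots> \<le> ?o * (2 * b\<^sup>2 + 2 * ?o * \<bar>c\<bar>)" using d2 bc dx o by (intro mult_mono) auto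
          finally show ?thesis .
        qed
        \<comment> \<open>The drift part \<open>c\<close> enters the square through c^2 and b c,
          both at most \<open>osc\<close> times |c|; summed over the cells, |c| is at most
          \<open>K\<close>.\<close>
        have q: "\<phi>'' x / 2 * (x' - x)\<^sup>2 \<ge> \<phi>'' x * b\<^sup>2 / 2 - 2 * M2 * ?o * \<bar>c\<bar>"
        proof -
          have "\<phi>'' x / 2 * (x' - x)\<^sup>2 = \<phi>'' x * b\<^sup>2 / 2 + \<phi>'' x * (c\<^sup>2 / 2 - b * c)"
            unfolding dx by (simp add: power2_eq_square algebra_simps)
          moreover have "\<bar>\<phi>'' x * (c\<^sup>2 / 2 - b * c)\<bar> \<le> M2 * (2 * (?o * \<bar>c\<bar>))"
          proof -
            have "0 \<le> c\<^sup>2" by simp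
            then have "\<bar>c\<^sup>2 / 2 - b * c\<bar> \<le> 2 * (?o * \<bar>c\<bar>)" using cc bcm by linarith
            then show ?thesis unfolding abs_mult[of "\<phi>'' x"] using M2 xx by (intro mult_mono) auto
          qed
          moreover have "M2 * (2 * (?o * \<bar>c\<bar>)) = 2 * M2 * ?o * \<bar>c\<bar>" by simp
          ultimately show ?thesis by linarith
        qed
        have "\<eta> * (x' - x)\<^sup>2 \<le> \<eta> * (2 * b\<^sup>2 + 2 * ?o * \<bar>c\<bar>)" "L * \<bar>x' - x\<bar> ^ 3 \<le> L * (?o * (2 * b\<^sup>2 + 2 * ?o * \<bar>c\<bar>))"
          using d2 d3 \<eta> L by (auto intro!: mult_left_mono)
        moreover have "\<phi>' x * (x' - x) = \<phi>' x * b - \<phi>' x * c" unfolding dx by (simp add: right_diff_distrib)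
        moreover have "(\<eta> + L * ?o) * (2 * b\<^sup>2 + 2 * ?o * \<bar>c\<bar>) = \<eta> * (2 * b\<^sup>2 + 2 * ?o * \<bar>c\<bar>) + L * (?o * (2 * b\<^sup>2 + 2 * ?o * \<bar>c\<bar>))"
          by (simp only: distrib_right mult.assoc)
        ultimately have "\<phi> x' - \<phi> x \<ge> \<phi>' x * b - \<phi>' x * c + \<phi>'' x * b\<^sup>2 / 2 - (2 * M2 * ?o * \<bar>c\<bar> + (\<eta> + L * ?o) * (2 * b\<^sup>2 + 2 * ?o * \<bar>c\<bar>))"
          using tay[OF xx] q by linarith
        then show ?thesis unfolding defs .
      qed
      have "\<phi> (y (\<tau> w) w) - \<phi> (y s w) = (\<Sum>i<Suc n. \<phi> (y (cell n (Suc i) w) w) - \<phi> (y (cell n i w) w))"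
        using sum_lessThan_telescope[of "\<lambda>i. \<phi> (y (cell n i w) w)" "Suc n"] cell_end[OF w(1)] cell_0[OF act[OF w]] by (simp del: sum.lessThan_Suc)
      also have "\<dots> \<ge> (\<Sum>i<Suc n. \<phi>' (y (cell n i w) w) * \<Delta>I n i w - \<phi>' (y (cell n i w) w) * \<Delta>D n i w + \<phi>'' (y (cell n i w) w) * (\<Delta>I n i w)\<^sup>2 / 2
          - (2 * M2 * ?o * \<bar>\<Delta>D n i w\<bar> + (\<eta> + L * ?o) * (2 * (\<Delta>I n i w)\<^sup>2 + 2 * ?o * \<bar>\<Delta>D n i w\<bar>)))" (is "_ \<ge> ?RHS")
        by (rule sum_mono) (use trm in auto)
      finally have 1: "\<phi> (y (\<tau> w) w) - \<phi> (y s w) \<ge> ?RHS" .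
      let ?v = "\<Sum>i<Suc n. \<bar>\<Delta>D n i w\<bar>"
      have 2: "?RHS = R1 n w - S1 n w + R2 n w / 2 - (2 * M2 * ?o * ?v + (\<eta> + L * ?o) * (2 * ?S + 2 * ?o * ?v))"
        unfolding R1_def S1_def R2_def quadvar_def sum_divide_distrib sum_distrib_left
        by (simp only: sum.distrib sum_subtractf sum_distrib_left[symmetric])
      have v: "?v \<le> K" "0 \<le> ?v" using sum_increments(1)[OF w(1), of n] by (auto intro: sum_nonneg simp del: sum.lessThan_Suc)
      have "2 * M2 * ?o * ?v + (\<eta> + L * ?o) * (2 * ?S + 2 * ?o * ?v) \<le> 2 * M2 * ?o * K + (\<eta> + L * ?o) * (2 * ?S + 2 * ?o * K)"
        using v M2(1) o \<eta> L by (intro add_mono mult_left_mono) auto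
      also have "\<dots> = 2 * \<eta> * ?S + (2 * M2 * K + 2 * \<eta> * K) * ?o + 2 * L * K * (?o * ?o) + 2 * L * (?o * ?S)"
        by (simp add: algebra_simps)
      also have "\<dots> \<le> 2 * \<eta> * ?S + (2 * M2 * K + 2 * \<eta> * K) * ?o + 2 * L * K * (3 * K * ?o) + 2 * L * (\<kappa> * ?S\<^sup>2 + 3 * K * ?o / \<kappa>)"
      proof (intro add_mono order_refl mult_left_mono)
        show "?o * ?o \<le> 3 * K * ?o" using o by (intro mult_right_mono) auto
        \<comment> \<open>Young's inequality trades the product of \<open>osc\<close> and the sum of
          squares for a small multiple of the squared sum, whose mean is bounded, plus a multiple of
          \<open>osc\<close>.\<close>
        have "0 \<le> (\<kappa> * ?S - ?o)\<^sup>2" by simp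
        then have "2 * (\<kappa> * (?o * ?S)) \<le> \<kappa>\<^sup>2 * ?S\<^sup>2 + ?o * ?o" by (simp add: power2_eq_square algebra_simps)
        also have "\<dots> \<le> \<kappa>\<^sup>2 * ?S\<^sup>2 + 3 * K * ?o" using o by (intro add_left_mono mult_right_mono) auto
        finally have "2 * (\<kappa> * (?o * ?S)) \<le> \<kappa>\<^sup>2 * ?S\<^sup>2 + 3 * K * ?o" .
        moreover have "0 \<le> \<kappa> * (?o * ?S)" using \<kappa> o(1) S0 by (intro mult_nonneg_nonneg) auto
        ultimately have "\<kappa> * (?o * ?S) \<le> \<kappa>\<^sup>2 * ?S\<^sup>2 + 3 * K * ?o" by linarith
        then have "\<kappa> * (?o * ?S) \<le> \<kappa> * (\<kappa> * ?S\<^sup>2 + 3 * K * ?o / \<kappa>)" using \<kappa> by (simp add: power2_eq_square distrib_left mult.assoc)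
        then show "?o * ?S \<le> \<kappa> * ?S\<^sup>2 + 3 * K * ?o / \<kappa>" using \<kappa> by (simp only: mult_le_cancel_left_pos)
      qed (use L K in auto)
      also have "\<dots> = err n w" unfolding err_def c3_def by (simp add: algebra_simps power2_eq_square)
      finally show ?thesis using 1 2 by linarith
    qed
    have em: "integrable M (err n)" "E (err n) \<le> 2 * \<eta> * K + 2 * L * \<kappa> * K2 + c3 * E (osc n)" "w \<in> space M \<Longrightarrow> 0 \<le> err n w" for n w
    proof -
      obtain Cq where Cq: "\<And>w. w \<in> space M \<Longrightarrow> \<bar>quadvar n (Suc n) w\<bar> \<le> Cq" using quadvar_moments(2)[of n] by blast
      note [measurable] = quadvar_moments(1)[of n] osc_facts(1)[of n]
      have i1: "integrable M (quadvar n (Suc n))" by (rule integrable_bounded[OF quadvar_moments(1) Cq])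
      have "\<bar>(quadvar n (Suc n) w)\<^sup>2\<bar> \<le> Cq\<^sup>2" if "w \<in> space M" for w using power_mono[OF Cq[OF that], of 2] by simp
      then have i2: "integrable M (\<lambda>w. (quadvar n (Suc n) w)\<^sup>2)" by (intro integrable_bounded) auto
      have i3: "integrable M (osc n)" using osc_facts(2)[of _ n] by (intro integrable_bounded[where C="3 * K"]) auto
      show "integrable M (err n)" unfolding err_def[abs_def] using i1 i2 i3 by auto
      have "E (err n) = 2 * \<eta> * E (quadvar n (Suc n)) + 2 * L * \<kappa> * E (\<lambda>w. (quadvar n (Suc n) w)\<^sup>2) + c3 * E (osc n)"
        unfolding err_def[abs_def] using i1 i2 i3 by simp
      also have "\<dots> \<le> 2 * \<eta> * K + 2 * L * \<kappa> * K2 + c3 * E (osc n)"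
        unfolding K2_def using quadvar_moments(3,4)[of n] \<eta> \<kappa> L c30 by (intro add_mono mult_left_mono order_refl) auto
      finally show "E (err n) \<le> 2 * \<eta> * K + 2 * L * \<kappa> * K2 + c3 * E (osc n)" .
      assume w: "w \<in> space M"
      have "0 \<le> quadvar n (Suc n) w" by (simp add: quadvar_def sum_nonneg del: sum.lessThan_Suc)
      then show "0 \<le> err n w" unfolding err_def using \<eta> L \<kappa> c30 osc_facts(2)[OF w, of n] by (intro add_nonneg_nonneg mult_nonneg_nonneg) auto
    qed
    have step: "E (\<lambda>w. \<Psi> w * \<phi> (y (\<tau> w) w)) - E (\<lambda>w. \<Psi> w * \<phi> (y s w)) + E (\<lambda>w. \<Psi> w * Tn n w)
      \<ge> - C' * (2 * \<eta> * K + 2 * L * \<kappa> * K2 + c3 * E (osc n))" for n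
    proof -
      have iT: "integrable M (\<lambda>w. \<Psi> w * S1 n w)"
      proof -
        have "\<bar>\<Psi> w * Tn n w\<bar> \<le> C' * ((M1 + M2) * K)" if w: "w \<in> space M" for w
          using Tb[OF w] M1 M2 K by (intro Pbd[OF w]) auto
        then have "integrable M (\<lambda>w. \<Psi> w * Tn n w)" by (intro integrable_bounded) auto
        then have "integrable M (\<lambda>w. \<Psi> w * Tn n w + (\<Psi> w * S2 n w) / 2)" using orth(5)[of n] by simp
        then show ?thesis by (simp add: Tn_def algebra_simps)
      qed
      have "E (\<lambda>w. \<Psi> w * R1 n w - \<Psi> w * S1 n w + \<Psi> w * R2 n w / 2 - C' * err n w)
         \<le> E (\<lambda>w. \<Psi> w * \<phi> (y (\<tau> w) w) - \<Psi> w * \<phi> (y s w))"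
      proof (rule integral_mono)
        show "integrable M (\<lambda>w. \<Psi> w * R1 n w - \<Psi> w * S1 n w + \<Psi> w * R2 n w / 2 - C' * err n w)"
          using orth(2,4)[of n] iT em(1)[of n] by auto
        show "integrable M (\<lambda>w. \<Psi> w * \<phi> (y (\<tau> w) w) - \<Psi> w * \<phi> (y s w))" using iphi by auto
        fix w assume w: "w \<in> space M"
        show "\<Psi> w * R1 n w - \<Psi> w * S1 n w + \<Psi> w * R2 n w / 2 - C' * err n w \<le> \<Psi> w * \<phi> (y (\<tau> w) w) - \<Psi> w * \<phi> (y s w)"
        proof (cases "\<Psi> w = 0")
          case True
          then show ?thesis using em(3)[OF w, of n] C'0 by simp
        next
          case False
          have "\<Psi> w * (R1 n w - S1 n w + R2 n w / 2 - err n w) \<le> \<Psi> w * (\<phi> (y (\<tau> w) w) - \<phi> (y s w))"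
            using path[OF w False] Psi0[OF w] by (intro mult_left_mono) auto
          moreover have "\<Psi> w * err n w \<le> C' * err n w" using Psi0[OF w] em(3)[OF w, of n] by (intro mult_right_mono)
          ultimately show ?thesis by (simp add: algebra_simps)
        qed
      qed
      moreover have "E (\<lambda>w. \<Psi> w * R1 n w - \<Psi> w * S1 n w + \<Psi> w * R2 n w / 2 - C' * err n w)
         = - E (\<lambda>w. \<Psi> w * S1 n w) + E (\<lambda>w. \<Psi> w * S2 n w) / 2 - C' * E (err n)"
        using orth[of n] iT em(1)[of n] by simp
      moreover have "E (\<lambda>w. \<Psi> w * Tn n w) = E (\<lambda>w. \<Psi> w * S1 n w) - E (\<lambda>w. \<Psi> w * S2 n w) / 2"
        using iT orth(5)[of n] by (simp add: Tn_def right_diff_distrib)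
      moreover have "C' * E (err n) \<le> C' * (2 * \<eta> * K + 2 * L * \<kappa> * K2 + c3 * E (osc n))"
        using em(2)[of n] C'0 by (intro mult_left_mono)
      ultimately show ?thesis using iphi by simp
    qed
    have "(\<lambda>n. - C' * (2 * \<eta> * K + 2 * L * \<kappa> * K2 + c3 * E (osc n))) \<longlonglongrightarrow> - C' * (2 * \<eta> * K + 2 * L * \<kappa> * K2 + c3 * 0)"
      by (intro tendsto_intros osc_facts(5))
    moreover have "(\<lambda>n. E (\<lambda>w. \<Psi> w * \<phi> (y (\<tau> w) w)) - E (\<lambda>w. \<Psi> w * \<phi> (y s w)) + E (\<lambda>w. \<Psi> w * Tn n w)) \<longlonglongrightarrow> X"
      unfolding X_def by (intro tendsto_intros lim1(1))
    ultimately have "- C' * (2 * \<eta> * K + 2 * L * \<kappa> * K2 + c3 * 0) \<le> X"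
      by (rule LIMSEQ_le) (use step in auto)
    moreover have "- C' * (2 * \<eta> * K + 2 * L * \<kappa> * K2 + c3 * 0) = - (2 * \<eta> * K + 2 * L * \<kappa> * K2) * C'" by (simp add: algebra_simps)
    ultimately show ?thesis by linarith
  qed
  have "X \<ge> 0"
  proof (rule field_le_epsilon)
    fix e :: real assume e: "e > 0"
    \<comment> \<open>\<open>L\<close> comes from the Taylor bound and depends on
      \<open>\<eta>\<close>, so \<open>\<kappa>\<close> is chosen last; each of the two error terms
      is then at most e / 2.\<close>
    define \<eta> where "\<eta> = e / (4 * (C' * K + 1))"
    have \<eta>: "\<eta> > 0" using e C'0 K by (simp add: \<eta>_def add_nonneg_pos)
    obtain L where L: "L \<ge> 0" "\<And>x x'. \<bar>x\<bar> \<le> K \<Longrightarrow> \<bar>x'\<bar> \<le> K \<Longrightarrow>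
     \<phi> x' - \<phi> x \<ge> \<phi>' x * (x' - x) + \<phi>'' x / 2 * (x' - x)\<^sup>2 - \<eta> * (x' - x)\<^sup>2 - L * \<bar>x' - x\<bar> ^ 3"
      using second_order_lower_bound[OF d1 d2 continuous_on_subset[OF c2] \<eta>, of K] by auto
    define \<kappa> where "\<kappa> = e / (4 * (L * K2 * C' + 1))"
    have \<kappa>: "\<kappa> > 0" using e L(1) K20 C'0 by (simp add: \<kappa>_def add_nonneg_pos)
    have 1: "2 * \<eta> * K * C' \<le> e / 2"
    proof -
      have "2 * \<eta> * K * C' \<le> 2 * (\<eta> * (C' * K + 1))" using \<eta> by (simp add: algebra_simps)
      also have "\<eta> * (C' * K + 1) = e / 4" using mult_nonneg_nonneg[OF C'0 K] by (simp add: \<eta>_def field_simps)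
      finally show ?thesis by simp
    qed
    have 2: "2 * L * \<kappa> * K2 * C' \<le> e / 2"
    proof -
      have "2 * L * \<kappa> * K2 * C' \<le> 2 * (\<kappa> * (L * K2 * C' + 1))" using \<kappa> by (simp add: algebra_simps)
      also have "\<kappa> * (L * K2 * C' + 1) = e / 4" using mult_nonneg_nonneg[OF mult_nonneg_nonneg[OF L(1) K20] C'0] by (simp add: \<kappa>_def field_simps)
      finally show ?thesis by simp
    qed
    have "X \<ge> - (2 * \<eta> * K + 2 * L * \<kappa> * K2) * C'" by (rule main[OF \<eta> \<kappa> L])
    then show "0 \<le> X + e" using 1 2 by (simp add: algebra_simps)
  qed
  moreover have "E (\<lambda>w. \<Psi> w * \<rho> w) \<le> E (\<lambda>w. \<Psi> w * \<theta> w)"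
    by (rule integral_mono_AE[OF lim1(2) P\<theta> \<rho>\<theta>])
  ultimately show ?thesis unfolding X_def \<theta>_def by simp
qed

end

end

section \<open>Localisation\<close>

context bm_space
begin

text \<open>The maximum over [0,t] is attained, so reaching \<open>c\<close> means exceeding each
  level \<open>c - 1 / Suc n\<close> at some rational time, which is a countable condition.\<close>

lemma hitting_event_measurable:
  fixes R :: "real \<Rightarrow> 'w \<Rightarrow> real"
  assumes Rc: "\<And>w. w \<in> space M \<Longrightarrow> continuous_on {0..T} (\<lambda>t. R t w)"
    and Ra: "\<And>t. t \<in> {0..T} \<Longrightarrow> R t \<in> borel_measurable (F t)" and t: "t \<in> {0..T}"
  shows "{w\<in>space M. \<exists>r\<in>{0..t}. c \<le> R r w} \<in> sets (F t)"
proof (cases "t = 0")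
  case True
  have [measurable]: "R 0 \<in> borel_measurable (F 0)" using Ra T_pos by simp
  have "{w\<in>space (F 0). c \<le> R 0 w} \<in> sets (F 0)" by measurable
  then show ?thesis using True by simp
next
  case False
  then have t0: "0 < t" using t by simp
  have Rct: "continuous_on {0..t} (\<lambda>t. R t w)" if "w \<in> space M" for w
    using Rc[OF that] t by (auto intro: continuous_on_subset)
  have "{w\<in>space M. \<exists>r\<in>{0..t}. c \<le> R r w} = (\<Inter>n. \<Union>q\<in>{0..t} \<inter> \<rat>. {w\<in>space (F t). c - 1 / real (Suc n) < R q w})" (is "?L = ?R")
  proof (intro set_eqI iffI)
    fix w assume "w \<in> ?L"
    then obtain r where w: "w \<in> space M" and r: "r \<in> {0..t}" "c \<le> R r w" by auto
    show "w \<in> ?R"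
    proof
      fix n
      have "R r w \<in> {c - 1 / real (Suc n)<..}" using r(2) by (simp add: less_le_trans[OF _ r(2)])
      from continuous_on_rational_hit[OF Rct[OF w] t0 open_greaterThan r(1) this]
      obtain q where "q \<in> {0..t} \<inter> \<rat>" "R q w \<in> {c - 1 / real (Suc n)<..}" .
      then show "w \<in> (\<Union>q\<in>{0..t} \<inter> \<rat>. {w\<in>space (F t). c - 1 / real (Suc n) < R q w})" using w by auto
    qed
  next
    fix w assume R: "w \<in> ?R"
    then have w: "w \<in> space M" by auto
    obtain r where r: "r \<in> {0..t}" "\<And>q. q \<in> {0..t} \<Longrightarrow> R q w \<le> R r w"
      using continuous_attains_sup[OF _ _ Rct[OF w]] t0 by fastforce
    have "c - 1 / real (Suc n) \<le> R r w" for n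
    proof -
      have "w \<in> (\<Union>q\<in>{0..t} \<inter> \<rat>. {w\<in>space (F t). c - 1 / real (Suc n) < R q w})" using R by blast
      then obtain q where "q \<in> {0..t}" "c - 1 / real (Suc n) < R q w" by auto
      then show ?thesis using r(2)[of q] by linarith
    qed
    moreover have "(\<lambda>n. c - inverse (real (Suc n))) \<longlonglongrightarrow> c - 0"
      by (intro tendsto_diff tendsto_const LIMSEQ_inverse_real_of_nat)
    ultimately have "c \<le> R r w" by (intro LIMSEQ_le_const2[of "\<lambda>n. c - inverse (real (Suc n))" c]) (auto simp: inverse_eq_divide)
    then show "w \<in> ?L" using w r(1) by auto
  qed
  also have "\<dots> \<in> sets (F t)"
  proof (rule sets.countable_INT, rule image_subsetI, rule sets.countable_UN')
    show "countable ({0..t} \<inter> \<rat>)" using countable_rat by blast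
    have "{w\<in>space (F t). c - 1 / real (Suc n) < R q w} \<in> sets (F t)" if "q \<in> {0..t} \<inter> \<rat>" for n q
    proof -
      have [measurable]: "R q \<in> borel_measurable (F t)" using that t by (intro F_measurable_mono[OF Ra]) auto
      show ?thesis by measurable
    qed
    then show "(\<lambda>q. {w\<in>space (F t). c - 1 / real (Suc n) < R q w}) ` ({0..t} \<inter> \<rat>) \<subseteq> sets (F t)" for n by blast
  qed auto
  finally show ?thesis .
qed

text \<open>Adding \<open>T\<close> keeps the set nonempty and gives the value \<open>T\<close> to
  paths that stay below \<open>c\<close>.\<close>

definition hit :: "(real \<Rightarrow> 'w \<Rightarrow> real) \<Rightarrow> real \<Rightarrow> 'w \<Rightarrow> real" where
  "hit R c w = Inf ({t\<in>{0..T}. c \<le> R t w} \<union> {T})"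

lemma hit_range: "0 \<le> hit R c w" "hit R c w \<le> T"
proof -
  show "0 \<le> hit R c w" unfolding hit_def using T_pos by (intro cInf_greatest) auto
  show "hit R c w \<le> T" unfolding hit_def using T_pos by (intro cInf_lower bdd_belowI[of _ 0]) auto
qed

lemma hit_lower: "t \<in> {0..T} \<Longrightarrow> c \<le> R t w \<Longrightarrow> hit R c w \<le> t"
  unfolding hit_def using T_pos by (intro cInf_lower bdd_belowI[of _ 0]) auto

lemma before_hit: "0 \<le> r \<Longrightarrow> r < hit R c w \<Longrightarrow> R r w < c"
  using hit_lower[of r c R w] hit_range(2)[of R c w] by force

text \<open>Before the hitting time the path is below \<open>c\<close>, hence by continuity at most
  \<open>c\<close> when the time is reached. A path that starts above \<open>c\<close> would violate
  this; positivity of the hitting time excludes it.\<close>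

lemma until_hit:
  assumes Rc: "continuous_on {0..T} (\<lambda>t. R t w)" and h: "0 < hit R c w" and r: "0 \<le> r" "r \<le> hit R c w"
  shows "R r w \<le> c"
proof -
  let ?h = "hit R c w"
  have "closed ({0..?h} \<inter> (\<lambda>t. R t w) -` {..c})"
    using Rc hit_range(2)[of R c w] by (intro continuous_closed_preimage) (auto intro: continuous_on_subset)
  then have "closed {t \<in> {0..?h}. R t w \<le> c}" by (simp add: vimage_def Int_def)
  moreover have "{0..<?h} \<subseteq> {t \<in> {0..?h}. R t w \<le> c}" using before_hit by (auto intro: less_imp_le)
  ultimately have "closure {0..<?h} \<subseteq> {t \<in> {0..?h}. R t w \<le> c}" by (rule closure_minimal[rotated])
  then show ?thesis using h r by auto
qed

lemma hit_never: "(\<And>t. t \<in> {0..T} \<Longrightarrow> R t w < c) \<Longrightarrow> hit R c w = T"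
proof -
  assume "\<And>t. t \<in> {0..T} \<Longrightarrow> R t w < c"
  then have e: "{t\<in>{0..T}. c \<le> R t w} = {}" by force
  show ?thesis unfolding hit_def e by simp
qed

text \<open>The times at or above the level form a closed set, so the infimum is attained, and for
  \<open>t\<close> before \<open>T\<close> the event of hitting by time \<open>t\<close> is the one
  of \<open>hitting_event_measurable\<close>.\<close>

lemma hit_stopping:
  assumes Rc: "\<And>w. w \<in> space M \<Longrightarrow> continuous_on {0..T} (\<lambda>t. R t w)"
    and Ra: "\<And>t. t \<in> {0..T} \<Longrightarrow> R t \<in> borel_measurable (F t)"
  shows "bounded_stopping (hit R c)"
  unfolding bounded_stopping_def
proof (intro conjI ballI)
  show "hit R c w \<in> {0..T}" for w using hit_range by auto
  show "stopping_time F (hit R c)"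
  proof (rule stopping_timeI)
    fix t
    consider "t < 0" | "t \<ge> T" | "0 \<le> t" "t < T" by linarith
    then show "Measurable.pred (F t) (\<lambda>w. hit R c w \<le> t)"
    proof cases
      case 1
      then have "(\<lambda>w. hit R c w \<le> t) = (\<lambda>_. False)" using hit_range(1)[of R c] by (auto simp: fun_eq_iff not_le intro: less_le_trans)
      then show ?thesis by simp
    next
      case 2
      then have "(\<lambda>w. hit R c w \<le> t) = (\<lambda>_. True)" using hit_range(2)[of R c] by (auto simp: fun_eq_iff intro: order_trans)
      then show ?thesis by simp
    next
      case 3
      have "{w\<in>space (F t). hit R c w \<le> t} = {w\<in>space M. \<exists>r\<in>{0..t}. c \<le> R r w}"
      proof (intro set_eqI iffI)
        fix w assume "w \<in> {w\<in>space (F t). hit R c w \<le> t}"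
        then have w: "w \<in> space M" "hit R c w \<le> t" by auto
        have cl: "closed ({r\<in>{0..T}. c \<le> R r w} \<union> {T})"
        proof (rule closed_Un)
          have "closed ({0..T} \<inter> (\<lambda>t. R t w) -` {c..})" by (intro continuous_closed_preimage Rc[OF w(1)]) auto
          then show "closed {r\<in>{0..T}. c \<le> R r w}" by (simp add: vimage_def Int_def)
        qed simp
        have "hit R c w \<in> {r\<in>{0..T}. c \<le> R r w} \<union> {T}"
          unfolding hit_def using T_pos by (intro closed_contains_Inf cl bdd_belowI[of _ 0]) auto
        then have "hit R c w \<in> {0..t}" "c \<le> R (hit R c w) w" using w(2) 3 by auto
        then show "w \<in> {w\<in>space M. \<exists>r\<in>{0..t}. c \<le> R r w}" using w(1) by auto
      next
        fix w assume "w \<in> {w\<in>space M. \<exists>r\<in>{0..t}. c \<le> R r w}"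
        then obtain r where "w \<in> space M" "r \<in> {0..t}" "c \<le> R r w" by auto
        then show "w \<in> {w\<in>space (F t). hit R c w \<le> t}" using hit_lower[of r c R w] 3 by auto
      qed
      also have "\<dots> \<in> sets (F t)" using 3 by (intro hitting_event_measurable[OF Rc Ra]) auto
      finally show ?thesis by (simp add: pred_def)
    qed
  qed
qed

lemma hit_eventually_T:
  assumes Rc: "continuous_on {0..T} (\<lambda>t. R t w)"
  shows "eventually (\<lambda>k. hit R (real k) w = T) sequentially"
proof -
  have "compact ((\<lambda>t. R t w) ` {0..T})" by (rule compact_continuous_image[OF Rc]) simp
  then obtain C where C: "\<And>t. t \<in> {0..T} \<Longrightarrow> \<bar>R t w\<bar> \<le> C"
    using compact_imp_bounded bounded_iff by (metis (mono_tags, lifting) image_eqI real_norm_def)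
  obtain k0 :: nat where "C < k0" using reals_Archimedean2 by blast
  then have "hit R (real k) w = T" if "k \<ge> k0" for k
    using C that by (intro hit_never) (force simp: abs_le_iff)
  then show ?thesis unfolding eventually_sequentially by blast
qed

end

section \<open>An adapted majorant for the variation of the drift integral\<close>

lemma sum_pairs: "(\<Sum>i<2 * N. f i) = (\<Sum>i<N. f (2 * i) + f (2 * i + 1))" for f :: "nat \<Rightarrow> real"
  by (induction N) auto

definition dyad :: "real \<Rightarrow> nat \<Rightarrow> nat \<Rightarrow> real" where "dyad T n i = T * real i / 2 ^ n"

text \<open>A drift \<open>a\<close> need not be progressive, so \<open>\<integral>\<bar>a\<bar>\<close> may fail to be adapted; the variation of the adapted process
  \<open>\<integral>a\<close> along dyadic points replaces it.\<close>

definition dyadic_variation :: "real \<Rightarrow> (real \<Rightarrow> real) \<Rightarrow> nat \<Rightarrow> real \<Rightarrow> real" where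
  "dyadic_variation T d n t = (\<Sum>i<2 ^ n. \<bar>d (min t (dyad T n (Suc i))) - d (min t (dyad T n i))\<bar>)"

text \<open>The first bound passes the continuity of \<open>W\<close> on to the variation. The
  second gives the dominance over |d t - d u|: absolute increments over cells split additively at
  \<open>u\<close> except on the one cell with \<open>u\<close> in its interior, which costs at most
  2 \<delta>. The last two make the variations converge as \<open>n\<close> grows.\<close>

lemma dyadic_variation_bounds:
  fixes d W :: "real \<Rightarrow> real"
  assumes T: "0 < T" and dW: "\<And>u v. 0 \<le> u \<Longrightarrow> u \<le> v \<Longrightarrow> v \<le> T \<Longrightarrow> \<bar>d v - d u\<bar> \<le> W v - W u"
    and ut: "0 \<le> u" "u \<le> t" "t \<le> T"
  shows "dyadic_variation T d n t - dyadic_variation T d n u \<le> W t - W u"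
    and "(\<And>v w. 0 \<le> v \<Longrightarrow> v \<le> w \<Longrightarrow> w \<le> T \<Longrightarrow> w - v \<le> T / 2 ^ n \<Longrightarrow> \<bar>d w - d v\<bar> \<le> \<delta>) \<Longrightarrow>
      \<bar>d t - d u\<bar> - 2 * \<delta> \<le> dyadic_variation T d n t - dyadic_variation T d n u"
    and "dyadic_variation T d n t \<le> dyadic_variation T d (Suc n) t"
    and "dyadic_variation T d n t \<le> W t - W 0"
proof -
  let ?p = "dyad T n"
  have p: "?p i \<le> ?p (Suc i)" "0 \<le> ?p i" "?p (Suc i) - ?p i = T / 2 ^ n" for i
    using T by (auto simp: dyad_def field_simps)
  have p0: "?p 0 = 0" "?p (2 ^ n) = T" by (simp_all add: dyad_def)
  \<comment> \<open>The part of the increment of \<open>e\<close> over [u,t] that falls into the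
    i-th dyadic cell; summed over the cells it telescopes.\<close>
  define b where "b e i = (e (min t (?p (Suc i))) - e (min u (?p (Suc i)))) - (e (min t (?p i)) - e (min u (?p i)))" for e :: "real \<Rightarrow> real" and i
  define tm where "tm x i = \<bar>d (min x (?p (Suc i))) - d (min x (?p i))\<bar>" for x i
  have tel: "(\<Sum>i<2 ^ n. b e i) = e t - e u" for e
    using sum_lessThan_telescope[of "\<lambda>i. e (min t (?p i)) - e (min u (?p i))" "2 ^ n"] ut p0
    by (simp add: b_def min_absorb1 min_absorb2)
  have bW: "\<bar>b d i\<bar> \<le> b W i" if i: "i < 2 ^ n" for i
  proof -
    consider "?p (Suc i) \<le> u" | "t \<le> ?p i" | "u < ?p (Suc i)" "?p i < t" by linarith
    then show ?thesis
    proof cases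
      case 1 then show ?thesis using ut p(1)[of i] by (simp add: b_def min_absorb2)
    next
      case 2 then show ?thesis using ut p(1)[of i] by (simp add: b_def min_absorb1)
    next
      case 3
      have "b e i = e (min t (?p (Suc i))) - e (max u (?p i))" for e
        using 3 ut by (cases "?p i \<le> u") (auto simp: b_def min_def max_def)
      moreover have "max u (?p i) \<le> min t (?p (Suc i))" using 3 ut p(1)[of i] by auto
      ultimately show ?thesis using dW[of "max u (?p i)" "min t (?p (Suc i))"] ut by auto
    qed
  qed
  have V: "dyadic_variation T d n x = (\<Sum>i<2 ^ n. tm x i)" for x by (simp add: dyadic_variation_def tm_def)
  have "dyadic_variation T d n t - dyadic_variation T d n u = (\<Sum>i<2 ^ n. tm t i - tm u i)" by (simp add: V sum_subtractf)
  also have "\<dots> \<le> (\<Sum>i<2 ^ n. b W i)"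
  proof (rule sum_mono)
    fix i :: nat assume "i \<in> {..<2 ^ n}"
    then have "\<bar>b d i\<bar> \<le> b W i" using bW by simp
    then show "tm t i - tm u i \<le> b W i" unfolding tm_def b_def[of d] by linarith
  qed
  finally show "dyadic_variation T d n t - dyadic_variation T d n u \<le> W t - W u" by (simp add: tel)
  { assume \<delta>: "\<And>v w. 0 \<le> v \<Longrightarrow> v \<le> w \<Longrightarrow> w \<le> T \<Longrightarrow> w - v \<le> T / 2 ^ n \<Longrightarrow> \<bar>d w - d v\<bar> \<le> \<delta>"
    have \<delta>0: "0 \<le> \<delta>" using \<delta>[of 0 0] T by simp
    \<comment> \<open>The only cell that can have \<open>u\<close> in its interior.\<close>
    define i0 where "i0 = nat \<lfloor>u * 2 ^ n / T\<rfloor>"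
    have low: "\<bar>b d i\<bar> - (if i = i0 then 2 * \<delta> else 0) \<le> tm t i - tm u i" if i: "i < 2 ^ n" for i
    proof -
      consider "?p (Suc i) \<le> u" | "u \<le> ?p i" | "?p i < u" "u < ?p (Suc i)" by linarith
      then show ?thesis
      proof cases
        case 1 then show ?thesis using ut p(1)[of i] \<delta>0 by (simp add: b_def tm_def min_absorb2)
      next
        case 2 then show ?thesis using ut p(1)[of i] \<delta>0 by (simp add: b_def tm_def min_absorb1)
      next
        case 3
        have a1: "real i < u * 2 ^ n / T" using 3(1) T by (simp add: dyad_def field_simps)
        have a2: "u * 2 ^ n / T < real (Suc i)" using 3(2) T by (simp add: dyad_def field_simps)
        have "\<lfloor>u * 2 ^ n / T\<rfloor> = int i" using a1 a2 by (intro floor_unique) auto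
        then have ii: "i = i0" by (simp add: i0_def)
        have "tm u i \<le> \<delta>" unfolding tm_def using 3 ut p(2,3)[of i] by (simp add: min_absorb1 min_absorb2) (intro \<delta>; simp)
        moreover have "\<bar>p' - q'\<bar> - 2 * \<delta> \<le> \<bar>p'\<bar> - \<bar>q'\<bar>" if "\<bar>q'\<bar> \<le> \<delta>" for p' q' :: real using that by linarith
        moreover have "b d i = (d (min t (?p (Suc i))) - d (min t (?p i))) - (d (min u (?p (Suc i))) - d (min u (?p i)))"
          by (simp add: b_def)
        ultimately show ?thesis unfolding tm_def by (simp add: ii)
      qed
    qed
    have "\<bar>d t - d u\<bar> - 2 * \<delta> \<le> (\<Sum>i<2 ^ n. \<bar>b d i\<bar>) - (\<Sum>i<2 ^ n. if i = i0 then 2 * \<delta> else 0)"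
    proof (rule diff_mono)
      show "\<bar>d t - d u\<bar> \<le> (\<Sum>i<2 ^ n. \<bar>b d i\<bar>)" unfolding tel[symmetric] by (rule sum_abs)
      show "(\<Sum>i<2 ^ n. if i = i0 then 2 * \<delta> else 0) \<le> 2 * \<delta>" using \<delta>0 by simp
    qed
    also have "\<dots> \<le> (\<Sum>i<2 ^ n. tm t i - tm u i)"
      unfolding sum_subtractf[symmetric] using low by (intro sum_mono) auto
    also have "\<dots> = dyadic_variation T d n t - dyadic_variation T d n u" by (simp add: V sum_subtractf)
    finally show "\<bar>d t - d u\<bar> - 2 * \<delta> \<le> dyadic_variation T d n t - dyadic_variation T d n u" . }
  show "dyadic_variation T d n t \<le> dyadic_variation T d (Suc n) t"
  proof -
    have e: "dyad T (Suc n) (2 * i) = dyad T n i" for i by (simp add: dyad_def)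
    have e2: "dyad T (Suc n) (Suc (2 * i + 1)) = dyad T n (Suc i)" for i by (simp add: dyad_def field_simps)
    have "dyadic_variation T d (Suc n) t = (\<Sum>i<2 ^ n. \<bar>d (min t (dyad T (Suc n) (Suc (2 * i)))) - d (min t (dyad T (Suc n) (2 * i)))\<bar>
        + \<bar>d (min t (dyad T (Suc n) (Suc (2 * i + 1)))) - d (min t (dyad T (Suc n) (2 * i + 1)))\<bar>)"
      unfolding dyadic_variation_def power_Suc by (rule sum_pairs)
    also have "\<dots> \<ge> dyadic_variation T d n t"
      unfolding dyadic_variation_def by (rule sum_mono, simp only: e e2) (simp del: abs_le_iff, linarith)
    finally show ?thesis .
  qed
  have "dyadic_variation T d n t \<le> (\<Sum>i<2 ^ n. W (min t (?p (Suc i))) - W (min t (?p i)))"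
    unfolding dyadic_variation_def
    using ut p(1,2) by (intro sum_mono dW) (auto simp: min_le_iff_disj)
  also have "\<dots> = W t - W 0"
    using sum_lessThan_telescope[of "\<lambda>i. W (min t (?p i))" "2 ^ n"] ut p0 by (simp add: min_absorb1 min_absorb2)
  finally show "dyadic_variation T d n t \<le> W t - W 0" .
qed

context bm_space
begin

text \<open>\<open>V\<close> is the limit of the dyadic variations of \<open>D\<close>. Each of
  these evaluates \<open>D\<close> only up to time \<open>t\<close>, so \<open>V\<close> is adapted.
  Its increments lie between the absolute increments of \<open>D\<close> and the increments of the
  integral of |a|; the latter gives continuity.\<close>

lemma variation_process:
  fixes a D :: "real \<Rightarrow> 'w \<Rightarrow> real"
  assumes a: "\<And>w. w \<in> space M \<Longrightarrow> set_integrable lborel {0..T} (\<lambda>r. a r w)"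
    and D: "\<And>w t. w \<in> space M \<Longrightarrow> t \<in> {0..T} \<Longrightarrow> D t w = (LBINT r:{0..t}. a r w)"
    and Da: "\<And>t. t \<in> {0..T} \<Longrightarrow> D t \<in> borel_measurable (F t)"
  obtains V where "\<And>t. t \<in> {0..T} \<Longrightarrow> V t \<in> borel_measurable (F t)"
    "\<And>w. w \<in> space M \<Longrightarrow> continuous_on {0..T} (\<lambda>t. V t w)" "\<And>w. w \<in> space M \<Longrightarrow> V 0 w = 0"
    "\<And>w t. w \<in> space M \<Longrightarrow> t \<in> {0..T} \<Longrightarrow> 0 \<le> V t w"
    "\<And>w u t. w \<in> space M \<Longrightarrow> 0 \<le> u \<Longrightarrow> u \<le> t \<Longrightarrow> t \<le> T \<Longrightarrow> \<bar>D t w - D u w\<bar> \<le> V t w - V u w"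
proof -
  define W where "W w t = (LBINT r:{0..t}. \<bar>a r w\<bar>)" for w t
  define Vn where "Vn n t w = dyadic_variation T (\<lambda>r. D r w) n t" for n t w
  define V where "V t w = (SUP n. Vn n t w)" for t w
  have dW: "\<bar>D v w - D u w\<bar> \<le> W w v - W w u" if "w \<in> space M" "0 \<le> u" "u \<le> v" "v \<le> T" for w u v
  proof -
    have ab: "set_integrable lborel {0..T} (\<lambda>r. \<bar>a r w\<bar>)" using a[OF that(1)] by (rule set_integrable_abs)
    have "set_integrable lborel {u<..v} (\<lambda>r. a r w)" using that by (auto intro: set_integrable_subset[OF a])
    then have "norm (LBINT r:{u<..v}. a r w) \<le> (LBINT r:{u<..v}. norm (a r w))" by (rule set_integral_norm_bound)
    then show ?thesis
      using that by (simp add: W_def D set_integral_diff_initial[OF a[OF that(1)]] set_integral_diff_initial[OF ab])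
  qed
  note db = dyadic_variation_bounds[OF T_pos, of "\<lambda>r. D r w" "W w" for w, folded Vn_def]
  have lim: "(\<lambda>n. Vn n t w) \<longlonglongrightarrow> V t w" if w: "w \<in> space M" and t: "t \<in> {0..T}" for w t
    unfolding V_def
  proof (rule LIMSEQ_incseq_SUP)
    show "bdd_above (range (\<lambda>n. Vn n t w))"
      using t db(4)[OF dW[OF w], where u=0 and t=t] by (intro bdd_aboveI[of _ "W w t - W w 0"]) auto
    show "incseq (\<lambda>n. Vn n t w)"
      using t db(3)[OF dW[OF w], where u=0 and t=t] by (intro incseq_SucI) auto
  qed
  have Vdiff: "V t w - V u w \<le> W w t - W w u" if w: "w \<in> space M" and ut: "0 \<le> u" "u \<le> t" "t \<le> T" for w u t
  proof (rule LIMSEQ_le_const2)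
    show "(\<lambda>n. Vn n t w - Vn n u w) \<longlonglongrightarrow> V t w - V u w" using w ut by (intro tendsto_diff lim) auto
    show "\<exists>N. \<forall>n\<ge>N. Vn n t w - Vn n u w \<le> W w t - W w u" using db(1)[OF dW[OF w] ut] by blast
  qed
  have Vlow: "\<bar>D t w - D u w\<bar> \<le> V t w - V u w" if w: "w \<in> space M" and ut: "0 \<le> u" "u \<le> t" "t \<le> T" for w u t
  proof (rule field_le_epsilon)
    fix e :: real assume e: "e > 0"
    have "continuous_on {0..T} (\<lambda>t. D t w)"
      using continuous_on_initial_integral[OF a[OF w]] by (subst continuous_on_cong[OF refl D[OF w]]) auto
    then have "uniformly_continuous_on {0..T} (\<lambda>t. D t w)" by (rule compact_uniformly_continuous) simp
    then obtain d where d: "d > 0" "\<And>v v'. v \<in> {0..T} \<Longrightarrow> v' \<in> {0..T} \<Longrightarrow> dist v v' < d \<Longrightarrow> dist (D v w) (D v' w) < e / 2"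
      unfolding uniformly_continuous_on_def using e half_gt_zero by metis
    have "(\<lambda>n. T * (1 / 2) ^ n) \<longlonglongrightarrow> T * 0" by (intro tendsto_mult_left LIMSEQ_power_zero) simp
    then have "eventually (\<lambda>n. T * (1 / 2) ^ n < d) sequentially" using d(1) order_tendstoD(2) by fastforce
    then obtain N where "\<And>n. n \<ge> N \<Longrightarrow> T * (1 / 2) ^ n < d" unfolding eventually_sequentially by blast
    then have N: "T / 2 ^ n < d" if "n \<ge> N" for n using that by (simp add: power_one_over)
    have "\<bar>D t w - D u w\<bar> - 2 * (e / 2) \<le> V t w - V u w"
    proof (rule LIMSEQ_le_const)
      show "(\<lambda>n. Vn n t w - Vn n u w) \<longlonglongrightarrow> V t w - V u w" using w ut by (intro tendsto_diff lim) auto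
      show "\<exists>N. \<forall>n\<ge>N. \<bar>D t w - D u w\<bar> - 2 * (e / 2) \<le> Vn n t w - Vn n u w"
      proof (intro exI allI impI db(2)[OF dW[OF w] ut])
        fix n v v' assume "N \<le> n" "0 \<le> v" "v \<le> v'" "v' \<le> T" "v' - v \<le> T / 2 ^ n"
        then show "\<bar>D v' w - D v w\<bar> \<le> e / 2" using d(2)[of v' v] N[of n] by (auto simp: dist_real_def)
      qed
    qed
    then show "\<bar>D t w - D u w\<bar> \<le> V t w - V u w + e" by simp
  qed
  show thesis
  proof (rule that[of V])
    fix t assume t: "t \<in> {0..T}"
    have "Vn n t \<in> borel_measurable (F t)" for n
      unfolding Vn_def dyadic_variation_def
    proof (intro borel_measurable_sum borel_measurable_abs borel_measurable_diff)
      have "0 \<le> dyad T n i" for i using T_pos by (simp add: dyad_def)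
      then show "(\<lambda>w. D (min t (dyad T n i)) w) \<in> borel_measurable (F t)" "(\<lambda>w. D (min t (dyad T n (Suc i))) w) \<in> borel_measurable (F t)" for i
        using t by (auto intro!: F_measurable_mono[OF Da])
    qed
    then show "V t \<in> borel_measurable (F t)"
      by (rule borel_measurable_LIMSEQ_real[where u="\<lambda>n. Vn n t", rotated]) (use lim t in auto)
  next
    fix w assume w: "w \<in> space M"
    have Wc: "continuous_on {0..T} (W w)"
      unfolding W_def by (rule continuous_on_initial_integral[OF set_integrable_abs[OF a[OF w]]])
    show "continuous_on {0..T} (\<lambda>t. V t w)"
      unfolding continuous_on_iff
    proof (intro ballI allI impI)
      fix x e :: real assume x: "x \<in> {0..T}" and e: "0 < e"
      obtain d where d: "d > 0" "\<And>x'. x' \<in> {0..T} \<Longrightarrow> dist x' x < d \<Longrightarrow> dist (W w x') (W w x) < e"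
        using Wc x e unfolding continuous_on_iff by meson
      have "dist (V x' w) (V x w) < e" if "x' \<in> {0..T}" "dist x' x < d" for x'
      proof (cases "x \<le> x'")
        case True
        then show ?thesis using Vdiff[OF w, of x x'] Vlow[OF w, of x x'] d(2)[OF that] x that(1) by (auto simp: dist_real_def)
      next
        case False
        then show ?thesis using Vdiff[OF w, of x' x] Vlow[OF w, of x' x] d(2)[OF that] x that(1) by (auto simp: dist_real_def)
      qed
      then show "\<exists>d>0. \<forall>x'\<in>{0..T}. dist x' x < d \<longrightarrow> dist (V x' w) (V x w) < e" using d(1) by blast
    qed
    have "Vn n 0 w = 0" for n
      using T_pos by (simp add: Vn_def dyadic_variation_def dyad_def min_absorb1)
    then show "V 0 w = 0" using LIMSEQ_unique[OF lim[OF w, of 0]] T_pos by simp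
    fix t assume t: "t \<in> {0..T}"
    show "0 \<le> V t w"
      by (rule LIMSEQ_le_const[OF lim[OF w t]]) (auto simp: Vn_def dyadic_variation_def sum_nonneg)
  qed (rule Vlow)
qed

end

text \<open>Class (D) enters in two ways: through integrability at stopping times, and through the
  limit of E |y| along stopping times that eventually equal \<open>T\<close>, where \<open>y\<close>
  vanishes.\<close>

locale class_D_semimart = semimart M T B J H P I z y a V for M :: "'w measure" and T and B :: "real \<Rightarrow> 'w \<Rightarrow> real^'d"
    and J H P I z y a V +
  assumes V_adapted: "\<And>t. t \<in> {0..T} \<Longrightarrow> V t \<in> borel_measurable (F t)"
    and V_cont: "\<And>w. w \<in> space M \<Longrightarrow> continuous_on {0..T} (\<lambda>t. V t w)"
    and V_0: "\<And>w. w \<in> space M \<Longrightarrow> V 0 w = 0"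
    and y_T: "\<And>w. w \<in> space M \<Longrightarrow> y T w = 0"
    and y_integrable: "\<And>\<tau>. bounded_stopping \<tau> \<Longrightarrow> integrable M (\<lambda>w. y (\<tau> w) w)"
    and class_D_limit: "\<And>\<tau>. (\<And>k::nat. bounded_stopping (\<tau> k)) \<Longrightarrow>
        (\<And>w. w \<in> space M \<Longrightarrow> eventually (\<lambda>k. \<tau> k w = T) sequentially) \<Longrightarrow>
        (\<lambda>k. E (\<lambda>w. \<bar>y (\<tau> k w) w\<bar>)) \<longlonglongrightarrow> 0"
begin

lemma y_time_integrable: "t \<in> {0..T} \<Longrightarrow> integrable M (y t)"
  using y_integrable[of "\<lambda>_. t"] stopping_time_const[of F t] by (simp add: bounded_stopping_def)

text \<open>The hitting times of \<open>R\<close> bound all processes at once. What is left at the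
  stopped time is compared with \<open>\<phi> 0\<close> by linear growth of \<open>\<phi>\<close>,
  and class (D) sends the difference to zero; faster growth would not be controlled here.\<close>

lemma global_ito_inequality:
  fixes \<phi> \<phi>' \<phi>'' :: "real \<Rightarrow> real" and \<Theta> :: "real \<Rightarrow> 'w \<Rightarrow> real"
  assumes d1: "\<And>x. (\<phi> has_real_derivative \<phi>' x) (at x)" and d2: "\<And>x. (\<phi>' has_real_derivative \<phi>'' x) (at x)"
    and c2: "continuous_on UNIV \<phi>''" and lip: "\<And>x. \<bar>\<phi> x - \<phi> 0\<bar> \<le> Lp * \<bar>x\<bar>"
    and Th: "integrable (TM) (\<lambda>(r, w). indicator {0..T} r * \<Theta> r w)"
    and ineq: "AE w in M. AE r in lborel. r \<in> {0..T} \<longrightarrow> \<phi>' (y r w) * a r w - \<phi>'' (y r w) / 2 * (norm (z r w))\<^sup>2 \<le> \<Theta> r w"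
    and s: "s \<in> {0..T}"
    and Psi: "\<Psi> \<in> borel_measurable (F s)" "\<And>w. w \<in> space M \<Longrightarrow> 0 \<le> \<Psi> w \<and> \<Psi> w \<le> C'"
  shows "E (\<lambda>w. \<Psi> w * \<phi> (y s w)) \<le> \<phi> 0 * E \<Psi> + E (\<lambda>w. \<Psi> w * (LBINT r:{s<..T}. \<Theta> r w))"
proof (cases "s = T")
  case True
  have "E (\<lambda>w. \<Psi> w * \<phi> (y s w)) = E (\<lambda>w. \<Psi> w * \<phi> 0)"
    using y_T True by (intro Bochner_Integration.integral_cong) auto
  then show ?thesis using True by (simp add: set_lebesgue_integral_def mult.commute)
next
  case False
  then have s': "0 \<le> s" "s < T" using s by auto
  have Lp: "0 \<le> Lp" using order_trans[OF abs_ge_zero lip[of 1]] by simp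
  have C'0: "0 \<le> C'" using Psi(2) not_empty by (metis all_not_in_conv order_trans)
  have \<phi>m[measurable]: "\<phi> \<in> borel_measurable borel"
    by (intro borel_measurable_continuous_onI continuous_at_imp_continuous_on) (simp add: DERIV_isCont[OF d1])
  have Pm[measurable]: "\<Psi> \<in> borel_measurable M" using F_measurable_M[OF Psi(1)] s by simp
  define R where "R t w = \<bar>y t w\<bar> + \<bar>I t w\<bar> + V t w + Q t w" for t w
  have Q0: "0 \<le> Q t w" for t w by (simp add: Q_def set_lebesgue_integral_def)
  have Rc: "continuous_on {0..T} (\<lambda>t. R t w)" if "w \<in> space M" for w
    unfolding R_def using y_cont[OF that] I_cont[OF that] V_cont[OF that] Q_continuous[OF that] by (intro continuous_intros)
  have stc: "bounded_stopping (\<lambda>_. T)" using stopping_time_const[of F T] T_pos by (simp add: bounded_stopping_def)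
  have Qa: "Q t \<in> borel_measurable (F t)" if "t \<in> {0..T}" for t
    using Q_stopped_measurable[OF stc that] that by (simp add: min_absorb1)
  have Ra: "R t \<in> borel_measurable (F t)" if "t \<in> {0..T}" for t
    unfolding R_def using progressive_adapted[OF y_prog that] progressive_adapted[OF I_prog that] V_adapted[OF that] Qa[OF that]
    by measurable
  define \<tau> where "\<tau> k = hit R (real k)" for k
  have \<tau>: "bounded_stopping (\<tau> k)" for k unfolding \<tau>_def by (rule hit_stopping[OF Rc Ra])
  have \<tau>r: "0 \<le> \<tau> k w" "\<tau> k w \<le> T" for k w unfolding \<tau>_def by (rule hit_range)+
  have ev: "eventually (\<lambda>k. \<tau> k w = T) sequentially" if "w \<in> space M" for w
    unfolding \<tau>_def using that by (intro hit_eventually_T[where R=R] Rc)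
  have RK: "R r w \<le> real k" if "w \<in> space M" "0 < \<tau> k w" "0 \<le> r" "r \<le> \<tau> k w" for w r k
    using that unfolding \<tau>_def by (intro until_hit[where R=R] Rc) auto
  have comp: "\<bar>y r w\<bar> \<le> R r w" "\<bar>I r w\<bar> \<le> R r w" "V r w \<le> R r w" "Q r w \<le> R r w"
    if "w \<in> space M" "0 \<le> r" "r \<le> T" for w r
    using V_nonneg[of w r] Q0[of r w] that unfolding R_def by auto
  \<comment> \<open>Switching the weight off on paths stopped by time \<open>s\<close> is measurable
    at time \<open>s\<close> and meets the requirement of the local inequality; for large
    \<open>k\<close> nothing is switched off.\<close>
  define \<Psi>k where "\<Psi>k k w = (if s < \<tau> k w then \<Psi> w else 0)" for k w
  have Pk: "\<Psi>k k \<in> borel_measurable (F s)" "\<And>w. w \<in> space M \<Longrightarrow> 0 \<le> \<Psi>k k w \<and> \<Psi>k k w \<le> C'"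
    "\<And>w. w \<in> space M \<Longrightarrow> \<tau> k w \<le> s \<Longrightarrow> \<Psi>k k w = 0" for k
  proof -
    show "\<Psi>k k \<in> borel_measurable (F s)"
      using stopping_pred[OF \<tau>[of k], of s] Psi(1) unfolding \<Psi>k_def[abs_def] by measurable
  qed (use Psi C'0 in \<open>auto simp: \<Psi>k_def\<close>)
  have Pkm[measurable]: "\<Psi>k k \<in> borel_measurable M" for k using F_measurable_M[OF Pk(1)] s by simp
  define \<theta> where "\<theta> k w = (LBINT r:{s<..\<tau> k w}. \<Theta> r w)" for k w
  have \<theta>i: "integrable M (\<theta> k)" for k unfolding \<theta>_def by (rule stopped_integral_integrable[OF Th \<tau> s'(1)])
  have ym[measurable]: "y s \<in> borel_measurable M" using y_time_integrable[OF s] by auto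
  have ytm[measurable]: "(\<lambda>w. y (\<tau> k w) w) \<in> borel_measurable M" for k using y_integrable[OF \<tau>] by auto
  have \<phi>b: "\<bar>\<phi> x\<bar> \<le> \<bar>\<phi> 0\<bar> + Lp * \<bar>x\<bar>" for x using lip[of x] by linarith
  have step: "E (\<lambda>w. \<Psi>k k w * \<phi> (y s w)) \<le> \<phi> 0 * E (\<Psi>k k) + C' * Lp * E (\<lambda>w. \<bar>y (\<tau> k w) w\<bar>)
      + E (\<lambda>w. \<Psi>k k w * \<theta> k w)" for k
  proof -
    have bI: "\<bar>I r w\<bar> \<le> real k" if w: "w \<in> space M" and r: "0 \<le> r" "r \<le> \<tau> k w" for w r
    proof (cases "0 < \<tau> k w")
      case True then show ?thesis using RK[OF w True r] comp(2)[OF w r(1) order_trans[OF r(2) \<tau>r(2)]] by linarith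
    next
      case False
      then have "r = 0" using r by linarith
      then show ?thesis using I_0[OF w] by simp
    qed
    have bQV: "Q (\<tau> k w) w \<le> real k \<and> V (\<tau> k w) w \<le> real k" if w: "w \<in> space M" for w
    proof (cases "0 < \<tau> k w")
      case True then show ?thesis using RK[OF w True \<tau>r(1) order_refl] comp(3,4)[OF w \<tau>r(1)[of k w] \<tau>r(2)[of k w]] by linarith
    next
      case False
      then have "\<tau> k w = 0" using \<tau>r(1)[of k w] by simp
      then show ?thesis using Q_0 V_0[OF w] by simp
    qed
    have bY: "\<bar>y r w\<bar> \<le> real k" if w: "w \<in> space M" and r: "0 < \<tau> k w" "0 \<le> r" "r \<le> \<tau> k w" for w r
      using RK[OF w r] comp(1)[OF w r(2) order_trans[OF r(3) \<tau>r(2)]] by linarith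
    have "E (\<lambda>w. \<Psi>k k w * \<phi> (y s w)) \<le> E (\<lambda>w. \<Psi>k k w * \<phi> (y (\<tau> k w) w)) + E (\<lambda>w. \<Psi>k k w * \<theta> k w)"
      unfolding \<theta>_def
      by (rule ito_inequality[where K="real k", OF s' \<tau> _ bI bQV[THEN conjunct1] bQV[THEN conjunct2] bY Pk d1 d2 c2 Th ineq]) auto
    also have "E (\<lambda>w. \<Psi>k k w * \<phi> (y (\<tau> k w) w)) \<le> E (\<lambda>w. \<phi> 0 * \<Psi>k k w + C' * Lp * \<bar>y (\<tau> k w) w\<bar>)"
    proof (rule integral_mono)
      have i1: "integrable M (\<lambda>w. \<bar>y (\<tau> k w) w\<bar>)" using y_integrable[OF \<tau>] by simp
      have i2: "integrable M (\<Psi>k k)" using Pk(2) by (intro integrable_bounded[where C=C']) auto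
      show "integrable M (\<lambda>w. \<phi> 0 * \<Psi>k k w + C' * Lp * \<bar>y (\<tau> k w) w\<bar>)" using i1 i2 by auto
      show "integrable M (\<lambda>w. \<Psi>k k w * \<phi> (y (\<tau> k w) w))"
      proof (rule Bochner_Integration.integrable_bound)
        show "integrable M (\<lambda>w. C' * (\<bar>\<phi> 0\<bar> + Lp * \<bar>y (\<tau> k w) w\<bar>))" using i1 by auto
        show "AE w in M. norm (\<Psi>k k w * \<phi> (y (\<tau> k w) w)) \<le> norm (C' * (\<bar>\<phi> 0\<bar> + Lp * \<bar>y (\<tau> k w) w\<bar>))"
          using Pk(2)[of _ k] \<phi>b C'0 Lp by (intro AE_I2) (auto simp: abs_mult intro!: mult_mono)
      qed measurable
      fix w assume w: "w \<in> space M"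
      have "\<Psi>k k w * \<phi> (y (\<tau> k w) w) \<le> \<Psi>k k w * (\<phi> 0 + Lp * \<bar>y (\<tau> k w) w\<bar>)"
        using Pk(2)[OF w, of k] lip[of "y (\<tau> k w) w"] by (intro mult_left_mono) auto
      moreover have "\<Psi>k k w * (Lp * \<bar>y (\<tau> k w) w\<bar>) \<le> C' * (Lp * \<bar>y (\<tau> k w) w\<bar>)"
        using Pk(2)[OF w, of k] Lp by (intro mult_right_mono) auto
      ultimately show "\<Psi>k k w * \<phi> (y (\<tau> k w) w) \<le> \<phi> 0 * \<Psi>k k w + C' * Lp * \<bar>y (\<tau> k w) w\<bar>"
        by (simp add: algebra_simps)
    qed
    also have "\<dots> = \<phi> 0 * E (\<Psi>k k) + C' * Lp * E (\<lambda>w. \<bar>y (\<tau> k w) w\<bar>)"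
    proof -
      have "integrable M (\<lambda>w. \<bar>y (\<tau> k w) w\<bar>)" "integrable M (\<Psi>k k)"
        using y_integrable[OF \<tau>] Pk(2) by (auto intro!: integrable_bounded[where C=C'])
      then show ?thesis by simp
    qed
    finally show ?thesis by simp
  qed
  have evP: "eventually (\<lambda>k. \<Psi>k k w = \<Psi> w \<and> \<theta> k w = (LBINT r:{s<..T}. \<Theta> r w)) sequentially" if w: "w \<in> space M" for w
    using ev[OF w] by eventually_elim (use s' in \<open>auto simp: \<Psi>k_def \<theta>_def\<close>)
  have l1: "(\<lambda>k. E (\<Psi>k k)) \<longlonglongrightarrow> E \<Psi>"
  proof (rule integral_dominated_convergence[where w="\<lambda>_. C'"])
    show "AE w in M. (\<lambda>k. \<Psi>k k w) \<longlonglongrightarrow> \<Psi> w"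
      by (intro AE_I2 tendsto_eventually eventually_mono[OF evP]) auto
  qed (use Pk(2) in auto)
  have l2: "(\<lambda>k. E (\<lambda>w. \<Psi>k k w * \<phi> (y s w))) \<longlonglongrightarrow> E (\<lambda>w. \<Psi> w * \<phi> (y s w))"
  proof (rule integral_dominated_convergence[where w="\<lambda>w. C' * (\<bar>\<phi> 0\<bar> + Lp * \<bar>y s w\<bar>)"])
    show "AE w in M. (\<lambda>k. \<Psi>k k w * \<phi> (y s w)) \<longlonglongrightarrow> \<Psi> w * \<phi> (y s w)"
      by (intro AE_I2 tendsto_eventually eventually_mono[OF evP]) auto
    show "integrable M (\<lambda>w. C' * (\<bar>\<phi> 0\<bar> + Lp * \<bar>y s w\<bar>))" using y_time_integrable[OF s] by auto
    show "AE w in M. norm (\<Psi>k k w * \<phi> (y s w)) \<le> C' * (\<bar>\<phi> 0\<bar> + Lp * \<bar>y s w\<bar>)" for k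
      using Pk(2)[of _ k] \<phi>b C'0 Lp by (intro AE_I2) (auto simp: abs_mult intro!: mult_mono)
  qed measurable
  interpret LM: pair_sigma_finite lborel M by unfold_locales
  \<comment> \<open>An integrable majorant of all the stopped integrals, for dominated convergence
    in \<open>k\<close>.\<close>
  define W where "W w = (\<integral>r. \<bar>indicator {0..T} r * \<Theta> r w\<bar> \<partial>lborel)" for w
  have Wi: "integrable M W"
    unfolding W_def
  proof (rule LM.integrable_snd)
    show "integrable (TM) (\<lambda>(r, w). \<bar>indicator {0..T} r * \<Theta> r w\<bar>)"
      using integrable_abs[OF Th] by (simp add: split_beta')
  qed
  have Thsec: "AE w in M. integrable lborel (\<lambda>r. indicator {0..T} r * \<Theta> r w)"
    using LM.AE_integrable_snd[OF Th] by simp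
  have \<theta>W: "AE w in M. \<bar>\<theta> k w\<bar> \<le> W w" for k
    using Thsec
  proof eventually_elim
    case (elim w)
    have "set_integrable lborel {0..T} (\<lambda>r. \<Theta> r w)" using elim by (simp add: set_integrable_def)
    then have ab: "set_integrable lborel {0..T} (\<lambda>r. \<bar>\<Theta> r w\<bar>)" and i: "set_integrable lborel {s<..\<tau> k w} (\<lambda>r. \<Theta> r w)"
      using s' \<tau>r(2)[of k w] by (auto intro!: set_integrable_abs elim!: set_integrable_subset)
    have "norm (\<theta> k w) \<le> (LBINT r:{s<..\<tau> k w}. norm (\<Theta> r w))" unfolding \<theta>_def by (rule set_integral_norm_bound[OF i])
    also have "\<dots> \<le> (LBINT r:{0..T}. norm (\<Theta> r w))"
      using s' \<tau>r(2)[of k w] ab by (intro set_integral_mono_subset) auto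
    also have "\<dots> = W w" unfolding W_def set_lebesgue_integral_def
      by (intro Bochner_Integration.integral_cong) (auto simp: abs_mult)
    finally show ?case by simp
  qed
  have [measurable]: "\<theta> k \<in> borel_measurable M" for k using \<theta>i by auto
  have [measurable]: "(\<lambda>w. LBINT r:{s<..T}. \<Theta> r w) \<in> borel_measurable M"
    using stopped_integral_integrable[OF Th stc s'(1)] by auto
  have l3: "(\<lambda>k. E (\<lambda>w. \<Psi>k k w * \<theta> k w)) \<longlonglongrightarrow> E (\<lambda>w. \<Psi> w * (LBINT r:{s<..T}. \<Theta> r w))"
  proof (rule integral_dominated_convergence[where w="\<lambda>w. C' * W w"])
    show "AE w in M. (\<lambda>k. \<Psi>k k w * \<theta> k w) \<longlonglongrightarrow> \<Psi> w * (LBINT r:{s<..T}. \<Theta> r w)"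
      by (intro AE_I2 tendsto_eventually eventually_mono[OF evP]) auto
    show "integrable M (\<lambda>w. C' * W w)" using Wi by simp
    show "AE w in M. norm (\<Psi>k k w * \<theta> k w) \<le> C' * W w" for k
      using \<theta>W[of k] AE_space by eventually_elim (use Pk(2)[of _ k] C'0 in \<open>auto simp: abs_mult intro!: mult_mono\<close>)
  qed measurable
  have "(\<lambda>k. \<phi> 0 * E (\<Psi>k k) + C' * Lp * E (\<lambda>w. \<bar>y (\<tau> k w) w\<bar>) + E (\<lambda>w. \<Psi>k k w * \<theta> k w))
     \<longlonglongrightarrow> \<phi> 0 * E \<Psi> + C' * Lp * 0 + E (\<lambda>w. \<Psi> w * (LBINT r:{s<..T}. \<Theta> r w))"
    by (intro tendsto_intros l1 l3 class_D_limit \<tau> ev)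
  from LIMSEQ_le[OF l2 this] show ?thesis using step by auto
qed

end

section \<open>Powers and Gronwall's inequality\<close>

lemma integral_exp_le:
  fixes k :: real
  assumes k: "k > 0" and r: "r \<le> T"
  shows "set_integrable lborel {r<..T} (\<lambda>v. exp (k * (T - v)))"
    "(LBINT v:{r<..T}. exp (k * (T - v))) \<le> exp (k * (T - r)) / k"
proof -
  have "((\<lambda>v. exp (k * (T - v))) has_integral (- exp (k * (T - T)) / k - (- exp (k * (T - r)) / k))) {r..T}"
    using k by (intro fundamental_theorem_of_calculus[OF r])
      (auto intro!: derivative_eq_intros simp flip: has_real_derivative_iff_has_vector_derivative)
  then have hi: "integral {r..T} (\<lambda>v. exp (k * (T - v))) = (exp (k * (T - r)) - 1) / k"
    using k by (simp add: integral_unique diff_divide_distrib)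
  have i: "set_integrable lborel {r..T} (\<lambda>v. exp (k * (T - v)))"
    by (intro borel_integrable_atLeastAtMost' continuous_intros)
  then show "set_integrable lborel {r<..T} (\<lambda>v. exp (k * (T - v)))" by (rule set_integrable_subset) auto
  have "(LBINT v:{r<..T}. exp (k * (T - v))) \<le> (LBINT v:{r..T}. exp (k * (T - v)))"
    using i by (intro set_integral_mono_subset) auto
  also have "\<dots> = (exp (k * (T - r)) - 1) / k" using set_borel_integral_eq_integral(2)[OF i] hi by simp
  also have "\<dots> \<le> exp (k * (T - r)) / k" using k by (simp add: divide_right_mono)
  finally show "(LBINT v:{r<..T}. exp (k * (T - v))) \<le> exp (k * (T - r)) / k" .
qed

text \<open>In the supremum weighted by e^(-2 m (T - r)) the integral term is a contraction with
  factor 1/2. Boundedness of \<open>u\<close> makes the supremum S finite, so S \<le> c + S / 2 can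
  be solved for S; this is the origin of the factor 2 in the conclusion.\<close>

lemma gronwall_backward:
  fixes u :: "real \<Rightarrow> real"
  assumes sT: "s \<le> T" and u: "\<And>r. r \<in> {s..T} \<Longrightarrow> 0 \<le> u r \<and> u r \<le> U"
    and ui: "set_integrable lborel {s<..T} u" and m: "m > 0"
    and ineq: "\<And>r. r \<in> {s..T} \<Longrightarrow> u r \<le> c + m * (LBINT v:{r<..T}. u v)"
  shows "u s \<le> 2 * c * exp (2 * m * (T - s))"
proof -
  define e where "e r = exp (2 * m * (T - r))" for r
  have e1: "e r \<ge> 1" if "r \<le> T" for r using m that by (simp add: e_def)
  have e0: "e r > 0" for r by (simp add: e_def)
  define S where "S = (SUP r\<in>{s..T}. u r / e r)"
  have bdd: "bdd_above ((\<lambda>r. u r / e r) ` {s..T})"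
  proof (rule bdd_aboveI)
    fix x assume "x \<in> (\<lambda>r. u r / e r) ` {s..T}"
    then obtain r where r: "r \<in> {s..T}" "x = u r / e r" by auto
    have "u r / e r \<le> u r" using u[OF r(1)] e1[of r] r(1) by (auto simp: divide_le_eq mult_le_cancel_left1)
    then show "x \<le> U" using u[OF r(1)] r by auto
  qed
  have le: "u r \<le> S * e r" if "r \<in> {s..T}" for r
  proof -
    have "u r / e r \<le> S" unfolding S_def using that bdd by (intro cSUP_upper)
    then show ?thesis using e0[of r] by (simp add: pos_divide_le_eq)
  qed
  have S0: "0 \<le> S" using le[of s] u[of s] sT e0[of s] zero_le_mult_iff[of S "e s"] by (auto intro: order_trans)
  have "S \<le> c + S / 2 \<or> False"
  proof
    have "u r / e r \<le> max c 0 + S / 2" if r: "r \<in> {s..T}" for r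
    proof -
      have sub: "{r<..T} \<subseteq> {s<..T}" using r by auto
      have "(LBINT v:{r<..T}. u v) \<le> (LBINT v:{r<..T}. S * e v)"
      proof (rule set_integral_mono)
        show "set_integrable lborel {r<..T} u" using set_integrable_subset[OF ui _ sub] by simp
        show "set_integrable lborel {r<..T} (\<lambda>v. S * e v)"
          using integral_exp_le(1)[of "2 * m" r T] m r by (simp add: e_def)
      qed (use le r in auto)
      also have "\<dots> = S * (LBINT v:{r<..T}. e v)" by simp
      also have "\<dots> \<le> S * (e r / (2 * m))"
        unfolding e_def using integral_exp_le(2)[of "2 * m" r T] m r S0 by (intro mult_left_mono) auto
      finally have "m * (LBINT v:{r<..T}. u v) \<le> m * (S * (e r / (2 * m)))" using m by (intro mult_left_mono) auto
      also have "\<dots> = S * e r / 2" using m by simp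
      finally have "u r \<le> c + S * e r / 2" using ineq[OF r] by simp
      also have "\<dots> \<le> max c 0 * e r + S * e r / 2"
      proof -
        have "max c 0 * 1 \<le> max c 0 * e r" using e1[of r] r by (intro mult_left_mono) auto
        then show ?thesis by simp
      qed
      also have "\<dots> = (max c 0 + S / 2) * e r" by (simp add: distrib_right)
      finally show ?thesis using e0[of r] by (simp add: pos_divide_le_eq)
    qed
    then have "S \<le> max c 0 + S / 2" unfolding S_def using sT by (intro cSUP_least) auto
    moreover have "0 \<le> c"
    proof -
      have "0 \<le> c + m * (LBINT v:{T<..T}. u v)" using u[of T] ineq[of T] sT by auto
      then show ?thesis by (simp add: set_lebesgue_integral_def)
    qed
    ultimately show "S \<le> c + S / 2" by simp
  qed
  then have "S \<le> 2 * c" by simp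
  then have "S * e s \<le> 2 * c * e s" using e0[of s] by (intro mult_right_mono) auto
  then have "u s \<le> 2 * c * e s" using order_trans[OF le[of s]] sT by simp
  then show ?thesis unfolding e_def .
qed

text \<open>A case split does instead of convexity, as the constants are free: if G is at most
  \<eta> b the first term alone dominates, otherwise b is at most G / \<eta> and the second
  does.\<close>

lemma young_powr:
  fixes b G :: real
  assumes "0 \<le> b" "0 \<le> G" "1 < q" "0 < \<eta>"
  shows "b powr (q - 1) * G \<le> \<eta> * b powr q + \<eta> powr (1 - q) * G powr q"
proof (cases "G \<le> \<eta> * b")
  case True
  have "b powr (q - 1) * G \<le> b powr (q - 1) * (\<eta> * b)" using True by (intro mult_left_mono) auto
  also have "\<dots> = \<eta> * b powr q"
    using assms by (cases "b = 0") (auto simp: powr_diff)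
  finally show ?thesis using assms by (smt (verit) mult_nonneg_nonneg powr_ge_zero)
next
  case False
  then have G0: "G > 0" using assms by (smt (verit) mult_nonneg_nonneg)
  have "b \<le> G / \<eta>" using False assms by (simp add: pos_le_divide_eq mult.commute)
  then have "b powr (q - 1) \<le> (G / \<eta>) powr (q - 1)" using assms by (intro powr_mono2) auto
  then have "b powr (q - 1) * G \<le> (G / \<eta>) powr (q - 1) * G" using G0 by (intro mult_right_mono) auto
  also have "\<dots> = \<eta> powr (1 - q) * G powr q"
    using G0 assms by (simp add: powr_divide powr_diff field_simps)
  finally show ?thesis using assms by (smt (verit) mult_nonneg_nonneg powr_ge_zero)
qed

text \<open>\<open>trunc_pow q N w = w\<^sup>q (1 + w / N)\<^sup>1\<^sup>-\<^sup>q\<close> behaves like \<open>w\<^sup>q\<close> for \<open>w \<le> N\<close> and grows linearly; its second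
  derivative is the single positive term \<open>q (q - 1) trunc_pow q N w N\<^sup>2 / (w\<^sup>2 (N + w)\<^sup>2)\<close>.\<close>

definition trunc_pow :: "real \<Rightarrow> real \<Rightarrow> real \<Rightarrow> real" where
  "trunc_pow q N w = w powr q * (1 + w / N) powr (1 - q)"

text \<open>The logarithmic derivative of \<open>trunc_pow\<close>.\<close>

definition trunc_rate :: "real \<Rightarrow> real \<Rightarrow> real \<Rightarrow> real" where
  "trunc_rate q N w = q / w + (1 - q) / (N + w)"

definition smooth_abs :: "real \<Rightarrow> real \<Rightarrow> real" where "smooth_abs e x = sqrt (x\<^sup>2 + e\<^sup>2)"

lemma smooth_abs_facts:
  assumes "e > 0"
  shows "smooth_abs e x > 0" "\<bar>x\<bar> \<le> smooth_abs e x" "smooth_abs e x \<le> \<bar>x\<bar> + e" "(smooth_abs e x)\<^sup>2 = x\<^sup>2 + e\<^sup>2"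
    "smooth_abs e 0 = e" "e \<le> smooth_abs e x"
    "(smooth_abs e has_real_derivative x / smooth_abs e x) (at x)"
    "((\<lambda>x. x / smooth_abs e x) has_real_derivative e\<^sup>2 / smooth_abs e x ^ 3) (at x)"
    "continuous_on UNIV (smooth_abs e)"
proof -
  have pos: "x\<^sup>2 + e\<^sup>2 > 0" for x using assms by (simp add: add_nonneg_pos)
  show p: "smooth_abs e x > 0" for x using pos by (simp add: smooth_abs_def)
  show "\<bar>x\<bar> \<le> smooth_abs e x" unfolding smooth_abs_def by (rule real_le_rsqrt) simp
  show "smooth_abs e x \<le> \<bar>x\<bar> + e" unfolding smooth_abs_def using assms by (intro real_le_lsqrt) (auto simp: power2_sum)
  show sq: "(smooth_abs e x)\<^sup>2 = x\<^sup>2 + e\<^sup>2" for x using pos[of x] by (simp add: smooth_abs_def)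
  show "smooth_abs e 0 = e" using assms by (simp add: smooth_abs_def)
  show "e \<le> smooth_abs e x" unfolding smooth_abs_def by (rule real_le_rsqrt) simp
  show d: "(smooth_abs e has_real_derivative x / smooth_abs e x) (at x)" for x
    unfolding smooth_abs_def[abs_def] using pos[of x] by (auto intro!: derivative_eq_intros simp: field_simps)
  have "((\<lambda>x. x / smooth_abs e x) has_real_derivative (1 * smooth_abs e x - x * (x / smooth_abs e x)) / (smooth_abs e x * smooth_abs e x)) (at x)"
    using p[of x] by (intro DERIV_divide DERIV_ident d) auto
  moreover have "(1 * smooth_abs e x - x * (x / smooth_abs e x)) / (smooth_abs e x * smooth_abs e x) = ((smooth_abs e x)\<^sup>2 - x\<^sup>2) / smooth_abs e x ^ 3"
    using p[of x] by (simp add: field_simps power2_eq_square power3_eq_cube)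
  ultimately show "((\<lambda>x. x / smooth_abs e x) has_real_derivative e\<^sup>2 / smooth_abs e x ^ 3) (at x)" by (simp add: sq)
  show "continuous_on UNIV (smooth_abs e)" unfolding smooth_abs_def[abs_def] by (intro continuous_intros)
qed

context
  fixes q N :: real
  assumes q: "1 < q" "q < 2" and N: "N \<ge> 1"
begin

text \<open>With the logarithmic derivative r the second derivative is \<open>trunc_pow\<close>
  times r^2 + r'. Because the coefficients q and 1 - q add up to 1, this factor is q (q - 1) times
  the square of 1 / w - 1 / (N + w).\<close>

lemma trunc_pow_facts:
  assumes w: "w > 0"
  shows "trunc_pow q N w > 0" "trunc_pow q N w \<le> w powr q" "w \<le> N \<Longrightarrow> 2 powr (1 - q) * w powr q \<le> trunc_pow q N w"
    "trunc_pow q N w \<le> N powr (q - 1) * w"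
    "0 < trunc_rate q N w" "trunc_rate q N w \<le> q / w" "1 / w \<le> trunc_rate q N w"
    "(trunc_rate q N w)\<^sup>2 + (- q / w\<^sup>2 - (1 - q) / (N + w)\<^sup>2) = q * (q - 1) * N\<^sup>2 / (w\<^sup>2 * (N + w)\<^sup>2)"
    "(trunc_pow q N has_real_derivative trunc_pow q N w * trunc_rate q N w) (at w)"
    "(trunc_rate q N has_real_derivative (- q / w\<^sup>2 - (1 - q) / (N + w)\<^sup>2)) (at w)"
proof -
  have N0: "N > 0" "N + w > 0" "1 + w / N > 1" using N w by (auto intro: add_pos_pos)
  have "1 + w / N \<noteq> 0" using N0(3) by linarith
  then show "trunc_pow q N w > 0" unfolding trunc_pow_def using w by (intro mult_pos_pos) auto
  have "(1 + w / N) powr (1 - q) \<le> (1 + w / N) powr 0" using N0 q by (intro powr_mono) auto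
  then show "trunc_pow q N w \<le> w powr q" unfolding trunc_pow_def using w N0 by (intro mult_left_le) auto
  show "2 powr (1 - q) * w powr q \<le> trunc_pow q N w" if "w \<le> N"
  proof -
    have "1 + w / N \<le> 2" using that N0 by simp
    then have "2 powr (1 - q) \<le> (1 + w / N) powr (1 - q)" using N0 q by (intro powr_mono2') auto
    then show ?thesis unfolding trunc_pow_def by (simp add: mult.commute mult_left_mono)
  qed
  show "trunc_pow q N w \<le> N powr (q - 1) * w"
  proof -
    have "w powr q * v powr (1 - q) = w * (w / v) powr (q - 1)" if "v > 0" for v
      using w that by (simp add: powr_divide powr_diff field_simps)
    then have "w powr q * (1 + w / N) powr (1 - q) = w * (w / (1 + w / N)) powr (q - 1)" using N0(3) by simp
    also have "\<dots> \<le> w * N powr (q - 1)"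
    proof (intro mult_left_mono powr_mono2)
      have "w / (1 + w / N) = N * (w / (N + w))" using N0 w by (simp add: field_simps)
      also have "\<dots> \<le> N * 1" using N0 w by (intro mult_left_mono) auto
      finally show "w / (1 + w / N) \<le> N" by simp
    qed (use q w N0 in auto)
    finally show ?thesis by (simp add: trunc_pow_def mult.commute)
  qed
  have r: "trunc_rate q N w = (q * N + w) / (w * (N + w))"
    unfolding trunc_rate_def using w N0 by (simp add: field_simps)
  show "0 < trunc_rate q N w" unfolding r using w N0 q by (intro divide_pos_pos mult_pos_pos add_pos_pos) auto
  have "(1 - q) / (N + w) \<le> 0" using q N0 by (simp add: divide_nonpos_pos)
  then show "trunc_rate q N w \<le> q / w" by (simp add: trunc_rate_def)
  show "1 / w \<le> trunc_rate q N w"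
  proof -
    have "1 / w = (N + w) / (w * (N + w))" using w N0 by simp
    also have "\<dots> \<le> (q * N + w) / (w * (N + w))" using w N0 q by (intro divide_right_mono) auto
    finally show ?thesis using r by simp
  qed
  show "(trunc_rate q N w)\<^sup>2 + (- q / w\<^sup>2 - (1 - q) / (N + w)\<^sup>2) = q * (q - 1) * N\<^sup>2 / (w\<^sup>2 * (N + w)\<^sup>2)"
  proof -
    have "(trunc_rate q N w)\<^sup>2 + (- q / w\<^sup>2 - (1 - q) / (N + w)\<^sup>2) = q * (q - 1) * (1 / w - 1 / (N + w))\<^sup>2"
    proof -
      have "(q * a + (1 - q) * b)\<^sup>2 + (- (q * a\<^sup>2) - (1 - q) * b\<^sup>2) = q * (q - 1) * (a - b)\<^sup>2" for a b :: real
        by (simp add: power2_eq_square algebra_simps)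
      from this[of "1 / w" "1 / (N + w)"] show ?thesis by (simp add: trunc_rate_def power_divide)
    qed
    also have "1 / w - 1 / (N + w) = N / (w * (N + w))" using w N0 by (simp add: field_simps)
    finally show ?thesis by (simp add: power_divide power_mult_distrib)
  qed
  have "((\<lambda>w. w powr q) has_real_derivative q * w powr (q - 1)) (at w)" by (rule has_real_derivative_powr[OF w])
  moreover have "((\<lambda>w. (1 + w / N) powr (1 - q)) has_real_derivative ((1 - q) * (1 + w / N) powr (1 - q - 1) * (1 / N))) (at w)"
  proof (rule DERIV_chain2[OF has_real_derivative_powr])
    show "0 < 1 + w / N" using N0(3) by linarith
    show "((\<lambda>w. 1 + w / N) has_real_derivative 1 / N) (at w)" using N0 by (auto intro!: derivative_eq_intros)
  qed
  ultimately have "(trunc_pow q N has_real_derivative (q * w powr (q - 1)) * (1 + w / N) powr (1 - q) + ((1 - q) * (1 + w / N) powr (1 - q - 1) * (1 / N)) * w powr q) (at w)"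
    unfolding trunc_pow_def[abs_def] by (rule DERIV_mult)
  moreover have "(q * w powr (q - 1)) * (1 + w / N) powr (1 - q) + ((1 - q) * (1 + w / N) powr (1 - q - 1) * (1 / N)) * w powr q = trunc_pow q N w * trunc_rate q N w"
  proof -
    have a: "w powr (q - 1) = w powr q / w" using w by (simp add: powr_diff)
    have "(1 + w / N) powr (1 - q - 1) = (1 + w / N) powr (1 - q) / (1 + w / N)"
      using N0 by (simp only: powr_diff[of _ "1 - q" 1]) simp
    moreover have "(1 + w / N) * N = N + w" using N0 by (simp add: distrib_right)
    ultimately have b: "(1 + w / N) powr (1 - q - 1) * (1 / N) = (1 + w / N) powr (1 - q) * (1 / (N + w))"
      by (metis divide_divide_eq_left times_divide_eq_right mult.right_neutral)
    show ?thesis unfolding trunc_pow_def trunc_rate_def a by (simp only: mult.assoc b) (simp add: algebra_simps)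
  qed
  ultimately show "(trunc_pow q N has_real_derivative trunc_pow q N w * trunc_rate q N w) (at w)" by simp
  show "(trunc_rate q N has_real_derivative (- q / w\<^sup>2 - (1 - q) / (N + w)\<^sup>2)) (at w)"
  proof -
    have "((\<lambda>w. c / (k + w)) has_real_derivative - (c / (k + w)\<^sup>2)) (at w)" if "k + w \<noteq> 0" for c k
      using that by (auto intro!: derivative_eq_intros simp: power2_eq_square)
    from DERIV_add[OF this[of 0 q] this[of N "1 - q"]] show ?thesis
      unfolding trunc_rate_def[abs_def] using w N0 by simp
  qed
qed

text \<open>One parameter governs both approximations of |x|^q: smoothing at scale 1 / N near zero
  and truncation at level \<open>N\<close>.\<close>

definition "tp x = trunc_pow q N (smooth_abs (1 / N) x)"
definition "tp' x = tp x * trunc_rate q N (smooth_abs (1 / N) x) * (x / smooth_abs (1 / N) x)"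
definition "tp'' x = tp x * (q * (q - 1) * N\<^sup>2 / ((smooth_abs (1 / N) x)\<^sup>2 * (N + smooth_abs (1 / N) x)\<^sup>2)) * (x / smooth_abs (1 / N) x)\<^sup>2
    + tp x * trunc_rate q N (smooth_abs (1 / N) x) * ((1 / N)\<^sup>2 / smooth_abs (1 / N) x ^ 3)"

text \<open>Linear growth, with a constant depending on \<open>N\<close>, admits \<open>tp\<close>
  to \<open>global_ito_inequality\<close>. The comparisons with powers of |x| have constants
  independent of \<open>N\<close> and so survive the limit.\<close>

lemma tp_facts:
  shows "(tp has_real_derivative tp' x) (at x)" "(tp' has_real_derivative tp'' x) (at x)" "continuous_on UNIV tp''"
    "\<bar>tp x - tp 0\<bar> \<le> q * N powr (q - 1) * \<bar>x\<bar>" "0 < tp x" "tp x \<le> (\<bar>x\<bar> + 1) powr q" "tp 0 \<le> (1 / N) powr q"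
    "smooth_abs (1 / N) x \<le> N \<Longrightarrow> 2 powr (1 - q) * \<bar>x\<bar> powr q \<le> tp x"
proof -
  let ?w = "smooth_abs (1 / N)"
  have e: "1 / N > 0" "1 / N \<le> 1" using N by auto
  note sf = smooth_abs_facts[OF e(1)]
  note tf = trunc_pow_facts[OF sf(1)]
  have dw: "(?w has_real_derivative x / ?w x) (at x)" for x by (rule sf(7))
  have d1: "((\<lambda>x. trunc_pow q N (?w x)) has_real_derivative (trunc_pow q N (?w x) * trunc_rate q N (?w x)) * (x / ?w x)) (at x)" for x
    by (rule DERIV_chain2[OF tf(9) dw])
  then show D: "(tp has_real_derivative tp' x) (at x)" for x
    unfolding tp_def[abs_def] tp'_def .
  have d2: "((\<lambda>x. trunc_rate q N (?w x)) has_real_derivative (- q / (?w x)\<^sup>2 - (1 - q) / (N + ?w x)\<^sup>2) * (x / ?w x)) (at x)" for x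
    by (rule DERIV_chain2[OF tf(10) dw])
  show "(tp' has_real_derivative tp'' x) (at x)"
  proof -
    have "(tp' has_real_derivative (tp' x * trunc_rate q N (?w x) + (- q / (?w x)\<^sup>2 - (1 - q) / (N + ?w x)\<^sup>2) * (x / ?w x) * tp x) * (x / ?w x)
       + ((1 / N)\<^sup>2 / ?w x ^ 3) * (tp x * trunc_rate q N (?w x))) (at x)"
      unfolding tp'_def[abs_def, of ] by (rule DERIV_mult[OF DERIV_mult[OF D d2] sf(8), unfolded tp'_def])
    moreover have "(tp' x * trunc_rate q N (?w x) + (- q / (?w x)\<^sup>2 - (1 - q) / (N + ?w x)\<^sup>2) * (x / ?w x) * tp x) * (x / ?w x)
       + ((1 / N)\<^sup>2 / ?w x ^ 3) * (tp x * trunc_rate q N (?w x)) = tp'' x"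
    proof -
      have "(t * r * b * r + c * b * t) * b + d * (t * r) = t * (r\<^sup>2 + c) * b\<^sup>2 + t * r * d" for t r b c d :: real
        by (simp add: power2_eq_square algebra_simps)
      then show ?thesis unfolding tp''_def tf(8)[symmetric] tp'_def .
    qed
    ultimately show ?thesis by simp
  qed
  have wne: "?w x \<noteq> 0" "N + ?w x \<noteq> 0" "0 < 1 + ?w x / N" for x using sf(1)[of x] N by (auto simp: add_pos_pos less_imp_neq[symmetric])
  have ctp: "continuous_on UNIV tp" by (rule continuous_at_imp_continuous_on) (simp add: DERIV_isCont[OF D])
  show "continuous_on UNIV tp''"
    unfolding tp''_def[abs_def] trunc_rate_def using wne N
    by (intro continuous_intros ctp sf(9)) auto
  show pos: "0 < tp x" for x unfolding tp_def by (rule tf(1))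
  show "tp x \<le> (\<bar>x\<bar> + 1) powr q"
  proof -
    have "tp x \<le> ?w x powr q" unfolding tp_def by (rule tf(2))
    also have "\<dots> \<le> (\<bar>x\<bar> + 1) powr q"
    proof (intro powr_mono2)
      show "?w x \<le> \<bar>x\<bar> + 1" using sf(3)[of x] e(2) by linarith
    qed (use sf(1)[of x] q in auto)
    finally show ?thesis .
  qed
  show "tp 0 \<le> (1 / N) powr q" unfolding tp_def using tf(2)[of 0] sf(5) by simp
  show "2 powr (1 - q) * \<bar>x\<bar> powr q \<le> tp x" if "?w x \<le> N"
  proof -
    have "2 powr (1 - q) * \<bar>x\<bar> powr q \<le> 2 powr (1 - q) * ?w x powr q" using sf(2)[of x] q by (intro mult_left_mono powr_mono2) auto
    also have "\<dots> \<le> tp x" unfolding tp_def by (rule tf(3)[OF that])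
    finally show ?thesis .
  qed
  have b: "\<bar>tp' x\<bar> \<le> q * N powr (q - 1)" for x
  proof -
    have 1: "tp x * trunc_rate q N (?w x) \<le> (N powr (q - 1) * ?w x) * (q / ?w x)"
      unfolding tp_def using tf(1)[of x] tf(5)[of x] sf(1)[of x] by (intro mult_mono tf(4) tf(6)) auto
    also have "\<dots> = q * N powr (q - 1)" using sf(1)[of x] by simp
    finally have 1: "tp x * trunc_rate q N (?w x) \<le> q * N powr (q - 1)" .
    have 2: "\<bar>x / ?w x\<bar> \<le> 1" using sf(1,2)[of x] by (simp add: divide_le_eq)
    have "\<bar>tp' x\<bar> = (tp x * trunc_rate q N (?w x)) * \<bar>x / ?w x\<bar>"
      unfolding tp'_def using pos[of x] tf(5)[of x] by (simp add: abs_mult)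
    also have "\<dots> \<le> (tp x * trunc_rate q N (?w x)) * 1" using 2 pos[of x] tf(5)[of x] by (intro mult_left_mono) auto
    finally show ?thesis using 1 by simp
  qed
  show "\<bar>tp x - tp 0\<bar> \<le> q * N powr (q - 1) * \<bar>x\<bar>"
    using field_differentiable_bound[of UNIV tp tp' "q * N powr (q - 1)" x 0] D b by (auto simp: has_field_derivative_at_within)
qed

text \<open>Let w be the smoothed |y|. For w \<le> N the second derivative is at least a multiple of
  tp / w^2 and absorbs the Lipschitz bound \<open>lam * Lz\<close> by completing the square. Beyond
  \<open>N\<close> the truncation has flattened the function, so the term is estimated by
  \<open>G\<close> instead and appears as an excess.\<close>

lemma tp_drift_bound:
  fixes yv av Lz G m lam :: real
  assumes drift: "av * yv \<le> m * yv\<^sup>2 + \<bar>yv\<bar> * min (lam * Lz) G" and m: "0 \<le> m" and lam: "0 \<le> lam" and Lz: "0 \<le> Lz" and G: "0 \<le> G"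
  shows "tp' yv * av - tp'' yv / 2 * Lz\<^sup>2 \<le> (q * m + 2 * q * lam\<^sup>2 / (q - 1)) * tp yv
      + (if N < smooth_abs (1 / N) yv then q * ((\<bar>yv\<bar> + 1) powr (q - 1) * G) else 0)"
proof -
  let ?w = "smooth_abs (1 / N) yv"
  have e: "1 / N > 0" "1 / N \<le> 1" using N by auto
  have sf: "?w > 0" "\<bar>yv\<bar> \<le> ?w" "?w \<le> \<bar>yv\<bar> + 1 / N" "?w\<^sup>2 = yv\<^sup>2 + (1 / N)\<^sup>2"
    by (rule smooth_abs_facts[OF e(1)])+
  note tf = trunc_pow_facts[OF sf(1)]
  define \<kappa> where "\<kappa> = tp yv"
  define k' where "k' = \<kappa> * trunc_rate q N ?w"
  have \<kappa>0: "\<kappa> > 0" unfolding \<kappa>_def tp_def by (rule tf(1))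
  have k'0: "0 \<le> k'" unfolding k'_def using \<kappa>0 tf(5) by simp
  have k'q: "k' \<le> q * \<kappa> / ?w"
    unfolding k'_def using mult_left_mono[OF tf(6) less_imp_le[OF \<kappa>0]] by (simp add: mult.commute)
  have yw: "\<bar>yv\<bar> / ?w \<le> 1" "0 \<le> \<bar>yv\<bar> / ?w" using sf(1,2) by auto
  have "tp' yv * av = k' / ?w * (av * yv)" unfolding tp'_def k'_def \<kappa>_def by (simp add: mult_ac)
  also have "\<dots> \<le> k' / ?w * (m * yv\<^sup>2 + \<bar>yv\<bar> * min (lam * Lz) G)"
    using k'0 sf(1) by (intro mult_left_mono drift) auto
  also have "\<dots> = m * (k' * (yv\<^sup>2 / ?w)) + k' * (\<bar>yv\<bar> / ?w) * min (lam * Lz) G" by (simp add: distrib_left add_divide_distrib mult_ac)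
  also have "m * (k' * (yv\<^sup>2 / ?w)) \<le> m * (q * \<kappa>)"
  proof (rule mult_left_mono[OF _ m])
    have "yv\<^sup>2 / ?w \<le> ?w" using sf(1) sf(4) by (simp add: pos_divide_le_eq power2_eq_square)
    then have "k' * (yv\<^sup>2 / ?w) \<le> (q * \<kappa> / ?w) * ?w" using k'q k'0 sf(1) \<kappa>0 q by (intro mult_mono) auto
    then show "k' * (yv\<^sup>2 / ?w) \<le> q * \<kappa>" using sf(1) by simp
  qed
  finally have 1: "tp' yv * av \<le> q * m * \<kappa> + k' * (\<bar>yv\<bar> / ?w) * min (lam * Lz) G" by (simp add: mult_ac)
  have t2: "tp'' yv = \<kappa> * (q * (q - 1) * N\<^sup>2 / (?w\<^sup>2 * (N + ?w)\<^sup>2)) * (yv / ?w)\<^sup>2 + k' * ((1 / N)\<^sup>2 / ?w ^ 3)"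
    by (simp add: tp''_def \<kappa>_def k'_def)
  have t20: "0 \<le> tp'' yv" unfolding t2 using \<kappa>0 k'0 q sf(1) N by (intro add_nonneg_nonneg mult_nonneg_nonneg divide_nonneg_nonneg) auto
  have mn: "min (lam * Lz) G \<le> lam * Lz" "min (lam * Lz) G \<le> G" "0 \<le> min (lam * Lz) G" using lam Lz G by auto
  show ?thesis
  proof (cases "N < ?w")
    case True
    have "k' * (\<bar>yv\<bar> / ?w) * min (lam * Lz) G \<le> q * ((\<bar>yv\<bar> + 1) powr (q - 1)) * G"
    proof (rule mult_mono)
      have "k' * (\<bar>yv\<bar> / ?w) \<le> k' * 1" using yw k'0 by (intro mult_left_mono)
      also have "\<dots> \<le> q * (?w powr q) / ?w"
      proof -
        have "q * \<kappa> / ?w \<le> q * (?w powr q) / ?w" unfolding \<kappa>_def tp_def using tf(2) q sf(1) by (intro divide_right_mono mult_left_mono) auto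
        then show ?thesis using k'q by simp
      qed
      also have "\<dots> = q * ?w powr (q - 1)" using sf(1) by (simp add: powr_diff)
      also have "\<dots> \<le> q * (\<bar>yv\<bar> + 1) powr (q - 1)"
      proof (intro mult_left_mono powr_mono2)
        show "?w \<le> \<bar>yv\<bar> + 1" using sf(3) e(2) by linarith
      qed (use sf(1) q in auto)
      finally show "k' * (\<bar>yv\<bar> / ?w) \<le> q * ((\<bar>yv\<bar> + 1) powr (q - 1))" .
    qed (use mn q in auto)
    moreover have "0 \<le> tp'' yv / 2 * Lz\<^sup>2" using t20 by simp
    moreover have "0 \<le> 2 * q * lam\<^sup>2 / (q - 1) * \<kappa>" using q \<kappa>0 by simp
    ultimately show ?thesis using 1 True unfolding \<kappa>_def[symmetric] by (simp add: distrib_right mult.assoc)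
  next
    case False
    \<comment> \<open>For w \<le> N the factor (N / (N + w))^2 is at least 1/4, which gives
      \<open>c\<close>. The bound c \<le> 1 comes from q < 2 and lets the second part of
      \<open>tp''\<close> carry the same constant.\<close>
    define c where "c = q * (q - 1) / 4"
    have c: "0 < c" "c \<le> 1" using q mult_mono[of q 2 "q - 1" 1] by (auto simp: c_def)
    have k1: "\<kappa> / ?w \<le> k'" unfolding k'_def using mult_left_mono[OF tf(7) less_imp_le[OF \<kappa>0]] by simp
    have lowt: "c * \<kappa> / ?w\<^sup>2 \<le> tp'' yv"
    proof -
      have a: "c / ?w\<^sup>2 \<le> q * (q - 1) * N\<^sup>2 / (?w\<^sup>2 * (N + ?w)\<^sup>2)"
      proof -
        have "1 / 4 \<le> N\<^sup>2 / (N + ?w)\<^sup>2"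
        proof -
          have "(N + ?w)\<^sup>2 \<le> (2 * N)\<^sup>2" using False N sf(1) by (intro power_mono) auto
          then show ?thesis using N sf(1) by (simp add: pos_le_divide_eq add_pos_pos power_mult_distrib)
        qed
        then have "q * (q - 1) / ?w\<^sup>2 * (1 / 4) \<le> q * (q - 1) / ?w\<^sup>2 * (N\<^sup>2 / (N + ?w)\<^sup>2)" using q by (intro mult_left_mono) auto
        then show ?thesis by (simp add: c_def mult_ac)
      qed
      \<comment> \<open>Splitting 1 as (y^2 + 1 / N^2) / w^2 matches the two parts of
        \<open>tp''\<close>: the first vanishes at y = 0, where the second, due to the smoothing,
        takes over.\<close>
      have "c * \<kappa> / ?w\<^sup>2 = c * \<kappa> / ?w\<^sup>2 * ((yv\<^sup>2 + (1 / N)\<^sup>2) / ?w\<^sup>2)" using sf(1) sf(4) by simp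
      also have "\<dots> = \<kappa> * (c / ?w\<^sup>2) * (yv / ?w)\<^sup>2 + (c * \<kappa> / ?w) * ((1 / N)\<^sup>2 / ?w ^ 3)"
        by (simp add: add_divide_distrib distrib_left power_divide power2_eq_square power3_eq_cube mult_ac)
      also have "\<dots> \<le> tp'' yv"
        unfolding t2
      proof (intro add_mono mult_right_mono mult_left_mono a)
        have "c * \<kappa> / ?w \<le> 1 * \<kappa> / ?w" using c \<kappa>0 sf(1) by (intro divide_right_mono mult_right_mono) auto
        then show "c * \<kappa> / ?w \<le> k'" using k1 by simp
      qed (use \<kappa>0 sf(1) in auto)
      finally show ?thesis .
    qed
    have "k' * (\<bar>yv\<bar> / ?w) * min (lam * Lz) G \<le> (q * \<kappa> / ?w) * 1 * (lam * Lz)"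
      using k'q k'0 yw mn \<kappa>0 sf(1) q by (intro mult_mono) auto
    moreover have "c * \<kappa> / ?w\<^sup>2 / 2 * Lz\<^sup>2 \<le> tp'' yv / 2 * Lz\<^sup>2" using lowt by (intro mult_right_mono divide_right_mono) auto
    moreover have "(q * \<kappa> / ?w) * 1 * (lam * Lz) - c * \<kappa> / ?w\<^sup>2 / 2 * Lz\<^sup>2 \<le> 2 * q * lam\<^sup>2 / (q - 1) * \<kappa>"
    proof -
      define x where "x = Lz / ?w"
      have e1: "(q * \<kappa> / ?w) * 1 * (lam * Lz) - c * \<kappa> / ?w\<^sup>2 / 2 * Lz\<^sup>2 = \<kappa> * (q * lam * x - c / 2 * x\<^sup>2)"
        unfolding x_def by (simp add: right_diff_distrib power_divide mult_ac)
      \<comment> \<open>Completing the square: the maximum of q lam x - c x^2 / 2 over x is (q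
        lam)^2 / (2 c).\<close>
      have "0 \<le> (c * x - q * lam)\<^sup>2" by simp
      then have "2 * c * (q * lam * x - c / 2 * x\<^sup>2) \<le> (q * lam)\<^sup>2" by (simp add: power2_eq_square algebra_simps)
      then have "q * lam * x - c / 2 * x\<^sup>2 \<le> (q * lam)\<^sup>2 / (2 * c)" using c by (simp add: pos_le_divide_eq mult.commute)
      also have "\<dots> = 2 * q * lam\<^sup>2 / (q - 1)" unfolding c_def using q by (simp add: field_simps power2_eq_square)
      finally have "\<kappa> * (q * lam * x - c / 2 * x\<^sup>2) \<le> \<kappa> * (2 * q * lam\<^sup>2 / (q - 1))" using \<kappa>0 by (intro mult_left_mono) auto
      then show ?thesis unfolding e1 by (simp add: mult.commute)
    qed
    ultimately show ?thesis using 1 False unfolding \<kappa>_def[symmetric] by (simp add: distrib_right)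
  qed
qed

end

section \<open>Processes with a monotone drift\<close>

context bm_space
begin

lemma progressive_joint_measurable_lborel:
  fixes X :: "real \<Rightarrow> 'w \<Rightarrow> real"
  assumes X: "progressive M B T X"
  shows "(\<lambda>x. indicator {0..T} (fst x) * X (fst x) (snd x)) \<in> borel_measurable (TM)"
proof -
  have "sets (TM) = sets (borel \<Otimes>\<^sub>M M)" by (intro sets_pair_measure_cong) auto
  then show ?thesis
    using progressive_joint_measurable_M[OF X] by (simp add: split_beta' cong: measurable_cong_sets)
qed

text \<open>Processes are controlled on [0,T] only, so the cut-off is made before and again after
  applying \<open>f\<close>; the outer one removes a nonzero value of \<open>f\<close> at
  zero.\<close>

lemma joint_measurable_compose:
  fixes X :: "real \<Rightarrow> 'w \<Rightarrow> real" and f :: "real \<Rightarrow> real"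
  assumes X: "(\<lambda>x. indicator {0..T} (fst x) * X (fst x) (snd x)) \<in> borel_measurable (TM)"
    and f: "f \<in> borel_measurable borel"
  shows "(\<lambda>x. indicator {0..T} (fst x) * f (X (fst x) (snd x))) \<in> borel_measurable (TM)"
proof -
  have "(\<lambda>x. indicator {0..T} (fst x) * f (indicator {0..T} (fst x) * X (fst x) (snd x))) \<in> borel_measurable (TM)"
    using measurable_compose[OF X f] by measurable
  moreover have "indicator {0..T} (fst x) * f (indicator {0..T} (fst x) * X (fst x) (snd x)) = indicator {0..T} (fst x) * f (X (fst x) (snd x))" for x
    by (simp add: indicator_def)
  ultimately show ?thesis by simp
qed

lemma time_integrable:
  fixes f :: "real \<Rightarrow> 'w \<Rightarrow> real"
  assumes f: "(\<lambda>x. indicator {0..T} (fst x) * f (fst x) (snd x)) \<in> borel_measurable (TM)"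
    and i: "\<And>r. r \<in> {0..T} \<Longrightarrow> integrable M (f r)" and C: "\<And>r. r \<in> {0..T} \<Longrightarrow> E (\<lambda>w. \<bar>f r w\<bar>) \<le> C"
  shows "integrable (TM) (\<lambda>(r, w). indicator {0..T} r * f r w)"
proof -
  interpret LM: pair_sigma_finite lborel M by unfold_locales
  note [measurable] = f
  show ?thesis
  proof (rule LM.Fubini_integrable)
    show "(\<lambda>(r, w). indicator {0..T} r * f r w) \<in> borel_measurable (TM)" using f by (simp add: split_beta')
    show "AE r in lborel. integrable M (\<lambda>w. case (r, w) of (r, w) \<Rightarrow> indicator {0..T} r * f r w)"
      using i by (auto simp: indicator_def intro!: AE_I2)
    have eq: "(\<integral>w. norm (case (r, w) of (r, w) \<Rightarrow> indicator {0..T} r * f r w) \<partial>M) = indicator {0..T} r * E (\<lambda>w. \<bar>f r w\<bar>)" for r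
      by (simp add: indicator_def)
    show "integrable lborel (\<lambda>r. \<integral>w. norm (case (r, w) of (r, w) \<Rightarrow> indicator {0..T} r * f r w) \<partial>M)"
    proof (rule Bochner_Integration.integrable_bound)
      show "integrable lborel (\<lambda>r. C * indicator {0..T} r)" by (intro integrable_mult_right integrable_real_indicator) (use T_pos in \<open>auto simp: less_top[symmetric]\<close>)
      show "AE r in lborel. norm (\<integral>w. norm (case (r, w) of (r, w) \<Rightarrow> indicator {0..T} r * f r w) \<partial>M) \<le> norm (C * indicator {0..T} r :: real)"
        unfolding eq using order_trans[OF C abs_ge_self] by (intro AE_I2) (auto simp: indicator_def)
    qed (use f in \<open>auto simp: split_beta' intro!: borel_measurable_lebesgue_integral\<close>)
  qed
qed

lemma time_fubini:
  fixes f :: "real \<Rightarrow> 'w \<Rightarrow> real"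
  assumes f: "integrable (TM) (\<lambda>(r, w). indicator {0..T} r * f r w)" and s: "0 \<le> s"
    and P: "\<Psi> \<in> borel_measurable M" "\<And>w. w \<in> space M \<Longrightarrow> \<bar>\<Psi> w\<bar> \<le> C'"
  shows "set_integrable lborel {s<..T} (\<lambda>r. E (\<lambda>w. \<Psi> w * f r w))"
    "E (\<lambda>w. \<Psi> w * (LBINT r:{s<..T}. f r w)) = (LBINT r:{s<..T}. E (\<lambda>w. \<Psi> w * f r w))"
    "integrable M (\<lambda>w. \<Psi> w * (LBINT r:{s<..T}. f r w))"
    "AE w in M. set_integrable lborel {0..T} (\<lambda>r. f r w)"
proof -
  interpret LM: pair_sigma_finite lborel M by unfold_locales
  let ?g = "\<lambda>r w. indicator {s<..T} r * (\<Psi> w * f r w)"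
  have g: "integrable (TM) (\<lambda>(r, w). ?g r w)"
  proof (rule Bochner_Integration.integrable_bound)
    show "integrable (TM) (\<lambda>x. C' * (case x of (r, w) \<Rightarrow> indicator {0..T} r * f r w))" using f by simp
    have [measurable]: "(\<lambda>x. \<Psi> (snd x)) \<in> borel_measurable (TM)" using measurable_compose[OF measurable_snd P(1)] .
    have [measurable]: "(\<lambda>x. indicator {0..T} (fst x) * f (fst x) (snd x)) \<in> borel_measurable (TM)"
      using borel_measurable_integrable[OF f] by (simp add: split_beta')
    have "(\<lambda>x. indicator {s<..T} (fst x) * (\<Psi> (snd x) * (indicator {0..T} (fst x) * f (fst x) (snd x)))) \<in> borel_measurable (TM)"
      by measurable
    moreover have "(\<lambda>x. indicator {s<..T} (fst x) * (\<Psi> (snd x) * (indicator {0..T} (fst x) * f (fst x) (snd x)))) = (\<lambda>(r, w). ?g r w)"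
      using s by (auto simp: fun_eq_iff indicator_def)
    ultimately show "(\<lambda>(r, w). ?g r w) \<in> borel_measurable (TM)" by simp
    have "norm (?g r w) \<le> norm (C' * (indicator {0..T} r * f r w))" if "w \<in> space M" for r w
      using P(2)[OF that] s by (auto simp: indicator_def abs_mult intro!: mult_right_mono)
    then show "AE x in TM. norm (case x of (r, w) \<Rightarrow> ?g r w) \<le> norm (C' * (case x of (r, w) \<Rightarrow> indicator {0..T} r * f r w))"
      by (intro AE_I2) (auto simp: space_pair_measure)
  qed
  have e1: "(\<integral>r. ?g r w \<partial>lborel) = \<Psi> w * (LBINT r:{s<..T}. f r w)" for w
  proof -
    have "(\<integral>r. ?g r w \<partial>lborel) = (\<integral>r. \<Psi> w * (indicator {s<..T} r * f r w) \<partial>lborel)"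
      by (intro Bochner_Integration.integral_cong) auto
    then show ?thesis by (simp add: set_lebesgue_integral_def)
  qed
  have e2: "(\<integral>w. ?g r w \<partial>M) = indicator {s<..T} r *\<^sub>R E (\<lambda>w. \<Psi> w * f r w)" for r by simp
  show "set_integrable lborel {s<..T} (\<lambda>r. E (\<lambda>w. \<Psi> w * f r w))"
    unfolding set_integrable_def e2[symmetric] by (rule LM.integrable_fst[OF g])
  show "integrable M (\<lambda>w. \<Psi> w * (LBINT r:{s<..T}. f r w))"
    unfolding e1[symmetric] by (rule LM.integrable_snd[OF g])
  show "E (\<lambda>w. \<Psi> w * (LBINT r:{s<..T}. f r w)) = (LBINT r:{s<..T}. E (\<lambda>w. \<Psi> w * f r w))"
    using LM.Fubini_integral[OF g] unfolding e1 e2 set_lebesgue_integral_def .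
  show "AE w in M. set_integrable lborel {0..T} (\<lambda>r. f r w)"
    using LM.AE_integrable_snd[OF f] by (simp add: set_integrable_def)
qed

end

text \<open>The drift bound keeps both estimates of the dependence on z: the integrable
  \<open>G\<close> serves to gain moments of \<open>y\<close>, the linear one to close the final
  estimate.\<close>

locale monotone_semimart = class_D_semimart M T B J H P I z y a V for M :: "'w measure" and T and B :: "real \<Rightarrow> 'w \<Rightarrow> real^'d"
    and J H P I z y a V +
  fixes G :: "real \<Rightarrow> 'w \<Rightarrow> real" and q m lam :: real
  assumes q: "1 < q" "q < 2" and m: "0 < m" and lam: "0 \<le> lam"
    and G_nonneg: "\<And>r w. 0 \<le> G r w"
    and G_meas: "(\<lambda>x. indicator {0..T} (fst x) * G (fst x) (snd x)) \<in> borel_measurable (TM)"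
    and G_q: "integrable (TM) (\<lambda>(r, w). indicator {0..T} r * (G r w powr q))"
    and y_bound: "\<exists>C. \<forall>t\<in>{0..T}. E (\<lambda>w. \<bar>y t w\<bar>) \<le> C"
    and drift: "AE w in M. AE r in lborel. r \<in> {0..T} \<longrightarrow>
        a r w * y r w \<le> m * (y r w)\<^sup>2 + \<bar>y r w\<bar> * min (lam * norm (z r w)) (G r w)"
begin

lemma y_meas: "(\<lambda>x. indicator {0..T} (fst x) * y (fst x) (snd x)) \<in> borel_measurable (TM)"
  by (rule progressive_joint_measurable_lborel[OF y_prog])

lemma const_time_integrable: "integrable (TM) (\<lambda>(r, w). indicator {0..T} r * (c::real))"
proof (rule time_integrable)
  have "(\<lambda>x. indicator {0..T} (fst x) * c) \<in> borel_measurable (TM)" by measurable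
  then show "(\<lambda>x. indicator {0..T} (fst x) * c) \<in> borel_measurable (TM)" .
qed (auto simp: prob_space)

lemma abs_y_time_integrable: "integrable (TM) (\<lambda>(r, w). indicator {0..T} r * \<bar>y r w\<bar>)"
proof -
  obtain C where C: "\<forall>t\<in>{0..T}. E (\<lambda>w. \<bar>y t w\<bar>) \<le> C" using y_bound by blast
  show ?thesis
    by (rule time_integrable[where C=C], rule joint_measurable_compose[OF y_meas]) (use C y_time_integrable in auto)
qed

lemma G_time_integrable: "integrable (TM) (\<lambda>(r, w). indicator {0..T} r * G r w)"
proof (rule Bochner_Integration.integrable_bound)
  show "integrable (TM) (\<lambda>x. (case x of (r, w) \<Rightarrow> indicator {0..T} r * (1::real)) + (case x of (r, w) \<Rightarrow> indicator {0..T} r * (G r w powr q)))"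
    by (rule Bochner_Integration.integrable_add[OF const_time_integrable G_q])
  show "(\<lambda>(r, w). indicator {0..T} r * G r w) \<in> borel_measurable (TM)" using G_meas by (simp add: split_beta')
  have "G r w \<le> 1 + G r w powr q" for r w
  proof (cases "G r w \<le> 1")
    case False
    then have "G r w powr 1 \<le> G r w powr q" using q by (intro powr_mono) auto
    then show ?thesis using False by simp
  next
    case True then show ?thesis using powr_ge_zero[of "G r w" q] by linarith
  qed
  then show "AE x in TM. norm (case x of (r, w) \<Rightarrow> indicator {0..T} r * G r w)
     \<le> norm ((case x of (r, w) \<Rightarrow> indicator {0..T} r * (1::real)) + (case x of (r, w) \<Rightarrow> indicator {0..T} r * (G r w powr q)))"
    using G_nonneg by (intro AE_I2) (auto simp: indicator_def)
qed

text \<open>The second-order term has the right sign and is dropped, and the minimum in the drift is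
  bounded by \<open>G\<close>. The smoothed absolute value exceeds |y| by at most e, which is
  arbitrarily small.\<close>

lemma abs_inequality:
  assumes s: "s \<in> {0..T}" and Psi: "\<Psi> \<in> borel_measurable (F s)" "\<And>w. w \<in> space M \<Longrightarrow> 0 \<le> \<Psi> w \<and> \<Psi> w \<le> C'"
  shows "E (\<lambda>w. \<Psi> w * \<bar>y s w\<bar>) \<le> E (\<lambda>w. \<Psi> w * (LBINT r:{s<..T}. m * \<bar>y r w\<bar> + G r w))"
proof -
  have C'0: "0 \<le> C'" using Psi(2) not_empty by (metis all_not_in_conv order_trans)
  have Pm[measurable]: "\<Psi> \<in> borel_measurable M" using F_measurable_M[OF Psi(1)] s by simp
  have Th: "integrable (TM) (\<lambda>(r, w). indicator {0..T} r * (m * \<bar>y r w\<bar> + G r w))"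
  proof -
    have "integrable (TM) (\<lambda>x. m * (case x of (r, w) \<Rightarrow> indicator {0..T} r * \<bar>y r w\<bar>) + (case x of (r, w) \<Rightarrow> indicator {0..T} r * G r w))"
      by (intro Bochner_Integration.integrable_add integrable_mult_right abs_y_time_integrable G_time_integrable)
    then show ?thesis by (simp add: split_beta' algebra_simps)
  qed
  have yi: "integrable M (\<lambda>w. \<bar>y s w\<bar>)" using y_time_integrable[OF s] by simp
  note [measurable] = borel_measurable_integrable[OF y_time_integrable[OF s]]
  have bd: "integrable M (\<lambda>w. \<Psi> w * f (y s w))" if "f \<in> borel_measurable borel" "\<And>x. \<bar>f x\<bar> \<le> \<bar>x\<bar> + e" "0 \<le> e" for f and e :: real
  proof (rule Bochner_Integration.integrable_bound)
    have fm: "(\<lambda>w. f (y s w)) \<in> borel_measurable M"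
      using measurable_compose[OF borel_measurable_integrable[OF y_time_integrable[OF s]] that(1)] .
    show "integrable M (\<lambda>w. C' * (\<bar>y s w\<bar> + e))" using yi by simp
    show "AE w in M. norm (\<Psi> w * f (y s w)) \<le> norm (C' * (\<bar>y s w\<bar> + e))"
      using Psi(2) that(2,3) C'0 by (intro AE_I2) (auto simp: abs_mult intro!: mult_mono)
    show "(\<lambda>w. \<Psi> w * f (y s w)) \<in> borel_measurable M" by (intro borel_measurable_times Pm fm)
  qed
  show ?thesis
  proof (rule field_le_epsilon)
    fix d :: real assume d: "d > 0"
    define e where "e = d / (C' + 1)"
    have e: "e > 0" using d C'0 by (simp add: e_def)
    have ed: "e * C' \<le> d" using d C'0 by (simp add: e_def pos_divide_le_eq mult_left_mono)
    note sf = smooth_abs_facts[OF e]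
    have [measurable]: "smooth_abs e \<in> borel_measurable borel" using sf(9) by (intro borel_measurable_continuous_onI)
    have c2: "continuous_on UNIV (\<lambda>x. e\<^sup>2 / smooth_abs e x ^ 3)"
      using sf(1) by (intro continuous_intros sf(9)) (auto simp: less_imp_neq[symmetric])
    have lip: "\<bar>smooth_abs e x - smooth_abs e 0\<bar> \<le> 1 * \<bar>x\<bar>" for x using sf(3)[of x] sf(5,6) by simp
    have "AE w in M. AE r in lborel. r \<in> {0..T} \<longrightarrow> y r w / smooth_abs e (y r w) * a r w - e\<^sup>2 / smooth_abs e (y r w) ^ 3 / 2 * (norm (z r w))\<^sup>2 \<le> m * \<bar>y r w\<bar> + G r w"
      using drift
    proof eventually_elim
      case (elim w)
      then show ?case
      proof eventually_elim
        case (elim r)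
        show ?case
        proof
          assume "r \<in> {0..T}"
          then have dr: "a r w * y r w \<le> m * (y r w)\<^sup>2 + \<bar>y r w\<bar> * min (lam * norm (z r w)) (G r w)" using elim by simp
          let ?w = "smooth_abs e (y r w)"
          have w: "?w > 0" "\<bar>y r w\<bar> \<le> ?w" by (rule sf)+
          have "a r w * y r w \<le> m * (y r w)\<^sup>2 + \<bar>y r w\<bar> * G r w"
            using dr mult_left_mono[OF min.cobounded2[of "lam * norm (z r w)" "G r w"], of "\<bar>y r w\<bar>"] by linarith
          also have "\<dots> = \<bar>y r w\<bar> * (m * \<bar>y r w\<bar> + G r w)" by (simp add: power2_eq_square distrib_left mult_ac abs_mult_self_eq)
          also have "\<dots> \<le> ?w * (m * \<bar>y r w\<bar> + G r w)" using w m G_nonneg[of r w] by (intro mult_right_mono) auto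
          finally have "y r w / ?w * a r w \<le> m * \<bar>y r w\<bar> + G r w" using w(1) by (simp add: pos_divide_le_eq mult_ac)
          moreover have "0 \<le> e\<^sup>2 / ?w ^ 3 / 2 * (norm (z r w))\<^sup>2" using w(1) by simp
          ultimately show "y r w / ?w * a r w - e\<^sup>2 / ?w ^ 3 / 2 * (norm (z r w))\<^sup>2 \<le> m * \<bar>y r w\<bar> + G r w" by linarith
        qed
      qed
    qed
    from global_ito_inequality[OF sf(7) sf(8) c2 lip Th this s Psi]
    have g: "E (\<lambda>w. \<Psi> w * smooth_abs e (y s w)) \<le> e * E \<Psi> + E (\<lambda>w. \<Psi> w * (LBINT r:{s<..T}. m * \<bar>y r w\<bar> + G r w))"
      by (simp add: sf(5))
    have "E \<Psi> \<le> E (\<lambda>_. C')" using Psi(2) C'0 by (intro integral_mono integrable_bounded[where C=C']) auto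
    then have "e * E \<Psi> \<le> d" using ed e order_trans[OF mult_left_mono[of "E \<Psi>" C' e]] by (simp add: prob_space)
    moreover have "E (\<lambda>w. \<Psi> w * \<bar>y s w\<bar>) \<le> E (\<lambda>w. \<Psi> w * smooth_abs e (y s w))"
    proof (rule integral_mono)
      show "integrable M (\<lambda>w. \<Psi> w * \<bar>y s w\<bar>)" by (rule bd[of abs 0]) auto
      show "integrable M (\<lambda>w. \<Psi> w * smooth_abs e (y s w))" by (rule bd[of "smooth_abs e" e]) (use sf(1,3) e in \<open>auto simp: less_imp_le\<close>)
    qed (use sf(2) Psi(2) in \<open>auto intro!: mult_left_mono\<close>)
    ultimately show "E (\<lambda>w. \<Psi> w * \<bar>y s w\<bar>) \<le> E (\<lambda>w. \<Psi> w * (LBINT r:{s<..T}. m * \<bar>y r w\<bar> + G r w)) + d"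
      using g by linarith
  qed
qed

text \<open>A weight measurable at \<open>s\<close> is measurable at every later time, so the
  preceding inequality holds for all r from \<open>s\<close> to \<open>T\<close> with the same
  weight, and Gronwall's inequality applies to E (\<Psi> |y r|). As \<open>\<Psi>\<close> is
  arbitrary, this is an estimate conditional on the past.\<close>

lemma weighted_abs_bound:
  assumes s: "s \<in> {0..T}" and Psi: "\<Psi> \<in> borel_measurable (F s)" "\<And>w. w \<in> space M \<Longrightarrow> 0 \<le> \<Psi> w \<and> \<Psi> w \<le> C'"
  shows "E (\<lambda>w. \<Psi> w * \<bar>y s w\<bar>) \<le> 2 * exp (2 * m * T) * E (\<lambda>w. \<Psi> w * (LBINT r:{s<..T}. G r w))"
proof -
  have C'0: "0 \<le> C'" using Psi(2) not_empty by (metis all_not_in_conv order_trans)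
  obtain C where C: "\<And>t. t \<in> {0..T} \<Longrightarrow> E (\<lambda>w. \<bar>y t w\<bar>) \<le> C" using y_bound by blast
  have Pm[measurable]: "\<Psi> \<in> borel_measurable M" using F_measurable_M[OF Psi(1)] s by simp
  have Pb: "\<bar>\<Psi> w\<bar> \<le> C'" if "w \<in> space M" for w using Psi(2)[OF that] by auto
  define u where "u r = E (\<lambda>w. \<Psi> w * \<bar>y r w\<bar>)" for r
  define c where "c = E (\<lambda>w. \<Psi> w * (LBINT r:{s<..T}. G r w))"
  have s0: "0 \<le> s" using s by simp
  have fy1: "set_integrable lborel {r<..T} (\<lambda>v. E (\<lambda>w. \<Psi> w * \<bar>y v w\<bar>))"
    and fy2: "E (\<lambda>w. \<Psi> w * (LBINT v:{r<..T}. \<bar>y v w\<bar>)) = (LBINT v:{r<..T}. E (\<lambda>w. \<Psi> w * \<bar>y v w\<bar>))"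
    and fy3: "integrable M (\<lambda>w. \<Psi> w * (LBINT v:{r<..T}. \<bar>y v w\<bar>))"
    and fG3: "integrable M (\<lambda>w. \<Psi> w * (LBINT v:{r<..T}. G v w))" if "0 \<le> r" for r
    using time_fubini(1-3)[OF abs_y_time_integrable that Pm Pb] time_fubini(3)[OF G_time_integrable that Pm Pb] by auto
  have fy4: "AE w in M. set_integrable lborel {0..T} (\<lambda>v. \<bar>y v w\<bar>)" "AE w in M. set_integrable lborel {0..T} (\<lambda>v. G v w)"
    by (rule time_fubini(4)[OF abs_y_time_integrable s0 Pm Pb] time_fubini(4)[OF G_time_integrable s0 Pm Pb], assumption)+
  have c0: "0 \<le> c" unfolding c_def using Psi(2) G_nonneg by (intro integral_nonneg_AE AE_I2) (auto simp: set_lebesgue_integral_def intro!: mult_nonneg_nonneg)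
  have "u s \<le> 2 * c * exp (2 * m * (T - s))"
  proof (rule gronwall_backward)
    show "s \<le> T" using s by simp
    show "0 \<le> u r \<and> u r \<le> C' * C" if "r \<in> {s..T}" for r
    proof
      have rT: "r \<in> {0..T}" using that s by auto
      note yi = y_time_integrable[OF rT]
      note [measurable] = borel_measurable_integrable[OF yi]
      show "0 \<le> u r" unfolding u_def using Psi(2) by (intro integral_nonneg_AE AE_I2) auto
      have i2: "integrable M (\<lambda>w. C' * \<bar>y r w\<bar>)" using yi by simp
      have "u r \<le> E (\<lambda>w. C' * \<bar>y r w\<bar>)"
        unfolding u_def
      proof (rule integral_mono[OF _ i2])
        show "integrable M (\<lambda>w. \<Psi> w * \<bar>y r w\<bar>)"
          by (rule Bochner_Integration.integrable_bound[OF i2]) (use Psi(2) C'0 in \<open>auto intro!: AE_I2 mult_right_mono simp: abs_mult\<close>)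
      qed (use Psi(2) in \<open>auto intro!: mult_right_mono\<close>)
      also have "\<dots> \<le> C' * C" using C[OF rT] C'0 by (simp add: mult_left_mono)
      finally show "u r \<le> C' * C" .
    qed
    show "set_integrable lborel {s<..T} u" unfolding u_def by (rule fy1[OF s0])
    show "m > 0" by (rule m)
    show "u r \<le> c + m * (LBINT v:{r<..T}. u v)" if r: "r \<in> {s..T}" for r
    proof -
      have rT: "r \<in> {0..T}" "0 \<le> r" using r s by auto
      have "u r \<le> E (\<lambda>w. \<Psi> w * (LBINT v:{r<..T}. m * \<bar>y v w\<bar> + G v w))"
        unfolding u_def by (rule abs_inequality[OF rT(1) F_measurable_mono[OF Psi(1)] Psi(2)]) (use r in auto)
      also have "\<dots> \<le> E (\<lambda>w. m * (\<Psi> w * (LBINT v:{r<..T}. \<bar>y v w\<bar>)) + \<Psi> w * (LBINT v:{s<..T}. G v w))"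
      proof (rule integral_mono_AE')
        show "integrable M (\<lambda>w. m * (\<Psi> w * (LBINT v:{r<..T}. \<bar>y v w\<bar>)) + \<Psi> w * (LBINT v:{s<..T}. G v w))"
          using fy3[OF rT(2)] fG3[OF s0] by simp
        show "AE w in M. \<Psi> w * (LBINT v:{r<..T}. m * \<bar>y v w\<bar> + G v w) \<le> m * (\<Psi> w * (LBINT v:{r<..T}. \<bar>y v w\<bar>)) + \<Psi> w * (LBINT v:{s<..T}. G v w)"
          using fy4 AE_space
        proof eventually_elim
          case (elim w)
          have sub: "{r<..T} \<subseteq> {0..T}" "{s<..T} \<subseteq> {0..T}" "{r<..T} \<subseteq> {s<..T}" using r s by auto
          have i: "set_integrable lborel {r<..T} (\<lambda>v. \<bar>y v w\<bar>)" "set_integrable lborel {r<..T} (\<lambda>v. G v w)" "set_integrable lborel {s<..T} (\<lambda>v. G v w)"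
            using set_integrable_subset[OF elim(1) _ sub(1)] set_integrable_subset[OF elim(2) _ sub(1)] set_integrable_subset[OF elim(2) _ sub(2)] by auto
          have "(LBINT v:{r<..T}. m * \<bar>y v w\<bar> + G v w) = m * (LBINT v:{r<..T}. \<bar>y v w\<bar>) + (LBINT v:{r<..T}. G v w)"
            using i by (subst set_integral_add(2)) auto
          also have "\<dots> \<le> m * (LBINT v:{r<..T}. \<bar>y v w\<bar>) + (LBINT v:{s<..T}. G v w)"
            using set_integral_mono_subset[OF i(3) sub(3)] G_nonneg by simp
          finally have "\<Psi> w * (LBINT v:{r<..T}. m * \<bar>y v w\<bar> + G v w) \<le> \<Psi> w * (m * (LBINT v:{r<..T}. \<bar>y v w\<bar>) + (LBINT v:{s<..T}. G v w))"
            using Psi(2)[OF elim(3)] by (intro mult_left_mono) auto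
          then show ?case by (simp add: algebra_simps)
        qed
        show "AE w in M. 0 \<le> m * (\<Psi> w * (LBINT v:{r<..T}. \<bar>y v w\<bar>)) + \<Psi> w * (LBINT v:{s<..T}. G v w)"
          using Psi(2) m G_nonneg by (intro AE_I2 add_nonneg_nonneg mult_nonneg_nonneg) (auto simp: set_lebesgue_integral_def)
      qed
      also have "\<dots> = m * (LBINT v:{r<..T}. u v) + c"
        using fy2[OF rT(2)] fy3[OF rT(2)] fG3[OF s0] by (simp add: u_def c_def)
      finally show ?thesis by simp
    qed
  qed
  also have "\<dots> \<le> 2 * c * exp (2 * m * T)" using c0 m s0 by (intro mult_left_mono) auto
  finally show ?thesis by (simp add: u_def c_def mult_ac)
qed

text \<open>With b = min |y s| n the weight b^(q - 1) produces b^q on the left. Young's inequality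
  splits b^(q - 1) G, and half of E b^q moves to the left, legitimately because truncation makes it
  finite. The bound does not depend on \<open>n\<close>, so Fatou's lemma removes the
  truncation.\<close>

lemma y_moment: "\<exists>C. \<forall>s\<in>{0..T}. integrable M (\<lambda>w. \<bar>y s w\<bar> powr q) \<and> E (\<lambda>w. \<bar>y s w\<bar> powr q) \<le> C"
proof -
  define K1 where "K1 = 2 * exp (2 * m * T)"
  have K1: "K1 > 0" by (simp add: K1_def)
  \<comment> \<open>Chosen so that the coefficient K1 \<eta> T of E b^q on the right is 1/2.\<close>
  define \<eta> where "\<eta> = 1 / (2 * K1 * T)"
  have \<eta>: "\<eta> > 0" using K1 T_pos by (simp add: \<eta>_def)
  define GQ where "GQ w = (LBINT r:{0<..T}. G r w powr q)" for w
  have GQi: "integrable M GQ" and GQs: "AE w in M. set_integrable lborel {0..T} (\<lambda>r. G r w powr q)"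
    using time_fubini(3,4)[OF G_q, of 0 "\<lambda>_. 1" 1] by (auto simp: GQ_def[abs_def])
  have GQ0: "0 \<le> GQ w" for w by (simp add: GQ_def set_lebesgue_integral_def)
  define Cq where "Cq = 2 * K1 * \<eta> powr (1 - q) * E GQ"
  have Cq0: "0 \<le> Cq" unfolding Cq_def using K1 GQ0 by (intro mult_nonneg_nonneg integral_nonneg_AE AE_I2) auto
  have "integrable M (\<lambda>w. \<bar>y s w\<bar> powr q) \<and> E (\<lambda>w. \<bar>y s w\<bar> powr q) \<le> Cq" if s: "s \<in> {0..T}" for s
  proof -
    have ya: "y s \<in> borel_measurable (F s)" by (rule progressive_adapted[OF y_prog s])
    note [measurable] = borel_measurable_integrable[OF y_time_integrable[OF s]]
    have s0: "0 \<le> s" using s by simp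
    define b where "b n w = min \<bar>y s w\<bar> (real n)" for n w
    have b0: "0 \<le> b n w" "b n w \<le> \<bar>y s w\<bar>" "b n w \<le> real n" for n w by (auto simp: b_def)
    have [measurable]: "b n \<in> borel_measurable M" for n unfolding b_def by measurable
    have bnd: "E (\<lambda>w. b n w powr q) \<le> Cq" "integrable M (\<lambda>w. b n w powr q)" for n
    proof -
      have Pn: "(\<lambda>w. b n w powr (q - 1)) \<in> borel_measurable (F s)" unfolding b_def using ya by measurable
      have Pb: "0 \<le> b n w powr (q - 1) \<and> b n w powr (q - 1) \<le> real n powr (q - 1)" for w
        using b0 q by (auto intro!: powr_mono2)
      show bi: "integrable M (\<lambda>w. b n w powr q)"
        using b0 q by (intro integrable_bounded[where C="real n powr q"]) (auto intro!: powr_mono2)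
      have Pm: "(\<lambda>w. b n w powr (q - 1)) \<in> borel_measurable M" by measurable
      have Pb': "\<bar>b n w powr (q - 1)\<bar> \<le> real n powr (q - 1)" for w using Pb by simp
      note fG = time_fubini[OF G_time_integrable s0 Pm Pb']
      have "E (\<lambda>w. b n w powr q) \<le> E (\<lambda>w. b n w powr (q - 1) * \<bar>y s w\<bar>)"
      proof (rule integral_mono[OF bi])
        show "integrable M (\<lambda>w. b n w powr (q - 1) * \<bar>y s w\<bar>)"
        proof (rule Bochner_Integration.integrable_bound)
          show "integrable M (\<lambda>w. real n powr (q - 1) * \<bar>y s w\<bar>)" using y_time_integrable[OF s] by simp
          show "AE w in M. norm (b n w powr (q - 1) * \<bar>y s w\<bar>) \<le> norm (real n powr (q - 1) * \<bar>y s w\<bar>)"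
            using Pb by (intro AE_I2) (auto simp: abs_mult intro!: mult_right_mono)
        qed measurable
        show "b n w powr q \<le> b n w powr (q - 1) * \<bar>y s w\<bar>" for w
        proof -
          have "b n w powr q = b n w powr (q - 1) * b n w" using b0(1)[of n w] by (cases "b n w = 0") (auto simp: powr_diff)
          then show ?thesis using b0 by (simp add: mult_left_mono)
        qed
      qed
      also have "\<dots> \<le> K1 * E (\<lambda>w. b n w powr (q - 1) * (LBINT r:{s<..T}. G r w))"
        unfolding K1_def by (rule weighted_abs_bound[OF s Pn Pb])
      also have "E (\<lambda>w. b n w powr (q - 1) * (LBINT r:{s<..T}. G r w)) \<le> E (\<lambda>w. \<eta> * T * b n w powr q + \<eta> powr (1 - q) * GQ w)"
      proof (rule integral_mono_AE[OF fG(3)])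
        show "integrable M (\<lambda>w. \<eta> * T * b n w powr q + \<eta> powr (1 - q) * GQ w)" using bi GQi by simp
        show "AE w in M. b n w powr (q - 1) * (LBINT r:{s<..T}. G r w) \<le> \<eta> * T * b n w powr q + \<eta> powr (1 - q) * GQ w"
          using fG(4) GQs
        proof eventually_elim
          case (elim w)
          have sub: "{s<..T} \<subseteq> {0..T}" "{0<..T} \<subseteq> {0..T}" "{s<..T} \<subseteq> {0<..T}" using s by auto
          have iG: "set_integrable lborel {s<..T} (\<lambda>r. G r w)" by (rule set_integrable_subset[OF elim(1) _ sub(1)]) simp
          have iq: "set_integrable lborel {s<..T} (\<lambda>r. G r w powr q)" "set_integrable lborel {0<..T} (\<lambda>r. G r w powr q)"
            using set_integrable_subset[OF elim(2) _ sub(1)] set_integrable_subset[OF elim(2) _ sub(2)] by auto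
          have ic: "set_integrable lborel {s<..T} (\<lambda>r. \<eta> * b n w powr q)"
            unfolding set_integrable_def real_scaleR_def by (intro integrable_mult_left integrable_real_indicator) (use s in \<open>auto simp: less_top[symmetric]\<close>)
          have "b n w powr (q - 1) * (LBINT r:{s<..T}. G r w) = (LBINT r:{s<..T}. b n w powr (q - 1) * G r w)" by simp
          also have "\<dots> \<le> (LBINT r:{s<..T}. \<eta> * b n w powr q + \<eta> powr (1 - q) * G r w powr q)"
            using iG iq ic by (intro set_integral_mono set_integral_add(1) set_integrable_mult_right) (auto intro!: young_powr b0 G_nonneg q \<eta>)
          also have "\<dots> = (LBINT r:{s<..T}. \<eta> * b n w powr q) + \<eta> powr (1 - q) * (LBINT r:{s<..T}. G r w powr q)"
            using ic iq by (subst set_integral_add(2)) auto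
          also have "(LBINT r:{s<..T}. \<eta> * b n w powr q) = (T - s) * (\<eta> * b n w powr q)"
            using s by (simp add: set_lebesgue_integral_def)
          also have "\<dots> \<le> T * (\<eta> * b n w powr q)" using s \<eta> by (intro mult_right_mono) auto
          finally have "b n w powr (q - 1) * (LBINT r:{s<..T}. G r w) \<le> T * (\<eta> * b n w powr q) + \<eta> powr (1 - q) * (LBINT r:{s<..T}. G r w powr q)" by simp
          moreover have "(LBINT r:{s<..T}. G r w powr q) \<le> GQ w" unfolding GQ_def by (rule set_integral_mono_subset[OF iq(2) sub(3)]) auto
          then have "\<eta> powr (1 - q) * (LBINT r:{s<..T}. G r w powr q) \<le> \<eta> powr (1 - q) * GQ w" by (intro mult_left_mono) auto
          ultimately show ?case by (simp add: mult_ac)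
        qed
      qed
      also have "E (\<lambda>w. \<eta> * T * b n w powr q + \<eta> powr (1 - q) * GQ w) = \<eta> * T * E (\<lambda>w. b n w powr q) + \<eta> powr (1 - q) * E GQ"
        using bi GQi by simp
      finally have "E (\<lambda>w. b n w powr q) \<le> K1 * (\<eta> * T * E (\<lambda>w. b n w powr q) + \<eta> powr (1 - q) * E GQ)"
        using K1 by (simp add: mult_left_mono)
      also have "\<dots> = (K1 * \<eta> * T) * E (\<lambda>w. b n w powr q) + Cq / 2" by (simp add: Cq_def algebra_simps)
      also have "K1 * \<eta> * T = 1 / 2" using K1 T_pos by (simp add: \<eta>_def)
      finally show "E (\<lambda>w. b n w powr q) \<le> Cq" by simp
    qed
    have lim: "(\<lambda>n. b n w powr q) \<longlonglongrightarrow> \<bar>y s w\<bar> powr q" for w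
    proof (rule tendsto_eventually)
      obtain n0 :: nat where "\<bar>y s w\<bar> < n0" using reals_Archimedean2 by blast
      then have b: "b n w = \<bar>y s w\<bar>" if "n \<ge> n0" for n using that by (simp add: b_def)
      then show "\<forall>\<^sub>F n in sequentially. b n w powr q = \<bar>y s w\<bar> powr q" unfolding eventually_sequentially by (intro exI[of _ n0]) (simp add: b)
    qed
    have "(\<integral>\<^sup>+w. ennreal (\<bar>y s w\<bar> powr q) \<partial>M) = (\<integral>\<^sup>+w. liminf (\<lambda>n. ennreal (b n w powr q)) \<partial>M)"
      by (intro nn_integral_cong lim_imp_Liminf[symmetric] tendsto_ennrealI lim) simp
    also have "\<dots> \<le> liminf (\<lambda>n. \<integral>\<^sup>+w. ennreal (b n w powr q) \<partial>M)" by (rule nn_integral_liminf) auto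
    also have "\<dots> \<le> ennreal Cq"
    proof (rule Liminf_le)
      have "(\<integral>\<^sup>+w. ennreal (b n w powr q) \<partial>M) \<le> ennreal Cq" for n
        using bnd by (subst nn_integral_eq_integral) (auto intro: ennreal_leI)
      then show "\<forall>\<^sub>F n in sequentially. (\<integral>\<^sup>+w. ennreal (b n w powr q) \<partial>M) \<le> ennreal Cq" by simp
    qed simp
    finally have nn: "(\<integral>\<^sup>+w. ennreal (\<bar>y s w\<bar> powr q) \<partial>M) \<le> ennreal Cq" .
    then have "integrable M (\<lambda>w. \<bar>y s w\<bar> powr q)" by (intro integrableI_nonneg) (auto intro: le_less_trans)
    moreover have "E (\<lambda>w. \<bar>y s w\<bar> powr q) \<le> Cq"
      using nn Cq0 by (subst integral_eq_nn_integral) (auto intro!: enn2real_leI)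
    ultimately show ?thesis by blast
  qed
  then show ?thesis by blast
qed

end

context bm_space
begin

lemma time_integral_le:
  fixes f :: "real \<Rightarrow> 'w \<Rightarrow> real"
  assumes f: "integrable (TM) (\<lambda>(r, w). indicator {0..T} r * f r w)" and s: "0 \<le> s"
    and f0: "\<And>r w. 0 \<le> f r w"
  shows "E (\<lambda>w. LBINT r:{s<..T}. f r w) \<le> (\<integral>(r, w). indicator {0..T} r * f r w \<partial>(TM))"
proof -
  interpret LM: pair_sigma_finite lborel M by unfold_locales
  have e1: "(\<integral>r. indicator {0..T} r * f r w \<partial>lborel) = (LBINT r:{0..T}. f r w)" for w by (simp add: set_lebesgue_integral_def)
  have P: "(\<lambda>_. 1::real) \<in> borel_measurable M" "\<And>w. w \<in> space M \<Longrightarrow> \<bar>1::real\<bar> \<le> 1" by auto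
  have "E (\<lambda>w. LBINT r:{s<..T}. f r w) \<le> E (\<lambda>w. LBINT r:{0..T}. f r w)"
  proof (rule integral_mono_AE)
    show "integrable M (\<lambda>w. LBINT r:{s<..T}. f r w)" using time_fubini(3)[OF f s P] by simp
    show "integrable M (\<lambda>w. LBINT r:{0..T}. f r w)" using LM.integrable_snd[OF f] by (simp add: e1)
    show "AE w in M. (LBINT r:{s<..T}. f r w) \<le> (LBINT r:{0..T}. f r w)"
      using LM.AE_integrable_snd[OF f]
    proof eventually_elim
      case (elim w)
      then have "set_integrable lborel {0..T} (\<lambda>r. f r w)" by (simp add: set_integrable_def)
      then show ?case by (rule set_integral_mono_subset) (use s f0 in auto)
    qed
  qed
  also have "\<dots> = (\<integral>(r, w). indicator {0..T} r * f r w \<partial>(TM))"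
    using LM.integral_snd[OF f] by (simp add: e1)
  finally show ?thesis .
qed

end

lemma powr_plus_one_le:
  fixes x q :: real
  assumes "0 \<le> x" "0 \<le> q"
  shows "(x + 1) powr q \<le> 2 powr q * (x powr q + 1)"
proof -
  have "(x + 1) powr q \<le> (2 * max x 1) powr q" using assms by (intro powr_mono2) auto
  also have "\<dots> = 2 powr q * max x 1 powr q" by (simp add: powr_mult)
  also have "max x 1 powr q \<le> x powr q + 1" by (simp add: max_def)
  finally show ?thesis by (simp add: mult_left_mono)
qed

section \<open>From q-th moments to the vanishing of \<open>y\<close> and \<open>z\<close>\<close>

context monotone_semimart
begin

lemma y_moment_shifted:
  obtains C where "0 \<le> C" "\<And>r. r \<in> {0..T} \<Longrightarrow> integrable M (\<lambda>w. (\<bar>y r w\<bar> + 1) powr q)"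
    "\<And>r. r \<in> {0..T} \<Longrightarrow> E (\<lambda>w. (\<bar>y r w\<bar> + 1) powr q) \<le> C"
proof -
  obtain C where C: "\<And>s. s \<in> {0..T} \<Longrightarrow> integrable M (\<lambda>w. \<bar>y s w\<bar> powr q)"
    "\<And>s. s \<in> {0..T} \<Longrightarrow> E (\<lambda>w. \<bar>y s w\<bar> powr q) \<le> C" using y_moment by blast
  have bound: "(\<bar>x\<bar> + 1) powr q \<le> 2 powr q * (\<bar>x\<bar> powr q + 1)" for x :: real by (rule powr_plus_one_le) (use q in auto)
  have int: "integrable M (\<lambda>w. (\<bar>y r w\<bar> + 1) powr q)" if r: "r \<in> {0..T}" for r
  proof (rule Bochner_Integration.integrable_bound)
    note [measurable] = borel_measurable_integrable[OF y_time_integrable[OF r]]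
    show "integrable M (\<lambda>w. 2 powr q * (\<bar>y r w\<bar> powr q + 1))" using C(1)[OF r] by simp
    show "(\<lambda>w. (\<bar>y r w\<bar> + 1) powr q) \<in> borel_measurable M" by measurable
    show "AE w in M. norm ((\<bar>y r w\<bar> + 1) powr q) \<le> norm (2 powr q * (\<bar>y r w\<bar> powr q + 1))" using bound by (intro AE_I2) auto
  qed
  have le: "E (\<lambda>w. (\<bar>y r w\<bar> + 1) powr q) \<le> 2 powr q * (\<bar>C\<bar> + 1)" if r: "r \<in> {0..T}" for r
  proof -
    have "E (\<lambda>w. (\<bar>y r w\<bar> + 1) powr q) \<le> E (\<lambda>w. 2 powr q * (\<bar>y r w\<bar> powr q + 1))"
      using C(1)[OF r] bound by (intro integral_mono int[OF r]) auto
    also have "\<dots> = 2 powr q * (E (\<lambda>w. \<bar>y r w\<bar> powr q) + 1)" using C(1)[OF r] by (simp add: prob_space)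
    also have "\<dots> \<le> 2 powr q * (\<bar>C\<bar> + 1)" using C(2)[OF r] by (intro mult_left_mono) auto
    finally show ?thesis .
  qed
  show thesis by (rule that[OF _ int le]) auto
qed

lemma shifted_time_integrable: "integrable (TM) (\<lambda>(r, w). indicator {0..T} r * ((\<bar>y r w\<bar> + 1) powr q))"
proof -
  obtain C where C: "0 \<le> C" "\<And>r. r \<in> {0..T} \<Longrightarrow> integrable M (\<lambda>w. (\<bar>y r w\<bar> + 1) powr q)"
    "\<And>r. r \<in> {0..T} \<Longrightarrow> E (\<lambda>w. (\<bar>y r w\<bar> + 1) powr q) \<le> C" by (rule y_moment_shifted) blast
  show ?thesis by (rule time_integrable[OF joint_measurable_compose[OF y_meas], where C=C]) (use C in auto)
qed

text \<open>The remainder left by \<open>tp_drift_bound\<close> where the truncation is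
  active.\<close>

definition "excess N r w = (if N < smooth_abs (1 / N) (y r w) then q * ((\<bar>y r w\<bar> + 1) powr (q - 1) * G r w) else 0)"

lemma excess_nonneg: "0 \<le> excess N r w"
  using q G_nonneg by (auto simp: excess_def)

lemma excess_bound: "excess N r w \<le> q * ((\<bar>y r w\<bar> + 1) powr q + G r w powr q)"
proof -
  have "(\<bar>y r w\<bar> + 1) powr (q - 1) * G r w \<le> (\<bar>y r w\<bar> + 1) powr q + G r w powr q"
    using young_powr[of "\<bar>y r w\<bar> + 1" "G r w" q 1] G_nonneg q by simp
  then show ?thesis using q by (auto simp: excess_def)
qed

lemma smooth_abs_measurable[measurable]: "0 < e \<Longrightarrow> smooth_abs e \<in> borel_measurable borel"
  using smooth_abs_facts(9) by (intro borel_measurable_continuous_onI)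

lemma excess_meas:
  assumes "1 \<le> N"
  shows "(\<lambda>x. indicator {0..T} (fst x) * excess N (fst x) (snd x)) \<in> borel_measurable (TM)"
proof -
  have s[measurable]: "smooth_abs (1 / N) \<in> borel_measurable borel" using assms by (intro smooth_abs_measurable) auto
  have a: "(\<lambda>v. if N < smooth_abs (1 / N) v then q * (\<bar>v\<bar> + 1) powr (q - 1) else 0) \<in> borel_measurable borel" by measurable
  have "(\<lambda>x. (indicator {0..T} (fst x) * (if N < smooth_abs (1 / N) (y (fst x) (snd x)) then q * (\<bar>y (fst x) (snd x)\<bar> + 1) powr (q - 1) else 0))
     * (indicator {0..T} (fst x) * G (fst x) (snd x))) \<in> borel_measurable (TM)"
    by (rule borel_measurable_times[OF joint_measurable_compose[OF y_meas a] G_meas])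
  moreover have "(indicator {0..T} (fst x) * (if N < smooth_abs (1 / N) (y (fst x) (snd x)) then q * (\<bar>y (fst x) (snd x)\<bar> + 1) powr (q - 1) else 0))
     * (indicator {0..T} (fst x) * G (fst x) (snd x)) = indicator {0..T} (fst x) * excess N (fst x) (snd x)" for x
    by (simp add: indicator_def excess_def)
  ultimately show ?thesis by simp
qed

lemma excess_dominator: "integrable (TM) (\<lambda>(r, w). indicator {0..T} r * (q * ((\<bar>y r w\<bar> + 1) powr q + G r w powr q)))"
proof -
  have "integrable (TM) (\<lambda>x. q * ((case x of (r, w) \<Rightarrow> indicator {0..T} r * ((\<bar>y r w\<bar> + 1) powr q)) + (case x of (r, w) \<Rightarrow> indicator {0..T} r * (G r w powr q))))"
    by (intro Bochner_Integration.integrable_add integrable_mult_right shifted_time_integrable G_q)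
  then show ?thesis by (simp add: split_beta' algebra_simps)
qed

lemma excess_integrable:
  assumes N: "1 \<le> N"
  shows "integrable (TM) (\<lambda>(r, w). indicator {0..T} r * excess N r w)"
proof (rule Bochner_Integration.integrable_bound[OF excess_dominator])
  show "(\<lambda>(r, w). indicator {0..T} r * excess N r w) \<in> borel_measurable (TM)"
    using excess_meas[OF N] by (simp add: split_beta')
  have "norm (indicator {0..T} r * excess N r w) \<le> norm (indicator {0..T} r * (q * ((\<bar>y r w\<bar> + 1) powr q + G r w powr q)))" for r w
    using excess_nonneg[of N r w] order_trans[OF excess_bound[of N r w] abs_ge_self] by (auto simp: indicator_def)
  then show "AE x in TM. norm (case x of (r, w) \<Rightarrow> indicator {0..T} r * excess N r w)
      \<le> norm (case x of (r, w) \<Rightarrow> indicator {0..T} r * (q * ((\<bar>y r w\<bar> + 1) powr q + G r w powr q)))"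
    by (intro AE_I2) (simp add: split_beta')
qed

definition "excess_total N = (\<integral>(r, w). indicator {0..T} r * excess N r w \<partial>(TM))"

text \<open>Young's inequality dominates the excess by q-th powers of |y| + 1 and of
  \<open>G\<close>, uniformly in \<open>N\<close>; here the moment bound for \<open>y\<close> pays
  off. Pointwise the excess is zero once \<open>N\<close> exceeds |y| + 1.\<close>

lemma excess_total_tendsto: "(\<lambda>k. excess_total (real (Suc k))) \<longlonglongrightarrow> 0"
proof -
  define e where "e k x = indicator {0..T} (fst x) * excess (real (Suc k)) (fst x) (snd x)" for k x
  define w where "w x = indicator {0..T} (fst x) * (q * ((\<bar>y (fst x) (snd x)\<bar> + 1) powr q + G (fst x) (snd x) powr q))" for x
  have "(\<lambda>k. integral\<^sup>L (TM) (e k)) \<longlonglongrightarrow> integral\<^sup>L (TM) (\<lambda>x :: real \<times> 'w. 0)"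
  proof (rule integral_dominated_convergence[where w=w])
    show "integrable (TM) w" using excess_dominator by (simp add: w_def[abs_def] split_beta')
    show "e k \<in> borel_measurable (TM)" for k
      using excess_meas[of "real (Suc k)"] by (simp add: e_def[abs_def])
    show "AE x in TM. norm (e k x) \<le> w x" for k
      using excess_nonneg[of "real (Suc k)"] excess_bound[of "real (Suc k)"] by (intro AE_I2) (auto simp: indicator_def e_def w_def)
    have "(\<lambda>k. e k x) \<longlonglongrightarrow> 0" for x
    proof (rule tendsto_eventually)
      let ?y = "y (fst x) (snd x)"
      obtain n0 :: nat where n0: "\<bar>?y\<bar> + 1 < n0" using reals_Archimedean2 by blast
      have "e n x = 0" if n: "n \<ge> n0" for n
      proof -
        have e: "0 < 1 / real (Suc n)" "1 / real (Suc n) \<le> 1" by auto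
        have "smooth_abs (1 / real (Suc n)) ?y \<le> \<bar>?y\<bar> + 1 / real (Suc n)" by (rule smooth_abs_facts(3)[OF e(1)])
        also have "\<dots> \<le> real (Suc n)"
        proof -
          have "real n0 \<le> real n" using n by simp
          then show ?thesis using e(2) n0 of_nat_Suc[of n, where ?'a=real] by linarith
        qed
        finally show ?thesis by (simp add: excess_def e_def)
      qed
      then show "\<forall>\<^sub>F k in sequentially. e k x = 0"
        unfolding eventually_sequentially by blast
    qed
    then show "AE x in TM. (\<lambda>k. e k x) \<longlonglongrightarrow> 0" by (intro AE_I2)
  qed simp
  then show ?thesis by (simp add: excess_total_def e_def[abs_def] split_beta' del: of_nat_Suc)
qed

text \<open>Gronwall's inequality for E (tp (y r)). The exponential rate does not depend on
  \<open>N\<close>, so only the value at zero and the excess remain to be controlled as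
  \<open>N\<close> grows.\<close>

lemma tp_expectation_bound:
  assumes s: "s \<in> {0..T}" and N: "1 \<le> N"
  shows "integrable M (\<lambda>w. tp q N (y s w))"
    and "E (\<lambda>w. tp q N (y s w)) \<le> 2 * (tp q N 0 + excess_total N) * exp (2 * (q * m + 2 * q * lam\<^sup>2 / (q - 1)) * (T - s))"
proof -
  note tf = tp_facts[OF q N]
  obtain C where C: "0 \<le> C" "\<And>r. r \<in> {0..T} \<Longrightarrow> integrable M (\<lambda>w. (\<bar>y r w\<bar> + 1) powr q)"
    "\<And>r. r \<in> {0..T} \<Longrightarrow> E (\<lambda>w. (\<bar>y r w\<bar> + 1) powr q) \<le> C" by (rule y_moment_shifted) blast
  define C3 where "C3 = q * m + 2 * q * lam\<^sup>2 / (q - 1)"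
  have C3: "C3 > 0" using q m by (simp add: C3_def add_pos_nonneg)
  have tpm: "tp q N \<in> borel_measurable borel"
    by (intro borel_measurable_continuous_onI continuous_at_imp_continuous_on) (simp add: DERIV_isCont[OF tf(1)])
  have tpi: "integrable M (\<lambda>w. tp q N (y r w))" if r: "r \<in> {0..T}" for r
  proof (rule Bochner_Integration.integrable_bound[OF C(2)[OF r]])
    show "(\<lambda>w. tp q N (y r w)) \<in> borel_measurable M"
      using measurable_compose[OF borel_measurable_integrable[OF y_time_integrable[OF r]] tpm] .
    show "AE w in M. norm (tp q N (y r w)) \<le> norm ((\<bar>y r w\<bar> + 1) powr q)"
      using tf(5,6) by (intro AE_I2) (simp add: less_imp_le)
  qed
  show "integrable M (\<lambda>w. tp q N (y s w))" by (rule tpi[OF s])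
  define h where "h r = E (\<lambda>w. tp q N (y r w))" for r
  have h: "0 \<le> h r \<and> h r \<le> C" if r: "r \<in> {0..T}" for r
  proof
    show "0 \<le> h r" unfolding h_def using tf(5) by (intro integral_nonneg_AE AE_I2) (simp add: less_imp_le)
    have "h r \<le> E (\<lambda>w. (\<bar>y r w\<bar> + 1) powr q)" unfolding h_def using tf(6) by (intro integral_mono tpi C(2) r)
    then show "h r \<le> C" using C(3)[OF r] by simp
  qed
  have tpt: "integrable (TM) (\<lambda>(r, w). indicator {0..T} r * tp q N (y r w))"
    by (rule time_integrable[OF joint_measurable_compose[OF y_meas tpm], where C=C])
      (use tpi h tf(5) in \<open>auto simp: h_def abs_of_pos\<close>)
  have ext: "integrable (TM) (\<lambda>(r, w). indicator {0..T} r * excess N r w)" by (rule excess_integrable[OF N])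
  have Th: "integrable (TM) (\<lambda>(r, w). indicator {0..T} r * (C3 * tp q N (y r w) + excess N r w))"
  proof -
    have "integrable (TM) (\<lambda>x. C3 * (case x of (r, w) \<Rightarrow> indicator {0..T} r * tp q N (y r w)) + (case x of (r, w) \<Rightarrow> indicator {0..T} r * excess N r w))"
      by (intro Bochner_Integration.integrable_add integrable_mult_right tpt ext)
    then show ?thesis by (simp add: split_beta' algebra_simps)
  qed
  have ineq: "AE w in M. AE r in lborel. r \<in> {0..T} \<longrightarrow> tp' q N (y r w) * a r w - tp'' q N (y r w) / 2 * (norm (z r w))\<^sup>2 \<le> C3 * tp q N (y r w) + excess N r w"
    using drift
  proof eventually_elim
    case (elim w)
    then show ?case
    proof eventually_elim
      case (elim r)
      show ?case unfolding C3_def excess_def using elim m by (intro impI tp_drift_bound[OF q N] lam norm_ge_zero G_nonneg) auto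
    qed
  qed
  have P: "(\<lambda>_. 1::real) \<in> borel_measurable M" "\<And>w. w \<in> space M \<Longrightarrow> \<bar>1::real\<bar> \<le> 1" by auto
  have "h s \<le> 2 * (tp q N 0 + excess_total N) * exp (2 * C3 * (T - s))"
  proof (rule gronwall_backward)
    show "s \<le> T" using s by simp
    show "0 \<le> h r \<and> h r \<le> C" if "r \<in> {s..T}" for r using that s by (intro h) auto
    show "set_integrable lborel {s<..T} h" using time_fubini(1)[OF tpt _ P, of s] s by (simp add: h_def[abs_def])
    show "0 < C3" by (rule C3)
    show "h r \<le> tp q N 0 + excess_total N + C3 * (LBINT v:{r<..T}. h v)" if r: "r \<in> {s..T}" for r
    proof -
      have rT: "r \<in> {0..T}" "0 \<le> r" using r s by auto
      have fy: "E (\<lambda>w. LBINT v:{r<..T}. tp q N (y v w)) = (LBINT v:{r<..T}. h v)"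
          "integrable M (\<lambda>w. LBINT v:{r<..T}. tp q N (y v w))" "integrable M (\<lambda>w. LBINT v:{r<..T}. excess N v w)"
        using time_fubini(2,3)[OF tpt rT(2) P] time_fubini(3)[OF ext rT(2) P] by (auto simp: h_def)
      have f4: "AE w in M. set_integrable lborel {0..T} (\<lambda>v. tp q N (y v w))" by (rule time_fubini(4)[OF tpt rT(2) P])
      have f4': "AE w in M. set_integrable lborel {0..T} (\<lambda>v. excess N v w)" by (rule time_fubini(4)[OF ext rT(2) P])
      have "h r \<le> tp q N 0 + E (\<lambda>w. LBINT v:{r<..T}. C3 * tp q N (y v w) + excess N v w)"
        using global_ito_inequality[OF tf(1,2,3,4) Th ineq rT(1), of "\<lambda>_. 1" 1] by (simp add: h_def prob_space)
      also have "E (\<lambda>w. LBINT v:{r<..T}. C3 * tp q N (y v w) + excess N v w)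
          = E (\<lambda>w. C3 * (LBINT v:{r<..T}. tp q N (y v w)) + (LBINT v:{r<..T}. excess N v w))"
      proof (rule integral_cong_AE)
        show "(\<lambda>w. LBINT v:{r<..T}. C3 * tp q N (y v w) + excess N v w) \<in> borel_measurable M"
          using borel_measurable_integrable[OF time_fubini(3)[OF Th rT(2) P]] by simp
        show "(\<lambda>w. C3 * (LBINT v:{r<..T}. tp q N (y v w)) + (LBINT v:{r<..T}. excess N v w)) \<in> borel_measurable M"
          using borel_measurable_integrable[OF fy(2)] borel_measurable_integrable[OF fy(3)] by measurable
        show "AE w in M. (LBINT v:{r<..T}. C3 * tp q N (y v w) + excess N v w) = C3 * (LBINT v:{r<..T}. tp q N (y v w)) + (LBINT v:{r<..T}. excess N v w)"
          using f4 f4'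
        proof eventually_elim
          case (elim w)
          have sub: "{r<..T} \<subseteq> {0..T}" using rT by auto
          have "set_integrable lborel {r<..T} (\<lambda>v. tp q N (y v w))" "set_integrable lborel {r<..T} (\<lambda>v. excess N v w)"
            using set_integrable_subset[OF elim(1) _ sub] set_integrable_subset[OF elim(2) _ sub] by auto
          then show ?case by (subst set_integral_add(2)) auto
        qed
      qed
      also have "\<dots> = C3 * (LBINT v:{r<..T}. h v) + E (\<lambda>w. LBINT v:{r<..T}. excess N v w)" using fy by simp
      also have "E (\<lambda>w. LBINT v:{r<..T}. excess N v w) \<le> excess_total N"
        unfolding excess_total_def by (rule time_integral_le[OF ext rT(2) excess_nonneg])
      finally show ?thesis by simp
    qed
  qed
  then show "E (\<lambda>w. tp q N (y s w)) \<le> 2 * (tp q N 0 + excess_total N) * exp (2 * (q * m + 2 * q * lam\<^sup>2 / (q - 1)) * (T - s))"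
    by (simp add: h_def C3_def)
qed

text \<open>As \<open>N\<close> grows, both terms on the right of
  \<open>tp_expectation_bound\<close> vanish, while the left side recovers E |y s|^q up to the
  factor 2^(1 - q).\<close>

lemma y_zero_at:
  assumes s: "s \<in> {0..T}"
  shows "AE w in M. y s w = 0"
proof -
  have yq: "integrable M (\<lambda>w. \<bar>y s w\<bar> powr q)" using y_moment s by blast
  note [measurable] = borel_measurable_integrable[OF y_time_integrable[OF s]]
  \<comment> \<open>For N = \<open>Suc k\<close> the condition puts the smoothed |y| below
    \<open>N\<close>, where \<open>tp\<close> dominates 2^(1 - q) |y|^q; elsewhere positivity of
    \<open>tp\<close> suffices.\<close>
  define b where "b k w = (if \<bar>y s w\<bar> + 1 \<le> real (Suc k) then \<bar>y s w\<bar> powr q else 0)" for k w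
  have [measurable]: "b k \<in> borel_measurable M" for k unfolding b_def by measurable
  have l1: "(\<lambda>k. 2 powr (1 - q) * E (b k)) \<longlonglongrightarrow> 2 powr (1 - q) * E (\<lambda>w. \<bar>y s w\<bar> powr q)"
  proof (intro tendsto_mult_left integral_dominated_convergence[where w="\<lambda>w. \<bar>y s w\<bar> powr q"] yq)
    show "AE w in M. (\<lambda>k. b k w) \<longlonglongrightarrow> \<bar>y s w\<bar> powr q"
    proof (intro AE_I2 tendsto_eventually)
      fix w
      obtain n0 :: nat where n0: "\<bar>y s w\<bar> + 1 < n0" using reals_Archimedean2 by blast
      then show "\<forall>\<^sub>F k in sequentially. b k w = \<bar>y s w\<bar> powr q"
        unfolding eventually_sequentially by (intro exI[of _ n0]) (simp add: b_def)
    qed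
    show "AE w in M. norm (b k w) \<le> \<bar>y s w\<bar> powr q" for k by (intro AE_I2) (simp add: b_def)
  qed measurable
  have l2: "(\<lambda>k. 2 * (tp q (real (Suc k)) 0 + excess_total (real (Suc k))) * exp (2 * (q * m + 2 * q * lam\<^sup>2 / (q - 1)) * (T - s))) \<longlonglongrightarrow> 0"
  proof -
    have l0: "(\<lambda>k. 1 / real (Suc k)) \<longlonglongrightarrow> 0" using LIMSEQ_inverse_real_of_nat by (simp only: inverse_eq_divide)
    have lq: "(\<lambda>k. (1 / real (Suc k)) powr q) \<longlonglongrightarrow> 0"
      by (rule tendsto_zero_powrI[OF l0 tendsto_const]) (use q in \<open>auto intro!: always_eventually\<close>)
    have N: "1 \<le> real (Suc k)" for k by simp
    have "(\<lambda>k. tp q (real (Suc k)) 0) \<longlonglongrightarrow> 0"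
      by (rule tendsto_sandwich[OF _ _ tendsto_const lq])
        (use tp_facts(5,7)[OF q N] in \<open>auto intro!: always_eventually less_imp_le simp del: of_nat_Suc\<close>)
    then have "(\<lambda>k. 2 * (tp q (real (Suc k)) 0 + excess_total (real (Suc k))) * exp (2 * (q * m + 2 * q * lam\<^sup>2 / (q - 1)) * (T - s)))
       \<longlonglongrightarrow> 2 * (0 + 0) * exp (2 * (q * m + 2 * q * lam\<^sup>2 / (q - 1)) * (T - s))"
      by (intro tendsto_intros excess_total_tendsto)
    then show ?thesis by simp
  qed
  have l3: "2 powr (1 - q) * E (b k) \<le> 2 * (tp q (real (Suc k)) 0 + excess_total (real (Suc k))) * exp (2 * (q * m + 2 * q * lam\<^sup>2 / (q - 1)) * (T - s))" for k
  proof -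
    have N: "1 \<le> real (Suc k)" by simp
    have "2 powr (1 - q) * E (b k) = E (\<lambda>w. 2 powr (1 - q) * b k w)" by simp
    also have "\<dots> \<le> E (\<lambda>w. tp q (real (Suc k)) (y s w))"
    proof (rule integral_mono[OF _ tp_expectation_bound(1)[OF s N]])
      have "integrable M (b k)"
        by (rule Bochner_Integration.integrable_bound[OF yq]) (auto intro!: AE_I2 simp: b_def)
      then show "integrable M (\<lambda>w. 2 powr (1 - q) * b k w)" by simp
      show "2 powr (1 - q) * b k w \<le> tp q (real (Suc k)) (y s w)" for w
      proof (cases "\<bar>y s w\<bar> + 1 \<le> real (Suc k)")
        case True
        have e: "0 < 1 / real (Suc k)" "1 / real (Suc k) \<le> 1" by auto
        have "smooth_abs (1 / real (Suc k)) (y s w) \<le> \<bar>y s w\<bar> + 1 / real (Suc k)" by (rule smooth_abs_facts(3)[OF e(1)])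
        then have "smooth_abs (1 / real (Suc k)) (y s w) \<le> real (Suc k)" using e(2) True by linarith
        from tp_facts(8)[OF q N this] show ?thesis using True by (simp add: b_def)
      next
        case False
        then show ?thesis using tp_facts(5)[OF q N, of "y s w"] by (simp add: b_def)
      qed
    qed
    also have "\<dots> \<le> 2 * (tp q (real (Suc k)) 0 + excess_total (real (Suc k))) * exp (2 * (q * m + 2 * q * lam\<^sup>2 / (q - 1)) * (T - s))"
      by (rule tp_expectation_bound(2)[OF s N])
    finally show ?thesis .
  qed
  have "2 powr (1 - q) * E (\<lambda>w. \<bar>y s w\<bar> powr q) \<le> 0"
    by (rule LIMSEQ_le[OF l1 l2]) (use l3 in blast)
  then have "E (\<lambda>w. \<bar>y s w\<bar> powr q) \<le> 0" by (simp add: mult_le_0_iff)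
  moreover have "0 \<le> E (\<lambda>w. \<bar>y s w\<bar> powr q)" by simp
  ultimately have "E (\<lambda>w. \<bar>y s w\<bar> powr q) = 0" by linarith
  then have "AE w in M. \<bar>y s w\<bar> powr q = 0" using integral_nonneg_eq_0_iff_AE[OF yq] by simp
  then show ?thesis by (rule eventually_mono) simp
qed

lemma y_zero: "AE w in M. \<forall>t\<in>{0..T}. y t w = 0"
proof -
  have "AE w in M. \<forall>s\<in>{0..T} \<inter> \<rat>. y s w = 0"
    by (subst AE_ball_countable) (auto intro: y_zero_at countable_rat)
  then show ?thesis using AE_space
  proof eventually_elim
    case (elim w)
    show ?case
    proof (rule ccontr)
      assume "\<not> (\<forall>t\<in>{0..T}. y t w = 0)"
      then obtain t where t: "t \<in> {0..T}" "y t w \<in> - {0}" by auto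
      from continuous_on_rational_hit[OF y_cont[OF elim(2)] T_pos _ t]
      obtain r where "r \<in> {0..T} \<inter> \<rat>" "y r w \<in> - {0}" by blast
      then show False using elim(1) by auto
    qed
  qed
qed

text \<open>At y = 0 the function sqrt (1 + y^2) has first derivative 0 and second derivative 1, so
  the Ito inequality from time 0 reads 1 \<le> 1 - E (\<integral> g) / 2.\<close>

lemma z_zero: "AE w in M. AE r in lborel. r \<in> {0..T} \<longrightarrow> z r w = 0"
proof -
  interpret LM: pair_sigma_finite lborel M by unfold_locales
  \<comment> \<open>The mean of the energy of \<open>z\<close> may be infinite at this point; the
    cap at 1 keeps the bound integrable and has the same zeros.\<close>
  define g where "g r w = min ((norm (z r w))\<^sup>2) 1" for r w
  have zm: "(\<lambda>x. indicator {0..T} (fst x) *\<^sub>R z (fst x) (snd x)) \<in> borel_measurable (TM)"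
  proof -
    have "sets (TM) = sets (borel \<Otimes>\<^sub>M M)" by (intro sets_pair_measure_cong) auto
    then show ?thesis using progressive_joint_measurable_M[OF z_prog] by (simp add: split_beta' cong: measurable_cong_sets)
  qed
  have gm: "(\<lambda>x. indicator {0..T} (fst x) * g (fst x) (snd x)) \<in> borel_measurable (TM)"
  proof -
    have "(\<lambda>x. min ((norm (indicator {0..T} (fst x) *\<^sub>R z (fst x) (snd x)))\<^sup>2) 1) \<in> borel_measurable (TM)"
      using zm by measurable
    moreover have "min ((norm (indicator {0..T} (fst x) *\<^sub>R z (fst x) (snd x)))\<^sup>2) 1 = indicator {0..T} (fst x) * g (fst x) (snd x)" for x
      by (simp add: indicator_def g_def)
    ultimately show ?thesis by simp
  qed
  have gi: "integrable (TM) (\<lambda>(r, w). indicator {0..T} r * g r w)"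
  proof (rule Bochner_Integration.integrable_bound[OF const_time_integrable[of 1]])
    show "(\<lambda>(r, w). indicator {0..T} r * g r w) \<in> borel_measurable (TM)" using gm by (simp add: split_beta')
    show "AE x in TM. norm (case x of (r, w) \<Rightarrow> indicator {0..T} r * g r w) \<le> norm (case x of (r, w) \<Rightarrow> indicator {0..T} r * (1::real))"
      by (intro AE_I2) (auto simp: indicator_def g_def)
  qed
  have P: "(\<lambda>_. 1::real) \<in> borel_measurable M" "\<And>w. w \<in> space M \<Longrightarrow> \<bar>1::real\<bar> \<le> 1" by auto
  note sf = smooth_abs_facts[of 1, OF zero_less_one]
  have c2: "continuous_on UNIV (\<lambda>x. 1\<^sup>2 / smooth_abs 1 x ^ 3)"
    using sf(1) by (intro continuous_intros sf(9)) (auto simp: less_imp_neq[symmetric])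
  have lip: "\<bar>smooth_abs 1 x - smooth_abs 1 0\<bar> \<le> 1 * \<bar>x\<bar>" for x using sf(3)[of x] sf(5) sf(6)[of x] by simp
  have Th: "integrable (TM) (\<lambda>(r, w). indicator {0..T} r * (- (1 / 2) * g r w))"
  proof -
    have "integrable (TM) (\<lambda>x. - (1 / 2) * (case x of (r, w) \<Rightarrow> indicator {0..T} r * g r w))" using gi by simp
    then show ?thesis by (simp add: split_beta' mult_ac)
  qed
  have ineq: "AE w in M. AE r in lborel. r \<in> {0..T} \<longrightarrow> y r w / smooth_abs 1 (y r w) * a r w - 1\<^sup>2 / smooth_abs 1 (y r w) ^ 3 / 2 * (norm (z r w))\<^sup>2 \<le> - (1 / 2) * g r w"
    using y_zero
  proof eventually_elim
    case (elim w)
    show ?case using elim sf(5) by (intro AE_I2) (auto simp: g_def)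
  qed
  have "E (\<lambda>w. smooth_abs 1 (y 0 w)) \<le> 1 + E (\<lambda>w. LBINT r:{0<..T}. - (1 / 2) * g r w)"
    using global_ito_inequality[OF sf(7) sf(8) c2 lip Th ineq, of 0 "\<lambda>_. 1" 1] T_pos by (simp add: sf(5) prob_space)
  moreover have "1 \<le> E (\<lambda>w. smooth_abs 1 (y 0 w))"
  proof -
    have "E (\<lambda>w. smooth_abs 1 (y 0 w)) = E (\<lambda>_. 1)"
      using y_zero T_pos y_time_integrable[of 0] sf(5)
      by (intro integral_cong_AE measurable_compose[OF borel_measurable_integrable smooth_abs_measurable]) (auto elim: eventually_mono)
    then show ?thesis by (simp add: prob_space)
  qed
  moreover have "E (\<lambda>w. LBINT r:{0<..T}. - (1 / 2) * g r w) = - (1 / 2) * E (\<lambda>w. LBINT r:{0<..T}. g r w)"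
    by (simp only: set_integral_mult_right integral_mult_right_zero)
  ultimately have "E (\<lambda>w. LBINT r:{0<..T}. g r w) \<le> 0" by simp
  moreover have gn: "0 \<le> (LBINT r:{0<..T}. g r w)" for w by (simp add: set_lebesgue_integral_def g_def)
  ultimately have "E (\<lambda>w. LBINT r:{0<..T}. g r w) = 0" by (intro antisym integral_nonneg_AE AE_I2)
  moreover have "integrable M (\<lambda>w. LBINT r:{0<..T}. g r w)" using time_fubini(3)[OF gi order_refl P] by simp
  ultimately have "AE w in M. (LBINT r:{0<..T}. g r w) = 0" using gn by (subst (asm) integral_nonneg_eq_0_iff_AE) auto
  moreover have "AE w in M. set_integrable lborel {0..T} (\<lambda>r. g r w)" by (rule time_fubini(4)[OF gi order_refl P])
  ultimately show ?thesis
  proof eventually_elim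
    case (elim w)
    have "set_integrable lborel {0<..T} (\<lambda>r. g r w)" by (rule set_integrable_subset[OF elim(2)]) auto
    then have "AE r in lborel. indicator {0<..T} r *\<^sub>R g r w = 0"
      using elim(1) unfolding set_lebesgue_integral_def set_integrable_def
      by (subst (asm) integral_nonneg_eq_0_iff_AE) (auto simp: g_def)
    moreover have "AE r in lborel. r \<noteq> (0::real)" by (rule AE_lborel_singleton)
    ultimately show ?case
      by eventually_elim (auto simp: indicator_def g_def min_def split: if_splits)
  qed
qed

end

section \<open>Differences of solutions\<close>

text \<open>Compares x^\<delta> with squares at scale \<open>c\<close>. For c^2 = 1 + \<integral>
  |Z|^2 the time integral of the right side is of order c^\<delta>, which does the work of Jensen's
  inequality in time.\<close>

lemma powr_le_one_plus_scaled_square: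
  fixes x c \<delta> :: real
  assumes "0 \<le> x" "0 < c" "0 < \<delta>" "\<delta> \<le> 2"
  shows "x powr \<delta> \<le> c powr \<delta> * (1 + x\<^sup>2 / c\<^sup>2)"
proof -
  have "(x / c) powr \<delta> \<le> 1 + (x / c)\<^sup>2"
  proof (cases "x / c \<le> 1")
    case True
    then have "(x / c) powr \<delta> \<le> 1" using assms by (intro powr_le1) auto
    then show ?thesis by (smt (verit) zero_le_power2)
  next
    case False
    then have "(x / c) powr \<delta> \<le> (x / c) powr 2" using assms by (intro powr_mono) auto
    then show ?thesis using assms by simp
  qed
  moreover have "x powr \<delta> = c powr \<delta> * (x / c) powr \<delta>" using assms by (simp add: powr_divide)
  ultimately show ?thesis by (simp add: power_divide mult_left_mono)
qed

lemma powr_le_one_plus: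
  fixes x \<delta> :: real
  assumes "0 \<le> x" "0 < \<delta>" "\<delta> \<le> 1"
  shows "x powr \<delta> \<le> 1 + x"
proof (cases "x \<le> 1")
  case True
  then have "x powr \<delta> \<le> 1" using assms by (intro powr_le1) auto
  then show ?thesis using assms by simp
next
  case False
  then have "x powr \<delta> \<le> x powr 1" using assms by (intro powr_mono) auto
  then show ?thesis using False by simp
qed

lemma powr_add4_le:
  fixes a b c d \<delta> :: real
  assumes "0 \<le> a" "0 \<le> b" "0 \<le> c" "0 \<le> d" "0 \<le> \<delta>"
  shows "(a + b + c + d) powr \<delta> \<le> 4 powr \<delta> * (a powr \<delta> + b powr \<delta> + c powr \<delta> + d powr \<delta>)"
proof -
  define x where "x = max (max a b) (max c d)"
  have "(a + b + c + d) powr \<delta> \<le> (4 * x) powr \<delta>" using assms by (intro powr_mono2) (auto simp: x_def)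
  also have "\<dots> = 4 powr \<delta> * x powr \<delta>" by (simp add: powr_mult)
  also have "x powr \<delta> \<le> a powr \<delta> + b powr \<delta> + c powr \<delta> + d powr \<delta>"
    unfolding x_def by (auto simp: max_def)
  finally show ?thesis by (simp add: mult_left_mono)
qed

context bm_space
begin

text \<open>Null sets belong to every \<open>F t\<close> by augmentation, so paths may be reset on a
  null set.\<close>

lemma progressive_regularise:
  fixes X :: "real \<Rightarrow> 'w \<Rightarrow> 'b::real_normed_vector"
  assumes X: "progressive M B T X" and N: "N \<in> null_sets M"
  shows "progressive M B T (\<lambda>t w. if w \<in> N then 0 else X t w)"
  unfolding progressive_def
proof
  fix t assume t: "t \<in> {0..T}"
  let ?S = "restrict_space borel {0..t} \<Otimes>\<^sub>M fmeas M B t"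
  have "{x \<in> space ?S. snd x \<in> N} \<in> sets ?S"
    using measurable_sets[OF measurable_snd null_sets_F[OF N], of "restrict_space borel {0..t}" t] by (simp add: vimage_def Int_def conj_commute)
  then have "(\<lambda>x. if snd x \<in> N then 0 else X (fst x) (snd x)) \<in> borel_measurable ?S"
    using X t by (intro measurable_If) (auto simp: progressive_def split_beta')
  then show "(\<lambda>(s, w). if w \<in> N then 0 else X s w) \<in> borel_measurable ?S" by (simp add: split_beta')
qed

lemma progressive_diff:
  fixes X Y :: "real \<Rightarrow> 'w \<Rightarrow> 'b::{real_normed_vector, second_countable_topology}"
  assumes "progressive M B T X" "progressive M B T Y"
  shows "progressive M B T (\<lambda>t w. X t w - Y t w)"
  using assms unfolding progressive_def by (auto simp: split_beta' intro!: borel_measurable_diff)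

lemma progressive_initial:
  assumes X: "progressive M B T X"
  shows "progressive M B T (\<lambda>t w. X 0 w)"
  unfolding progressive_def
proof
  fix t assume t: "t \<in> {0..T}"
  have "X 0 \<in> borel_measurable (F t)" using F_measurable_mono[OF progressive_adapted[OF X, of 0], of t] t T_pos by simp
  then show "(\<lambda>(s, w). X 0 w) \<in> borel_measurable (restrict_space borel {0..t} \<Otimes>\<^sub>M fmeas M B t)"
    unfolding split_beta' by (rule measurable_compose[OF measurable_snd])
qed

text \<open>Prepares for an integral that vanishes at time 0 on every path;
  \<open>ito_integral\<close> gives this only almost surely.\<close>

lemma elem_approx_normalise:
  assumes A: "elem_approx J H P I Z"
    and eq: "AE w in M. \<forall>t\<in>{0..T}. I' t w = I t w - I 0 w \<and> Z' t w = Z t w"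
  shows "elem_approx (\<lambda>m t w. J m t w - J m 0 w) H P I' Z'"
proof -
  have 1: "AE w in M. (\<lambda>m. \<integral>\<^sup>+ t. ennreal ((norm (H m t w - Z t w))\<^sup>2) * indicator {0..T} t \<partial>lborel) \<longlonglongrightarrow> 0"
    and 2: "AE w in M. uniform_limit {0..T} (\<lambda>m t. J m t w) (\<lambda>t. I t w) sequentially"
    using A by (auto simp: elem_approx_def)
  have 3: "AE w in M. (\<lambda>m. \<integral>\<^sup>+ t. ennreal ((norm (H m t w - Z' t w))\<^sup>2) * indicator {0..T} t \<partial>lborel) \<longlonglongrightarrow> 0"
    using 1 eq
  proof eventually_elim
    case (elim w)
    have "(\<integral>\<^sup>+ t. ennreal ((norm (H m t w - Z' t w))\<^sup>2) * indicator {0..T} t \<partial>lborel)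
        = (\<integral>\<^sup>+ t. ennreal ((norm (H m t w - Z t w))\<^sup>2) * indicator {0..T} t \<partial>lborel)" for m
      using elim(2) by (intro nn_integral_cong) (auto simp: indicator_def)
    then show ?case using elim(1) by simp
  qed
  have 4: "AE w in M. uniform_limit {0..T} (\<lambda>m t. J m t w - J m 0 w) (\<lambda>t. I' t w) sequentially"
    using 2 eq
  proof eventually_elim
    case (elim w)
    show ?case
    proof (rule uniform_limitI)
      fix e :: real assume e: "0 < e"
      then have "\<forall>\<^sub>F m in sequentially. \<forall>t\<in>{0..T}. dist (J m t w) (I t w) < e / 2"
        by (intro uniform_limitD[OF elim(1)]) simp
      then show "\<forall>\<^sub>F m in sequentially. \<forall>t\<in>{0..T}. dist (J m t w - J m 0 w) (I' t w) < e"
      proof eventually_elim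
        case (elim m)
        have 0: "dist (J m 0 w) (I 0 w) < e / 2" using elim T_pos by simp
        show ?case
        proof
          fix t assume t: "t \<in> {0..T}"
          then have "dist (J m t w) (I t w) < e / 2" using elim by blast
          moreover have "I' t w = I t w - I 0 w" using \<open>\<forall>t\<in>{0..T}. I' t w = I t w - I 0 w \<and> Z' t w = Z t w\<close> t by blast
          ultimately show "dist (J m t w - J m 0 w) (I' t w) < e" using 0 unfolding dist_real_def by linarith
        qed
      qed
    qed
  qed
  show ?thesis using A 3 4 unfolding elem_approx_def by (intro conjI) simp_all
qed

lemma classD_tail:
  assumes Y: "classD M B T Y" and e: "0 < e"
  obtains c where "0 \<le> c" "\<And>\<tau>. bounded_stopping \<tau> \<Longrightarrow> (\<integral>\<^sup>+ w. ennreal (if c < \<bar>Y (\<tau> w) w\<bar> then \<bar>Y (\<tau> w) w\<bar> else 0) \<partial>M) \<le> ennreal e"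
proof -
  let ?S = "{(\<lambda>w. Y (\<tau> w) w) | \<tau>. stopping_time (fmeas M B) \<tau> \<and> (\<forall>w\<in>space M. \<tau> w \<in> {0..T})}"
  have "unif_integrable M ?S" using Y by (simp only: classD_def)
  then have "\<exists>c. \<forall>X\<in>?S. (\<integral>\<^sup>+ w. ennreal \<bar>X w\<bar> * indicator {w. c < \<bar>X w\<bar>} w \<partial>M) < ennreal e"
    unfolding unif_integrable_def using e by (elim conjE allE impE)
  then obtain c where c: "\<forall>X\<in>?S. (\<integral>\<^sup>+ w. ennreal \<bar>X w\<bar> * indicator {w. c < \<bar>X w\<bar>} w \<partial>M) < ennreal e" ..
  show thesis
  proof (rule that[of "max c 0"])
    fix \<tau> assume t: "bounded_stopping \<tau>"
    have "(\<integral>\<^sup>+ w. ennreal (if max c 0 < \<bar>Y (\<tau> w) w\<bar> then \<bar>Y (\<tau> w) w\<bar> else 0) \<partial>M)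
        \<le> (\<integral>\<^sup>+ w. ennreal \<bar>Y (\<tau> w) w\<bar> * indicator {w. c < \<bar>Y (\<tau> w) w\<bar>} w \<partial>M)"
      by (intro nn_integral_mono) (auto simp: indicator_def)
    also have "\<dots> < ennreal e" by (rule c[THEN bspec]) (use t in \<open>auto simp: bounded_stopping_def\<close>)
    finally show "(\<integral>\<^sup>+ w. ennreal (if max c 0 < \<bar>Y (\<tau> w) w\<bar> then \<bar>Y (\<tau> w) w\<bar> else 0) \<partial>M) \<le> ennreal e" by simp
  qed simp
qed

lemma classD_measurable: "classD M B T Y \<Longrightarrow> bounded_stopping \<tau> \<Longrightarrow> (\<lambda>w. Y (\<tau> w) w) \<in> borel_measurable M"
  unfolding classD_def unif_integrable_def bounded_stopping_def by blast

lemma classD_bounded: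
  assumes Y: "classD M B T Y"
  obtains C where "\<And>\<tau>. bounded_stopping \<tau> \<Longrightarrow> integrable M (\<lambda>w. Y (\<tau> w) w)"
    "\<And>\<tau>. bounded_stopping \<tau> \<Longrightarrow> E (\<lambda>w. \<bar>Y (\<tau> w) w\<bar>) \<le> C"
proof -
  obtain c where c: "0 \<le> c" "\<And>\<tau>. bounded_stopping \<tau> \<Longrightarrow> (\<integral>\<^sup>+ w. ennreal (if c < \<bar>Y (\<tau> w) w\<bar> then \<bar>Y (\<tau> w) w\<bar> else 0) \<partial>M) \<le> ennreal 1"
    by (rule classD_tail[OF Y zero_less_one]) blast
  have nn: "(\<integral>\<^sup>+ w. ennreal \<bar>Y (\<tau> w) w\<bar> \<partial>M) \<le> ennreal (c + 1)" if t: "bounded_stopping \<tau>" for \<tau>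
  proof -
    note [measurable] = classD_measurable[OF Y t]
    have "(\<integral>\<^sup>+ w. ennreal \<bar>Y (\<tau> w) w\<bar> \<partial>M) \<le> (\<integral>\<^sup>+ w. ennreal c + ennreal (if c < \<bar>Y (\<tau> w) w\<bar> then \<bar>Y (\<tau> w) w\<bar> else 0) \<partial>M)"
      using c(1) by (intro nn_integral_mono) (auto simp: ennreal_plus[symmetric] intro!: ennreal_leI simp del: ennreal_plus)
    also have "\<dots> = ennreal c + (\<integral>\<^sup>+ w. ennreal (if c < \<bar>Y (\<tau> w) w\<bar> then \<bar>Y (\<tau> w) w\<bar> else 0) \<partial>M)"
      by (subst nn_integral_add) (auto simp: emeasure_space_1)
    also have "\<dots> \<le> ennreal c + ennreal 1" by (intro add_left_mono c(2) t)
    finally show ?thesis using c(1) by simp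
  qed
  have i: "integrable M (\<lambda>w. Y (\<tau> w) w)" if t: "bounded_stopping \<tau>" for \<tau>
    using nn[OF t] classD_measurable[OF Y t] by (intro integrableI_bounded) (auto intro: le_less_trans)
  have b: "E (\<lambda>w. \<bar>Y (\<tau> w) w\<bar>) \<le> c + 1" if t: "bounded_stopping \<tau>" for \<tau>
    using nn[OF t] classD_measurable[OF Y t] c(1) by (subst integral_eq_nn_integral) (auto intro!: enn2real_leI)
  show thesis by (rule that[of "c + 1"]) (rule i b, assumption)+
qed

text \<open>The part of |Y1 - Y2| below a level vanishes by dominated convergence, since the
  stopping times are eventually \<open>T\<close>; the rest is controlled by the tails of
  \<open>Y1\<close> and \<open>Y2\<close> separately.\<close>

lemma classD_diff_tendsto:
  assumes Y1: "classD M B T Y1" and Y2: "classD M B T Y2"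
    and T: "AE w in M. Y1 T w = Y2 T w" and t: "\<And>k::nat. bounded_stopping (\<tau> k)"
    and ev: "\<And>w. w \<in> space M \<Longrightarrow> eventually (\<lambda>k. \<tau> k w = T) sequentially"
  shows "(\<lambda>k. E (\<lambda>w. \<bar>Y1 (\<tau> k w) w - Y2 (\<tau> k w) w\<bar>)) \<longlonglongrightarrow> 0"
proof (rule LIMSEQ_I)
  fix e :: real assume e: "0 < e"
  then have e8: "0 < e / 8" by simp
  obtain c1 where c1: "0 \<le> c1" "\<And>\<tau>. bounded_stopping \<tau> \<Longrightarrow> (\<integral>\<^sup>+ w. ennreal (if c1 < \<bar>Y1 (\<tau> w) w\<bar> then \<bar>Y1 (\<tau> w) w\<bar> else 0) \<partial>M) \<le> ennreal (e / 8)"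
    by (rule classD_tail[OF Y1 e8]) blast
  obtain c2 where c2: "0 \<le> c2" "\<And>\<tau>. bounded_stopping \<tau> \<Longrightarrow> (\<integral>\<^sup>+ w. ennreal (if c2 < \<bar>Y2 (\<tau> w) w\<bar> then \<bar>Y2 (\<tau> w) w\<bar> else 0) \<partial>M) \<le> ennreal (e / 8)"
    by (rule classD_tail[OF Y2 e8]) blast
  \<comment> \<open>If the difference exceeds \<open>c\<close>, the larger of |Y1| and |Y2| is at
    least half of it and lies above its level, so twice the tails dominate the difference.\<close>
  define c where "c = 2 * max c1 c2"
  have c0: "0 \<le> c" using c1 c2 by (simp add: c_def)
  define X where "X k w = \<bar>Y1 (\<tau> k w) w - Y2 (\<tau> k w) w\<bar>" for k w
  define R1 where "R1 k w = (if c1 < \<bar>Y1 (\<tau> k w) w\<bar> then \<bar>Y1 (\<tau> k w) w\<bar> else 0)" for k w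
  define R2 where "R2 k w = (if c2 < \<bar>Y2 (\<tau> k w) w\<bar> then \<bar>Y2 (\<tau> k w) w\<bar> else 0)" for k w
  note m[measurable] = classD_measurable[OF Y1 t] classD_measurable[OF Y2 t]
  have iY1: "integrable M (\<lambda>w. Y1 (\<tau> k w) w)" for k by (rule classD_bounded[OF Y1]) (use t in blast)
  have iY2: "integrable M (\<lambda>w. Y2 (\<tau> k w) w)" for k by (rule classD_bounded[OF Y2]) (use t in blast)
  have Rm[measurable]: "R1 k \<in> borel_measurable M" "R2 k \<in> borel_measurable M" "X k \<in> borel_measurable M" for k
    unfolding R1_def R2_def X_def by measurable
  have iX: "integrable M (X k)" for k unfolding X_def using iY1 iY2 by simp
  have iR: "integrable M (R1 k)" "integrable M (R2 k)" for k
    by (rule Bochner_Integration.integrable_bound[OF iY1[of k]], auto intro!: AE_I2 simp: R1_def)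
      (rule Bochner_Integration.integrable_bound[OF iY2[of k]], auto intro!: AE_I2 simp: R2_def)
  have R: "E (R1 k) \<le> e / 8" "E (R2 k) \<le> e / 8" for k
  proof -
    have "E (R1 k) = enn2real (\<integral>\<^sup>+ w. ennreal (R1 k w) \<partial>M)" "E (R2 k) = enn2real (\<integral>\<^sup>+ w. ennreal (R2 k w) \<partial>M)"
      by (rule integral_eq_nn_integral; auto simp: R1_def R2_def)+
    then show "E (R1 k) \<le> e / 8" "E (R2 k) \<le> e / 8"
      using enn2real_leI[OF less_imp_le[OF e8] c1(2)[OF t[of k]]] enn2real_leI[OF less_imp_le[OF e8] c2(2)[OF t[of k]]]
      unfolding R1_def R2_def by linarith+
  qed
  have "(\<lambda>k. E (\<lambda>w. min (X k w) c)) \<longlonglongrightarrow> E (\<lambda>w. 0)"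
  proof (rule integral_dominated_convergence[where w="\<lambda>_. c"])
    show "AE w in M. (\<lambda>k. min (X k w) c) \<longlonglongrightarrow> 0"
      using T AE_space
    proof eventually_elim
      case (elim w)
      show ?case by (rule tendsto_eventually, rule eventually_mono[OF ev[OF elim(2)]]) (use elim c0 in \<open>simp add: X_def\<close>)
    qed
    show "AE w in M. norm (min (X k w) c) \<le> c" for k using c0 by (intro AE_I2) (auto simp: X_def)
  qed auto
  then have "(\<lambda>k. E (\<lambda>w. min (X k w) c)) \<longlonglongrightarrow> 0" by simp
  from LIMSEQ_D[OF this, of "e / 2"] e obtain k0 where k0: "\<And>k. k \<ge> k0 \<Longrightarrow> \<bar>E (\<lambda>w. min (X k w) c)\<bar> < e / 2" by auto
  have "norm (E (X k) - 0) < e" if k: "k \<ge> k0" for k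
  proof -
    have im: "integrable M (\<lambda>w. min (X k w) c)"
      by (rule Bochner_Integration.integrable_bound[OF iX[of k]]) (use c0 in \<open>auto intro!: AE_I2 simp: X_def\<close>)
    have "E (X k) \<le> E (\<lambda>w. min (X k w) c + 2 * R1 k w + 2 * R2 k w)"
    proof (rule integral_mono[OF iX])
      show "integrable M (\<lambda>w. min (X k w) c + 2 * R1 k w + 2 * R2 k w)" using im iR by simp
      show "X k w \<le> min (X k w) c + 2 * R1 k w + 2 * R2 k w" for w
        using c1(1) c2(1) unfolding X_def R1_def R2_def c_def by (auto simp: min_def max_def abs_if split: if_splits)
    qed
    also have "\<dots> = E (\<lambda>w. min (X k w) c) + 2 * E (R1 k) + 2 * E (R2 k)" using im iR by simp
    also have "\<dots> < e" using k0[OF k] R[of k] by linarith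
    finally have "E (X k) < e" .
    moreover have "0 \<le> E (X k)" by (simp add: X_def)
    ultimately show ?thesis by simp
  qed
  then show "\<exists>k0. \<forall>k\<ge>k0. norm (E (\<lambda>w. \<bar>Y1 (\<tau> k w) w - Y2 (\<tau> k w) w\<bar>) - 0) < e"
    unfolding X_def by blast
qed

lemma product_integrableI:
  fixes f :: "real \<Rightarrow> 'w \<Rightarrow> real"
  assumes f: "(\<lambda>x. indicator {0..T} (fst x) * f (fst x) (snd x)) \<in> borel_measurable (TM)"
    and fin: "(\<integral>\<^sup>+ w. (\<integral>\<^sup>+ r. ennreal \<bar>f r w\<bar> * indicator {0..T} r \<partial>lborel) \<partial>M) < \<infinity>"
  shows "integrable (TM) (\<lambda>(r, w). indicator {0..T} r * f r w)"
proof -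
  interpret LM: pair_sigma_finite lborel M by unfold_locales
  note [measurable] = f
  have eq: "ennreal (norm (indicator {0..T} r * f r w)) = ennreal \<bar>f r w\<bar> * indicator {0..T} r" for r :: real and w
    by (simp add: indicator_def)
  have m: "(\<lambda>x. ennreal (norm (indicator {0..T} (fst x) * f (fst x) (snd x)))) \<in> borel_measurable (TM)" by measurable
  have "(\<integral>\<^sup>+ x. ennreal (norm (indicator {0..T} (fst x) * f (fst x) (snd x))) \<partial>(TM)) < \<infinity>"
    using LM.nn_integral_snd[of "\<lambda>x. ennreal (norm (indicator {0..T} (fst x) * f (fst x) (snd x)))"] m fin
    unfolding fst_conv snd_conv eq by simp
  then have "integrable (TM) (\<lambda>x. indicator {0..T} (fst x) * f (fst x) (snd x))"
    by (intro integrableI_bounded f)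
  then show ?thesis by (simp add: split_beta')
qed

lemma norm_joint_measurable:
  fixes Z :: "real \<Rightarrow> 'w \<Rightarrow> real^'d" and h :: "real \<Rightarrow> real"
  assumes Z: "progressive M B T Z" and h: "h \<in> borel_measurable borel"
  shows "(\<lambda>x. indicator {0..T} (fst x) * h (norm (Z (fst x) (snd x)))) \<in> borel_measurable (TM)"
proof (rule joint_measurable_compose[OF _ h])
  have "sets (TM) = sets (borel \<Otimes>\<^sub>M M)" by (intro sets_pair_measure_cong) auto
  then have "(\<lambda>x. indicator {0..T} (fst x) *\<^sub>R Z (fst x) (snd x)) \<in> borel_measurable (TM)"
    using progressive_joint_measurable_M[OF Z] by (simp add: split_beta' cong: measurable_cong_sets)
  then have "(\<lambda>x. norm (indicator {0..T} (fst x) *\<^sub>R Z (fst x) (snd x))) \<in> borel_measurable (TM)" by measurable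
  then show "(\<lambda>x. indicator {0..T} (fst x) * norm (Z (fst x) (snd x))) \<in> borel_measurable (TM)" by simp
qed

lemma square_set_integrable:
  fixes Z :: "real \<Rightarrow> 'w \<Rightarrow> real^'d"
  assumes Z: "progressive M B T Z" and w: "w \<in> space M"
    and fin: "(\<integral>\<^sup>+ t. ennreal ((norm (Z t w))\<^sup>2) * indicator {0..T} t \<partial>lborel) < \<infinity>"
  shows "set_integrable lborel {0..T} (\<lambda>t. (norm (Z t w))\<^sup>2)"
  unfolding set_integrable_def
proof (rule integrableI_bounded)
  have "(\<lambda>s. (norm (indicator {0..T} s *\<^sub>R Z s w))\<^sup>2) \<in> borel_measurable lborel"
    using progressive_section[OF Z w] by measurable
  moreover have "(norm (indicator {0..T} s *\<^sub>R Z s w))\<^sup>2 = indicator {0..T} s *\<^sub>R (norm (Z s w))\<^sup>2" for s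
    by (simp add: indicator_def)
  ultimately show "(\<lambda>s. indicator {0..T} s *\<^sub>R (norm (Z s w))\<^sup>2) \<in> borel_measurable lborel" by simp
  have "ennreal (norm (indicator {0..T} s *\<^sub>R (norm (Z s w))\<^sup>2)) = ennreal ((norm (Z s w))\<^sup>2) * indicator {0..T} s" for s
    by (simp add: indicator_def)
  then show "(\<integral>\<^sup>+ s. ennreal (norm (indicator {0..T} s *\<^sub>R (norm (Z s w))\<^sup>2)) \<partial>lborel) < \<infinity>" using fin by simp
qed

text \<open>Pathwise the time integral of |Z|^\<delta> is at most (T + 1) c^\<delta> with c = sqrt
  (1 + \<integral> |Z|^2), and c^\<delta> \<le> c^\<beta> because c is at least 1. The mean of
  c^\<beta> is finite by membership in \<open>inMbeta\<close>.\<close>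

lemma inMbeta_powr_integrable:
  assumes Z: "inMbeta M B T \<beta> Z" and d: "0 < \<delta>" "\<delta> \<le> \<beta>" "\<delta> \<le> 2"
  shows "integrable (TM) (\<lambda>(r, w). indicator {0..T} r * (norm (Z r w) powr \<delta>))"
proof (rule product_integrableI)
  have Zp: "progressive M B T Z" using Z by (simp add: inMbeta_def inM_def)
  show "(\<lambda>x. indicator {0..T} (fst x) * (norm (Z (fst x) (snd x)) powr \<delta>)) \<in> borel_measurable (TM)"
    by (rule norm_joint_measurable[OF Zp]) measurable
  define S where "S w = (LBINT t:{0..T}. (norm (Z t w))\<^sup>2)" for w
  have S0: "0 \<le> S w" for w by (simp add: S_def set_lebesgue_integral_def)
  have [measurable]: "S \<in> borel_measurable M"
  proof -
    have "(\<lambda>x. indicator {0..T} (fst x) * (norm (Z (fst x) (snd x)))\<^sup>2) \<in> borel_measurable (TM)"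
      by (rule norm_joint_measurable[OF Zp]) measurable
    from measurable_compose[OF measurable_pair_swap' this]
    have "(\<lambda>(w, t). indicator {0..T} t * (norm (Z t w))\<^sup>2) \<in> borel_measurable (M \<Otimes>\<^sub>M lborel)" by (simp add: split_beta')
    then show ?thesis unfolding S_def[abs_def] set_lebesgue_integral_def real_scaleR_def by (rule lborel.borel_measurable_lebesgue_integral)
  qed
  define K where "K = (T + 1) * 2 powr (\<beta> / 2)"
  have K0: "0 \<le> K" using T_pos by (simp add: K_def)
  have fin: "AE w in M. (\<integral>\<^sup>+ t. ennreal ((norm (Z t w))\<^sup>2) * indicator {0..T} t \<partial>lborel) < \<infinity>"
    using Z by (simp add: inMbeta_def inM_def)
  have "(\<integral>\<^sup>+ w. (\<integral>\<^sup>+ r. ennreal \<bar>norm (Z r w) powr \<delta>\<bar> * indicator {0..T} r \<partial>lborel) \<partial>M)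
      \<le> (\<integral>\<^sup>+ w. ennreal K * (ennreal (S w powr (\<beta> / 2)) + 1) \<partial>M)"
  proof (rule nn_integral_mono_AE)
    show "AE w in M. (\<integral>\<^sup>+ r. ennreal \<bar>norm (Z r w) powr \<delta>\<bar> * indicator {0..T} r \<partial>lborel) \<le> ennreal K * (ennreal (S w powr (\<beta> / 2)) + 1)"
      using fin AE_space
    proof eventually_elim
      case (elim w)
      have si: "set_integrable lborel {0..T} (\<lambda>t. (norm (Z t w))\<^sup>2)" by (rule square_set_integrable[OF Zp elim(2,1)])
      define c where "c = sqrt (1 + S w)"
      have c: "1 \<le> c" "c\<^sup>2 = 1 + S w" "0 < c" using S0[of w] by (auto simp: c_def)
      have ci: "set_integrable lborel {0..T} (\<lambda>r. c powr \<delta> :: real)"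
        unfolding set_integrable_def real_scaleR_def by (intro integrable_mult_left integrable_real_indicator) (use T_pos in \<open>auto simp: less_top[symmetric]\<close>)
      let ?b = "\<lambda>r. c powr \<delta> + c powr \<delta> / c\<^sup>2 * (norm (Z r w))\<^sup>2"
      have bi: "set_integrable lborel {0..T} ?b" using ci si by (intro set_integral_add(1) set_integrable_mult_right)
      have "(\<integral>\<^sup>+ r. ennreal \<bar>norm (Z r w) powr \<delta>\<bar> * indicator {0..T} r \<partial>lborel) \<le> (\<integral>\<^sup>+ r. ennreal (indicator {0..T} r *\<^sub>R ?b r) \<partial>lborel)"
      proof (rule nn_integral_mono)
        fix r
        have "norm (Z r w) powr \<delta> \<le> ?b r"
          using powr_le_one_plus_scaled_square[of "norm (Z r w)" c \<delta>] c(3) d by (simp add: distrib_left)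
        then show "ennreal \<bar>norm (Z r w) powr \<delta>\<bar> * indicator {0..T} r \<le> ennreal (indicator {0..T} r *\<^sub>R ?b r)"
          by (auto simp: indicator_def simp del: ennreal_plus intro!: ennreal_leI)
      qed
      also have "\<dots> = ennreal (LBINT r:{0..T}. ?b r)"
        using bi unfolding set_integrable_def set_lebesgue_integral_def by (intro nn_integral_eq_integral) auto
      also have "(LBINT r:{0..T}. ?b r) = T * c powr \<delta> + c powr \<delta> / c\<^sup>2 * S w"
      proof -
        have "(LBINT r:{0..T}. ?b r) = (LBINT r:{0..T}. c powr \<delta>) + (LBINT r:{0..T}. c powr \<delta> / c\<^sup>2 * (norm (Z r w))\<^sup>2)"
          using ci si by (intro set_integral_add(2) set_integrable_mult_right)
        moreover have "(LBINT r:{0..T}. c powr \<delta>) = T * c powr \<delta>" using T_pos by (simp add: set_lebesgue_integral_def)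
        ultimately show ?thesis by (simp add: S_def)
      qed
      also have "\<dots> \<le> K * (S w powr (\<beta> / 2) + 1)"
      proof -
        have "c powr \<delta> / c\<^sup>2 * S w = c powr \<delta> * (S w / (1 + S w))" by (simp add: c(2))
        also have "\<dots> \<le> c powr \<delta> * 1" using S0[of w] by (intro mult_left_mono) auto
        finally have "T * c powr \<delta> + c powr \<delta> / c\<^sup>2 * S w \<le> (T + 1) * c powr \<delta>" by (simp add: algebra_simps)
        also have "c powr \<delta> \<le> c powr \<beta>" using c(1) d by (intro powr_mono) auto
        also have "c powr \<beta> = (S w + 1) powr (\<beta> / 2)" using S0[of w] by (simp add: c_def powr_half_sqrt[symmetric] powr_powr add.commute)
        also have "\<dots> \<le> 2 powr (\<beta> / 2) * (S w powr (\<beta> / 2) + 1)" using d S0 by (intro powr_plus_one_le) auto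
        finally show ?thesis using T_pos by (simp add: K_def mult_left_mono mult_ac)
      qed
      finally show ?case using K0 S0[of w] by (simp add: ennreal_mult'' ennreal_leI)
    qed
  qed
  also have "\<dots> = ennreal K * ((\<integral>\<^sup>+ w. ennreal (S w powr (\<beta> / 2)) \<partial>M) + 1)"
    by (subst nn_integral_cmult, measurable, subst nn_integral_add) (auto simp: emeasure_space_1)
  also have "\<dots> < \<infinity>" using Z by (auto simp: inMbeta_def S_def ennreal_mult_less_top)
  finally show "(\<integral>\<^sup>+ w. (\<integral>\<^sup>+ r. ennreal \<bar>norm (Z r w) powr \<delta>\<bar> * indicator {0..T} r \<partial>lborel) \<partial>M) < \<infinity>" .
qed

text \<open>Only first moments of |g| and |Y| are at hand, so \<delta> \<le> 1 lets them enter
  linearly; for \<open>Z1\<close> and \<open>Z2\<close> the condition is that \<delta> does not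
  exceed their exponents.\<close>

lemma growth_bound_integrable:
  assumes g: "progressive M B T g" "(\<integral>\<^sup>+ w. (\<integral>\<^sup>+ t. ennreal \<bar>g t w\<bar> * indicator {0..T} t \<partial>lborel) \<partial>M) < \<infinity>"
    and Y: "progressive M B T Y" "classD M B T Y"
    and Z1: "inMbeta M B T \<beta>1 Z1" and Z2: "inMbeta M B T \<beta>2 Z2"
    and d: "0 < \<delta>" "\<delta> \<le> 1" "\<delta> \<le> \<beta>1" "\<delta> \<le> \<beta>2"
  shows "(\<lambda>x. indicator {0..T} (fst x) * (\<bar>g (fst x) (snd x)\<bar> + \<bar>Y (fst x) (snd x)\<bar> + norm (Z1 (fst x) (snd x)) + norm (Z2 (fst x) (snd x)))) \<in> borel_measurable (TM)"
    and "integrable (TM) (\<lambda>(r, w). indicator {0..T} r * (\<bar>g r w\<bar> + \<bar>Y r w\<bar> + norm (Z1 r w) + norm (Z2 r w)) powr \<delta>)"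
proof -
  have Zp: "progressive M B T Z1" "progressive M B T Z2" using Z1 Z2 by (auto simp: inMbeta_def inM_def)
  have gm: "(\<lambda>x. indicator {0..T} (fst x) * \<bar>g (fst x) (snd x)\<bar>) \<in> borel_measurable (TM)"
    by (rule joint_measurable_compose[OF progressive_joint_measurable_lborel[OF g(1)]]) measurable
  have Ym: "(\<lambda>x. indicator {0..T} (fst x) * \<bar>Y (fst x) (snd x)\<bar>) \<in> borel_measurable (TM)"
    by (rule joint_measurable_compose[OF progressive_joint_measurable_lborel[OF Y(1)]]) measurable
  have Zm: "(\<lambda>x. indicator {0..T} (fst x) * norm (Z1 (fst x) (snd x))) \<in> borel_measurable (TM)"
    "(\<lambda>x. indicator {0..T} (fst x) * norm (Z2 (fst x) (snd x))) \<in> borel_measurable (TM)"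
    using norm_joint_measurable[OF Zp(1), of "\<lambda>x. x"] norm_joint_measurable[OF Zp(2), of "\<lambda>x. x"] by auto
  have "(\<lambda>x. indicator {0..T} (fst x) * \<bar>g (fst x) (snd x)\<bar> + indicator {0..T} (fst x) * \<bar>Y (fst x) (snd x)\<bar>
      + indicator {0..T} (fst x) * norm (Z1 (fst x) (snd x)) + indicator {0..T} (fst x) * norm (Z2 (fst x) (snd x))) \<in> borel_measurable (TM)"
    by (intro borel_measurable_add gm Ym Zm)
  then show m: "(\<lambda>x. indicator {0..T} (fst x) * (\<bar>g (fst x) (snd x)\<bar> + \<bar>Y (fst x) (snd x)\<bar> + norm (Z1 (fst x) (snd x)) + norm (Z2 (fst x) (snd x)))) \<in> borel_measurable (TM)"
    by (simp add: distrib_left)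
  have gi: "integrable (TM) (\<lambda>(r, w). indicator {0..T} r * \<bar>g r w\<bar>)"
    by (rule product_integrableI[OF gm]) (use g(2) in simp)
  have const: "bounded_stopping (\<lambda>_. t)" if "t \<in> {0..T}" for t
    using that stopping_time_const[of F t] by (simp add: bounded_stopping_def)
  have Yi: "integrable (TM) (\<lambda>(r, w). indicator {0..T} r * \<bar>Y r w\<bar>)"
  proof -
    obtain C where C: "\<And>\<tau>. bounded_stopping \<tau> \<Longrightarrow> integrable M (\<lambda>w. Y (\<tau> w) w)"
      "\<And>\<tau>. bounded_stopping \<tau> \<Longrightarrow> E (\<lambda>w. \<bar>Y (\<tau> w) w\<bar>) \<le> C" by (rule classD_bounded[OF Y(2)]) blast
    show ?thesis
      by (rule time_integrable[OF Ym, of C]) (use C(1)[OF const] C(2)[OF const] in auto)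
  qed
  have oi: "integrable (TM) (\<lambda>(r, w). indicator {0..T} r * (1::real))"
  proof (rule product_integrableI)
    have "(\<integral>\<^sup>+ w. (\<integral>\<^sup>+ r. ennreal \<bar>1\<bar> * indicator {0..T} (r::real) \<partial>lborel) \<partial>M) = ennreal T"
      using T_pos by (simp add: emeasure_space_1)
    then show "(\<integral>\<^sup>+ w. (\<integral>\<^sup>+ r. ennreal \<bar>1\<bar> * indicator {0..T} (r::real) \<partial>lborel) \<partial>M) < \<infinity>" by simp
  qed measurable
  have Zi: "integrable (TM) (\<lambda>(r, w). indicator {0..T} r * (norm (Z1 r w) powr \<delta>))"
    "integrable (TM) (\<lambda>(r, w). indicator {0..T} r * (norm (Z2 r w) powr \<delta>))"
    using inMbeta_powr_integrable[OF Z1 d(1,3)] inMbeta_powr_integrable[OF Z2 d(1,4)] d(2) by auto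
  let ?D = "\<lambda>r w. 4 powr \<delta> * (2 * 1 + \<bar>g r w\<bar> + \<bar>Y r w\<bar> + norm (Z1 r w) powr \<delta> + norm (Z2 r w) powr \<delta>)"
  have D: "integrable (TM) (\<lambda>(r, w). indicator {0..T} r * ?D r w)"
  proof -
    have "integrable (TM) (\<lambda>x. 4 powr \<delta> * (2 * (case x of (r, w) \<Rightarrow> indicator {0..T} r * (1::real)) + (case x of (r, w) \<Rightarrow> indicator {0..T} r * \<bar>g r w\<bar>)
      + (case x of (r, w) \<Rightarrow> indicator {0..T} r * \<bar>Y r w\<bar>) + (case x of (r, w) \<Rightarrow> indicator {0..T} r * (norm (Z1 r w) powr \<delta>))
      + (case x of (r, w) \<Rightarrow> indicator {0..T} r * (norm (Z2 r w) powr \<delta>))))"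
      by (intro integrable_mult_right Bochner_Integration.integrable_add oi gi Yi Zi)
    then show ?thesis by (simp add: split_beta' algebra_simps)
  qed
  show "integrable (TM) (\<lambda>(r, w). indicator {0..T} r * (\<bar>g r w\<bar> + \<bar>Y r w\<bar> + norm (Z1 r w) + norm (Z2 r w)) powr \<delta>)"
  proof (rule Bochner_Integration.integrable_bound[OF D])
    have "(\<lambda>x. x powr \<delta>) \<in> borel_measurable borel" by measurable
    from joint_measurable_compose[OF m this]
    show "(\<lambda>(r, w). indicator {0..T} r * (\<bar>g r w\<bar> + \<bar>Y r w\<bar> + norm (Z1 r w) + norm (Z2 r w)) powr \<delta>) \<in> borel_measurable (TM)"
      by (simp add: split_beta')
    have "(\<bar>g r w\<bar> + \<bar>Y r w\<bar> + norm (Z1 r w) + norm (Z2 r w)) powr \<delta> \<le> \<bar>?D r w\<bar>" for r w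
    proof -
      have "(\<bar>g r w\<bar> + \<bar>Y r w\<bar> + norm (Z1 r w) + norm (Z2 r w)) powr \<delta> \<le> 4 powr \<delta> * (\<bar>g r w\<bar> powr \<delta> + \<bar>Y r w\<bar> powr \<delta> + norm (Z1 r w) powr \<delta> + norm (Z2 r w) powr \<delta>)"
        using d by (intro powr_add4_le) auto
      also have "\<dots> \<le> ?D r w"
        using powr_le_one_plus[of "\<bar>g r w\<bar>" \<delta>] powr_le_one_plus[of "\<bar>Y r w\<bar>" \<delta>] d by (intro mult_left_mono) auto
      finally show ?thesis by linarith
    qed
    then show "AE x in TM. norm (case x of (r, w) \<Rightarrow> indicator {0..T} r * (\<bar>g r w\<bar> + \<bar>Y r w\<bar> + norm (Z1 r w) + norm (Z2 r w)) powr \<delta>)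
        \<le> norm (case x of (r, w) \<Rightarrow> indicator {0..T} r * ?D r w)"
      by (intro AE_I2) (simp add: split_beta' indicator_def)
  qed
qed

end

text \<open>Both values are compared with the one at z = 0, the comparison that (Z) provides; hence
  the factor 2.\<close>

lemma growth_difference_bound:
  fixes u v w g' y \<alpha> \<gamma> a b :: real
  assumes "\<bar>u - w\<bar> \<le> \<gamma> * (g' + \<bar>y\<bar> + a) powr \<alpha>" "\<bar>v - w\<bar> \<le> \<gamma> * (g' + \<bar>y\<bar> + b) powr \<alpha>"
    and "0 \<le> g'" "0 \<le> a" "0 \<le> b" "0 \<le> \<gamma>" "0 \<le> \<alpha>"
  shows "\<bar>u - v\<bar> \<le> 2 * \<gamma> * (\<bar>g'\<bar> + \<bar>y\<bar> + a + b) powr \<alpha>"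
proof -
  have "\<gamma> * (g' + \<bar>y\<bar> + a) powr \<alpha> \<le> \<gamma> * (\<bar>g'\<bar> + \<bar>y\<bar> + a + b) powr \<alpha>"
    "\<gamma> * (g' + \<bar>y\<bar> + b) powr \<alpha> \<le> \<gamma> * (\<bar>g'\<bar> + \<bar>y\<bar> + a + b) powr \<alpha>"
    using assms by (auto intro!: mult_left_mono powr_mono2)
  then show ?thesis using assms(1,2) by linarith
qed

lemma set_integral_closed_left:
  fixes h :: "real \<Rightarrow> real"
  assumes h: "set_integrable lborel {0..T} h" and t: "0 \<le> t" "t \<le> T"
  shows "(LBINT s:{t..T}. h s) = (LBINT s:{0..T}. h s) - (LBINT s:{0..t}. h s)"
proof -
  have i: "set_integrable lborel {t..T} h" "set_integrable lborel {t<..T} h"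
    using t by (auto intro!: set_integrable_subset[OF h])
  have "(LBINT s:{t..T}. h s) = (LBINT s:{t<..T}. h s)"
    unfolding set_lebesgue_integral_def
    by (rule integral_cong_AE[OF i[unfolded set_integrable_def, THEN borel_measurable_integrable]],
        rule eventually_mono[OF AE_lborel_singleton[of t]]) (auto simp: indicator_def)
  then show ?thesis using set_integral_diff_initial[OF h t order_refl] by simp
qed

theorem theorem3p9:
  fixes M :: "'w measure" and B :: "real \<Rightarrow> 'w \<Rightarrow> real^'d" and T :: real
    and \<xi> :: "'w \<Rightarrow> real" and f :: "'w \<Rightarrow> real \<Rightarrow> real \<Rightarrow> real^'d \<Rightarrow> real"
    and V :: "real \<Rightarrow> 'w \<Rightarrow> real"
    and \<alpha> \<gamma> :: real and g :: "real \<Rightarrow> 'w \<Rightarrow> real"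
    and Y1 Y2 :: "real \<Rightarrow> 'w \<Rightarrow> real" and Z1 Z2 :: "real \<Rightarrow> 'w \<Rightarrow> real^'d"
  assumes "prob_space M" and "complete_measure M" and "T > 0"
    and "brownian_motion M T B"
    and "\<xi> \<in> borel_measurable (fmeas M B T)"
    and "classV M B T V"
    and "\<forall>y z. progressive M B T (\<lambda>t \<omega>. f \<omega> t y z)"
    and H2: "\<exists>L>0. AE \<omega> in M. \<forall>t\<in>{0..T}. \<forall>y z z'.
               \<bar>f \<omega> t y z - f \<omega> t y z'\<bar> \<le> L * norm (z - z')"
    and H3: "\<exists>\<mu>. AE \<omega> in M. \<forall>t\<in>{0..T}. \<forall>y y' z.
               (f \<omega> t y z - f \<omega> t y' z) * (y - y') \<le> \<mu> * (y - y')\<^sup>2"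
    and Z_alpha: "0 < \<alpha>" "\<alpha> < 1" and Z_gamma: "\<gamma> \<ge> 0"
    and Z_g: "progressive M B T g" "AE \<omega> in M. \<forall>t\<in>{0..T}. 0 \<le> g t \<omega>"
      "(\<integral>\<^sup>+ \<omega>. (\<integral>\<^sup>+ t. ennreal (g t \<omega>) * indicator {0..T} t \<partial>lborel) \<partial>M) < \<infinity>"
    and Z_bound: "AE \<omega> in M. \<forall>t\<in>{0..T}. \<forall>y z.
               \<bar>f \<omega> t y z - f \<omega> t y 0\<bar> \<le> \<gamma> * (g t \<omega> + \<bar>y\<bar> + norm z) powr \<alpha>"
    and sol1: "bsde_solution M B T \<xi> f V Y1 Z1" "classD M B T Y1" "\<exists>\<beta>>\<alpha>. inMbeta M B T \<beta> Z1"
    and sol2: "bsde_solution M B T \<xi> f V Y2 Z2" "classD M B T Y2" "\<exists>\<beta>>\<alpha>. inMbeta M B T \<beta> Z2"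
  shows "(AE \<omega> in M. \<forall>t\<in>{0..T}. Y1 t \<omega> = Y2 t \<omega>) \<and>
         (AE \<omega> in M. AE t in lborel. t \<in> {0..T} \<longrightarrow> Z1 t \<omega> = Z2 t \<omega>)"
proof -
  interpret bm_space M T B
    by (intro bm_space.intro bm_space_axioms.intro assms)
  let ?f1 = "\<lambda>w s. f w s (Y1 s w) (Z1 s w)" and ?f2 = "\<lambda>w s. f w s (Y2 s w) (Z2 s w)"
  obtain L where L: "0 < L" "AE w in M. \<forall>t\<in>{0..T}. \<forall>y z z'. \<bar>f w t y z - f w t y z'\<bar> \<le> L * norm (z - z')" using H2 by blast
  obtain \<mu> where mu: "AE w in M. \<forall>t\<in>{0..T}. \<forall>y y' z. (f w t y z - f w t y' z) * (y - y') \<le> \<mu> * (y - y')\<^sup>2" using H3 by blast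
  obtain \<beta>1 \<beta>2 where b: "\<alpha> < \<beta>1" "inMbeta M B T \<beta>1 Z1" "\<alpha> < \<beta>2" "inMbeta M B T \<beta>2 Z2" using sol1(3) sol2(3) by blast
  have Yp: "progressive M B T Y1" "progressive M B T Y2" and Zp: "progressive M B T Z1" "progressive M B T Z2"
    using sol1(1) sol2(1) by (auto simp: bsde_solution_def inM_def)
  obtain I1 where I1: "ito_integral M B T Z1 I1" "AE w in M. \<forall>t\<in>{0..T}. Y1 t w = \<xi> w + (LBINT s:{t..T}. ?f1 w s) + (V T w - V t w) - (I1 T w - I1 t w)"
    using sol1(1) unfolding bsde_solution_def by blast
  obtain I2 where I2: "ito_integral M B T Z2 I2" "AE w in M. \<forall>t\<in>{0..T}. Y2 t w = \<xi> w + (LBINT s:{t..T}. ?f2 w s) + (V T w - V t w) - (I2 T w - I2 t w)"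
    using sol2(1) unfolding bsde_solution_def by blast
  have Ip: "progressive M B T I1" "progressive M B T I2"
    and Ic: "\<And>w. w \<in> space M \<Longrightarrow> continuous_on {0..T} (\<lambda>t. I1 t w)" "\<And>w. w \<in> space M \<Longrightarrow> continuous_on {0..T} (\<lambda>t. I2 t w)"
    using I1(1) I2(1) by (auto simp: ito_integral_def)
  have fi: "AE w in M. set_integrable lborel {0..T} (?f1 w)" "AE w in M. set_integrable lborel {0..T} (?f2 w)"
    and Zf: "AE w in M. (\<integral>\<^sup>+ t. ennreal ((norm (Z1 t w))\<^sup>2) * indicator {0..T} t \<partial>lborel) < \<infinity>"
      "AE w in M. (\<integral>\<^sup>+ t. ennreal ((norm (Z2 t w))\<^sup>2) * indicator {0..T} t \<partial>lborel) < \<infinity>"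
    using sol1(1) sol2(1) unfolding bsde_solution_def inM_def by blast+
  note all_AE = AE_conjI[OF L(2) AE_conjI[OF mu AE_conjI[OF Z_g(2) AE_conjI[OF Z_bound AE_conjI[OF I1(2) AE_conjI[OF I2(2)
    AE_conjI[OF fi(1) AE_conjI[OF fi(2) AE_conjI[OF Zf]]]]]]]]]
  \<comment> \<open>One null set outside of which all the almost sure conditions hold
    together.\<close>
  obtain N where N: "N \<in> null_sets M" and good: "\<And>w. w \<in> space M \<Longrightarrow> w \<notin> N \<Longrightarrow>
    (\<forall>t\<in>{0..T}. \<forall>y z z'. \<bar>f w t y z - f w t y z'\<bar> \<le> L * norm (z - z')) \<and>
    (\<forall>t\<in>{0..T}. \<forall>y y' z. (f w t y z - f w t y' z) * (y - y') \<le> \<mu> * (y - y')\<^sup>2) \<and>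
    (\<forall>t\<in>{0..T}. 0 \<le> g t w) \<and>
    (\<forall>t\<in>{0..T}. \<forall>y z. \<bar>f w t y z - f w t y 0\<bar> \<le> \<gamma> * (g t w + \<bar>y\<bar> + norm z) powr \<alpha>) \<and>
    (\<forall>t\<in>{0..T}. Y1 t w = \<xi> w + (LBINT s:{t..T}. ?f1 w s) + (V T w - V t w) - (I1 T w - I1 t w)) \<and>
    (\<forall>t\<in>{0..T}. Y2 t w = \<xi> w + (LBINT s:{t..T}. ?f2 w s) + (V T w - V t w) - (I2 T w - I2 t w)) \<and>
    set_integrable lborel {0..T} (?f1 w) \<and> set_integrable lborel {0..T} (?f2 w) \<and>
    (\<integral>\<^sup>+ t. ennreal ((norm (Z1 t w))\<^sup>2) * indicator {0..T} t \<partial>lborel) < \<infinity> \<and>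
    (\<integral>\<^sup>+ t. ennreal ((norm (Z2 t w))\<^sup>2) * indicator {0..T} t \<partial>lborel) < \<infinity>"
    by (rule AE_E3[OF all_AE]) simp
  have AE_N: "AE w in M. w \<notin> N" by (rule AE_not_in[OF N])
  \<comment> \<open>Resetting to zero on \<open>N\<close> makes the equations hold on every path, as
    the locales demand, and keeps \<open>y\<close>, \<open>z\<close> and \<open>I\<close>
    progressive.\<close>
  define y where "y t w = (if w \<in> N then 0 else Y1 t w - Y2 t w)" for t w
  define z where "z t w = (if w \<in> N then 0 else Z1 t w - Z2 t w)" for t w
  define a where "a t w = (if w \<in> N then 0 else ?f1 w t - ?f2 w t)" for t w
  define I where "I t w = (if w \<in> N then 0 else (I1 t w - I2 t w) - (I1 0 w - I2 0 w))" for t w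
  obtain J1 H1 P1 where A1: "elem_approx J1 H1 P1 I1 Z1" by (rule ito_integral_AE_approx[OF I1(1) Zp(1)])
  obtain J2 H2 P2 where A2: "elem_approx J2 H2 P2 I2 Z2" by (rule ito_integral_AE_approx[OF I2(1) Zp(2)])
  define J where "J m t w = (J1 m t w - J2 m t w) - (J1 m 0 w - J2 m 0 w)" for m t w
  define H where "H m t w = H1 m t w - H2 m t w" for m t w
  define P where "P m = P1 m \<union> P2 m" for m
  have approx: "elem_approx J H P I z"
    unfolding J_def[abs_def] H_def[abs_def] P_def[abs_def]
    by (rule elem_approx_normalise[OF elem_approx_diff[OF A1 A2 Zp]], rule eventually_mono[OF AE_N]) (simp add: I_def z_def)
  have yp: "progressive M B T y" and zp: "progressive M B T z"
    unfolding y_def[abs_def] z_def[abs_def] by (intro progressive_regularise progressive_diff Yp Zp N)+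
  have Ip': "progressive M B T I" unfolding I_def[abs_def]
    by (intro progressive_regularise progressive_diff progressive_initial Ip N)
  have I_c: "continuous_on {0..T} (\<lambda>t. I t w)" if "w \<in> space M" for w
    unfolding I_def by (cases "w \<in> N") (use that in \<open>auto intro!: continuous_intros Ic\<close>)
  have zsq: "set_integrable lborel {0..T} (\<lambda>r. (norm (z r w))\<^sup>2)" if w: "w \<in> space M" for w
  proof (cases "w \<in> N")
    case True
    then show ?thesis by (simp add: z_def set_integrable_def)
  next
    case False
    have s: "set_integrable lborel {0..T} (\<lambda>r. (norm (Z1 r w))\<^sup>2)" "set_integrable lborel {0..T} (\<lambda>r. (norm (Z2 r w))\<^sup>2)"
      using good[OF w False] by (auto intro!: square_set_integrable Zp w)
    have "set_integrable lborel {0..T} (\<lambda>r. 2 * (norm (Z1 r w))\<^sup>2 + 2 * (norm (Z2 r w))\<^sup>2)"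
      using s by (intro set_integral_add(1) set_integrable_mult_right)
    then show ?thesis
    proof (rule set_integrable_bound)
      have "(\<lambda>s. (norm (indicator {0..T} s *\<^sub>R z s w))\<^sup>2) \<in> borel_measurable lborel"
        using progressive_section[OF zp w] by measurable
      moreover have "(norm (indicator {0..T} s *\<^sub>R z s w))\<^sup>2 = indicator {0..T} s *\<^sub>R (norm (z s w))\<^sup>2" for s
        by (simp add: indicator_def)
      ultimately show "set_borel_measurable lborel {0..T} (\<lambda>r. (norm (z r w))\<^sup>2)" by (simp add: set_borel_measurable_def)
      have "(norm (u - v))\<^sup>2 \<le> 2 * (norm u)\<^sup>2 + 2 * (norm v)\<^sup>2" for u v :: "real^'d"
      proof -
        have "(norm (u - v))\<^sup>2 \<le> (norm u + norm v)\<^sup>2" by (intro power_mono norm_triangle_ineq4) simp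
        also have "\<dots> \<le> 2 * (norm u)\<^sup>2 + 2 * (norm v)\<^sup>2" using sum_squares_bound[of "norm u" "norm v"] by (simp add: power2_sum)
        finally show ?thesis .
      qed
      then show "AE r in lborel. r \<in> {0..T} \<longrightarrow> norm ((norm (z r w))\<^sup>2) \<le> norm (2 * (norm (Z1 r w))\<^sup>2 + 2 * (norm (Z2 r w))\<^sup>2)"
        using False by (intro AE_I2) (simp add: z_def)
    qed
  qed
  have ai: "set_integrable lborel {0..T} (\<lambda>r. a r w)" if w: "w \<in> space M" for w
    using good[OF w] by (cases "w \<in> N") (auto simp: a_def set_integrable_def right_diff_distrib)
  have yeq: "y t w = y 0 w - (LBINT r:{0..t}. a r w) + I t w" and yT: "y T w = 0" if w: "w \<in> space M" and t: "t \<in> {0..T}" for t w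
  proof -
    have "y t w = y 0 w - (LBINT r:{0..t}. a r w) + I t w \<and> y T w = 0"
    proof (cases "w \<in> N")
      case True
      then show ?thesis by (simp add: y_def a_def I_def)
    next
      case False
      note G = good[OF w False]
      have i: "set_integrable lborel {0..T} (?f1 w)" "set_integrable lborel {0..T} (?f2 w)" using G by auto
      \<comment> \<open>\<open>\<xi>\<close> and \<open>V\<close> cancel, so \<open>y\<close> ends
        at zero and inherits no jumps.\<close>
      have Y: "Y1 u w - Y2 u w = (LBINT s:{u..T}. ?f1 w s) - (LBINT s:{u..T}. ?f2 w s) - (I1 T w - I1 u w) + (I2 T w - I2 u w)"
        if "u \<in> {0..T}" for u
      proof -
        have "Y1 u w = \<xi> w + (LBINT s:{u..T}. ?f1 w s) + (V T w - V u w) - (I1 T w - I1 u w)"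
          "Y2 u w = \<xi> w + (LBINT s:{u..T}. ?f2 w s) + (V T w - V u w) - (I2 T w - I2 u w)" using G that by blast+
        then show ?thesis by linarith
      qed
      have sp: "(LBINT s:{u..T}. ?f1 w s) = (LBINT s:{0..T}. ?f1 w s) - (LBINT s:{0..u}. ?f1 w s)"
        "(LBINT s:{u..T}. ?f2 w s) = (LBINT s:{0..T}. ?f2 w s) - (LBINT s:{0..u}. ?f2 w s)" if "u \<in> {0..T}" for u
        using that by (auto intro!: set_integral_closed_left i)
      have t0: "0 \<in> {0..T}" "T \<in> {0..T}" using T_pos by auto
      have sub: "{0..t} \<subseteq> {0..T}" using t by auto
      have "(LBINT r:{0..t}. a r w) = (LBINT r:{0..t}. ?f1 w r) - (LBINT r:{0..t}. ?f2 w r)"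
        using False set_integral_diff(2)[OF set_integrable_subset[OF i(1) _ sub] set_integrable_subset[OF i(2) _ sub]] by (simp add: a_def)
      moreover have "(LBINT s:{0..0}. ?f1 w s) = 0" "(LBINT s:{0..0}. ?f2 w s) = 0"
        using sp[OF t0(1)] by simp_all
      ultimately show ?thesis using Y[OF t] Y[OF t0(1)] Y[OF t0(2)] sp[OF t] sp[OF t0(1)] sp[OF t0(2)] False by (simp add: y_def I_def)
    qed
    then show "y t w = y 0 w - (LBINT r:{0..t}. a r w) + I t w" "y T w = 0" by auto
  qed
  \<comment> \<open>Written through adapted processes instead of as the integral of
    \<open>a\<close>, so that adaptedness is visible although \<open>a\<close> need not be
    progressive.\<close>
  define D where "D t w = y 0 w - y t w + I t w" for t w
  have Deq: "D t w = (LBINT r:{0..t}. a r w)" if "w \<in> space M" "t \<in> {0..T}" for t w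
    using yeq[OF that] by (simp add: D_def)
  have Da: "D t \<in> borel_measurable (F t)" if t: "t \<in> {0..T}" for t
  proof -
    have "y 0 \<in> borel_measurable (F t)" using F_measurable_mono[OF progressive_adapted[OF yp, of 0], of t] t by simp
    then show ?thesis unfolding D_def[abs_def] using progressive_adapted[OF yp t] progressive_adapted[OF Ip' t] by measurable
  qed
  have yc: "continuous_on {0..T} (\<lambda>t. y t w)" if w: "w \<in> space M" for w
  proof -
    have "continuous_on {0..T} (\<lambda>t. y 0 w - (LBINT r:{0..t}. a r w) + I t w)"
      by (intro continuous_intros continuous_on_initial_integral ai w I_c)
    then show ?thesis by (rule continuous_on_eq) (rule yeq[OF w, symmetric])
  qed
  obtain W where W: "\<And>t. t \<in> {0..T} \<Longrightarrow> W t \<in> borel_measurable (F t)"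
    "\<And>w. w \<in> space M \<Longrightarrow> continuous_on {0..T} (\<lambda>t. W t w)" "\<And>w. w \<in> space M \<Longrightarrow> W 0 w = 0"
    "\<And>w t. w \<in> space M \<Longrightarrow> t \<in> {0..T} \<Longrightarrow> 0 \<le> W t w"
    "\<And>w u t. w \<in> space M \<Longrightarrow> 0 \<le> u \<Longrightarrow> u \<le> t \<Longrightarrow> t \<le> T \<Longrightarrow> \<bar>D t w - D u w\<bar> \<le> W t w - W u w"
    by (rule variation_process[of a D, OF ai Deq Da]) blast+
  have ym: "(\<lambda>w. y (\<tau> w) w) \<in> borel_measurable M" if t: "bounded_stopping \<tau>" for \<tau>
  proof -
    have "(\<lambda>w. y (min T (\<tau> w)) w) \<in> borel_measurable M"
      using F_measurable_M[OF progressive_stopped[OF yp t, of T]] T_pos by simp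
    moreover have "y (min T (\<tau> w)) w = y (\<tau> w) w" if "w \<in> space M" for w using t that by (auto simp: bounded_stopping_def min_def)
    ultimately show ?thesis by (simp cong: measurable_cong)
  qed
  have yY: "AE w in M. y (\<tau> w) w = Y1 (\<tau> w) w - Y2 (\<tau> w) w" for \<tau> by (rule eventually_mono[OF AE_N]) (simp add: y_def)
  obtain C1 where C1: "\<And>\<tau>. bounded_stopping \<tau> \<Longrightarrow> integrable M (\<lambda>w. Y1 (\<tau> w) w)"
    "\<And>\<tau>. bounded_stopping \<tau> \<Longrightarrow> E (\<lambda>w. \<bar>Y1 (\<tau> w) w\<bar>) \<le> C1" by (rule classD_bounded[OF sol1(2)]) blast
  obtain C2 where C2: "\<And>\<tau>. bounded_stopping \<tau> \<Longrightarrow> integrable M (\<lambda>w. Y2 (\<tau> w) w)"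
    "\<And>\<tau>. bounded_stopping \<tau> \<Longrightarrow> E (\<lambda>w. \<bar>Y2 (\<tau> w) w\<bar>) \<le> C2" by (rule classD_bounded[OF sol2(2)]) blast
  have yi: "integrable M (\<lambda>w. y (\<tau> w) w)" if t: "bounded_stopping \<tau>" for \<tau>
    using integrable_cong_AE[OF ym[OF t] _ yY] C1(1)[OF t] C2(1)[OF t] by simp
  have yabs: "E (\<lambda>w. \<bar>y (\<tau> w) w\<bar>) = E (\<lambda>w. \<bar>Y1 (\<tau> w) w - Y2 (\<tau> w) w\<bar>)" if t: "bounded_stopping \<tau>" for \<tau>
    by (rule integral_cong_AE) (use ym[OF t] C1(1)[OF t] C2(1)[OF t] eventually_mono[OF yY[of \<tau>]] in auto)
  have const: "bounded_stopping (\<lambda>_. t)" if "t \<in> {0..T}" for t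
    using that stopping_time_const[of F t] by (simp add: bounded_stopping_def)
  have YT: "AE w in M. Y1 T w = Y2 T w"
    using AE_N AE_space
  proof eventually_elim
    case (elim w)
    then show ?case using yT[OF elim(2), of T] T_pos by (simp add: y_def)
  qed
  have cl: "(\<lambda>k. E (\<lambda>w. \<bar>y (\<tau> k w) w\<bar>)) \<longlonglongrightarrow> 0"
    if t: "\<And>k::nat. bounded_stopping (\<tau> k)" and ev: "\<And>w. w \<in> space M \<Longrightarrow> eventually (\<lambda>k. \<tau> k w = T) sequentially" for \<tau>
    using classD_diff_tendsto[OF sol1(2) sol2(2) YT t ev] by (simp add: yabs[OF t])
  \<comment> \<open>The midpoint between \<alpha> and the least of 1, 2 \<alpha>, \<beta>1 and
    \<beta>2, so that all inequalities are strict: 1 serves g and Y2, the exponents \<beta>1 and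
    \<beta>2 serve Z1 and Z2, and 2 \<alpha> keeps q = \<delta> / \<alpha> below 2.\<close>
  define \<delta> where "\<delta> = (\<alpha> + min (min 1 (2 * \<alpha>)) (min \<beta>1 \<beta>2)) / 2"
  have d: "\<alpha> < \<delta>" "\<delta> < 1" "\<delta> < 2 * \<alpha>" "\<delta> < \<beta>1" "\<delta> < \<beta>2" using Z_alpha b(1,3) by (auto simp: \<delta>_def min_def)
  define q where "q = \<delta> / \<alpha>"
  have q: "1 < q" "q < 2" "\<alpha> * q = \<delta>" using d Z_alpha by (auto simp: q_def pos_divide_less_eq)
  define S where "S r w = \<bar>g r w\<bar> + \<bar>Y2 r w\<bar> + norm (Z1 r w) + norm (Z2 r w)" for r w
  have S0: "0 \<le> S r w" for r w by (simp add: S_def)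
  define G where "G r w = 2 * \<gamma> * S r w powr \<alpha>" for r w
  have g_fin: "(\<integral>\<^sup>+ w. (\<integral>\<^sup>+ t. ennreal \<bar>g t w\<bar> * indicator {0..T} t \<partial>lborel) \<partial>M) < \<infinity>"
  proof -
    have "(\<integral>\<^sup>+ w. (\<integral>\<^sup>+ t. ennreal \<bar>g t w\<bar> * indicator {0..T} t \<partial>lborel) \<partial>M) = (\<integral>\<^sup>+ w. (\<integral>\<^sup>+ t. ennreal (g t w) * indicator {0..T} t \<partial>lborel) \<partial>M)"
    proof (rule nn_integral_cong_AE, rule eventually_mono[OF Z_g(2)])
      fix w assume "\<forall>t\<in>{0..T}. 0 \<le> g t w"
      then show "(\<integral>\<^sup>+ t. ennreal \<bar>g t w\<bar> * indicator {0..T} t \<partial>lborel) = (\<integral>\<^sup>+ t. ennreal (g t w) * indicator {0..T} t \<partial>lborel)"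
        by (intro nn_integral_cong) (auto simp: indicator_def)
    qed
    then show ?thesis using Z_g(3) by simp
  qed
  have gb: "(\<lambda>x. indicator {0..T} (fst x) * S (fst x) (snd x)) \<in> borel_measurable (TM)"
    "integrable (TM) (\<lambda>(r, w). indicator {0..T} r * S r w powr \<delta>)"
    unfolding S_def by (rule growth_bound_integrable[where \<delta>=\<delta>, OF Z_g(1) g_fin Yp(2) sol2(2) b(2,4)]; use d Z_alpha in simp)+
  have Gm: "(\<lambda>x. indicator {0..T} (fst x) * G (fst x) (snd x)) \<in> borel_measurable (TM)"
    unfolding G_def by (rule joint_measurable_compose[OF gb(1), where f="\<lambda>x. 2 * \<gamma> * x powr \<alpha>"]) measurable
  have Gq: "integrable (TM) (\<lambda>(r, w). indicator {0..T} r * (G r w powr q))"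
  proof -
    have "integrable (TM) (\<lambda>x. (2 * \<gamma>) powr q * (case x of (r, w) \<Rightarrow> indicator {0..T} r * S r w powr \<delta>))" using gb(2) by simp
    moreover have "G r w powr q = (2 * \<gamma>) powr q * S r w powr \<delta>" for r w
      using Z_gamma S0 by (simp add: G_def powr_mult powr_powr q(3))
    ultimately show ?thesis by (simp add: split_beta' mult_ac)
  qed
  \<comment> \<open>\<open>\<mu>\<close> may be negative or zero, whereas Gronwall's inequality asks
    for a positive rate.\<close>
  define m where "m = max \<mu> 0 + 1"
  have dr: "AE w in M. AE r in lborel. r \<in> {0..T} \<longrightarrow>
      a r w * y r w \<le> m * (y r w)\<^sup>2 + \<bar>y r w\<bar> * min (L * norm (z r w)) (G r w)"
    using AE_N AE_space
  proof eventually_elim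
    case (elim w)
    note gd = good[OF elim(2,1)]
    show ?case
    proof (intro AE_I2 impI)
      fix r assume r: "r \<in> {0..T}"
      \<comment> \<open>An intermediate value: from the first solution to \<open>?u\<close> only y
        changes, which is the case of (H3); from there to the second only z changes, at the fixed
        value Y2. Hence \<open>S\<close> involves Y2 but not Y1.\<close>
      let ?u = "f w r (Y2 r w) (Z1 r w)"
      have 1: "(?f1 w r - ?u) * (Y1 r w - Y2 r w) \<le> \<mu> * (Y1 r w - Y2 r w)\<^sup>2" using gd r by blast
      also have "\<dots> \<le> m * (Y1 r w - Y2 r w)\<^sup>2" by (intro mult_right_mono) (auto simp: m_def)
      finally have 1: "(?f1 w r - ?u) * (Y1 r w - Y2 r w) \<le> m * (Y1 r w - Y2 r w)\<^sup>2" .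
      have 2: "\<bar>?u - ?f2 w r\<bar> \<le> L * norm (Z1 r w - Z2 r w)" using gd r by blast
      have 3: "\<bar>?u - ?f2 w r\<bar> \<le> G r w"
        unfolding G_def S_def
        by (rule growth_difference_bound[where w="f w r (Y2 r w) 0"]) (use gd r Z_gamma Z_alpha in auto)
      have "(?u - ?f2 w r) * (Y1 r w - Y2 r w) \<le> \<bar>Y1 r w - Y2 r w\<bar> * \<bar>?u - ?f2 w r\<bar>"
        by (metis abs_ge_self abs_mult mult.commute)
      also have "\<dots> \<le> \<bar>Y1 r w - Y2 r w\<bar> * min (L * norm (Z1 r w - Z2 r w)) (G r w)"
        using 2 3 by (intro mult_left_mono) auto
      finally show "a r w * y r w \<le> m * (y r w)\<^sup>2 + \<bar>y r w\<bar> * min (L * norm (z r w)) (G r w)"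
        using 1 elim(1) by (simp add: a_def y_def z_def algebra_simps)
    qed
  qed
  have T_mem: "T \<in> {0..T}" using T_pos by simp
  interpret ito_process M T B J H P I z
    by unfold_locales (use approx zp zsq Ip' I_c in \<open>auto simp: I_def[of 0]\<close>)
  interpret semimart M T B J H P I z y a W
  proof unfold_locales
    show "progressive M B T y" by (rule yp)
    show "continuous_on {0..T} (\<lambda>t. y t w)" if "w \<in> space M" for w by (rule yc[OF that])
    show "set_integrable lborel {0..T} (\<lambda>r. a r w)" if "w \<in> space M" for w by (rule ai[OF that])
    show "y t w = y 0 w - (LBINT r:{0..t}. a r w) + I t w" if "w \<in> space M" "t \<in> {0..T}" for w t by (rule yeq[OF that])
    show "0 \<le> W t w" if "w \<in> space M" "t \<in> {0..T}" for w t by (rule W(4)[OF that])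
    show "\<bar>(LBINT r:{0..t}. a r w) - (LBINT r:{0..u}. a r w)\<bar> \<le> W t w - W u w" if "w \<in> space M" "0 \<le> u" "u \<le> t" "t \<le> T" for w u t
      using W(5)[OF that] Deq[OF that(1), of t] Deq[OF that(1), of u] that by simp
  qed
  interpret class_D_semimart M T B J H P I z y a W
    by unfold_locales (use W(1-3) yT[OF _ T_mem] yi cl in auto)
  interpret monotone_semimart M T B J H P I z y a W G q m L
  proof unfold_locales
    have "E (\<lambda>w. \<bar>y t w\<bar>) \<le> C1 + C2" if t: "t \<in> {0..T}" for t
    proof -
      note c = const[OF t]
      have "E (\<lambda>w. \<bar>y t w\<bar>) = E (\<lambda>w. \<bar>Y1 t w - Y2 t w\<bar>)" using yabs[OF c] .
      also have "\<dots> \<le> E (\<lambda>w. \<bar>Y1 t w\<bar> + \<bar>Y2 t w\<bar>)" using C1(1)[OF c] C2(1)[OF c] by (intro integral_mono) auto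
      also have "\<dots> = E (\<lambda>w. \<bar>Y1 t w\<bar>) + E (\<lambda>w. \<bar>Y2 t w\<bar>)" using C1(1)[OF c] C2(1)[OF c] by simp
      finally show ?thesis using C1(2)[OF c] C2(2)[OF c] by simp
    qed
    then show "\<exists>C. \<forall>t\<in>{0..T}. E (\<lambda>w. \<bar>y t w\<bar>) \<le> C" by blast
  qed (use q L Gm Gq dr Z_gamma S0 in \<open>auto simp: m_def G_def\<close>)
  have "AE w in M. \<forall>t\<in>{0..T}. Y1 t w = Y2 t w"
    using y_zero AE_N
  proof eventually_elim
    case (elim w)
    then show ?case by (simp add: y_def)
  qed
  moreover have "AE w in M. AE t in lborel. t \<in> {0..T} \<longrightarrow> Z1 t w = Z2 t w"
    using z_zero AE_N
  proof eventually_elim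
    case (elim w)
    then show ?case by (simp add: z_def)
  qed
  ultimately show ?thesis ..
qed

end
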